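(* Consider the fully discrete conservative DLRA–DG algorithm for the Vlasov–Poisson equation described in the context (rank-adaptive unconventional integrator with fixed velocity functions $U_1,\dots,U_m$, explicit Euler time stepping with step size $\tau>0$), where a central flux ($\alpha=1$) is used for computing the K-steps. Assume $m\ge 1+d$ and that the functions $1,v_1,\dots,v_d$ belong to $\mathrm{span}\{U_1,\dots,U_m\}$. Let $f^n$ ($n=0,1,2,\dots$) be the computed approximations and let, for $s=1,\dots,d$, $$\rho^n=\int_{\Omega^{(v)}} f^n\,\mathrm d\bm v,\qquad j^n_s=\int_{\Omega^{(v)}} v_s f^n\,\mathrm d\bm v,\qquad \bm\sigma_s^n=\Big[\int_{\Omega^{(v)}}v_sv_{s'}f^n\,\mathrm d\bm v\Big]_{s'=1,\dots,d}.$$ Then (in exact arithmetic) for all $n=0,1,2,\dots$, all $s=1,\dots,d$ and all $\psi\in\mathcal V^{(x)}_{h,p}$, $$\frac1\tau\int_{\Omega^{(x)}}(j_s^{n+1}-j_s^n)\,\psi\,\mathrm d\bm x+\sum_{T\in\mathcal T_h^{(x)}}\int_T\big(-\bm\sigma_s^n\cdot\nabla\psi+E_s^n\rho^n\psi\big)\,\mathrm d\bm x+\sum_{e\in\mathcal F_h^{(x)}}\int_e\big(\bm n^{(e)}\cdot\{\bm\sigma_s^n\}_e\big)\,[\psi]_e\,\mathrm dS=0,$$ which is the DG discretization with central fluxes and explicit Euler time stepping of the continuity equation $\partial_tj_s+\nabla_x\cdot\bm\sigma_s=-E_s\rho$. Hence the total momentum is conserved: $\int_{\Omega^{(x)}}\bm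 j^{n+1}\,\mathrm d\bm x=\int_{\Omega^{(x)}}\bm j^n\,\mathrm d\bm x$ for all $n$, where $\bm j^n=(j_1^n,\dots,j_d^n)$.
   Context: **Equation.** Vlasov–Poisson: $\partial_t f+\bm v\cdot\nabla_{\bm x}f-\bm E\cdot\nabla_{\bm v}f=0$, $\bm E=-\nabla_{\bm x}\Phi$, $-\Delta\Phi=1-\int f\,\mathrm d\bm v$. **Domains and DG spaces.** $\Omega^{(x)},\Omega^{(v)}\subset\mathbb R^d$ are bounded boxes regarded as periodic domains. The velocity box is a computational domain replacing $\mathbb R^d$, and it is assumed to be so large that it contains the support of the solution in its interior: for every $n$, $f^n(\bm x,\bm v)=0$ for $\bm v$ in a neighbourhood of the boundary of the box $\Omega^{(v)}$. For $y\in\{x,v\}$, $\mathcal T_h^{(y)}$ is a (not necessarily conforming) finite periodic triangulation of $\Omega^{(y)}$, and $\mathcal V^{(y)}_{h,k}=\{U\in L_2(\Omega^{(y)}):U|_T \text{ is a polynomial of degree}\le k\text{ for all }T\in\mathcal T_h^{(y)}\}$. The spaces $\mathcal V^{(x)}_{h,p}$ and $\mathcal V^{(v)}_{h,q}$ (degrees $p,q$) are used. $\mathcal F^{(y)}_h$ is the set of $(d-1)$-dimensional faces (interfaces between neighbouring elements; by periodicity all faces are interior, those on the boundary of the box being identified with the opposite ones). Each $e\in\mathcal F_h^{(y)}$ carries a fixed unit normal $\bm n^{(e)}$, and $U^\pm_e(\bm y)=\lim_{\epsilon\to0^+}U(\bm y\pm\epsilon\bm n^{(e)})$, $\{U\}_e=\frac12(U_e^++U_e^-)$,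 $[U]_e=U_e^--U_e^+$ (componentwise for vectors). **Inner products.** $(\cdot,\cdot)_x,(\cdot,\cdot)_v,(\cdot,\cdot)_{xv}$ are the $L_2$ inner products on $\Omega^{(x)},\Omega^{(v)},\Omega^{(x)}\times\Omega^{(v)}$ (for vector functions, summed over components); $(V,W)_{v,\omega}=\int_{\Omega^{(v)}}VW\omega\,\mathrm d\bm v$ with $\omega(\bm v)=\exp(-\|\bm v\|^2/2)$. **Discrete derivative.** For piecewise smooth $U$ and $V$ on $\mathcal T_h^{(y)}$, $(\hat{\mathrm d}_{y_s}U,V)_y:=\sum_T\int_T\partial_{y_s}U\,V\,\mathrm d\bm y-\sum_e\int_e n^{(e)}_s[U]_e\{V\}_e\,\mathrm dS$. **Numerical flux.** For symmetric matrices $\mathsf A^{(1)},\dots,\mathsf A^{(d)}$ put $\mathsf A_e=\sum_s n_s^{(e)}\mathsf A^{(s)}$ and $\bm F_e^*(\bm U_e^-,\bm U_e^+)=\mathsf A_e\{\bm U\}_e+\frac{1-\alpha}2|\mathsf A_e|[\bm U]_e$, with $|\mathsf A_e|$ the matrix absolute value; $\alpha=1$ is the central flux. **State at step $n$.** $f^n=\omega\sum_{i,j=1}^rS^n_{ij}X^n_i\otimes V^n_j$, with $X_i^n\in\mathcal V^{(x)}_{h,p}$ orthonormal in $(\cdot,\cdot)_x$, $V_j^n\in\mathcal V^{(v)}_{h,q}$ orthonormal in $(\cdot,\cdot)_{v,\omega}$, $V^n_a=U_a$ for $a=1,\dots,m$ with fixed functions $U_a\in\mathcal V_{h,q}^{(v)}$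 independent of $n$, and $S^n_{a\mu}=0$ for $a\le m<\mu$ (always achievable by a change of the basis $X^n$). The rank $r$ may depend on $n$. Set $K^n_j=\sum_iX_i^nS^n_{ij}$. $\bm E^n=-\nabla\Phi^n$ is the exact electric field of $\rho^n=(f^n,1)_v$, i.e. $\Phi^n$ is periodic and $-\Delta\Phi^n=1-\rho^n$; the initial data satisfy the compatibility condition $\int_{\Omega^{(x)}}\rho^0\,\mathrm d\bm x=|\Omega^{(x)}|$. **One time step.** (K-step) $\mathsf A^{(x,s)}_{ij}=(v_sV_j^n,V_i^n)_{v,\omega}$, $\mathsf B^{(x,s)}_{h,ij}=(\hat{\mathrm d}_{v_s}(\omega V_j^n),V_i^n)_v$. Find $\bm K^{n+1}\in(\mathcal V_{h,p}^{(x)})^r$ with $$\tfrac1\tau(\bm K^{n+1}-\bm K^n,\bm\psi)_x+\sum_T\sum_s\int_T\big[-(\mathsf A^{(x,s)}\bm K^n)\cdot\partial_{x_s}\bm\psi-E^n_s(\mathsf B_h^{(x,s)}\bm K^n)\cdot\bm\psi\big]\mathrm d\bm x+\sum_{e\in\mathcal F_h^{(x)}}\int_e\bm F^*_e((\bm K^n)_e^-,(\bm K^n)_e^+)\cdot[\bm\psi]_e\,\mathrm dS=0$$ for all $\bm\psi\in(\mathcal V^{(x)}_{h,p})^r$ (flux built from $\mathsf A^{(x,s)}$). (L-step) $\mathsf A^{(v,s)}_{ij}=(-E^n_sX_j^n,X_i^n)_x$, $\mathsf B^{(v,s)}_{h,ij}=(\hat{\mathrm d}_{x_s}X_j^n,X_i^n)_x$;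 $\widehat{\mathsf A}^{(v,s)},\widehat{\mathsf B}_h^{(v,s)}$ are the submatrices with both indices in $\{m+1,\dots,r\}$, and $\bar{\mathsf A}^{(v,s)},\bar{\mathsf B}_h^{(v,s)}$ those with row index in $\{m+1,\dots,r\}$ and all columns; $\bar S=[S^n_{ia}]_{i\le r,a\le m}$, $\bm U=[U_a]_a$. $\mathcal P_\omega:\mathcal V_{h,q}^{(v)}\to\mathcal V_{h,q}^{(v)}$ is the invertible map with $(\mathcal P_\omega L,\psi)_v=(\omega L,\psi)_v$ for all $\psi\in\mathcal V_{h,q}^{(v)}$. With $\widehat L^n_\mu=\mathcal P_\omega(\sum_{\nu>m}S^n_{\mu\nu}V^n_\nu)$, $\mu=m+1,\dots,r$, find $\widehat{\bm L}^{n+1}\in(\mathcal V_{h,q}^{(v)})^{r-m}$ with $(U_a,\widehat L^{n+1}_\mu)_v=0$ and $$\tfrac1\tau(\widehat{\bm L}^{n+1}-\widehat{\bm L}^n,\bm\psi)_v+\sum_T\sum_s\int_T\big[-(\widehat{\mathsf A}^{(v,s)}\widehat{\bm L}^n)\cdot\partial_{v_s}\bm\psi+v_s(\widehat{\mathsf B}_h^{(v,s)}\widehat{\bm L}^n)\cdot\bm\psi\big]\mathrm d\bm v+\sum_{e\in\mathcal F_h^{(v)}}\int_e\bm F_e^*((\widehat{\bm L}^n)^-_e,(\widehat{\bm L}^n)^+_e)\cdot[\bm\psi]_e\,\mathrm dS=-\sum_s\big(\bar{\mathsf A}^{(v,s)}\bar S\,\partial_{v_s}(\omega\bm U)+v_s\bar{\mathsf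 B}_h^{(v,s)}\bar S\,\omega\bm U,\bm\psi\big)_v$$ for all $\bm\psi\in(\mathcal V_{h,q}^{(v)})^{r-m}$ with $(U_a,\psi_\mu)_{v,\omega}=0$ (derivatives elementwise, flux built from $\widehat{\mathsf A}^{(v,s)}$). Set $L^{n+1}_\mu=\mathcal P_\omega^{-1}\widehat L_\mu^{n+1}$. (Augmentation) $\{\tilde X_k^{n+1}\}_k\subset\mathcal V^{(x)}_{h,p}$ is a $(\cdot,\cdot)_x$-orthonormal basis of $\mathrm{span}\{X_i^n,K_i^{n+1}\}_{i\le r}$ (generically $2r$ functions), and $\{\tilde V_\ell^{n+1}\}_\ell\subset\mathcal V^{(v)}_{h,q}$ is a $(\cdot,\cdot)_{v,\omega}$-orthonormal basis of $\mathrm{span}(\{V_j^n\}_{j\le r}\cup\{L_\mu^{n+1}\}_{\mu>m})$ (generically $2r-m$ functions) with $\tilde V_a^{n+1}=U_a$ for $a\le m$. Put $\tilde S^n_{k\ell}=\sum_{ij}(\tilde X_k^{n+1},X_i^n)_xS^n_{ij}(\tilde V_\ell^{n+1},V_j^n)_{v,\omega}$. (S-step) $\tilde S^{n+1}_{k\ell}=\tilde S^n_{k\ell}-\tau\sum_{i,j,s}\big[(\hat{\mathrm d}_{x_s}X_i^n,\tilde X_k^{n+1})_xS_{ij}^n(\tilde V_\ell^{n+1},v_sV_j^n)_{v,\omega}+(\tilde X_k^{n+1},-E_s^nX_i^n)_xS^n_{ij}(\hat{\mathrm d}_{v_s}(\omega V_j^n),\tilde V_\ell^{n+1})_v\big]$.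 (Truncation) Write $\omega\sum_{k\ell}\tilde S^{n+1}_{k\ell}\tilde X_k^{n+1}\otimes\tilde V_\ell^{n+1}=\omega\sum_{a\le m}\tilde K_a\otimes U_a+\omega\sum_{\ell>m}\tilde K_\ell\otimes\tilde V_\ell^{n+1}$. The first sum is kept; in the second, $\sum_{\ell>m}\tilde K_\ell\otimes\tilde V^{n+1}_\ell$ is replaced by a truncated singular value decomposition, whose velocity functions lie in $\mathrm{span}\{\tilde V_\ell^{n+1}\}_{\ell>m}$ and hence are $(\cdot,\cdot)_{v,\omega}$-orthogonal to all $U_a$. The result is $f^{n+1}$, rewritten in the format of the state at step $n+1$. *)

theory Defs
  imports "HOL-Analysis.Analysis"
begin

section \<open>Periodic meshes\<close>

text \<open>
  The domain is the box \<open>cbox (lo M) (hi M)\<close>, seen as a torus. A face is stored as one subset of the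
  closed box (representing all its lattice translates), together with a chosen unit normal.
\<close>

record ('d::finite) mesh =
  lo :: "real ^ 'd"
  hi :: "real ^ 'd"
  cells :: "(real ^ 'd) set set"
  faces :: "(real ^ 'd) set set"
  nrm :: "(real ^ 'd) set \<Rightarrow> real ^ 'd"

definition Omega :: "('d::finite) mesh \<Rightarrow> (real ^ 'd) set"
  where "Omega M = cbox (lo M) (hi M)"

definition periods :: "('d::finite) mesh \<Rightarrow> (real ^ 'd) set"
  where "periods M = {z. \<exists>k :: 'd \<Rightarrow> int. \<forall>i. z $ i = of_int (k i) * (hi M $ i - lo M $ i)}"

definition wrap :: "('d::finite) mesh \<Rightarrow> real ^ 'd \<Rightarrow> real ^ 'd"
  where "wrap M y = (\<chi> i. lo M $ i
           + (hi M $ i - lo M $ i) * frac ((y $ i - lo M $ i) / (hi M $ i - lo M $ i)))"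

text \<open>
  Neighbouring elements need not share a full facet, so the faces are the
  \<open>(d - 1)\<close>-dimensional intersections of elements modulo periods. The translated copy of an element
  may meet the element itself (\<open>T = T'\<close>, \<open>z \<noteq> 0\<close>), e.g. on a mesh with a single element.
\<close>

definition interface :: "('d::finite) mesh \<Rightarrow> (real ^ 'd) set \<Rightarrow> bool"
  where "interface M e \<longleftrightarrow>
    (\<exists>T\<in>cells M. \<exists>T'\<in>cells M. \<exists>z\<in>periods M.
       e = T \<inter> (+) z ` T' \<and> aff_dim e = int CARD('d) - 1)"

text \<open>
  Elements are convex polytopes with nonempty interior; this covers simplices as well as boxes.
  No conformity is required, neither inside the box nor across its identified sides.
\<close>

definition periodic_mesh :: "('d::finite) mesh \<Rightarrow> bool"
  where "periodic_mesh M \<longleftrightarrow>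
    (\<forall>i. lo M $ i < hi M $ i) \<and>
    finite (cells M) \<and>
    (\<forall>T\<in>cells M. polytope T \<and> interior T \<noteq> {}) \<and>
    (\<forall>T\<in>cells M. \<forall>T'\<in>cells M. T \<noteq> T' \<longrightarrow> interior T \<inter> interior T' = {}) \<and>
    \<Union> (cells M) = Omega M \<and>
    finite (faces M) \<and>
    (\<forall>e\<in>faces M. interface M e) \<and>
    (\<forall>e. interface M e \<longrightarrow> (\<exists>!e'. e' \<in> faces M \<and> (\<exists>z\<in>periods M. e' = (+) z ` e))) \<and>
    (\<forall>e\<in>faces M. norm (nrm M e) = 1 \<and> (\<forall>x\<in>e. \<forall>y\<in>e. nrm M e \<bullet> (x - y) = 0))"

text \<open>
  Surface integral over the flat face \<open>e\<close> with unit normal \<open>n\<close>: by Fubini it is the volume integral,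
  over the prism of height 1 with base \<open>e\<close>, of the integrand extended constantly along \<open>n\<close>.
  For \<open>d = 1\<close> this is evaluation at a point.
\<close>

definition face_integral :: "('d::finite) mesh \<Rightarrow> (real ^ 'd) set \<Rightarrow> (real ^ 'd \<Rightarrow> real) \<Rightarrow> real"
  where "face_integral M e g =
    (let n = nrm M e; y0 = (SOME y. y \<in> e) in
      LINT y : {x + t *\<^sub>R n | x t. x \<in> e \<and> t \<in> {0..1}} | lebesgue.
        g (y - ((y - y0) \<bullet> n) *\<^sub>R n))"


section \<open>Discontinuous Galerkin spaces\<close>

definition poly_deg_le :: "nat \<Rightarrow> (real ^ 'd::finite \<Rightarrow> real) \<Rightarrow> bool"
  where "poly_deg_le k P \<longleftrightarrow>
    (\<exists>c :: ('d \<Rightarrow> nat) \<Rightarrow> real. \<forall>y. P y = (\<Sum>\<alpha> | (\<Sum>i\<in>UNIV. \<alpha> i) \<le> k. c \<alpha> * (\<Prod>i\<in>UNIV. y $ i ^ \<alpha> i)))"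

text \<open>
  An element of the DG space is only defined up to null sets. We use the representative vanishing off
  the open elements, so that equality of functions is equality in \<open>L\<^sub>2\<close>;
  \<open>canon M g\<close> is this representative of a piecewise continuous \<open>g\<close>.
\<close>

definition dg_space :: "('d::finite) mesh \<Rightarrow> nat \<Rightarrow> (real ^ 'd \<Rightarrow> real) set"
  where "dg_space M k = {U.
    (\<forall>T\<in>cells M. \<exists>P. poly_deg_le k P \<and> (\<forall>y\<in>interior T. U y = P y)) \<and>
    (\<forall>y. y \<notin> (\<Union>T\<in>cells M. interior T) \<longrightarrow> U y = 0)}"

definition canon :: "('d::finite) mesh \<Rightarrow> (real ^ 'd \<Rightarrow> real) \<Rightarrow> real ^ 'd \<Rightarrow> real"
  where "canon M g = (\<lambda>y. if y \<in> (\<Union>T\<in>cells M. interior T) then g y else 0)"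

definition lin_span :: "('a \<Rightarrow> real) set \<Rightarrow> ('a \<Rightarrow> real) set"
  where "lin_span G = {u. \<exists>H c. finite H \<and> H \<subseteq> G \<and> (\<forall>y. u y = (\<Sum>g\<in>H. c g * g y))}"

definition pd :: "'d \<Rightarrow> (real ^ 'd::finite \<Rightarrow> real) \<Rightarrow> real ^ 'd \<Rightarrow> real"
  where "pd s U y = deriv (\<lambda>t. U (y + t *\<^sub>R axis s 1)) 0"

text \<open>One-sided traces of the periodic extension of \<open>U\<close>.\<close>

definition trp :: "('d::finite) mesh \<Rightarrow> (real ^ 'd) set \<Rightarrow> (real ^ 'd \<Rightarrow> real) \<Rightarrow> real ^ 'd \<Rightarrow> real"
  where "trp M e U y = Lim (at_right 0) (\<lambda>\<epsilon>. U (wrap M (y + \<epsilon> *\<^sub>R nrm M e)))"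

definition trm :: "('d::finite) mesh \<Rightarrow> (real ^ 'd) set \<Rightarrow> (real ^ 'd \<Rightarrow> real) \<Rightarrow> real ^ 'd \<Rightarrow> real"
  where "trm M e U y = Lim (at_right 0) (\<lambda>\<epsilon>. U (wrap M (y - \<epsilon> *\<^sub>R nrm M e)))"

definition avg :: "('d::finite) mesh \<Rightarrow> (real ^ 'd) set \<Rightarrow> (real ^ 'd \<Rightarrow> real) \<Rightarrow> real ^ 'd \<Rightarrow> real"
  where "avg M e U y = (trp M e U y + trm M e U y) / 2"

definition jump :: "('d::finite) mesh \<Rightarrow> (real ^ 'd) set \<Rightarrow> (real ^ 'd \<Rightarrow> real) \<Rightarrow> real ^ 'd \<Rightarrow> real"
  where "jump M e U y = trm M e U y - trp M e U y"

definition ip :: "('d::finite) mesh \<Rightarrow> (real ^ 'd \<Rightarrow> real) \<Rightarrow> (real ^ 'd \<Rightarrow> real) \<Rightarrow> real"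
  where "ip M U V = (LINT y : Omega M | lebesgue. U y * V y)"

definition gw :: "real ^ 'd::finite \<Rightarrow> real"
  where "gw v = exp (- (norm v)\<^sup>2 / 2)"

definition ipw :: "('d::finite) mesh \<Rightarrow> (real ^ 'd \<Rightarrow> real) \<Rightarrow> (real ^ 'd \<Rightarrow> real) \<Rightarrow> real"
  where "ipw M V W = (LINT v : Omega M | lebesgue. V v * W v * gw v)"

definition dhat :: "('d::finite) mesh \<Rightarrow> 'd \<Rightarrow> (real ^ 'd \<Rightarrow> real) \<Rightarrow> (real ^ 'd \<Rightarrow> real) \<Rightarrow> real"
  where "dhat M s U V =
    (\<Sum>T\<in>cells M. LINT y : T | lebesgue. pd s U y * V y)
    - (\<Sum>e\<in>faces M. face_integral M e (\<lambda>y. nrm M e $ s * jump M e U y * avg M e V y))"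


section \<open>Numerical flux\<close>

text \<open>
  Matrices and vectors are indexed by a finite set \<open>I\<close> of naturals; entries outside \<open>I\<close> are irrelevant.
  \<open>mat_abs I A\<close> is \<open>Q |\<Lambda>| Q\<^sup>T\<close> for a spectral decomposition \<open>A = Q \<Lambda> Q\<^sup>T\<close> of the symmetric matrix \<open>A\<close>; on
  \<open>I\<close> it does not depend on the decomposition.
\<close>

definition mat_abs :: "nat set \<Rightarrow> (nat \<Rightarrow> nat \<Rightarrow> real) \<Rightarrow> nat \<Rightarrow> nat \<Rightarrow> real"
  where "mat_abs I A = (SOME B. \<exists>Q l.
    (\<forall>i\<in>I. \<forall>j\<in>I. (\<Sum>k\<in>I. Q k i * Q k j) = (if i = j then 1 else 0)) \<and>
    (\<forall>i\<in>I. \<forall>j\<in>I. A i j = (\<Sum>k\<in>I. Q i k * l k * Q j k)) \<and>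
    (\<forall>i\<in>I. \<forall>j\<in>I. B i j = (\<Sum>k\<in>I. Q i k * \<bar>l k\<bar> * Q j k)))"

definition face_mat :: "('d::finite) mesh \<Rightarrow> ('d \<Rightarrow> nat \<Rightarrow> nat \<Rightarrow> real) \<Rightarrow> (real ^ 'd) set \<Rightarrow> nat \<Rightarrow> nat \<Rightarrow> real"
  where "face_mat M A e i j = (\<Sum>s\<in>UNIV. nrm M e $ s * A s i j)"

definition num_flux :: "('d::finite) mesh \<Rightarrow> nat set \<Rightarrow> real \<Rightarrow> ('d \<Rightarrow> nat \<Rightarrow> nat \<Rightarrow> real) \<Rightarrow> (real ^ 'd) set
    \<Rightarrow> (nat \<Rightarrow> real ^ 'd \<Rightarrow> real) \<Rightarrow> nat \<Rightarrow> real ^ 'd \<Rightarrow> real"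
  where "num_flux M I \<alpha> A e U i y =
    (\<Sum>j\<in>I. face_mat M A e i j * avg M e (U j) y)
    + (1 - \<alpha>) / 2 * (\<Sum>j\<in>I. mat_abs I (face_mat M A e) i j * jump M e (U j) y)"


section \<open>Electric field\<close>

definition sq_integrable :: "('d::finite) mesh \<Rightarrow> (real ^ 'd \<Rightarrow> real) \<Rightarrow> bool"
  where "sq_integrable M g \<longleftrightarrow> g \<in> borel_measurable (lebesgue_on (Omega M))
    \<and> integrable (lebesgue_on (Omega M)) (\<lambda>x. (g x)\<^sup>2)"

definition periodic_C1 :: "('d::finite) mesh \<Rightarrow> (real ^ 'd \<Rightarrow> real) \<Rightarrow> bool"
  where "periodic_C1 M \<phi> \<longleftrightarrow>
    (\<forall>x. \<phi> differentiable (at x)) \<and> (\<forall>s. continuous_on UNIV (pd s \<phi>)) \<and>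
    (\<forall>x. \<forall>z\<in>periods M. \<phi> (x + z) = \<phi> x)"

text \<open>
  Weak gradient on the torus: testing with periodic functions expresses the periodicity of \<open>\<Phi>\<close>.
\<close>

definition weak_gradient :: "('d::finite) mesh \<Rightarrow> (real ^ 'd \<Rightarrow> real) \<Rightarrow> (real ^ 'd \<Rightarrow> real ^ 'd) \<Rightarrow> bool"
  where "weak_gradient M \<Phi> G \<longleftrightarrow>
    sq_integrable M \<Phi> \<and> (\<forall>s. sq_integrable M (\<lambda>x. G x $ s)) \<and>
    (\<forall>s \<phi>. periodic_C1 M \<phi> \<longrightarrow>
       (LINT x : Omega M | lebesgue. G x $ s * \<phi> x) = - (LINT x : Omega M | lebesgue. \<Phi> x * pd s \<phi> x))"

text \<open>
  \<open>E = - \<nabla>\<Phi>\<close> where \<open>\<Phi>\<close> is a periodic \<open>H\<^sup>1\<close> weak solution of \<open>- \<Delta>\<Phi> = 1 - \<rho>\<close>. As \<open>\<rho>\<close> is only piecewise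
  polynomial, there is no classical solution in general.
\<close>

definition electric_field :: "('d::finite) mesh \<Rightarrow> (real ^ 'd \<Rightarrow> real) \<Rightarrow> (real ^ 'd \<Rightarrow> real ^ 'd) \<Rightarrow> bool"
  where "electric_field M \<rho> E \<longleftrightarrow>
    (\<exists>\<Phi> G. weak_gradient M \<Phi> G \<and>
       (\<forall>\<phi>. periodic_C1 M \<phi> \<longrightarrow>
          (LINT x : Omega M | lebesgue. (\<Sum>s\<in>UNIV. G x $ s * pd s \<phi> x))
          = (LINT x : Omega M | lebesgue. (1 - \<rho> x) * \<phi> x)) \<and>
       (\<forall>x. E x = - G x))"


section \<open>Low-rank states and their moments\<close>

text \<open>All index ranges start at 1.\<close>

record ('d::finite) state =
  rk :: nat
  Xf :: "nat \<Rightarrow> real ^ 'd \<Rightarrow> real"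
  Sf :: "nat \<Rightarrow> nat \<Rightarrow> real"
  Vf :: "nat \<Rightarrow> real ^ 'd \<Rightarrow> real"

definition dens :: "('d::finite) state \<Rightarrow> real ^ 'd \<Rightarrow> real ^ 'd \<Rightarrow> real"
  where "dens st x v = gw v * (\<Sum>i=1..rk st. \<Sum>j=1..rk st. Sf st i j * Xf st i x * Vf st j v)"

definition Kf :: "('d::finite) state \<Rightarrow> nat \<Rightarrow> real ^ 'd \<Rightarrow> real"
  where "Kf st j x = (\<Sum>i=1..rk st. Xf st i x * Sf st i j)"

definition charge :: "('d::finite) mesh \<Rightarrow> 'd state \<Rightarrow> real ^ 'd \<Rightarrow> real"
  where "charge Mv st x = (LINT v : Omega Mv | lebesgue. dens st x v)"

definition current :: "('d::finite) mesh \<Rightarrow> 'd state \<Rightarrow> 'd \<Rightarrow> real ^ 'd \<Rightarrow> real"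
  where "current Mv st s x = (LINT v : Omega Mv | lebesgue. v $ s * dens st x v)"

definition stress :: "('d::finite) mesh \<Rightarrow> 'd state \<Rightarrow> 'd \<Rightarrow> 'd \<Rightarrow> real ^ 'd \<Rightarrow> real"
  where "stress Mv st s s' x = (LINT v : Omega Mv | lebesgue. v $ s * v $ s' * dens st x v)"

definition orthonormal :: "(('a \<Rightarrow> real) \<Rightarrow> ('a \<Rightarrow> real) \<Rightarrow> real) \<Rightarrow> nat \<Rightarrow> (nat \<Rightarrow> 'a \<Rightarrow> real) \<Rightarrow> bool"
  where "orthonormal inn r u \<longleftrightarrow> (\<forall>i\<in>{1..r}. \<forall>j\<in>{1..r}. inn (u i) (u j) = (if i = j then 1 else 0))"

definition valid_state :: "('d::finite) mesh \<Rightarrow> 'd mesh \<Rightarrow> nat \<Rightarrow> nat \<Rightarrow> nat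
    \<Rightarrow> (nat \<Rightarrow> real ^ 'd \<Rightarrow> real) \<Rightarrow> 'd state \<Rightarrow> bool"
  where "valid_state Mx Mv p q m U st \<longleftrightarrow>
    m \<le> rk st \<and>
    (\<forall>i\<in>{1..rk st}. Xf st i \<in> dg_space Mx p) \<and> orthonormal (ip Mx) (rk st) (Xf st) \<and>
    (\<forall>j\<in>{1..rk st}. Vf st j \<in> dg_space Mv q) \<and> orthonormal (ipw Mv) (rk st) (Vf st) \<and>
    (\<forall>a\<in>{1..m}. Vf st a = U a) \<and>
    (\<forall>a\<in>{1..m}. \<forall>\<mu>\<in>{m+1..rk st}. Sf st a \<mu> = 0)"

definition vanishes_near_boundary :: "('d::finite) mesh \<Rightarrow> 'd mesh \<Rightarrow> 'd state \<Rightarrow> bool"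
  where "vanishes_near_boundary Mx Mv st \<longleftrightarrow>
    (\<exists>W. open W \<and> frontier (Omega Mv) \<subseteq> W \<and> (\<forall>x\<in>Omega Mx. \<forall>v\<in>W \<inter> Omega Mv. dens st x v = 0))"


section \<open>One time step\<close>

definition Ax :: "('d::finite) mesh \<Rightarrow> 'd state \<Rightarrow> 'd \<Rightarrow> nat \<Rightarrow> nat \<Rightarrow> real"
  where "Ax Mv st s i j = ipw Mv (\<lambda>v. v $ s * Vf st j v) (Vf st i)"

definition Bx :: "('d::finite) mesh \<Rightarrow> 'd state \<Rightarrow> 'd \<Rightarrow> nat \<Rightarrow> nat \<Rightarrow> real"
  where "Bx Mv st s i j = dhat Mv s (\<lambda>v. gw v * Vf st j v) (Vf st i)"

definition k_step :: "('d::finite) mesh \<Rightarrow> 'd mesh \<Rightarrow> nat \<Rightarrow> real \<Rightarrow> real \<Rightarrow> (real ^ 'd \<Rightarrow> real ^ 'd)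
    \<Rightarrow> 'd state \<Rightarrow> (nat \<Rightarrow> real ^ 'd \<Rightarrow> real) \<Rightarrow> bool"
  where "k_step Mx Mv p \<alpha> \<tau> E st Knew \<longleftrightarrow>
    (let I = {1..rk st}; K = Kf st; A = Ax Mv st; B = Bx Mv st in
     (\<forall>i\<in>I. Knew i \<in> dg_space Mx p) \<and>
     (\<forall>\<psi>. (\<forall>i\<in>I. \<psi> i \<in> dg_space Mx p) \<longrightarrow>
        1 / \<tau> * (\<Sum>i\<in>I. ip Mx (\<lambda>x. Knew i x - K i x) (\<psi> i))
        + (\<Sum>T\<in>cells Mx. \<Sum>s\<in>UNIV. LINT x : T | lebesgue.
             - (\<Sum>i\<in>I. (\<Sum>j\<in>I. A s i j * K j x) * pd s (\<psi> i) x)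
             - E x $ s * (\<Sum>i\<in>I. (\<Sum>j\<in>I. B s i j * K j x) * \<psi> i x))
        + (\<Sum>e\<in>faces Mx. face_integral Mx e
             (\<lambda>x. \<Sum>i\<in>I. num_flux Mx I \<alpha> A e K i x * jump Mx e (\<psi> i) x))
        = 0))"

definition P_omega :: "('d::finite) mesh \<Rightarrow> nat \<Rightarrow> (real ^ 'd \<Rightarrow> real) \<Rightarrow> real ^ 'd \<Rightarrow> real"
  where "P_omega Mv q L = (THE H. H \<in> dg_space Mv q \<and>
    (\<forall>\<psi>\<in>dg_space Mv q. ip Mv H \<psi> = ip Mv (\<lambda>v. gw v * L v) \<psi>))"

definition Av :: "('d::finite) mesh \<Rightarrow> (real ^ 'd \<Rightarrow> real ^ 'd) \<Rightarrow> 'd state \<Rightarrow> 'd \<Rightarrow> nat \<Rightarrow> nat \<Rightarrow> real"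
  where "Av Mx E st s i j = ip Mx (\<lambda>x. - E x $ s * Xf st j x) (Xf st i)"

definition Bv :: "('d::finite) mesh \<Rightarrow> 'd state \<Rightarrow> 'd \<Rightarrow> nat \<Rightarrow> nat \<Rightarrow> real"
  where "Bv Mx st s i j = dhat Mx s (Xf st j) (Xf st i)"

text \<open>
  The submatrices with hats and bars are obtained by restricting the ranges of the indices.
\<close>

definition l_step :: "('d::finite) mesh \<Rightarrow> 'd mesh \<Rightarrow> nat \<Rightarrow> nat \<Rightarrow> (nat \<Rightarrow> real ^ 'd \<Rightarrow> real) \<Rightarrow> real \<Rightarrow> real
    \<Rightarrow> (real ^ 'd \<Rightarrow> real ^ 'd) \<Rightarrow> 'd state \<Rightarrow> (nat \<Rightarrow> real ^ 'd \<Rightarrow> real) \<Rightarrow> bool"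
  where "l_step Mx Mv q m U \<alpha> \<tau> E st Lnew \<longleftrightarrow>
    (let I = {1..rk st}; J = {m+1..rk st}; A = Av Mx E st; B = Bv Mx st;
         L = (\<lambda>\<mu>. P_omega Mv q (\<lambda>v. \<Sum>\<nu>\<in>J. Sf st \<mu> \<nu> * Vf st \<nu> v)) in
     \<exists>Lh.
       (\<forall>\<mu>\<in>J. Lh \<mu> \<in> dg_space Mv q \<and> (\<forall>a\<in>{1..m}. ip Mv (U a) (Lh \<mu>) = 0)) \<and>
       (\<forall>\<psi>. (\<forall>\<mu>\<in>J. \<psi> \<mu> \<in> dg_space Mv q \<and> (\<forall>a\<in>{1..m}. ipw Mv (U a) (\<psi> \<mu>) = 0)) \<longrightarrow>
          1 / \<tau> * (\<Sum>\<mu>\<in>J. ip Mv (\<lambda>v. Lh \<mu> v - L \<mu> v) (\<psi> \<mu>))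
          + (\<Sum>T\<in>cells Mv. \<Sum>s\<in>UNIV. LINT v : T | lebesgue.
               - (\<Sum>\<mu>\<in>J. (\<Sum>\<nu>\<in>J. A s \<mu> \<nu> * L \<nu> v) * pd s (\<psi> \<mu>) v)
               + v $ s * (\<Sum>\<mu>\<in>J. (\<Sum>\<nu>\<in>J. B s \<mu> \<nu> * L \<nu> v) * \<psi> \<mu> v))
          + (\<Sum>e\<in>faces Mv. face_integral Mv e
               (\<lambda>v. \<Sum>\<mu>\<in>J. num_flux Mv J \<alpha> A e L \<mu> v * jump Mv e (\<psi> \<mu>) v))
          = - (\<Sum>s\<in>UNIV. \<Sum>\<mu>\<in>J. ip Mv
                (\<lambda>v. (\<Sum>i\<in>I. \<Sum>a=1..m. A s \<mu> i * Sf st i a * pd s (\<lambda>w. gw w * U a w) v)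
                   + v $ s * (\<Sum>i\<in>I. \<Sum>a=1..m. B s \<mu> i * Sf st i a * (gw v * U a v)))
                (\<psi> \<mu>))) \<and>
       (\<forall>\<mu>\<in>J. Lnew \<mu> = inv_into (dg_space Mv q) (P_omega Mv q) (Lh \<mu>)))"

definition augmentation :: "('d::finite) mesh \<Rightarrow> 'd mesh \<Rightarrow> nat \<Rightarrow> nat \<Rightarrow> nat \<Rightarrow> (nat \<Rightarrow> real ^ 'd \<Rightarrow> real)
    \<Rightarrow> 'd state \<Rightarrow> (nat \<Rightarrow> real ^ 'd \<Rightarrow> real) \<Rightarrow> (nat \<Rightarrow> real ^ 'd \<Rightarrow> real)
    \<Rightarrow> nat \<Rightarrow> (nat \<Rightarrow> real ^ 'd \<Rightarrow> real) \<Rightarrow> nat \<Rightarrow> (nat \<Rightarrow> real ^ 'd \<Rightarrow> real) \<Rightarrow> bool"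
  where "augmentation Mx Mv p q m U st Knew Lnew Rx Xt Rv Vt \<longleftrightarrow>
    (\<forall>k\<in>{1..Rx}. Xt k \<in> dg_space Mx p) \<and> orthonormal (ip Mx) Rx Xt \<and>
    lin_span (Xt ` {1..Rx}) = lin_span (Xf st ` {1..rk st} \<union> Knew ` {1..rk st}) \<and>
    (\<forall>l\<in>{1..Rv}. Vt l \<in> dg_space Mv q) \<and> orthonormal (ipw Mv) Rv Vt \<and>
    lin_span (Vt ` {1..Rv}) = lin_span (Vf st ` {1..rk st} \<union> Lnew ` {m+1..rk st}) \<and>
    m \<le> Rv \<and> (\<forall>a\<in>{1..m}. Vt a = U a)"

definition s_step :: "('d::finite) mesh \<Rightarrow> 'd mesh \<Rightarrow> real \<Rightarrow> (real ^ 'd \<Rightarrow> real ^ 'd) \<Rightarrow> 'd state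
    \<Rightarrow> nat \<Rightarrow> (nat \<Rightarrow> real ^ 'd \<Rightarrow> real) \<Rightarrow> nat \<Rightarrow> (nat \<Rightarrow> real ^ 'd \<Rightarrow> real)
    \<Rightarrow> (nat \<Rightarrow> nat \<Rightarrow> real) \<Rightarrow> bool"
  where "s_step Mx Mv \<tau> E st Rx Xt Rv Vt Snew \<longleftrightarrow>
    (let I = {1..rk st}; X = Xf st; V = Vf st; S = Sf st;
         St = (\<lambda>k l. \<Sum>i\<in>I. \<Sum>j\<in>I. ip Mx (Xt k) (X i) * S i j * ipw Mv (Vt l) (V j)) in
     \<forall>k\<in>{1..Rx}. \<forall>l\<in>{1..Rv}.
       Snew k l = St k l - \<tau> * (\<Sum>i\<in>I. \<Sum>j\<in>I. \<Sum>s\<in>UNIV.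
           dhat Mx s (X i) (Xt k) * S i j * ipw Mv (Vt l) (\<lambda>v. v $ s * V j v)
         + ip Mx (Xt k) (\<lambda>x. - E x $ s * X i x) * S i j * dhat Mv s (\<lambda>v. gw v * V j v) (Vt l)))"

text \<open>
  \<open>\<Sum>k=1..R. \<sigma> k * P k \<otimes> Q k\<close> is a singular value decomposition of the second sum, of which the first
  \<open>R' \<le> R\<close> terms are retained; the truncation rank \<open>R'\<close> is arbitrary (rank adaptivity).
\<close>

definition truncation :: "('d::finite) mesh \<Rightarrow> 'd mesh \<Rightarrow> nat \<Rightarrow> (nat \<Rightarrow> real ^ 'd \<Rightarrow> real)
    \<Rightarrow> nat \<Rightarrow> (nat \<Rightarrow> real ^ 'd \<Rightarrow> real) \<Rightarrow> nat \<Rightarrow> (nat \<Rightarrow> real ^ 'd \<Rightarrow> real)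
    \<Rightarrow> (nat \<Rightarrow> nat \<Rightarrow> real) \<Rightarrow> 'd state \<Rightarrow> bool"
  where "truncation Mx Mv m U Rx Xt Rv Vt Snew st' \<longleftrightarrow>
    (let Kt = (\<lambda>l x. \<Sum>k=1..Rx. Snew k l * Xt k x) in
     \<exists>R R' \<sigma> P Q.
       R' \<le> R \<and>
       (\<forall>k\<in>{1..R}. 0 \<le> \<sigma> k) \<and> (\<forall>k\<in>{1..R}. \<forall>l\<in>{1..R}. k \<le> l \<longrightarrow> \<sigma> l \<le> \<sigma> k) \<and>
       orthonormal (ip Mx) R P \<and> (\<forall>k\<in>{1..R}. P k \<in> lin_span (Xt ` {1..Rx})) \<and>
       orthonormal (ipw Mv) R Q \<and> (\<forall>k\<in>{1..R}. Q k \<in> lin_span (Vt ` {m+1..Rv})) \<and>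
       (\<forall>x v. (\<Sum>l=m+1..Rv. Kt l x * Vt l v) = (\<Sum>k=1..R. \<sigma> k * P k x * Q k v)) \<and>
       (\<forall>x v. dens st' x v =
          gw v * (\<Sum>a=1..m. Kt a x * U a v) + gw v * (\<Sum>k=1..R'. \<sigma> k * P k x * Q k v)))"

definition time_step :: "('d::finite) mesh \<Rightarrow> 'd mesh \<Rightarrow> nat \<Rightarrow> nat \<Rightarrow> nat \<Rightarrow> (nat \<Rightarrow> real ^ 'd \<Rightarrow> real)
    \<Rightarrow> real \<Rightarrow> real \<Rightarrow> real \<Rightarrow> (real ^ 'd \<Rightarrow> real ^ 'd) \<Rightarrow> 'd state \<Rightarrow> 'd state \<Rightarrow> bool"
  where "time_step Mx Mv p q m U \<alpha>K \<alpha>L \<tau> E st st' \<longleftrightarrow>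
    (\<exists>Knew Lnew Rx Xt Rv Vt Snew.
       k_step Mx Mv p \<alpha>K \<tau> E st Knew \<and>
       l_step Mx Mv q m U \<alpha>L \<tau> E st Lnew \<and>
       augmentation Mx Mv p q m U st Knew Lnew Rx Xt Rv Vt \<and>
       s_step Mx Mv \<tau> E st Rx Xt Rv Vt Snew \<and>
       truncation Mx Mv m U Rx Xt Rv Vt Snew st')"

end

theory Submission
  imports Defs
begin

text \<open>
  The coefficient functions of \<open>U\<^sub>1, \<dots>, U\<^sub>m\<close> are not touched by the truncation, and the S-step reproduces for
  them the functions \<open>K\<^sub>a\<close> of the K-step: integration by parts on every element identifies the weak
  form with central flux with the discrete derivative used in the S-step, and the update of the
  K-step lies in the augmented space of position functions. Since \<open>v\<^sub>s = \<Sum>\<^sub>a c\<^sub>a U\<^sub>a\<close>, testing the K-step with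
  \<open>c\<^sub>a \<psi>\<close> gives the balance of \<open>j\<^sub>s\<close>; its force term is \<open>E\<^sub>s \<rho>\<close> because \<open>f\<close> vanishes near the boundary
  of the velocity box, so the jump of the periodic extension of \<open>v\<^sub>s\<close> across that boundary does not contribute.

  For \<open>\<psi> = 1\<close> the total momentum changes by \<open>-\<tau> \<integral> E\<^sub>s \<rho>\<close>. With \<open>E = -\<nabla>\<Phi>\<close> and \<open>\<Delta>\<Phi> = \<rho> - 1\<close> only weak, this
  integral is the limit of the integrals with \<open>\<rho> - 1\<close> replaced by its mollification by the even
  periodic kernels \<open>\<beta>\<^sub>n(z) = \<Prod>\<^sub>i ((1 + cos(2\<pi> z\<^sub>i / \<ell>\<^sub>i)) / 2)\<^sup>n\<close>; these all vanish because
  \<open>\<integral>\<integral> \<partial>\<^sub>r\<Phi>(x) \<partial>\<^sub>r\<Phi>(y) \<partial>\<^sub>s\<beta>\<^sub>n(x - y)\<close> is antisymmetric under exchange of \<open>x\<close> and \<open>y\<close>.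
\<close>

section \<open>Integration along lines\<close>

text \<open>Two obstacles shape the proof. A surface integral is given as a volume integral over a
  prism, and meshes need not be conforming: a face may be only part of a geometric facet, may adjoin
  the same cell from both sides, and is stored as one copy among its translates. The boundary of a
  cell is therefore indexed by pairs (face, side), and these pieces have to be shown to have
  disjoint relative interiors and to cover the frontier up to codimension 2. Smoothness is known
  only on open cells, traces only on relative interiors of faces, so identities are compared up to
  null sets. For the total force, the classical route writes \<open>E \<Delta>\<Phi>\<close> as the
  divergence of the Maxwell stress tensor. Here \<open>E\<close> is only square integrable while
  test functions are periodic and continuously differentiable, so \<open>E\<close> itself cannot be
  inserted; a mollified component of it can. The limit rests on the averages of
  \<open>1 - \<rho>\<close>: they are uniformly bounded and converge at every point of an open cell,
  so dominated convergence works with a merely integrable \<open>E\<close>.\<close>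

text \<open>
  Both integrals of the divergence theorem on a convex cell are sliced by the lines of direction \<open>u\<close>.
  The slab \<open>{y. 0 \<le> u \<bullet> y \<le> 1}\<close> with unit \<open>u\<close> meets each such line in a segment of length 1 and so serves as
  the parameter space of lines with full-dimensional Lebesgue measure: no measure on the hyperplane
  orthogonal to \<open>u\<close> is needed. The shadow of \<open>S\<close> is the union of the lines that meet \<open>S\<close>.
\<close>

definition shadow :: "'a::euclidean_space \<Rightarrow> 'a set \<Rightarrow> 'a set"
  where "shadow u S = {y. \<exists>t. y + t *\<^sub>R u \<in> S}"

definition slab :: "'a::euclidean_space \<Rightarrow> 'a set"
  where "slab k = {y. 0 \<le> k \<bullet> y \<and> k \<bullet> y \<le> 1}"

text \<open>As a Minkowski sum with a line through the origin, the shadow inherits the calculus of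
  convexity and relative interiors of sums.\<close>

lemma shadow_eq_sum: "shadow u S = S + span {u}"
proof (intro set_eqI iffI)
  fix y assume "y \<in> shadow u S"
  then obtain t where "y + t *\<^sub>R u \<in> S" by (auto simp: shadow_def)
  moreover have "y = (y + t *\<^sub>R u) + (-t) *\<^sub>R u" by simp
  ultimately show "y \<in> S + span {u}"
    by (metis set_plus_intro span_base span_scale insertI1)
next
  fix y assume "y \<in> S + span {u}"
  then obtain a b where "y = a + b" "a \<in> S" "b \<in> span {u}" by (auto simp: set_plus_def)
  then obtain t where "y = a + t *\<^sub>R u" by (auto simp: span_singleton)
  then have "y + (-t) *\<^sub>R u \<in> S" using \<open>a \<in> S\<close> by simp
  then show "y \<in> shadow u S" unfolding shadow_def by blast
qed

lemma shadow_mono: "S \<subseteq> T \<Longrightarrow> shadow u S \<subseteq> shadow u T"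
  by (auto simp: shadow_def)

lemma convex_shadow: "convex S \<Longrightarrow> convex (shadow u S)"
  by (simp add: shadow_eq_sum convex_set_plus subspace_imp_convex)

lemma rel_interior_shadow: "convex S \<Longrightarrow> rel_interior (shadow u S) = shadow u (rel_interior S)"
  by (simp add: shadow_eq_sum rel_interior_sum subspace_imp_convex rel_interior_affine
      subspace_imp_affine)

text \<open>Frontiers of convex sets are null. If the interior is empty, the whole set lies in its
  frontier; otherwise the relative interior is the interior.\<close>

lemma negligible_convex_diff_rel_interior:
  fixes S :: "'a::euclidean_space set"
  assumes "convex S"
  shows "negligible (S - rel_interior S)"
proof (cases "interior S = {}")
  case True
  then have "negligible S"
    using assms negligible_convex_frontier[OF assms] by (auto simp: frontier_def negligible_subset closure_subset)
  then show ?thesis by (rule negligible_subset) auto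
next
  case False
  then have "rel_interior S = interior S" by (simp add: rel_interior_nonempty_interior)
  then have "S - rel_interior S \<subseteq> frontier S" using closure_subset by (auto simp: frontier_def)
  then show ?thesis using negligible_convex_frontier[OF assms] negligible_subset by blast
qed

text \<open>Almost no line meets a convex set in its relative boundary alone: the shadow of the
  relative interior is the relative interior of the shadow, and the shadow is again convex.\<close>

lemma negligible_shadow_rel_frontier:
  "convex S \<Longrightarrow> negligible (shadow u S - shadow u (rel_interior S))"
  using negligible_convex_diff_rel_interior[OF convex_shadow] rel_interior_shadow by metis

lemma negligible_aff_dim:
  fixes S :: "'a::euclidean_space set"
  assumes "aff_dim S < int DIM('a)"
  shows "negligible S"
proof -
  obtain a b where "a \<noteq> 0" "S \<subseteq> {x. a \<bullet> x = b}"
    using aff_lowdim_subset_hyperplane[OF assms] by metis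
  then show ?thesis using negligible_hyperplane[of a b] negligible_subset by blast
qed

text \<open>One extra direction raises the affine dimension by at most one. For any \<open>x\<close>
  in \<open>S\<close> the shadow lies in the affine hull of \<open>S\<close> and
  \<open>x + u\<close>, which is still a proper affine subspace.\<close>

lemma negligible_shadow_low_dim:
  fixes S :: "'a::euclidean_space set"
  assumes "aff_dim S \<le> int DIM('a) - 2"
  shows "negligible (shadow u S)"
proof (cases "S = {}")
  case True then show ?thesis by (simp add: shadow_def)
next
  case False
  then obtain x where x: "x \<in> S" by auto
  let ?H = "affine hull (insert (x + u) S)"
  have "shadow u S \<subseteq> ?H"
  proof
    fix y assume "y \<in> shadow u S"
    then obtain t where t: "y + t *\<^sub>R u \<in> S" by (auto simp: shadow_def)
    have "(y + t *\<^sub>R u) \<in> ?H" "x \<in> ?H" "x + u \<in> ?H"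
      using x t by (auto intro: hull_inc)
    then have "1 *\<^sub>R (y + t *\<^sub>R u) + t *\<^sub>R x + (-t) *\<^sub>R (x + u) \<in> ?H"
      using mem_affine_3[of ?H "y + t *\<^sub>R u" x "x+u" 1 t "-t"] affine_affine_hull by auto
    then show "y \<in> ?H" by (simp add: algebra_simps)
  qed
  moreover have "aff_dim ?H < int DIM('a)"
    using assms by (simp add: aff_dim_insert split: if_splits)
  ultimately show ?thesis using negligible_aff_dim negligible_subset by blast
qed

lemma negligible_shadow_parallel:
  assumes "S \<subseteq> {x. n \<bullet> x = c}" "n \<noteq> 0" "n \<bullet> u = 0"
  shows "negligible (shadow u S)"
proof -
  have "shadow u S \<subseteq> {x. n \<bullet> x = c}"
    using assms by (force simp: shadow_def inner_simps)
  then show ?thesis using negligible_hyperplane[of n c] assms(2) negligible_subset by blast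
qed

section \<open>Fubini along lines and invariance under shears\<close>

lemma nn_integral_lborel_translate:
  fixes g :: "'a::euclidean_space \<Rightarrow> ennreal"
  assumes "g \<in> borel_measurable borel"
  shows "(\<integral>\<^sup>+y. g (y + a) \<partial>lborel) = (\<integral>\<^sup>+y. g y \<partial>lborel)"
proof -
  have "(\<integral>\<^sup>+y. g y \<partial>lborel) = (\<integral>\<^sup>+y. g y \<partial>distr lborel borel ((+) a))"
    by (simp add: lborel_distr_plus)
  also have "\<dots> = (\<integral>\<^sup>+y. g (a + y) \<partial>lborel)"
    using assms by (subst nn_integral_distr) auto
  finally show ?thesis by (simp add: add.commute)
qed

lemma measurable_slab [measurable]: "slab k \<in> sets borel"
proof -
  have "slab k = {y. 0 \<le> k \<bullet> y} \<inter> {y. k \<bullet> y \<le> 1}" by (auto simp: slab_def)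
  then show ?thesis by simp
qed

lemma slab_shift: "k \<bullet> u = 1 \<Longrightarrow> y - t *\<^sub>R u \<in> slab k \<longleftrightarrow> k \<bullet> y - 1 \<le> t \<and> t \<le> k \<bullet> y"
  by (auto simp: slab_def inner_simps)

text \<open>Exchange the integrals, translate by \<open>t *\<^sub>R u\<close>, exchange back: the
  point \<open>y\<close> is then counted for all \<open>t\<close> between
  \<open>k \<bullet> y - 1\<close> and \<open>k \<bullet> y\<close>, an interval of length 1. The
  slab normal \<open>k\<close> is kept apart from \<open>u\<close>, so directions that are not unit
  vectors are covered as well.\<close>

lemma nn_integral_slab:
  fixes g :: "'a::euclidean_space \<Rightarrow> ennreal"
  assumes [measurable]: "g \<in> borel_measurable borel" and ku: "k \<bullet> u = 1"
  shows "(\<integral>\<^sup>+y. \<integral>\<^sup>+t. indicator (slab k) y * g (y + t *\<^sub>R u) \<partial>lborel \<partial>lborel)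
    = (\<integral>\<^sup>+y. g y \<partial>lborel)"
proof -
  have "(\<integral>\<^sup>+y. \<integral>\<^sup>+t. indicator (slab k) y * g (y + t *\<^sub>R u) \<partial>lborel \<partial>lborel)
      = (\<integral>\<^sup>+t. \<integral>\<^sup>+y. indicator (slab k) y * g (y + t *\<^sub>R u) \<partial>lborel \<partial>(lborel :: real measure))"
    by (subst lborel_pair.Fubini') auto
  also have "\<dots> = (\<integral>\<^sup>+t. \<integral>\<^sup>+y. indicator (slab k) (y - t *\<^sub>R u) * g y \<partial>lborel \<partial>(lborel :: real measure))"
  proof (rule nn_integral_cong)
    fix t :: real
    show "(\<integral>\<^sup>+y. indicator (slab k) y * g (y + t *\<^sub>R u) \<partial>lborel)
      = (\<integral>\<^sup>+y. indicator (slab k) (y - t *\<^sub>R u) * g y \<partial>lborel)"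
      using nn_integral_lborel_translate[of "\<lambda>y. indicator (slab k) (y - t *\<^sub>R u) * g y" "t *\<^sub>R u"]
      by simp
  qed
  also have "\<dots> = (\<integral>\<^sup>+y. \<integral>\<^sup>+t. indicator (slab k) (y - t *\<^sub>R u) * g y \<partial>(lborel :: real measure) \<partial>lborel)"
    by (subst lborel_pair.Fubini') auto
  also have "\<dots> = (\<integral>\<^sup>+y. (\<integral>\<^sup>+t. indicator {k \<bullet> y - 1 .. k \<bullet> y} t \<partial>(lborel :: real measure)) * g y \<partial>lborel)"
  proof (rule nn_integral_cong)
    fix y :: 'a
    have "indicator (slab k) (y - t *\<^sub>R u) = (indicator {k \<bullet> y - 1 .. k \<bullet> y} t :: ennreal)" for t
      by (auto simp: slab_shift[OF ku] indicator_def)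
    then show "(\<integral>\<^sup>+t. indicator (slab k) (y - t *\<^sub>R u) * g y \<partial>lborel)
      = (\<integral>\<^sup>+t. indicator {k \<bullet> y - 1 .. k \<bullet> y} t \<partial>(lborel :: real measure)) * g y"
      by (simp add: nn_integral_multc)
  qed
  also have "\<dots> = (\<integral>\<^sup>+y. g y \<partial>lborel)" by simp
  finally show ?thesis .
qed

text \<open>The same exchange for signed integrands; both product integrands it passes through are
  integrable because their absolute values reduce to the integral of
  \<open>norm (g y)\<close>.\<close>

lemma integral_slab:
  fixes g :: "'a::euclidean_space \<Rightarrow> real"
  assumes g: "integrable lborel g" and ku: "k \<bullet> u = 1"
  shows "integrable lborel (\<lambda>y. indicator (slab k) y * (LINT t|lborel. g (y + t *\<^sub>R u)))"
    and "(LINT y|lborel. indicator (slab k) y * (LINT t|lborel. g (y + t *\<^sub>R u))) = integral\<^sup>L lborel g"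
proof -
  have [measurable]: "g \<in> borel_measurable borel" using borel_measurable_integrable[OF g] by simp
  let ?f = "\<lambda>(y, t). indicator (slab k) y * g (y + t *\<^sub>R u)"
  have int: "integrable (lborel \<Otimes>\<^sub>M (lborel :: real measure)) ?f"
  proof (rule integrableI_bounded)
    show "?f \<in> borel_measurable (lborel \<Otimes>\<^sub>M lborel)" by measurable
    have "(\<integral>\<^sup>+x. norm (?f x) \<partial>(lborel \<Otimes>\<^sub>M lborel))
        = (\<integral>\<^sup>+y. \<integral>\<^sup>+t. norm (?f (y, t)) \<partial>lborel \<partial>lborel)"
      by (subst lborel.nn_integral_fst[symmetric]) auto
    also have "\<dots> = (\<integral>\<^sup>+y. \<integral>\<^sup>+t. indicator (slab k) y * ennreal (norm (g (y + t *\<^sub>R u))) \<partial>(lborel::real measure) \<partial>lborel)"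
      by (intro nn_integral_cong) (auto simp: indicator_def)
    also have "\<dots> = (\<integral>\<^sup>+y. norm (g y) \<partial>lborel)"
      by (rule nn_integral_slab) (use ku in auto)
    also have "\<dots> < \<infinity>" using g by (simp add: integrable_iff_bounded)
    finally show "(\<integral>\<^sup>+x. norm (?f x) \<partial>(lborel \<Otimes>\<^sub>M lborel)) < \<infinity>" .
  qed
  show "integrable lborel (\<lambda>y. indicator (slab k) y * (LINT t|lborel. g (y + t *\<^sub>R u)))"
    using lborel_pair.integrable_fst'[OF int] by (simp add: split_beta)
  have "(LINT y|lborel. indicator (slab k) y * (LINT t|lborel. g (y + t *\<^sub>R u)))
      = (LINT y|lborel. LINT t|lborel. ?f (y, t))" by simp
  also have "\<dots> = (LINT t|lborel. LINT y|lborel. ?f (y, t))"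
    using lborel_pair.Fubini_integral[of "\<lambda>y t. ?f (y, t)"] int by (simp add: split_beta)
  also have "\<dots> = (LINT t|lborel. LINT y|lborel. indicator (slab k) (y - t *\<^sub>R u) * g y)"
  proof (rule Bochner_Integration.integral_cong[OF refl])
    fix t :: real
    have "(LINT y|lborel. indicator (slab k) (y - t *\<^sub>R u) * g y)
      = (LINT y|distr lborel borel ((+) (t *\<^sub>R u)). indicator (slab k) (y - t *\<^sub>R u) * g y)"
      by (simp add: lborel_distr_plus)
    also have "\<dots> = (LINT y|lborel. ?f (y, t))"
      by (subst integral_distr) (auto simp: add.commute)
    finally show "(LINT y|lborel. ?f (y, t)) = (LINT y|lborel. indicator (slab k) (y - t *\<^sub>R u) * g y)" ..
  qed
  also have "\<dots> = (LINT y|lborel. LINT t|lborel. indicator (slab k) (y - t *\<^sub>R u) * g y)"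
  proof -
    let ?h = "\<lambda>(y, t). indicator (slab k) (y - t *\<^sub>R u) * g y"
    have "integrable (lborel \<Otimes>\<^sub>M (lborel :: real measure)) ?h"
    proof (rule integrableI_bounded)
      show "?h \<in> borel_measurable (lborel \<Otimes>\<^sub>M lborel)" by measurable
      have "(\<integral>\<^sup>+x. norm (?h x) \<partial>(lborel \<Otimes>\<^sub>M lborel))
          = (\<integral>\<^sup>+y. \<integral>\<^sup>+t. norm (?h (y, t)) \<partial>(lborel::real measure) \<partial>lborel)"
        by (subst lborel.nn_integral_fst[symmetric]) auto
      also have "\<dots> = (\<integral>\<^sup>+y. \<integral>\<^sup>+t. indicator {k \<bullet> y - 1 .. k \<bullet> y} t * ennreal (norm (g y)) \<partial>(lborel::real measure) \<partial>lborel)"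
        by (intro nn_integral_cong) (auto simp: slab_shift[OF ku] indicator_def)
      also have "\<dots> = (\<integral>\<^sup>+y. norm (g y) \<partial>lborel)"
        by (simp add: nn_integral_multc)
      also have "\<dots> < \<infinity>" using g by (simp add: integrable_iff_bounded)
      finally show "(\<integral>\<^sup>+x. norm (?h x) \<partial>(lborel \<Otimes>\<^sub>M lborel)) < \<infinity>" .
    qed
    then show ?thesis
      using lborel_pair.Fubini_integral[of "\<lambda>y t. ?h (y, t)"] by (simp add: split_beta)
  qed
  also have "\<dots> = integral\<^sup>L lborel g"
  proof (rule Bochner_Integration.integral_cong[OF refl])
    fix y
    have "(LINT t|lborel. indicator (slab k) (y - t *\<^sub>R u) * g y)
      = (LINT t|lborel. indicator {k \<bullet> y - 1 .. k \<bullet> y} t *\<^sub>R g y)"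
      by (intro Bochner_Integration.integral_cong) (auto simp: slab_shift[OF ku] indicator_def)
    also have "\<dots> = g y" by (subst integral_scaleR_left) auto
    finally show "(LINT t|lborel. indicator (slab k) (y - t *\<^sub>R u) * g y) = g y" .
  qed
  finally show "(LINT y|lborel. indicator (slab k) y * (LINT t|lborel. g (y + t *\<^sub>R u))) = integral\<^sup>L lborel g" .
qed

text \<open>The displacement depends on \<open>n \<bullet> y\<close> only, which is constant along
  lines of direction \<open>w\<close> as \<open>n \<bullet> w = 0\<close>. On each such line the
  shear is a translation, and the lines are put together by the slab formula.\<close>

lemma nn_integral_shear:
  fixes g :: "'a::euclidean_space \<Rightarrow> ennreal"
  assumes g[measurable]: "g \<in> borel_measurable borel" and nw: "n \<bullet> w = 0"
  shows "(\<integral>\<^sup>+y. g (y + (n \<bullet> y - c) *\<^sub>R w) \<partial>lborel) = (\<integral>\<^sup>+y. g y \<partial>lborel)"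
proof (cases "w = 0")
  case False
  let ?k = "w /\<^sub>R (w \<bullet> w)"
  have k: "?k \<bullet> w = 1" using False by simp
  have "(\<integral>\<^sup>+y. g (y + (n \<bullet> y - c) *\<^sub>R w) \<partial>lborel)
    = (\<integral>\<^sup>+y. \<integral>\<^sup>+t. indicator (slab ?k) y * g ((y + t *\<^sub>R w) + (n \<bullet> (y + t *\<^sub>R w) - c) *\<^sub>R w) \<partial>lborel \<partial>lborel)"
    by (rule nn_integral_slab[OF _ k, symmetric]) measurable
  also have "\<dots> = (\<integral>\<^sup>+y. \<integral>\<^sup>+t. indicator (slab ?k) y * g (y + t *\<^sub>R w) \<partial>lborel \<partial>lborel)"
  proof (rule nn_integral_cong)
    fix y
    have "(\<integral>\<^sup>+t. indicator (slab ?k) y * g ((y + t *\<^sub>R w) + (n \<bullet> (y + t *\<^sub>R w) - c) *\<^sub>R w) \<partial>lborel)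
      = (\<integral>\<^sup>+t. indicator (slab ?k) y * g (y + (t + (n \<bullet> y - c)) *\<^sub>R w) \<partial>(lborel::real measure))"
      by (intro nn_integral_cong) (simp add: inner_simps nw algebra_simps)
    also have "\<dots> = (\<integral>\<^sup>+t. indicator (slab ?k) y * g (y + t *\<^sub>R w) \<partial>lborel)"
      by (rule nn_integral_lborel_translate[where g = "\<lambda>t. indicator (slab ?k) y * g (y + t *\<^sub>R w)"]) measurable
    finally show "(\<integral>\<^sup>+t. indicator (slab ?k) y * g ((y + t *\<^sub>R w) + (n \<bullet> (y + t *\<^sub>R w) - c) *\<^sub>R w) \<partial>lborel)
      = (\<integral>\<^sup>+t. indicator (slab ?k) y * g (y + t *\<^sub>R w) \<partial>lborel)" .
  qed
  also have "\<dots> = (\<integral>\<^sup>+y. g y \<partial>lborel)" by (rule nn_integral_slab[OF g k])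
  finally show ?thesis .
qed simp

lemma distr_shear:
  fixes w :: "'a::euclidean_space"
  assumes nw: "n \<bullet> w = 0"
  shows "distr lborel borel (\<lambda>y. y + (n \<bullet> y - c) *\<^sub>R w) = lborel"
proof (rule measure_eqI)
  fix A assume "A \<in> sets (distr lborel borel (\<lambda>y. y + (n \<bullet> y - c) *\<^sub>R w))"
  then have A[measurable]: "A \<in> sets borel" by simp
  have "emeasure (distr lborel borel (\<lambda>y. y + (n \<bullet> y - c) *\<^sub>R w)) A
    = (\<integral>\<^sup>+y. indicator A y \<partial>distr lborel borel (\<lambda>y. y + (n \<bullet> y - c) *\<^sub>R w))"
    using A by (simp del: nn_integral_distr)
  also have "\<dots> = (\<integral>\<^sup>+y. indicator A (y + (n \<bullet> y - c) *\<^sub>R w) \<partial>lborel)"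
    by (subst nn_integral_distr) auto
  also have "\<dots> = emeasure lborel A"
    using nn_integral_shear[of "indicator A" n w c] nw A by simp
  finally show "emeasure (distr lborel borel (\<lambda>y. y + (n \<bullet> y - c) *\<^sub>R w)) A = emeasure lborel A" .
qed simp

section \<open>Surface integrals over flat faces\<close>

text \<open>The surface integral with the normal and the level of its hyperplane as free parameters,
  so that the normal can be reversed and the face translated independently of any mesh. The argument
  of \<open>h\<close> is the orthogonal projection to the hyperplane
  \<open>n \<bullet> x = c\<close>.\<close>

definition flat_int :: "'a::euclidean_space \<Rightarrow> real \<Rightarrow> 'a set \<Rightarrow> ('a \<Rightarrow> real) \<Rightarrow> real"
  where "flat_int n c e h =
    (LINT y : {x + t *\<^sub>R n | x t. x \<in> e \<and> t \<in> {0..1}} | lebesgue. h (y - (n \<bullet> y - c) *\<^sub>R n))"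

lemma prism_eq:
  assumes "e \<subseteq> {x. n \<bullet> x = c}" "n \<bullet> v = 1"
  shows "{x + t *\<^sub>R v | x t. x \<in> e \<and> t \<in> {0..1}}
    = {y. y - (n \<bullet> y - c) *\<^sub>R v \<in> e \<and> n \<bullet> y - c \<in> {0..1}}"
proof (intro set_eqI iffI)
  fix y assume "y \<in> {x + t *\<^sub>R v | x t. x \<in> e \<and> t \<in> {0..1}}"
  then show "y \<in> {y. y - (n \<bullet> y - c) *\<^sub>R v \<in> e \<and> n \<bullet> y - c \<in> {0..1}}"
    using assms by (auto simp: inner_simps subset_iff)
next
  fix y assume "y \<in> {y. y - (n \<bullet> y - c) *\<^sub>R v \<in> e \<and> n \<bullet> y - c \<in> {0..1}}"
  moreover have "y = (y - (n \<bullet> y - c) *\<^sub>R v) + (n \<bullet> y - c) *\<^sub>R v" by simp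
  ultimately show "y \<in> {x + t *\<^sub>R v | x t. x \<in> e \<and> t \<in> {0..1}}" by blast
qed

lemma compact_prism:
  fixes v :: "'a::euclidean_space"
  assumes "compact e"
  shows "compact {x + t *\<^sub>R v | x t. x \<in> e \<and> t \<in> {0..1::real}}"
proof -
  have "{x + t *\<^sub>R v | x t. x \<in> e \<and> t \<in> {0..1}} = (\<lambda>(x, t). x + t *\<^sub>R v) ` (e \<times> {0..1})"
    by (fastforce simp: image_iff)
  also have "compact \<dots>"
  proof (rule compact_continuous_image)
    show "continuous_on (e \<times> {0..1::real}) (\<lambda>(x, t). x + t *\<^sub>R v)"
      unfolding case_prod_unfold by (intro continuous_intros)
  qed (simp add: assms compact_Times)
  finally show ?thesis .
qed

text \<open>Passage from \<open>lebesgue\<close>, used in the statements, to \<open>lborel\<close>,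
  where Fubini and changes of variables are carried out.\<close>

lemma set_integral_lebesgue_compact:
  fixes f :: "'a::euclidean_space \<Rightarrow> real"
  assumes "compact S" "continuous_on S f"
  shows "integrable lborel (\<lambda>y. indicator S y * f y)"
    and "(LINT y:S|lebesgue. f y) = (LINT y|lborel. indicator S y * f y)"
    and "set_integrable lebesgue S f"
proof -
  show 1: "integrable lborel (\<lambda>y. indicator S y * f y)"
    using borel_integrable_compact[OF assms] by simp
  show "(LINT y:S|lebesgue. f y) = (LINT y|lborel. indicator S y * f y)"
    using 1 unfolding set_lebesgue_integral_def
    by (simp add: integral_completion borel_measurable_integrable)
  show "set_integrable lebesgue S f"
    using 1 unfolding set_integrable_def by (simp add: integrable_completion)
qed

text \<open>A shear turns the right prism over \<open>e\<close> into an oblique one in direction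
  \<open>u\<close> without changing the volume. A line of direction \<open>u\<close> that crosses
  \<open>e\<close> stays in the oblique prism for a parameter length
  \<open>1 / \<bar>n \<bullet> u\<bar>\<close>, and there the integrand is constantly the value of
  \<open>h\<close> at the crossing point. The surface integral weighted by
  \<open>n \<bullet> u\<close> thus becomes an integral over lines, signed by the side from which
  they cross.\<close>

lemma flat_int_slab:
  fixes n :: "'a::euclidean_space"
  assumes n: "norm n = 1" and ku: "k \<bullet> u = 1" and nu: "n \<bullet> u \<noteq> 0"
    and e: "compact e" "e \<subseteq> {x. n \<bullet> x = c}" and h: "continuous_on UNIV h"
  defines "H \<equiv> \<lambda>y. indicator (shadow u e) y * h (y + ((c - n \<bullet> y) / (n \<bullet> u)) *\<^sub>R u)"
  shows "integrable lborel (\<lambda>y. indicator (slab k) y * H y)"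
    and "(n \<bullet> u) * flat_int n c e h = sgn (n \<bullet> u) * (LINT y|lborel. indicator (slab k) y * H y)"
proof -
  let ?P = "{x + t *\<^sub>R n | x t. x \<in> e \<and> t \<in> {0..1}}"
  define v where "v = u /\<^sub>R (n \<bullet> u)"
  define g where "g = (\<lambda>y. indicator ?P y * h (y - (n \<bullet> y - c) *\<^sub>R n))"
  \<comment> \<open>With \<open>n \<bullet> v = 1\<close>, this shear sends
    \<open>x + t *\<^sub>R v\<close> to \<open>x + t *\<^sub>R n\<close> for \<open>x\<close> in
    \<open>e\<close>: it maps the oblique prism onto the right one and preserves
    \<open>n \<bullet> y\<close>.\<close>
  define \<sigma> where "\<sigma> = (\<lambda>y. y + (n \<bullet> y - c) *\<^sub>R (n - v))"
  have nn: "n \<bullet> n = 1" using n by (simp add: dot_square_norm)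
  have nv: "n \<bullet> v = 1" using nu by (simp add: v_def)
  have w: "n \<bullet> (n - v) = 0" by (simp add: inner_simps nn nv)
  have cont: "continuous_on ?P (\<lambda>y. h (y - (n \<bullet> y - c) *\<^sub>R n))"
    by (intro continuous_on_compose2[OF h] continuous_intros) auto
  have gi: "integrable lborel g" and fl: "flat_int n c e h = integral\<^sup>L lborel g"
    using set_integral_lebesgue_compact[OF compact_prism[OF e(1)] cont]
    by (simp_all add: g_def flat_int_def)
  have [measurable]: "\<sigma> \<in> borel \<rightarrow>\<^sub>M borel" by (simp add: \<sigma>_def)
  have gs: "integrable lborel (\<lambda>y. g (\<sigma> y))"
  proof -
    have "integrable (distr lborel borel \<sigma>) g" using gi distr_shear[OF w, of c] by (simp add: \<sigma>_def)
    then show ?thesis by (subst (asm) integrable_distr_eq) (use gi in auto)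
  qed
  have gs_eq: "(LINT y|lborel. g (\<sigma> y)) = integral\<^sup>L lborel g"
  proof -
    have "integral\<^sup>L (distr lborel borel \<sigma>) g = integral\<^sup>L lborel g"
      using distr_shear[OF w, of c] by (simp add: \<sigma>_def)
    then show ?thesis by (subst (asm) integral_distr) (use gi in auto)
  qed
  have inner: "(LINT t|lborel. g (\<sigma> (y + t *\<^sub>R u))) = inverse \<bar>n \<bullet> u\<bar> * H y" for y
  proof -
    let ?p = "y + ((c - n \<bullet> y) / (n \<bullet> u)) *\<^sub>R u"
    have proj: "\<sigma> z - (n \<bullet> \<sigma> z - c) *\<^sub>R n = z - (n \<bullet> z - c) *\<^sub>R v" "n \<bullet> \<sigma> z = n \<bullet> z" for z
      using nv nn by (simp_all add: \<sigma>_def inner_simps algebra_simps)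
    have p: "(y + t *\<^sub>R u) - (n \<bullet> (y + t *\<^sub>R u) - c) *\<^sub>R v = ?p" for t
      using nu by (simp add: v_def inner_simps field_simps scaleR_add_left[symmetric] scaleR_diff_left[symmetric]
          del: scaleR_left_diff_distrib)
    have pp: "\<sigma> (y + t *\<^sub>R u) - (n \<bullet> \<sigma> (y + t *\<^sub>R u) - c) *\<^sub>R n = ?p" for t
      by (rule trans[OF proj(1) p])
    have sh: "?p \<in> e \<longleftrightarrow> y \<in> shadow u e"
    proof
      assume "y \<in> shadow u e"
      then obtain t where t: "y + t *\<^sub>R u \<in> e" by (auto simp: shadow_def)
      then have "n \<bullet> y + t * (n \<bullet> u) = c" using e(2) by (auto simp: inner_simps)
      then have "t = (c - n \<bullet> y) / (n \<bullet> u)" using nu by (auto simp: field_simps)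
      then show "?p \<in> e" using t by simp
    qed (auto simp: shadow_def)
    have "g (\<sigma> (y + t *\<^sub>R u)) = H y * indicator {0..1} (n \<bullet> y - c + (n \<bullet> u) * t)" for t
    proof -
      have "indicator ?P (\<sigma> (y + t *\<^sub>R u)) = (indicator (shadow u e) y * indicator {0..1} (n \<bullet> y - c + (n \<bullet> u) * t) :: real)"
      proof -
        have 2: "n \<bullet> \<sigma> (y + t *\<^sub>R u) - c = n \<bullet> y - c + (n \<bullet> u) * t"
          by (simp add: proj inner_simps)
        show ?thesis
          unfolding prism_eq[OF e(2) nn] indicator_def mem_Collect_eq pp sh unfolding 2 by auto
      qed
      then show ?thesis unfolding g_def H_def pp by simp
    qed
    then have "(LINT t|lborel. g (\<sigma> (y + t *\<^sub>R u)))
        = H y * (LINT t|lborel. indicator {0..1} (n \<bullet> y - c + (n \<bullet> u) * t))"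
      by simp
    also have "(LINT t|lborel. indicator {0..1} (n \<bullet> y - c + (n \<bullet> u) * t)) = inverse \<bar>n \<bullet> u\<bar>"
      using lborel_integral_real_affine[OF nu, of "indicator {0..1} :: real \<Rightarrow> real" "n \<bullet> y - c"] nu
      by (simp add: field_simps)
    finally show ?thesis by simp
  qed
  have ind: "indicator (slab k) y * (LINT t|lborel. g (\<sigma> (y + t *\<^sub>R u)))
     = inverse \<bar>n \<bullet> u\<bar> * (indicator (slab k) y * H y)" for y
    by (simp add: inner)
  have "integrable lborel (\<lambda>y. inverse \<bar>n \<bullet> u\<bar> * (indicator (slab k) y * H y))"
    using integral_slab(1)[OF gs ku] by (simp only: ind)
  then show "integrable lborel (\<lambda>y. indicator (slab k) y * H y)"
    using nu by simp
  have "integral\<^sup>L lborel g = inverse \<bar>n \<bullet> u\<bar> * (LINT y|lborel. indicator (slab k) y * H y)"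
    using integral_slab(2)[OF gs ku] gs_eq by (simp add: ind)
  then show "(n \<bullet> u) * flat_int n c e h = sgn (n \<bullet> u) * (LINT y|lborel. indicator (slab k) y * H y)"
    using nu by (auto simp: fl sgn_if field_simps abs_if split: if_splits)
qed

lemma shadow_uminus: "shadow (- u) S = shadow u S"
proof -
  have "(\<exists>t. y + t *\<^sub>R (- u) \<in> S) \<longleftrightarrow> (\<exists>t. y + t *\<^sub>R u \<in> S)" for y
    by (metis scaleR_minus_left scaleR_minus_right minus_minus)
  then show ?thesis by (simp add: shadow_def)
qed

section \<open>The divergence theorem on a convex cell\<close>

text \<open>
  A line that is not parallel to any facet it meets and passes through relative interiors only leaves the
  cell through exactly one facet; \<open>\<D>\<close> collects pieces of the boundary of codimension at least 2.
\<close>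

lemma exit_facet:
  fixes T :: "'a::euclidean_space set" and e :: "'i \<Rightarrow> 'a set"
  assumes e: "\<And>i. i \<in> I \<Longrightarrow> e i \<subseteq> T \<and> e i \<subseteq> {x. \<nu> i \<bullet> x = c i} \<and> T \<subseteq> {x. \<nu> i \<bullet> x \<le> c i}"
    and disj: "\<And>i j. i \<in> I \<Longrightarrow> j \<in> I \<Longrightarrow> i \<noteq> j \<Longrightarrow> rel_interior (e i) \<inter> rel_interior (e j) = {}"
    and cover: "frontier T \<subseteq> (\<Union>i\<in>I. e i) \<union> \<Union>\<D>"
    and b: "y + b *\<^sub>R u \<in> T" "\<And>t. t > b \<Longrightarrow> y + t *\<^sub>R u \<notin> T"
    and a: "a < b" "y + a *\<^sub>R u \<in> T"
    and gen1: "\<And>i. i \<in> I \<Longrightarrow> y \<in> shadow u (e i) \<Longrightarrow> y \<in> shadow u (rel_interior (e i)) \<and> \<nu> i \<bullet> u \<noteq> 0"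
    and gen2: "\<And>D. D \<in> \<D> \<Longrightarrow> y \<notin> shadow u D"
  shows "\<exists>i\<in>I. {j \<in> I. y \<in> shadow u (e j) \<and> \<nu> j \<bullet> u > 0} = {i} \<and> (c i - \<nu> i \<bullet> y) / (\<nu> i \<bullet> u) = b"
proof -
  have fr: "y + b *\<^sub>R u \<in> frontier T"
  proof -
    have "y + b *\<^sub>R u \<notin> interior T"
    proof
      assume "y + b *\<^sub>R u \<in> interior T"
      then obtain r where r: "r > 0" "ball (y + b *\<^sub>R u) r \<subseteq> T"
        by (meson mem_interior)
      define s where "s = r / 2 / (norm u + 1)"
      have s: "s > 0" using r by (simp add: s_def add_nonneg_pos)
      have "s * norm u < r"
      proof -
        have 1: "s * norm u \<le> s * (norm u + 1)" using s by simp
        have 2: "norm u + 1 \<noteq> 0" using norm_ge_zero[of u] by linarith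
        have "r / 2 / x * x = r / 2" if "x \<noteq> 0" for x :: real using that by simp
        from this[OF 2] have "s * (norm u + 1) = r / 2" unfolding s_def .
        with 1 r show ?thesis by linarith
      qed
      then have "y + (b + s) *\<^sub>R u \<in> ball (y + b *\<^sub>R u) r"
        using s by (simp add: dist_norm algebra_simps)
      then show False using subsetD[OF r(2)] b(2)[of "b + s"] s by auto
    qed
    then show ?thesis using b(1) closure_subset by (auto simp: frontier_def)
  qed
  \<comment> \<open>Along the line the functional \<open>\<nu> i\<close> increases, and on
    \<open>T\<close> it is at most its value \<open>c i\<close> on \<open>e i\<close>; so a point of
    \<open>e i\<close> with \<open>\<nu> i \<bullet> u > 0\<close> is the last point of the line in
    \<open>T\<close>.\<close>
  have hit: "t = b" if "i \<in> I" "y + t *\<^sub>R u \<in> e i" "\<nu> i \<bullet> u > 0" for i t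
  proof -
    have "y + t *\<^sub>R u \<in> T" using e that by blast
    then have "t \<le> b" using b(2)[of t] by force
    have "\<nu> i \<bullet> (y + b *\<^sub>R u) \<le> \<nu> i \<bullet> (y + t *\<^sub>R u)"
    proof -
      have "\<nu> i \<bullet> (y + b *\<^sub>R u) \<le> c i" using e[OF that(1)] b(1) by blast
      moreover have "\<nu> i \<bullet> (y + t *\<^sub>R u) = c i" using e[OF that(1)] that(2) by blast
      ultimately show ?thesis by simp
    qed
    then have "b * (\<nu> i \<bullet> u) \<le> t * (\<nu> i \<bullet> u)" by (simp add: inner_simps)
    then show "t = b" using that(3) \<open>t \<le> b\<close> by simp
  qed
  have ri: "y + b *\<^sub>R u \<in> rel_interior (e i)" if i: "i \<in> I" "y \<in> shadow u (e i)" "\<nu> i \<bullet> u > 0" for i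
  proof -
    obtain t where t: "y + t *\<^sub>R u \<in> rel_interior (e i)" using gen1[OF i(1,2)] by (auto simp: shadow_def)
    then have "y + t *\<^sub>R u \<in> e i" using rel_interior_subset[of "e i"] by (rule rev_subsetD)
    then have "t = b" by (rule hit[OF i(1) _ i(3)])
    then show ?thesis using t by simp
  qed
  obtain i where i: "i \<in> I" "y + b *\<^sub>R u \<in> e i"
  proof -
    have "y + b *\<^sub>R u \<notin> D" if "D \<in> \<D>" for D using gen2[OF that] by (auto simp: shadow_def)
    then have "y + b *\<^sub>R u \<in> (\<Union>i\<in>I. e i)" using fr cover by (metis UnE UnionE subsetD)
    then show ?thesis using that by auto
  qed
  then have ysh: "y \<in> shadow u (e i)" by (auto simp: shadow_def)
  \<comment> \<open>The line comes from a point of \<open>T\<close> at parameter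
    \<open>a < b\<close>, where \<open>\<nu> i\<close> is at most \<open>c i\<close>; the value 0 is
    excluded by the general position of the line.\<close>
  have pos: "\<nu> i \<bullet> u > 0"
  proof -
    have "\<nu> i \<bullet> (y + a *\<^sub>R u) \<le> \<nu> i \<bullet> (y + b *\<^sub>R u)"
    proof -
      have "\<nu> i \<bullet> (y + a *\<^sub>R u) \<le> c i" using e[OF i(1)] a(2) by blast
      moreover have "\<nu> i \<bullet> (y + b *\<^sub>R u) = c i" using e[OF i(1)] i(2) by blast
      ultimately show ?thesis by simp
    qed
    then have "a * (\<nu> i \<bullet> u) \<le> b * (\<nu> i \<bullet> u)" by (simp add: inner_simps)
    then have "0 \<le> (b - a) * (\<nu> i \<bullet> u)" by (simp add: algebra_simps)
    then have "\<nu> i \<bullet> u \<ge> 0" using a(1) by (simp add: zero_le_mult_iff)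
    then show ?thesis using gen1[OF i(1) ysh] by auto
  qed
  \<comment> \<open>Two such facets would share the exit point, and general position puts it in the
    relative interior of both.\<close>
  have "j = i" if "j \<in> I" "y \<in> shadow u (e j)" "\<nu> j \<bullet> u > 0" for j
    using disj[OF that(1) i(1)] ri[OF that] ri[OF i(1) ysh pos] by blast
  then have "{j \<in> I. y \<in> shadow u (e j) \<and> \<nu> j \<bullet> u > 0} = {i}"
    using i(1) ysh pos by blast
  moreover have "(c i - \<nu> i \<bullet> y) / (\<nu> i \<bullet> u) = b"
  proof -
    have "\<nu> i \<bullet> (y + b *\<^sub>R u) = c i" using e[OF i(1)] i(2) by blast
    then have "c i - \<nu> i \<bullet> y = b * (\<nu> i \<bullet> u)" by (simp add: inner_simps)
    then show ?thesis using pos by simp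
  qed
  ultimately show ?thesis using i(1) by (intro bexI[of _ i] conjI)
qed

lemma compact_line_section:
  fixes T :: "'a::euclidean_space set"
  assumes "convex T" "compact T" "u \<noteq> 0" "y \<in> shadow u (interior T)"
  obtains a b where "a < b" "{t. y + t *\<^sub>R u \<in> T} = {a..b}"
proof -
  let ?J = "{t. y + t *\<^sub>R u \<in> T}"
  obtain t0 where t0: "y + t0 *\<^sub>R u \<in> interior T" using assms(4) by (auto simp: shadow_def)
  have "closed ?J"
    using continuous_closed_vimage[of T "\<lambda>t. y + t *\<^sub>R u"] compact_imp_closed[OF assms(2)]
    by (simp add: vimage_def continuous_intros)
  moreover have "bounded ?J"
  proof -
    obtain B where B: "\<And>x. x \<in> T \<Longrightarrow> norm x \<le> B"
      using compact_imp_bounded[OF assms(2)] unfolding bounded_iff by blast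
    have "norm t \<le> (B + norm y) / norm u" if "t \<in> ?J" for t
    proof -
      have "norm (t *\<^sub>R u) \<le> norm (y + t *\<^sub>R u) + norm y" using norm_triangle_ineq4[of "y + t *\<^sub>R u" y] by simp
      also have "\<dots> \<le> B + norm y" using B that by auto
      finally show ?thesis using assms(3) by (simp add: field_simps)
    qed
    then show ?thesis by (auto simp: bounded_iff)
  qed
  ultimately have comp: "compact ?J" by (simp add: compact_eq_bounded_closed)
  have conv: "convex ?J"
  proof (rule convexI)
    fix s t p q :: real assume *: "s \<in> ?J" "t \<in> ?J" "0 \<le> p" "0 \<le> q" "p + q = 1"
    have "p *\<^sub>R (y + s *\<^sub>R u) + q *\<^sub>R (y + t *\<^sub>R u) \<in> T"
      using convexD[OF assms(1), of "y + s *\<^sub>R u" "y + t *\<^sub>R u" p q] * by simp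
    moreover have "p *\<^sub>R (y + s *\<^sub>R u) + q *\<^sub>R (y + t *\<^sub>R u) = (p + q) *\<^sub>R y + (p * s + q * t) *\<^sub>R u"
      by (simp add: algebra_simps)
    ultimately show "p *\<^sub>R s + q *\<^sub>R t \<in> ?J" using * by simp
  qed
  have "open {t. y + t *\<^sub>R u \<in> interior T}"
    using continuous_open_vimage[of "interior T" "\<lambda>t. y + t *\<^sub>R u"]
    by (simp add: vimage_def continuous_intros)
  then obtain r where r: "r > 0" "ball t0 r \<subseteq> {t. y + t *\<^sub>R u \<in> interior T}"
    by (rule openE[where x = t0]) (use t0 in simp)
  have "connected ?J \<and> compact ?J" using comp convex_connected[OF conv] by simp
  then obtain a b where ab: "?J = {a..b}" unfolding connected_compact_interval_1 by (elim exE)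
  have "t0 \<in> ball t0 r" "t0 + r/2 \<in> ball t0 r"
    using r(1) by (simp_all add: dist_real_def)
  then have "t0 \<in> ?J" "t0 + r/2 \<in> ?J"
    using r(2) interior_subset[of T] by blast+
  then have "a < b" unfolding ab using r by auto
  then show ?thesis using that ab by simp
qed

text \<open>On almost every line of direction \<open>u\<close> the fundamental theorem of calculus
  gives \<open>F\<close> at the exit minus \<open>F\<close> at the entry. The weighted surface
  integrals are integrals over the same lines, to which only the exit facet contributes with sign
  \<open>1\<close> and only the entry facet with sign \<open>-1\<close>.\<close>

lemma cell_divergence:
  fixes T :: "'a::euclidean_space set" and e :: "'i \<Rightarrow> 'a set" and F :: "'a \<Rightarrow> real"
  assumes T: "convex T" "compact T"
    and F': "continuous_on UNIV F'" and F: "\<And>x. (F has_derivative (\<lambda>h. F' x \<bullet> h)) (at x)"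
    and I: "finite I"
    and e: "\<And>i. i \<in> I \<Longrightarrow> norm (\<nu> i) = 1 \<and> compact (e i) \<and> convex (e i)"
      "\<And>i. i \<in> I \<Longrightarrow> e i \<subseteq> T \<and> e i \<subseteq> {x. \<nu> i \<bullet> x = c i} \<and> T \<subseteq> {x. \<nu> i \<bullet> x \<le> c i}"
    and disj: "\<And>i j. i \<in> I \<Longrightarrow> j \<in> I \<Longrightarrow> i \<noteq> j \<Longrightarrow> rel_interior (e i) \<inter> rel_interior (e j) = {}"
    and D: "finite \<D>" "\<And>D. D \<in> \<D> \<Longrightarrow> aff_dim D \<le> int DIM('a) - 2"
    and cover: "frontier T \<subseteq> (\<Union>i\<in>I. e i) \<union> \<Union>\<D>"
    and u: "u \<bullet> u = 1"
    and int: "interior T \<noteq> {}"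
  shows "(LINT y:T|lebesgue. F' y \<bullet> u) = (\<Sum>i\<in>I. (\<nu> i \<bullet> u) * flat_int (\<nu> i) (c i) (e i) F)"
proof -
  have u0: "u \<noteq> 0" using u by auto
  have contF: "continuous_on UNIV F"
    using has_derivative_continuous[OF F] by (simp add: continuous_at_imp_continuous_on)
  \<comment> \<open>The exceptional lines: those that touch a facet only in its rim, meet a facet
    parallel to \<open>u\<close>, hit a boundary piece of codimension 2, or touch the cell only in
    its relative boundary.\<close>
  define N where "N = (\<Union>i\<in>I. shadow u (e i) - shadow u (rel_interior (e i)))
    \<union> (\<Union>i\<in>{i\<in>I. \<nu> i \<bullet> u = 0}. shadow u (e i)) \<union> (\<Union>D\<in>\<D>. shadow u D)
    \<union> (shadow u T - shadow u (rel_interior T))"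
  have N: "negligible N"
  proof -
    have "negligible (shadow u (e i))" if "i \<in> I" "\<nu> i \<bullet> u = 0" for i
      by (rule negligible_shadow_parallel[of _ "\<nu> i" "c i"]) (use that e(1)[OF that(1)] e(2)[OF that(1)] in auto)
    then have "negligible (\<Union>i\<in>{i\<in>I. \<nu> i \<bullet> u = 0}. shadow u (e i))"
      using I by (intro negligible_Union) auto
    moreover have "negligible (\<Union>i\<in>I. shadow u (e i) - shadow u (rel_interior (e i)))"
      using I e(1) by (intro negligible_Union) (auto intro!: negligible_shadow_rel_frontier)
    moreover have "negligible (\<Union>D\<in>\<D>. shadow u D)"
      using D by (intro negligible_Union) (auto intro!: negligible_shadow_low_dim)
    ultimately show ?thesis
      unfolding N_def using negligible_shadow_rel_frontier[OF T(1)] by (intro negligible_Un) 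
  qed
  \<comment> \<open>Facets parallel to \<open>u\<close> have weight 0 and get the integrand 0, since
    a line crosses them in no single point.\<close>
  define G where "G = (\<lambda>i y. if \<nu> i \<bullet> u = 0 then 0 else
    sgn (\<nu> i \<bullet> u) * (indicator (shadow u (e i)) y * F (y + ((c i - \<nu> i \<bullet> y) / (\<nu> i \<bullet> u)) *\<^sub>R u)))"
  have G: "integrable lborel (\<lambda>y. indicator (slab u) y * G i y)
    \<and> (\<nu> i \<bullet> u) * flat_int (\<nu> i) (c i) (e i) F = (LINT y|lborel. indicator (slab u) y * G i y)"
    if i: "i \<in> I" for i
  proof (cases "\<nu> i \<bullet> u = 0")
    case False
    have eq: "indicator (slab u) y * G i y = sgn (\<nu> i \<bullet> u) * (indicator (slab u) y *
        (indicator (shadow u (e i)) y * F (y + ((c i - \<nu> i \<bullet> y) / (\<nu> i \<bullet> u)) *\<^sub>R u)))" for y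
      using False by (simp add: G_def)
    show ?thesis
      unfolding eq using flat_int_slab[of "\<nu> i" u u "e i" "c i" F] e[OF i] u False contF by simp
  qed (simp add: G_def)
  define g where "g = (\<lambda>y. indicator T y * (F' y \<bullet> u))"
  have cont': "continuous_on T (\<lambda>y. F' y \<bullet> u)"
    by (intro continuous_intros continuous_on_subset[OF F']) auto
  have g: "integrable lborel g" "(LINT y:T|lebesgue. F' y \<bullet> u) = integral\<^sup>L lborel g"
    using set_integral_lebesgue_compact[OF T(2) cont'] by (simp_all add: g_def)
  have pt: "(LINT t|lborel. g (y + t *\<^sub>R u)) = (\<Sum>i\<in>I. G i y)" if y: "y \<notin> N" for y
  proof (cases "y \<in> shadow u T")
    case False
    then have "g (y + t *\<^sub>R u) = 0" for t by (auto simp: g_def shadow_def)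
    moreover have "G i y = 0" if "i \<in> I" for i
      using False shadow_mono[of "e i" T u] e(2)[OF that] by (auto simp: G_def indicator_def)
    ultimately show ?thesis by simp
  next
    case True
    moreover have "y \<notin> shadow u T - shadow u (rel_interior T)" using y unfolding N_def by blast
    ultimately have "y \<in> shadow u (interior T)"
      using int by (simp add: rel_interior_nonempty_interior)
    then obtain a b where ab: "a < b" "{t. y + t *\<^sub>R u \<in> T} = {a..b}"
      by (rule compact_line_section[OF T u0])
    have mem: "y + t *\<^sub>R u \<in> T \<longleftrightarrow> t \<in> {a..b}" for t
      using arg_cong[OF ab(2), of "\<lambda>S. t \<in> S"] by simp
    have yN: "\<forall>i\<in>I. y \<in> shadow u (e i) \<longrightarrow> y \<in> shadow u (rel_interior (e i))"
        "\<forall>i. \<nu> i \<bullet> u = 0 \<longrightarrow> i \<in> I \<longrightarrow> y \<notin> shadow u (e i)" "\<forall>D\<in>\<D>. y \<notin> shadow u D"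
      using y unfolding N_def by simp_all
    have gen1: "y \<in> shadow u (rel_interior (e i)) \<and> \<nu> i \<bullet> u \<noteq> 0" if "i \<in> I" "y \<in> shadow u (e i)" for i
      using that yN(1)[rule_format, of i] yN(2)[rule_format, of i] by blast
    have gen2: "y \<notin> shadow u D" if "D \<in> \<D>" for D
      using that yN(3) by blast
    have "\<exists>i\<in>I. {j \<in> I. y \<in> shadow u (e j) \<and> \<nu> j \<bullet> u > 0} = {i} \<and> (c i - \<nu> i \<bullet> y) / (\<nu> i \<bullet> u) = b"
      proof (rule exit_facet[where T = T and \<D> = \<D> and a = a])
        show "y + b *\<^sub>R u \<in> T" "a < b" "y + a *\<^sub>R u \<in> T" using ab(1) by (simp_all add: mem)
        show "y + t *\<^sub>R u \<notin> T" if "b < t" for t using mem[of t] that by simp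
      qed (fact e(2) disj cover gen1 gen2)+
    then obtain p where p: "{j \<in> I. y \<in> shadow u (e j) \<and> \<nu> j \<bullet> u > 0} = {p}" "(c p - \<nu> p \<bullet> y) / (\<nu> p \<bullet> u) = b"
      by (elim bexE conjE)
    \<comment> \<open>The entry point is the exit point of the reversed line, whose parameter runs
      from \<open>- b\<close> to \<open>- a\<close>.\<close>
    have "\<exists>i\<in>I. {j \<in> I. y \<in> shadow (- u) (e j) \<and> \<nu> j \<bullet> (- u) > 0} = {i} \<and> (c i - \<nu> i \<bullet> y) / (\<nu> i \<bullet> (- u)) = - a"
    proof (rule exit_facet[where T = T and \<D> = \<D> and a = "- b"])
      show "y + - a *\<^sub>R - u \<in> T" "- b < - a" "y + - b *\<^sub>R - u \<in> T"
        using ab(1) by (simp_all add: mem)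
      show "y + t *\<^sub>R - u \<notin> T" if "- a < t" for t
        using mem[of "- t"] that by simp
      show "y \<in> shadow (- u) (rel_interior (e i)) \<and> \<nu> i \<bullet> - u \<noteq> 0" if "i \<in> I" "y \<in> shadow (- u) (e i)" for i
        using gen1[OF that(1)] that(2) by (simp add: shadow_uminus)
      show "y \<notin> shadow (- u) D" if "D \<in> \<D>" for D using gen2[OF that] by (simp add: shadow_uminus)
    qed (fact e(2) disj cover)+
    then obtain q where "{j \<in> I. y \<in> shadow (- u) (e j) \<and> \<nu> j \<bullet> (- u) > 0} = {q}"
        "(c q - \<nu> q \<bullet> y) / (\<nu> q \<bullet> (- u)) = - a"
      by (elim bexE conjE)
    then have q: "{j \<in> I. y \<in> shadow u (e j) \<and> \<nu> j \<bullet> u < 0} = {q}" "(c q - \<nu> q \<bullet> y) / (\<nu> q \<bullet> u) = a"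
      by (simp_all add: shadow_uminus)
    let ?f = "\<lambda>i. F (y + ((c i - \<nu> i \<bullet> y) / (\<nu> i \<bullet> u)) *\<^sub>R u)"
    have "(\<Sum>i\<in>I. G i y) = (\<Sum>i\<in>I. (if y \<in> shadow u (e i) \<and> \<nu> i \<bullet> u > 0 then ?f i else 0)
       - (if y \<in> shadow u (e i) \<and> \<nu> i \<bullet> u < 0 then ?f i else 0))"
      by (intro sum.cong) (auto simp: G_def)
    also have "\<dots> = sum ?f {j \<in> I. y \<in> shadow u (e j) \<and> \<nu> j \<bullet> u > 0} - sum ?f {j \<in> I. y \<in> shadow u (e j) \<and> \<nu> j \<bullet> u < 0}"
      unfolding sum_subtractf by (simp only: sum.inter_filter[OF I])
    also have "\<dots> = F (y + b *\<^sub>R u) - F (y + a *\<^sub>R u)"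
      unfolding p(1) q(1) by (simp add: p(2) q(2))
    also have "\<dots> = (LINT t|lborel. (F' (y + t *\<^sub>R u) \<bullet> u) * indicator {a..b} t)"
    proof (rule integral_FTC_Icc_real[symmetric])
      show "a \<le> b" using ab(1) by simp
      fix t :: real
      show "DERIV (\<lambda>t. F (y + t *\<^sub>R u)) t :> F' (y + t *\<^sub>R u) \<bullet> u"
      proof -
        have "((\<lambda>t. F (y + t *\<^sub>R u)) has_derivative (\<lambda>h. F' (y + t *\<^sub>R u) \<bullet> (h *\<^sub>R u))) (at t)"
          by (rule has_derivative_compose[where g = F, OF _ F]) (auto intro!: derivative_eq_intros)
        then show ?thesis by (simp add: has_field_derivative_def mult_commute_abs)
      qed
      show "isCont (\<lambda>t. F' (y + t *\<^sub>R u) \<bullet> u) t"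
      proof -
        have "continuous_on UNIV (\<lambda>t. F' (y + t *\<^sub>R u) \<bullet> u)"
          by (intro continuous_intros continuous_on_compose2[OF F']) auto
        then show ?thesis by (simp add: continuous_on_eq_continuous_at)
      qed
    qed
    also have "\<dots> = (LINT t|lborel. g (y + t *\<^sub>R u))"
      by (intro Bochner_Integration.integral_cong) (auto simp: g_def indicator_def mem)
    finally show ?thesis ..
  qed
  have ae: "AE y in lborel. indicator (slab u) y * (LINT t|lborel. g (y + t *\<^sub>R u)) = (\<Sum>i\<in>I. indicator (slab u) y * G i y)"
  proof -
    have "AE y in lebesgue. y \<notin> N" using N by (simp add: negligible_iff_null_sets AE_not_in)
    then have "AE y in lborel. y \<notin> N" by (simp add: AE_completion_iff)
    then show ?thesis by eventually_elim (simp add: pt sum_distrib_left)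
  qed
  have "(LINT y:T|lebesgue. F' y \<bullet> u) = (LINT y|lborel. indicator (slab u) y * (LINT t|lborel. g (y + t *\<^sub>R u)))"
    using integral_slab(2)[OF g(1) u] g(2) by simp
  also have "\<dots> = (LINT y|lborel. (\<Sum>i\<in>I. indicator (slab u) y * G i y))"
  proof (rule integral_cong_AE[OF _ _ ae])
    show "(\<lambda>y. \<Sum>i\<in>I. indicator (slab u) y * G i y) \<in> borel_measurable lborel"
      using G by (intro borel_measurable_sum borel_measurable_integrable) blast
  qed (intro borel_measurable_integrable integral_slab(1)[OF g(1) u])
  also have "\<dots> = (\<Sum>i\<in>I. LINT y|lborel. indicator (slab u) y * G i y)"
    using G by (intro Bochner_Integration.integral_sum) auto
  also have "\<dots> = (\<Sum>i\<in>I. (\<nu> i \<bullet> u) * flat_int (\<nu> i) (c i) (e i) F)"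
    using G by (intro sum.cong) auto
  finally show ?thesis .
qed

section \<open>Continuously differentiable functions\<close>

text \<open>Smoothness is asked on the whole space. On a cell a function is represented by a global
  extension, as is natural for polynomials, and boundary values are then plain values of the
  extension.\<close>

definition C1 :: "('a::euclidean_space \<Rightarrow> real) \<Rightarrow> bool"
  where "C1 F \<longleftrightarrow> (\<exists>F'. continuous_on UNIV F' \<and> (\<forall>x. (F has_derivative (\<lambda>h. F' x \<bullet> h)) (at x)))"

lemma C1I: "continuous_on UNIV F' \<Longrightarrow> (\<And>x. (F has_derivative (\<lambda>h. F' x \<bullet> h)) (at x)) \<Longrightarrow> C1 F"
  unfolding C1_def by blast

lemma C1E:
  assumes "C1 F"
  obtains F' where "continuous_on UNIV F'" "\<And>x. (F has_derivative (\<lambda>h. F' x \<bullet> h)) (at x)"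
  using assms unfolding C1_def by blast

lemma C1_continuous: "C1 F \<Longrightarrow> continuous_on UNIV F"
  by (erule C1E) (meson continuous_at_imp_continuous_on has_derivative_continuous)

lemma C1_const: "C1 (\<lambda>x. c)"
  by (rule C1I[where F' = "\<lambda>x. 0"]) auto

lemma C1_inner: "C1 (\<lambda>x. a \<bullet> x)"
  by (rule C1I[where F' = "\<lambda>x. a"]) (auto intro!: derivative_eq_intros)

lemma C1_nth: "C1 (\<lambda>x :: real ^ 'd::finite. x $ i)"
  using C1_inner[of "axis i (1::real)"] by (simp add: inner_axis')

lemma C1_add:
  assumes "C1 F" "C1 G" shows "C1 (\<lambda>x. F x + G x)"
proof -
  obtain F' where F: "continuous_on UNIV F'" "\<And>x. (F has_derivative (\<lambda>h. F' x \<bullet> h)) (at x)"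
    by (rule C1E[OF assms(1)]) (rule that)
  obtain G' where G: "continuous_on UNIV G'" "\<And>x. (G has_derivative (\<lambda>h. G' x \<bullet> h)) (at x)"
    by (rule C1E[OF assms(2)]) (rule that)
  show ?thesis
    by (rule C1I[where F' = "\<lambda>x. F' x + G' x"])
       (auto intro!: continuous_intros F G derivative_eq_intros simp: inner_simps)
qed

lemma C1_mult:
  assumes "C1 F" "C1 G" shows "C1 (\<lambda>x. F x * G x)"
proof -
  obtain F' where F: "continuous_on UNIV F'" "\<And>x. (F has_derivative (\<lambda>h. F' x \<bullet> h)) (at x)"
    by (rule C1E[OF assms(1)]) (rule that)
  obtain G' where G: "continuous_on UNIV G'" "\<And>x. (G has_derivative (\<lambda>h. G' x \<bullet> h)) (at x)"
    by (rule C1E[OF assms(2)]) (rule that)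
  show ?thesis
    by (rule C1I[where F' = "\<lambda>x. F x *\<^sub>R G' x + G x *\<^sub>R F' x"])
       (auto intro!: continuous_intros F(1) G(1) C1_continuous assms derivative_eq_intros F(2) G(2) simp: inner_simps)
qed

lemma C1_sum: "(\<And>i. i \<in> A \<Longrightarrow> C1 (F i)) \<Longrightarrow> C1 (\<lambda>x. \<Sum>i\<in>A. F i x)"
  by (induction A rule: infinite_finite_induct) (auto intro!: C1_const C1_add)

lemma C1_prod: "(\<And>i. i \<in> A \<Longrightarrow> C1 (F i)) \<Longrightarrow> C1 (\<lambda>x. \<Prod>i\<in>A. F i x)"
  by (induction A rule: infinite_finite_induct) (auto intro!: C1_const C1_mult)

lemma C1_power: "C1 F \<Longrightarrow> C1 (\<lambda>x. F x ^ n)"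
  by (induction n) (auto intro!: C1_const C1_mult)

lemma C1_cmult: "C1 F \<Longrightarrow> C1 (\<lambda>x. c * F x)"
  by (intro C1_mult C1_const)

lemma C1_poly_deg_le: "poly_deg_le k P \<Longrightarrow> C1 P"
proof -
  assume "poly_deg_le k P"
  then obtain c where "P = (\<lambda>y. \<Sum>\<alpha> | (\<Sum>i\<in>UNIV. \<alpha> i) \<le> k. c \<alpha> * (\<Prod>i\<in>UNIV. y $ i ^ \<alpha> i))"
    unfolding poly_deg_le_def by blast
  then show "C1 P" by (simp add: C1_sum C1_cmult C1_prod C1_power C1_nth)
qed

lemma C1_compose:
  assumes "C1 F" and g: "continuous_on UNIV g'" "\<And>x. (g has_real_derivative g' x) (at x)"
  shows "C1 (\<lambda>x. g (F x))"
proof -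
  obtain F' where F: "continuous_on UNIV F'" "\<And>x. (F has_derivative (\<lambda>h. F' x \<bullet> h)) (at x)"
    by (rule C1E[OF assms(1)]) (rule that)
  show ?thesis
  proof (rule C1I[where F' = "\<lambda>x. g' (F x) *\<^sub>R F' x"])
    show "continuous_on UNIV (\<lambda>x. g' (F x) *\<^sub>R F' x)"
      by (intro continuous_intros F continuous_on_compose2[OF g(1)] C1_continuous assms) auto
    show "((\<lambda>x. g (F x)) has_derivative (\<lambda>h. (g' (F x) *\<^sub>R F' x) \<bullet> h)) (at x)" for x
      using has_derivative_compose[OF F(2)[of x] g(2)[of "F x", unfolded has_field_derivative_def]]
      by (simp add: mult.commute)
  qed
qed

lemma C1_gw: "C1 (gw :: real ^ 'd::finite \<Rightarrow> real)"
proof -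
  have "gw = (\<lambda>v :: real ^ 'd. exp ((\<Sum>i\<in>UNIV. (-1/2) * (v $ i ^ 2))))"
    unfolding sum_distrib_left[symmetric]
    by (simp add: fun_eq_iff gw_def power2_norm_eq_inner inner_vec_def power2_eq_square[where a = "x $ i" for x :: "real ^ 'd" and i])
  moreover have "C1 (\<lambda>v :: real ^ 'd. exp ((\<Sum>i\<in>UNIV. (-1/2) * (v $ i ^ 2))))"
    by (rule C1_compose[where g = exp and g' = exp])
      (intro C1_sum C1_cmult C1_power C1_nth continuous_intros DERIV_exp)+
  ultimately show ?thesis by simp
qed

lemma pd_has_derivative:
  assumes "(F has_derivative D) (at y)"
  shows "pd s F y = D (axis s 1)"
proof -
  have lin: "linear D" using assms has_derivative_linear by blast
  have "((\<lambda>t. F (y + t *\<^sub>R axis s 1)) has_derivative (\<lambda>h. D (h *\<^sub>R axis s 1))) (at 0)"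
    by (rule has_derivative_compose[where g = F]) (use assms in \<open>auto intro!: derivative_eq_intros\<close>)
  then have "((\<lambda>t. F (y + t *\<^sub>R axis s 1)) has_field_derivative D (axis s 1)) (at 0)"
    by (simp add: has_field_derivative_def linear_scale[OF lin] mult_commute_abs)
  then show ?thesis by (simp add: pd_def DERIV_imp_deriv)
qed

lemma pd_cong_open:
  fixes F :: "real ^ 'd::finite \<Rightarrow> real"
  assumes "open S" "y \<in> S" "\<And>x. x \<in> S \<Longrightarrow> F x = G x"
  shows "pd s F y = pd s G y"
proof -
  have "open ((\<lambda>t. y + t *\<^sub>R axis s (1::real)) -` S)"
    by (rule continuous_open_vimage[OF assms(1)]) (intro continuous_intros)
  then have "eventually (\<lambda>t. t \<in> (\<lambda>t. y + t *\<^sub>R axis s (1::real)) -` S) (nhds 0)"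
    by (rule eventually_nhds_in_open) (use assms(2) in simp)
  then have "eventually (\<lambda>t. F (y + t *\<^sub>R axis s 1) = G (y + t *\<^sub>R axis s 1)) (nhds 0)"
    by eventually_elim (simp add: assms(3))
  then show ?thesis unfolding pd_def by (rule deriv_cong_ev) simp
qed

lemma C1_pd:
  fixes F :: "real ^ 'd::finite \<Rightarrow> real"
  assumes "C1 F"
  obtains F' where "continuous_on UNIV F'" "\<And>x. (F has_derivative (\<lambda>h. F' x \<bullet> h)) (at x)"
    "\<And>x s. pd s F x = F' x $ s" "\<And>x s. pd s F x = F' x \<bullet> axis s 1"
proof -
  obtain F' where F: "continuous_on UNIV F'" "\<And>x. (F has_derivative (\<lambda>h. F' x \<bullet> h)) (at x)"
    by (rule C1E[OF assms]) (rule that)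
  show ?thesis using that[OF F] pd_has_derivative[OF F(2)] by (simp add: inner_axis)
qed

lemma continuous_on_pd: "C1 F \<Longrightarrow> continuous_on UNIV (pd s F)"
  by (erule C1_pd) (simp add: fun_eq_iff[symmetric] continuous_on_component cong: continuous_on_cong)

lemma pd_add:
  assumes "C1 F" "C1 G"
  shows "pd s (\<lambda>x. F x + G x) y = pd s F y + pd s G y"
proof -
  obtain F' where F: "\<And>x. (F has_derivative (\<lambda>h. F' x \<bullet> h)) (at x)"
    by (rule C1E[OF assms(1)]) (rule that)
  obtain G' where G: "\<And>x. (G has_derivative (\<lambda>h. G' x \<bullet> h)) (at x)"
    by (rule C1E[OF assms(2)]) (rule that)
  show ?thesis
    using pd_has_derivative[OF has_derivative_add[OF F G], of s y]
      pd_has_derivative[OF F, of s y] pd_has_derivative[OF G, of s y] by simp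
qed

lemma pd_mult:
  assumes "C1 F" "C1 G"
  shows "pd s (\<lambda>x. F x * G x) y = pd s F y * G y + F y * pd s G y"
proof -
  obtain F' where F: "\<And>x. (F has_derivative (\<lambda>h. F' x \<bullet> h)) (at x)"
    by (rule C1E[OF assms(1)]) (rule that)
  obtain G' where G: "\<And>x. (G has_derivative (\<lambda>h. G' x \<bullet> h)) (at x)"
    by (rule C1E[OF assms(2)]) (rule that)
  show ?thesis
    using pd_has_derivative[OF has_derivative_mult[OF F G], of s y]
      pd_has_derivative[OF F, of s y] pd_has_derivative[OF G, of s y] by simp
qed

lemma pd_const: "pd s (\<lambda>x. c) y = 0"
  by (rule pd_has_derivative[where D = "\<lambda>h. 0", simplified]) simp

lemma pd_cmult: "C1 F \<Longrightarrow> pd s (\<lambda>x. c * F x) y = c * pd s F y"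
  using pd_mult[OF C1_const, of F s c y] by (simp add: pd_const)

lemma pd_nth: "pd s (\<lambda>x. x $ i) y = (if s = i then 1 else 0)"
  by (subst pd_has_derivative[OF bounded_linear_imp_has_derivative[OF bounded_linear_vec_nth]]) (auto simp: axis_def)

section \<open>Null-set modifications and transformation rules of flat integrals\<close>

lemma borel_measurable_lebesgue_spike:
  fixes f g :: "'a::euclidean_space \<Rightarrow> 'b::topological_space"
  assumes f: "f \<in> borel_measurable lebesgue" and N: "negligible N" and eq: "\<And>x. x \<notin> N \<Longrightarrow> g x = f x"
  shows "g \<in> borel_measurable lebesgue"
proof (rule borel_measurableI)
  fix S :: "'b set" assume "open S"
  then have "f -` S \<inter> space lebesgue \<in> sets lebesgue" using measurable_sets[OF f, of S] by simp
  moreover have "N \<in> sets lebesgue" using N negligible_imp_sets by blast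
  moreover have "g -` S \<inter> N \<in> sets lebesgue" using N negligible_imp_sets negligible_subset by (metis Int_lower2)
  moreover have "g -` S \<inter> space lebesgue = ((f -` S \<inter> space lebesgue) - N) \<union> (g -` S \<inter> N)" using eq by auto
  ultimately show "g -` S \<inter> space lebesgue \<in> sets lebesgue" by (metis sets.Un sets.Diff)
qed

text \<open>Every subset of a Lebesgue null set is measurable, so the modified function inherits
  measurability; this is what permits arbitrary values on frontiers of cells and rims of
  faces.\<close>

lemma set_integral_spike:
  fixes f g :: "'a::euclidean_space \<Rightarrow> real"
  assumes f: "set_integrable lebesgue S f" and N: "negligible N" and eq: "\<And>x. x \<in> S \<Longrightarrow> x \<notin> N \<Longrightarrow> g x = f x"
  shows "(LINT x:S|lebesgue. g x) = (LINT x:S|lebesgue. f x)" and "set_integrable lebesgue S g"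
proof -
  have 1: "(\<lambda>x. indicator S x *\<^sub>R f x) \<in> borel_measurable lebesgue"
    using f unfolding set_integrable_def by auto
  have 2: "(\<lambda>x. indicator S x *\<^sub>R g x) \<in> borel_measurable lebesgue"
    by (rule borel_measurable_lebesgue_spike[OF 1 N]) (use eq in \<open>auto simp: indicator_def\<close>)
  have ae: "AE x in lebesgue. indicator S x *\<^sub>R g x = indicator S x *\<^sub>R f x"
    using N unfolding negligible_iff_null_sets
    by (rule AE_I'[rotated 0]) (use eq in \<open>auto simp: indicator_def\<close>)
  show "(LINT x:S|lebesgue. g x) = (LINT x:S|lebesgue. f x)"
    unfolding set_lebesgue_integral_def by (rule integral_cong_AE[OF 2 1 ae])
  show "set_integrable lebesgue S g"
    using f unfolding set_integrable_def by (subst integrable_cong_AE[OF 2 1 ae])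
qed

lemma integral_lborel_translate:
  fixes g :: "'a::euclidean_space \<Rightarrow> real"
  assumes [measurable]: "g \<in> borel_measurable borel"
  shows "(LINT y|lborel. g (y + a)) = integral\<^sup>L lborel g"
proof -
  have "integral\<^sup>L lborel g = integral\<^sup>L (distr lborel borel ((+) a)) g"
    by (simp add: lborel_distr_plus)
  also have "\<dots> = (LINT y|lborel. g (a + y))"
    by (subst integral_distr) auto
  finally show ?thesis by (simp add: add.commute)
qed

lemma flat_int_lborel:
  fixes n :: "'a::euclidean_space"
  assumes "compact e" "continuous_on UNIV h"
  defines "P \<equiv> {x + t *\<^sub>R n | x t. x \<in> e \<and> t \<in> {0..1::real}}"
  shows "flat_int n c e h = (LINT y|lborel. indicator P y * h (y - (n \<bullet> y - c) *\<^sub>R n))"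
    and "integrable lborel (\<lambda>y. indicator P y * h (y - (n \<bullet> y - c) *\<^sub>R n))"
    and "set_integrable lebesgue P (\<lambda>y. h (y - (n \<bullet> y - c) *\<^sub>R n))"
proof -
  have cont: "continuous_on P (\<lambda>y. h (y - (n \<bullet> y - c) *\<^sub>R n))"
    by (intro continuous_on_compose2[OF assms(2)] continuous_intros) auto
  have comp: "compact P" unfolding P_def by (rule compact_prism[OF assms(1)])
  show "flat_int n c e h = (LINT y|lborel. indicator P y * h (y - (n \<bullet> y - c) *\<^sub>R n))"
    using set_integral_lebesgue_compact(2)[OF comp cont] by (simp add: flat_int_def P_def)
  show "integrable lborel (\<lambda>y. indicator P y * h (y - (n \<bullet> y - c) *\<^sub>R n))"
    using set_integral_lebesgue_compact(1)[OF comp cont] .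
  show "set_integrable lebesgue P (\<lambda>y. h (y - (n \<bullet> y - c) *\<^sub>R n))"
    using set_integral_lebesgue_compact(3)[OF comp cont] .
qed

text \<open>A point of the prism whose foot is outside the relative interior of \<open>e\<close>
  lies on a line of direction \<open>n\<close> that meets \<open>e\<close> only in its rim, and
  those lines form a null set. Traces can be evaluated in relative interiors only, hence this
  form.\<close>

lemma flat_int_spike:
  fixes n :: "'a::euclidean_space"
  assumes n: "norm n = 1" and e: "compact e" "convex e" "e \<subseteq> {x. n \<bullet> x = c}" and h: "continuous_on UNIV h"
    and eq: "\<And>x. x \<in> rel_interior e \<Longrightarrow> g x = h x"
  shows "flat_int n c e g = flat_int n c e h"
  unfolding flat_int_def
proof (rule set_integral_spike(1)[OF flat_int_lborel(3)[OF e(1) h]])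
  show "negligible (shadow n e - shadow n (rel_interior e))"
    by (rule negligible_shadow_rel_frontier[OF e(2)])
  fix y assume y: "y \<in> {x + t *\<^sub>R n | x t. x \<in> e \<and> t \<in> {0..1}}" "y \<notin> shadow n e - shadow n (rel_interior e)"
  have nn: "n \<bullet> n = 1" using n by (simp add: dot_square_norm)
  obtain x t where xt: "y = x + t *\<^sub>R n" "x \<in> e" using y(1) by blast
  then have "y + (- t) *\<^sub>R n \<in> e" by simp
  then have "y \<in> shadow n (rel_interior e)" using y(2) unfolding shadow_def by blast
  then obtain t' where t': "y + t' *\<^sub>R n \<in> rel_interior e" by (auto simp: shadow_def)
  then have "y + t' *\<^sub>R n \<in> {x. n \<bullet> x = c}" using e(3) rel_interior_subset by blast
  then have t'_eq: "t' = c - n \<bullet> y" using nn by (simp add: inner_simps)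
  have "y - (n \<bullet> y - c) *\<^sub>R n = y + t' *\<^sub>R n" unfolding t'_eq by (simp add: algebra_simps)
  then show "g (y - (n \<bullet> y - c) *\<^sub>R n) = h (y - (n \<bullet> y - c) *\<^sub>R n)" using eq[OF t'] by (simp only:)
qed

lemma flat_int_add:
  assumes "compact e" "continuous_on UNIV f" "continuous_on UNIV g"
  shows "flat_int n c e (\<lambda>x. f x + g x) = flat_int n c e f + flat_int n c e g"
  unfolding flat_int_def
  using flat_int_lborel(3)[OF assms(1,2), of n c] flat_int_lborel(3)[OF assms(1,3), of n c]
  by (simp add: set_integral_add)

lemma flat_int_cmult: "flat_int n c e (\<lambda>x. a * f x) = a * flat_int n c e f"
  unfolding flat_int_def by simp

text \<open>The two prisms lie on opposite sides of \<open>e\<close>, but both volume integrals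
  reduce to the same integral over the lines of direction \<open>n\<close>.\<close>

lemma flat_int_uminus:
  fixes n :: "'a::euclidean_space"
  assumes n: "norm n = 1" and e: "compact e" "e \<subseteq> {x. n \<bullet> x = c}" and h: "continuous_on UNIV h"
  shows "flat_int (- n) (- c) e h = flat_int n c e h"
proof -
  have nn: "n \<bullet> n = 1" using n by (simp add: dot_square_norm)
  have e': "e \<subseteq> {x. - n \<bullet> x = - c}" using e(2) by auto
  have "- flat_int (- n) (- c) e h = - (LINT y|lborel. indicator (slab n) y * (indicator (shadow n e) y * h (y + ((c - n \<bullet> y) / (n \<bullet> n)) *\<^sub>R n)))"
    using flat_int_slab(2)[of "- n" n n e "- c" h] n nn e(1) e' h by simp
  moreover have "flat_int n c e h = (LINT y|lborel. indicator (slab n) y * (indicator (shadow n e) y * h (y + ((c - n \<bullet> y) / (n \<bullet> n)) *\<^sub>R n)))"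
    using flat_int_slab(2)[of n n n e c h] n nn e h by simp
  ultimately show ?thesis by simp
qed

lemma flat_int_translate:
  fixes n :: "'a::euclidean_space"
  assumes e: "compact e" and h: "continuous_on UNIV h"
  shows "flat_int n (c - n \<bullet> z) ((+) (- z) ` e) h = flat_int n c e (\<lambda>x. h (x - z))"
proof -
  have comp: "compact ((+) (- z) ` e)" using compact_translation[OF e] .
  have cont: "continuous_on UNIV (\<lambda>x. h (x - z))"
    by (intro continuous_on_compose2[OF h] continuous_intros) auto
  let ?g = "\<lambda>y. indicator {x + t *\<^sub>R n | x t. x \<in> e \<and> t \<in> {0..1}} y * h (y - (n \<bullet> y - c) *\<^sub>R n - z)"
  have gm: "?g \<in> borel_measurable borel"
    using borel_measurable_integrable[OF flat_int_lborel(2)[OF e cont, of n c]] by simp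
  have "flat_int n (c - n \<bullet> z) ((+) (- z) ` e) h = (LINT y|lborel. ?g (y + z))"
    unfolding flat_int_lborel(1)[OF comp h]
  proof (rule Bochner_Integration.integral_cong[OF refl])
    fix y
    have "y \<in> {x + t *\<^sub>R n | x t. x \<in> (+) (- z) ` e \<and> t \<in> {0..1}} \<longleftrightarrow> y + z \<in> {x + t *\<^sub>R n | x t. x \<in> e \<and> t \<in> {0..1}}"
    proof
      assume "y \<in> {x + t *\<^sub>R n | x t. x \<in> (+) (- z) ` e \<and> t \<in> {0..1}}"
      then obtain x t where "y = - z + x + t *\<^sub>R n" "x \<in> e" "t \<in> {0..1}" by blast
      moreover from this have "y + z = x + t *\<^sub>R n" by simp
      ultimately show "y + z \<in> {x + t *\<^sub>R n | x t. x \<in> e \<and> t \<in> {0..1}}" by blast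
    next
      assume "y + z \<in> {x + t *\<^sub>R n | x t. x \<in> e \<and> t \<in> {0..1}}"
      then obtain x t where "y + z = x + t *\<^sub>R n" "x \<in> e" "t \<in> {0..1}" by blast
      moreover from this have "y = (- z + x) + t *\<^sub>R n" by (simp add: algebra_simps eq_diff_eq)
      ultimately show "y \<in> {x + t *\<^sub>R n | x t. x \<in> (+) (- z) ` e \<and> t \<in> {0..1}}" by blast
    qed
    moreover have "y + z - (n \<bullet> (y + z) - c) *\<^sub>R n - z = y - (n \<bullet> y - (c - n \<bullet> z)) *\<^sub>R n"
      by (simp add: inner_simps algebra_simps)
    ultimately show "indicator {x + t *\<^sub>R n | x t. x \<in> (+) (- z) ` e \<and> t \<in> {0..1}} y * h (y - (n \<bullet> y - (c - n \<bullet> z)) *\<^sub>R n)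
      = ?g (y + z)"
      unfolding indicator_def by presburger
  qed
  also have "\<dots> = integral\<^sup>L lborel ?g" by (rule integral_lborel_translate[OF gm])
  also have "\<dots> = flat_int n c e (\<lambda>x. h (x - z))"
    using flat_int_lborel(1)[OF e cont, of n c] by simp
  finally show ?thesis .
qed

text \<open>A hyperplane separating the two interiors contains \<open>A \<inter> B\<close> and hence
  \<open>e\<close>. Since \<open>e\<close> spans a hyperplane, the two hyperplanes agree;
  \<open>\<sigma>\<close> records which set lies on which side of the given normal.\<close>

lemma separate_along_facet:
  fixes A B e :: "'a::euclidean_space set"
  assumes A: "convex A" "interior A \<noteq> {}" and B: "convex B" "interior B \<noteq> {}"
    and disj: "interior A \<inter> interior B = {}" and e: "e \<subseteq> A \<inter> B"
    and hull: "affine hull e = {x. n \<bullet> x = c}" and n: "norm n = 1" and ne: "e \<noteq> {}"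
  shows "\<exists>\<sigma>\<in>{1, -1}. A \<subseteq> {x. \<sigma> * (n \<bullet> x) \<le> \<sigma> * c} \<and> B \<subseteq> {x. - \<sigma> * (n \<bullet> x) \<le> - \<sigma> * c}"
proof -
  have nn: "n \<bullet> n = 1" using n by (simp add: dot_square_norm)
  obtain a b where a: "a \<noteq> 0" "\<forall>x\<in>interior A. a \<bullet> x \<le> b" "\<forall>x\<in>interior B. b \<le> a \<bullet> x"
    using separating_hyperplane_sets[OF convex_interior[OF A(1)] convex_interior[OF B(1)] A(2) B(2) disj] by metis
  have "closure (interior A) \<subseteq> {x. a \<bullet> x \<le> b}"
    using a(2) by (intro closure_minimal closed_halfspace_le) auto
  then have A': "A \<subseteq> {x. a \<bullet> x \<le> b}"
    using convex_closure_interior[OF A] closure_subset[of A] by simp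
  have "closure (interior B) \<subseteq> {x. a \<bullet> x \<ge> b}"
    using a(3) by (intro closure_minimal closed_halfspace_ge) auto
  then have B': "B \<subseteq> {x. a \<bullet> x \<ge> b}"
    using convex_closure_interior[OF B] closure_subset[of B] by simp
  have "e \<subseteq> {x. a \<bullet> x = b}" using e A' B' by fastforce
  then have hyp: "{x. n \<bullet> x = c} \<subseteq> {x. a \<bullet> x = b}"
    using hull_minimal[of e "{x. a \<bullet> x = b}" affine, OF _ affine_hyperplane] hull by simp
  obtain y where "y \<in> e" using ne by auto
  then have y: "n \<bullet> y = c" "a \<bullet> y = b" using hull hyp hull_subset[of e affine] by auto
  \<comment> \<open>The component of \<open>a\<close> orthogonal to \<open>n\<close>. Moving from
    \<open>y\<close> by \<open>h\<close> stays in the hyperplane of \<open>e\<close>, hence in the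
    separating one, so \<open>a \<bullet> h = 0\<close>; together with
    \<open>n \<bullet> h = 0\<close> this gives \<open>h \<bullet> h = 0\<close>.\<close>
  define h where "h = a - (a \<bullet> n) *\<^sub>R n"
  have nh: "n \<bullet> h = 0" using nn by (simp add: h_def inner_simps inner_commute)
  then have "y + h \<in> {x. n \<bullet> x = c}" using y by (simp add: inner_simps)
  then have "a \<bullet> (y + h) = b" using hyp by blast
  then have ah: "a \<bullet> h = 0" using y by (simp add: inner_simps)
  have "h \<bullet> h = (a - (a \<bullet> n) *\<^sub>R n) \<bullet> h" by (simp add: h_def)
  then have "h \<bullet> h = a \<bullet> h - (a \<bullet> n) * (n \<bullet> h)" by (simp only: inner_diff_left inner_scaleR_left)
  then have "h = 0" using ah nh by simp
  then have a_eq: "a = (a \<bullet> n) *\<^sub>R n" by (simp add: h_def)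
  define k where "k = a \<bullet> n"
  have l0: "k \<noteq> 0" using a(1) a_eq unfolding k_def by auto
  have ax: "a \<bullet> x = k * (n \<bullet> x)" for x using a_eq unfolding k_def by (metis inner_scaleR_left)
  have b: "b = k * c" using ax[of y] y by simp
  show ?thesis
  proof (cases "k > 0")
    case True
    then show ?thesis using A' B' by (intro bexI[of _ 1]) (auto simp: ax b)
  next
    case False
    then have "k < 0" using l0 by simp
    then show ?thesis using A' B' by (intro bexI[of _ "-1"]) (auto simp: ax b)
  qed
qed

text \<open>The point \<open>p + \<epsilon> *\<^sub>R w\<close> is a proper convex combination of an
  interior point \<open>q\<close> of \<open>C\<close> and a point of the hyperplane that tends to
  \<open>p\<close> and so eventually belongs to \<open>e\<close>. The direction \<open>w\<close> may
  be oblique: besides normals, bisectors of two normals occur later.\<close>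

lemma eventually_interior_near_facet:
  fixes C :: "'a::euclidean_space set"
  assumes C: "convex C" "interior C \<noteq> {}" "C \<subseteq> {x. n \<bullet> x \<le> c}" and n: "norm n = 1"
    and e: "e \<subseteq> C" "affine hull e = {x. n \<bullet> x = c}" and p: "p \<in> rel_interior e" and w: "n \<bullet> w < 0"
  shows "\<forall>\<^sub>F \<epsilon> in at_right 0. p + \<epsilon> *\<^sub>R w \<in> interior C"
proof -
  obtain q where q: "q \<in> interior C" using C(2) by auto
  have nn: "n \<bullet> n = 1" using n by (simp add: dot_square_norm)
  have nq: "n \<bullet> q < c"
  proof -
    obtain r where r: "r > 0" "ball q r \<subseteq> C" using q by (meson mem_interior)
    have "q + (r/2) *\<^sub>R n \<in> ball q r" using r n by (simp add: dist_norm)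
    then have "n \<bullet> (q + (r/2) *\<^sub>R n) \<le> c" using r C(3) by blast
    then have "n \<bullet> q + r / 2 \<le> c" using nn by (simp add: inner_simps)
    then show ?thesis using r(1) by linarith
  qed
  have np: "n \<bullet> p = c" using p e(2) rel_interior_subset[of e] hull_subset[of e affine] by blast
  obtain d where d: "d > 0" "ball p d \<inter> affine hull e \<subseteq> e" using p by (auto simp: mem_rel_interior_ball)
  \<comment> \<open>The weight of \<open>q\<close>, chosen so that the remaining point
    \<open>x \<epsilon>\<close> satisfies \<open>n \<bullet> x \<epsilon> = c\<close>; it is
    positive and tends to 0 with \<open>\<epsilon>\<close>.\<close>
  define l where "l = (\<lambda>\<epsilon>. \<epsilon> * (n \<bullet> w) / (n \<bullet> q - c))"
  define x where "x = (\<lambda>\<epsilon>. (p + \<epsilon> *\<^sub>R w - l \<epsilon> *\<^sub>R q) /\<^sub>R (1 - l \<epsilon>))"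
  have l0: "(l \<longlongrightarrow> 0) (at_right 0)" unfolding l_def using nq by (auto intro!: tendsto_eq_intros)
  have x0: "(x \<longlongrightarrow> p) (at_right 0)" unfolding x_def by (auto intro!: tendsto_eq_intros l0)
  have 1: "\<forall>\<^sub>F \<epsilon> in at_right 0. dist (x \<epsilon>) p < d" using x0 d(1) by (rule tendstoD)
  have 2: "\<forall>\<^sub>F \<epsilon> in at_right 0. l \<epsilon> < 1" using l0 by (rule order_tendstoD) simp
  have 3: "\<forall>\<^sub>F \<epsilon> in at_right 0. (0::real) < \<epsilon>" by (simp add: eventually_at_right_less)
  show ?thesis using 1 2 3
  proof eventually_elim
    case (elim \<epsilon>)
    have lpos: "l \<epsilon> > 0" unfolding l_def using elim(3) w nq by (intro divide_neg_neg mult_pos_neg) auto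
    have "n \<bullet> q - c \<noteq> 0" using nq by linarith
    then have leq: "l \<epsilon> * (n \<bullet> q - c) = \<epsilon> * (n \<bullet> w)" by (simp add: l_def)
    have "(1 - l \<epsilon>) * (n \<bullet> x \<epsilon>) = n \<bullet> ((1 - l \<epsilon>) *\<^sub>R x \<epsilon>)" by simp
    also have "(1 - l \<epsilon>) *\<^sub>R x \<epsilon> = p + \<epsilon> *\<^sub>R w - l \<epsilon> *\<^sub>R q" using elim(2) by (simp add: x_def)
    also have "n \<bullet> \<dots> = (1 - l \<epsilon>) * c" using leq by (simp add: inner_simps np algebra_simps)
    finally have "n \<bullet> x \<epsilon> = c" using elim(2) by simp
    then have "x \<epsilon> \<in> C" using d(2) elim(1) e by (auto simp: dist_commute)
    then have "x \<epsilon> - l \<epsilon> *\<^sub>R (x \<epsilon> - q) \<in> interior C"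
      using mem_interior_convex_shrink[OF C(1) q, of "x \<epsilon>" "l \<epsilon>"] lpos elim(2) by simp
    moreover have "x \<epsilon> - l \<epsilon> *\<^sub>R (x \<epsilon> - q) = (1 - l \<epsilon>) *\<^sub>R x \<epsilon> + l \<epsilon> *\<^sub>R q" by (simp add: algebra_simps)
    moreover have "(1 - l \<epsilon>) *\<^sub>R x \<epsilon> = p + \<epsilon> *\<^sub>R w - l \<epsilon> *\<^sub>R q" using elim(2) by (simp add: x_def)
    ultimately show ?case by simp
  qed
qed

section \<open>Geometry of periodic meshes\<close>

text \<open>
  A pair \<open>C = (T, z)\<close> stands for the translate \<open>z + T\<close> of a cell by a period; \<open>side M e \<sigma> C\<close> says that this
  copy has \<open>e\<close> on its boundary and lies on the side of \<open>e\<close> where \<open>\<sigma>\<close> times the signed distance is \<open>\<le> 0\<close>, so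
  \<open>\<sigma> = 1\<close> is the side of the trace \<open>U\<^sup>-\<close>.
\<close>

definition face_level :: "('d::finite) mesh \<Rightarrow> (real ^ 'd) set \<Rightarrow> real"
  where "face_level M e = nrm M e \<bullet> (SOME y. y \<in> e)"

definition side :: "('d::finite) mesh \<Rightarrow> (real ^ 'd) set \<Rightarrow> real \<Rightarrow> (real ^ 'd) set \<times> (real ^ 'd) \<Rightarrow> bool"
  where "side M e \<sigma> C \<longleftrightarrow> fst C \<in> cells M \<and> snd C \<in> periods M \<and> e \<subseteq> (+) (snd C) ` fst C
    \<and> (+) (snd C) ` fst C \<subseteq> {x. \<sigma> * (nrm M e \<bullet> x) \<le> \<sigma> * face_level M e}"

locale dg_mesh =
  fixes M :: "('d::finite) mesh"
  assumes pm: "periodic_mesh M"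
begin

lemma mesh_facts:
  shows "\<forall>i. lo M $ i < hi M $ i" and finite_cells: "finite (cells M)"
    and "\<forall>T\<in>cells M. polytope T \<and> interior T \<noteq> {}"
    and "\<forall>T\<in>cells M. \<forall>T'\<in>cells M. T \<noteq> T' \<longrightarrow> interior T \<inter> interior T' = {}"
    and Union_cells: "\<Union> (cells M) = Omega M" and finite_faces: "finite (faces M)"
    and "\<forall>e\<in>faces M. interface M e"
    and "\<forall>e. interface M e \<longrightarrow> (\<exists>!e'. e' \<in> faces M \<and> (\<exists>z\<in>periods M. e' = (+) z ` e))"
    and "\<forall>e\<in>faces M. norm (nrm M e) = 1 \<and> (\<forall>x\<in>e. \<forall>y\<in>e. nrm M e \<bullet> (x - y) = 0)"
  using pm unfolding periodic_mesh_def by - (elim conjE, assumption)+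

lemma lo_less_hi: "lo M $ i < hi M $ i"
  using mesh_facts(1) by (rule spec)

lemma cell:
  assumes "T \<in> cells M"
  shows "convex T" "compact T" "closed T" "interior T \<noteq> {}" "T \<subseteq> Omega M"
proof -
  have "polytope T" "interior T \<noteq> {}" using mesh_facts(3)[rule_format, OF assms] by simp_all
  then show "convex T" "compact T" "closed T" "interior T \<noteq> {}"
    by (auto simp: polytope_imp_convex polytope_imp_compact compact_imp_closed)
  show "T \<subseteq> Omega M" using assms Union_cells by blast
qed

lemma periods_zero: "0 \<in> periods M"
  unfolding periods_def by (auto intro!: exI[of _ "\<lambda>i. 0"])

lemma periods_diff: "z \<in> periods M \<Longrightarrow> w \<in> periods M \<Longrightarrow> z - w \<in> periods M"
  unfolding periods_def
proof safe
  fix k l :: "'d \<Rightarrow> int"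
  assume "\<forall>i. z $ i = of_int (k i) * (hi M $ i - lo M $ i)" "\<forall>i. w $ i = of_int (l i) * (hi M $ i - lo M $ i)"
  then show "\<exists>k. \<forall>i. (z - w) $ i = of_int (k i) * (hi M $ i - lo M $ i)"
    by (intro exI[of _ "\<lambda>i. k i - l i"]) (simp add: left_diff_distrib)
qed

lemma periods_uminus: "z \<in> periods M \<Longrightarrow> - z \<in> periods M"
  using periods_diff[OF periods_zero] by simp

lemma periods_add: "z \<in> periods M \<Longrightarrow> w \<in> periods M \<Longrightarrow> z + w \<in> periods M"
  using periods_diff[of z "- w"] periods_uminus by simp

lemma period_large:
  assumes "z \<in> periods M" "z \<noteq> 0"
  shows "\<exists>i. \<bar>z $ i\<bar> \<ge> hi M $ i - lo M $ i"
proof -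
  obtain k :: "'d \<Rightarrow> int" where k: "\<And>i. z $ i = of_int (k i) * (hi M $ i - lo M $ i)"
    using assms(1) unfolding periods_def by blast
  obtain i where i: "z $ i \<noteq> 0" using assms(2) by (auto simp: vec_eq_iff)
  then have "k i \<noteq> 0" using k by auto
  then have "1 \<le> \<bar>k i\<bar>" by linarith
  then have "1 \<le> \<bar>real_of_int (k i)\<bar>" by linarith
  then have "1 * (hi M $ i - lo M $ i) \<le> \<bar>real_of_int (k i)\<bar> * (hi M $ i - lo M $ i)"
    using lo_less_hi[of i] by (intro mult_right_mono) auto
  then show ?thesis using lo_less_hi[of i] by (intro exI[of _ i]) (simp add: k abs_mult)
qed

lemma interior_Omega: "interior (Omega M) = box (lo M) (hi M)"
  by (simp add: Omega_def interior_cbox)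

lemma interior_cell_box: "T \<in> cells M \<Longrightarrow> interior T \<subseteq> box (lo M) (hi M)"
  using cell(5)[of T] interior_mono interior_Omega by blast

text \<open>For equal shifts this is disjointness of the cells. For different shifts, two points of
  the open box differ by less than a side length in every coordinate, while a nonzero period reaches
  a side length in some coordinate. The case of one cell with two shifts is included.\<close>

lemma cells_disjoint:
  assumes "T \<in> cells M" "T' \<in> cells M" "z \<in> periods M" "z' \<in> periods M" "(T, z) \<noteq> (T', z')"
  shows "interior ((+) z ` T) \<inter> interior ((+) z' ` T') = {}"
proof (rule ccontr)
  assume "\<not> ?thesis"
  then obtain a b where ab: "z + a = z' + b" "a \<in> interior T" "b \<in> interior T'"
    unfolding interior_translation by blast
  show False
  proof (cases "z = z'")
    case True
    then have "interior T \<inter> interior T' \<noteq> {}" "T \<noteq> T'" using ab assms(5) by auto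
    then show False using mesh_facts(4)[rule_format, OF assms(1,2)] by simp
  next
    case False
    have "z' - z \<in> periods M" using periods_diff assms by blast
    then obtain i where i: "\<bar>(z' - z) $ i\<bar> \<ge> hi M $ i - lo M $ i" using period_large[of "z' - z"] False by auto
    have "z' - z = a - b" using ab(1) by (simp add: algebra_simps)
    then have "\<bar>a $ i - b $ i\<bar> \<ge> hi M $ i - lo M $ i" using i by (metis vector_minus_component)
    moreover have "a \<in> box (lo M) (hi M)" "b \<in> box (lo M) (hi M)" using ab interior_cell_box assms by blast+
    then have "lo M $ i < a $ i" "a $ i < hi M $ i" "lo M $ i < b $ i" "b $ i < hi M $ i" by (auto simp: mem_box_cart)
    ultimately show False by linarith
  qed
qed

section \<open>Reduction to the box and covering of space by tiles\<close>

lemma wrap_eq: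
  assumes "y - z \<in> box (lo M) (hi M)" "z \<in> periods M"
  shows "wrap M y = y - z"
proof -
  obtain k :: "'d \<Rightarrow> int" where k: "\<And>i. z $ i = of_int (k i) * (hi M $ i - lo M $ i)"
    using assms(2) unfolding periods_def by blast
  have "lo M $ i + (hi M $ i - lo M $ i) * frac ((y $ i - lo M $ i) / (hi M $ i - lo M $ i)) = y $ i - z $ i" for i
  proof -
    let ?L = "hi M $ i - lo M $ i" and ?a = "(y $ i - z $ i - lo M $ i) / (hi M $ i - lo M $ i)"
    have L: "?L > 0" using lo_less_hi[of i] by simp
    have "lo M $ i < y $ i - z $ i" "y $ i - z $ i < hi M $ i" using assms(1) by (auto simp: mem_box_cart)
    then have a: "0 \<le> ?a" "?a < 1" using L by (auto simp: field_simps)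
    have "(y $ i - lo M $ i) / ?L = ?a + of_int (k i)" using L by (simp add: k field_simps)
    then have "frac ((y $ i - lo M $ i) / ?L) = ?a" using a by (simp add: frac_unique_iff)
    then show ?thesis using L by simp
  qed
  then show ?thesis by (simp add: wrap_def vec_eq_iff)
qed

lemma wrap_mem: "wrap M y \<in> Omega M"
proof -
  have "lo M $ i \<le> wrap M y $ i \<and> wrap M y $ i \<le> hi M $ i" for i
  proof -
    let ?f = "frac ((y $ i - lo M $ i) / (hi M $ i - lo M $ i))"
    have "0 \<le> ?f" "?f < 1" by (auto simp: frac_lt_1)
    then have "0 \<le> (hi M $ i - lo M $ i) * ?f" "(hi M $ i - lo M $ i) * ?f \<le> (hi M $ i - lo M $ i) * 1"
      using lo_less_hi[of i] by (auto intro!: mult_nonneg_nonneg mult_left_mono)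
    then show ?thesis by (simp add: wrap_def)
  qed
  then show ?thesis by (simp add: Omega_def mem_box_cart)
qed

lemma wrap_period: "y - wrap M y \<in> periods M"
proof -
  have "(y - wrap M y) $ i = of_int \<lfloor>(y $ i - lo M $ i) / (hi M $ i - lo M $ i)\<rfloor> * (hi M $ i - lo M $ i)" for i
  proof -
    let ?L = "hi M $ i - lo M $ i" and ?a = "(y $ i - lo M $ i) / (hi M $ i - lo M $ i)"
    have "?L * ?a = y $ i - lo M $ i" using lo_less_hi[of i] by simp
    then have "lo M $ i + ?L * frac ?a = y $ i - of_int \<lfloor>?a\<rfloor> * ?L"
      unfolding frac_def right_diff_distrib[of ?L ?a] by (simp add: mult.commute)
    then show ?thesis by (simp add: wrap_def)
  qed
  then show ?thesis unfolding periods_def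
    by (intro CollectI exI[of _ "\<lambda>i. \<lfloor>(y $ i - lo M $ i) / (hi M $ i - lo M $ i)\<rfloor>"] allI)
qed

lemma tiles_cover: "\<exists>T\<in>cells M. \<exists>z\<in>periods M. y \<in> (+) z ` T"
proof -
  obtain T where "T \<in> cells M" "wrap M y \<in> T" using wrap_mem[of y] Union_cells by blast
  moreover have "y = (y - wrap M y) + wrap M y" by simp
  ultimately show ?thesis using wrap_period[of y] by blast
qed

lemma finite_periods: "finite {z \<in> periods M. norm z \<le> R}"
proof -
  let ?N = "\<lambda>i. \<lceil>R / (hi M $ i - lo M $ i)\<rceil>"
  let ?K = "PiE UNIV (\<lambda>i. {- ?N i .. ?N i})"
  have "{z \<in> periods M. norm z \<le> R} \<subseteq> (\<lambda>k. \<chi> i. of_int (k i) * (hi M $ i - lo M $ i)) ` ?K"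
  proof
    fix z assume z: "z \<in> {z \<in> periods M. norm z \<le> R}"
    then obtain k :: "'d \<Rightarrow> int" where k: "\<And>i. z $ i = of_int (k i) * (hi M $ i - lo M $ i)"
      unfolding periods_def by blast
    have "k i \<in> {- ?N i .. ?N i}" for i
    proof -
      have L: "hi M $ i - lo M $ i > 0" using lo_less_hi[of i] by simp
      have "\<bar>z $ i\<bar> \<le> R" using z component_le_norm_cart[of z i] by auto
      then have "\<bar>real_of_int (k i)\<bar> * (hi M $ i - lo M $ i) \<le> R" using L by (simp add: k abs_mult)
      then have "\<bar>real_of_int (k i)\<bar> \<le> R / (hi M $ i - lo M $ i)" using L by (simp add: field_simps)
      then have "\<bar>real_of_int (k i)\<bar> \<le> real_of_int (?N i)" by linarith
      then show ?thesis by auto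
    qed
    then have "k \<in> ?K" by (simp add: PiE_UNIV_domain)
    moreover have "z = (\<chi> i. of_int (k i) * (hi M $ i - lo M $ i))" using k by (simp add: vec_eq_iff)
    ultimately show "z \<in> (\<lambda>k. \<chi> i. of_int (k i) * (hi M $ i - lo M $ i)) ` ?K" by blast
  qed
  then show ?thesis by (rule finite_subset) (auto intro!: finite_PiE)
qed

definition radius :: real where "radius = (SOME B. \<forall>x\<in>Omega M. norm x \<le> B)"

lemma radius: "x \<in> Omega M \<Longrightarrow> norm x \<le> radius"
proof -
  have "\<exists>B. \<forall>x\<in>Omega M. norm x \<le> B" using bounded_cbox unfolding Omega_def bounded_iff by blast
  from someI_ex[OF this] show "x \<in> Omega M \<Longrightarrow> norm x \<le> radius" unfolding radius_def by blast
qed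

text \<open>Only finitely many tiles come near \<open>p\<close>, and they are closed. If none but
  \<open>T\<close> contained \<open>p\<close>, deleting the others from a ball around
  \<open>p\<close> would leave a neighbourhood of \<open>p\<close> covered by \<open>T\<close>
  alone.\<close>

lemma frontier_cell_neighbour:
  assumes T: "T \<in> cells M" and p: "p \<in> frontier T"
  shows "\<exists>T'\<in>cells M. \<exists>z\<in>{z \<in> periods M. norm z \<le> 2 * radius + 1}. (T', z) \<noteq> (T, 0) \<and> p \<in> (+) z ` T'"
proof (rule ccontr)
  assume no: "\<not> ?thesis"
  \<comment> \<open>A point \<open>y = z + x\<close> of the tile at distance below 1 from
    \<open>p\<close> gives \<open>norm z \<le> norm y + norm x\<close>, which is at most
    \<open>(radius + 1) + radius\<close>.\<close>
  define Z where "Z = {z \<in> periods M. norm z \<le> 2 * radius + 1}"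
  define \<K> where "\<K> = {C \<in> cells M \<times> Z. C \<noteq> (T, 0)}"
  define K where "K = (\<Union>(T', z)\<in>\<K>. (+) z ` T')"
  have "finite \<K>" unfolding \<K>_def Z_def
    by (rule finite_subset[of _ "cells M \<times> {z \<in> periods M. norm z \<le> 2 * radius + 1}"])
       (auto intro!: finite_cartesian_product finite_cells finite_periods)
  then have "closed K" unfolding K_def
    by (intro closed_UN ballI) (auto simp: \<K>_def cell(3) intro!: closed_translation)
  moreover have "p \<notin> K" using no unfolding K_def \<K>_def Z_def by blast
  moreover have pT: "p \<in> T" using p cell(3)[OF T] frontier_subset_eq by blast
  moreover have "ball p 1 - K \<subseteq> T"
  proof
    fix y assume y: "y \<in> ball p 1 - K"
    obtain T' z where Tz: "T' \<in> cells M" "z \<in> periods M" "y \<in> (+) z ` T'" using tiles_cover by blast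
    then obtain x where x: "y = z + x" "x \<in> T'" by blast
    have "norm z \<le> norm y + norm x" using norm_triangle_ineq4[of y x] by (simp add: x)
    moreover have "norm y \<le> norm p + 1" using y norm_triangle_ineq2[of y p] by (simp add: dist_norm norm_minus_commute)
    moreover have "norm p \<le> radius" "norm x \<le> radius" using radius pT x cell(5) T Tz by blast+
    ultimately have "z \<in> Z" using Tz by (simp add: Z_def)
    then have "(T', z) = (T, 0)" using y Tz unfolding K_def \<K>_def by blast
    then show "y \<in> T" using x by simp
  qed
  ultimately have "p \<in> interior T"
    by (intro interiorI[of "ball p 1 - K"]) auto
  then show False using p by (simp add: frontier_def)
qed

section \<open>Faces and the two tiles adjoining them\<close>

lemma face_interface:
  assumes "e \<in> faces M"
  obtains T T' z where "T \<in> cells M" "T' \<in> cells M" "z \<in> periods M" "e = T \<inter> (+) z ` T'"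
    "(T, 0) \<noteq> (T', z)" "aff_dim e = int CARD('d) - 1"
proof -
  have "interface M e" using mesh_facts(7) assms by (rule bspec)
  then obtain T T' z where *: "T \<in> cells M" "T' \<in> cells M" "z \<in> periods M" "e = T \<inter> (+) z ` T'"
    "aff_dim e = int CARD('d) - 1" unfolding interface_def by (elim bexE conjE)
  have "(T, 0) \<noteq> (T', z)"
  proof
    assume "(T, 0) = (T', z)"
    then have "e = T" using * by auto
    then have "aff_dim e = int CARD('d)" using aff_dim_nonempty_interior[OF cell(4)[OF *(1)]] by simp
    then show False using * by simp
  qed
  then show ?thesis using that[OF *(1-4) _ *(5)] by simp
qed

lemma face:
  assumes e: "e \<in> faces M"
  shows "compact e" "convex e" "e \<noteq> {}" "norm (nrm M e) = 1" "e \<subseteq> {x. nrm M e \<bullet> x = face_level M e}"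
    "affine hull e = {x. nrm M e \<bullet> x = face_level M e}" "aff_dim e = int CARD('d) - 1"
proof -
  obtain T T' z where *: "T \<in> cells M" "T' \<in> cells M" "z \<in> periods M" "e = T \<inter> (+) z ` T'"
    "(T, 0) \<noteq> (T', z)" "aff_dim e = int CARD('d) - 1"
    by (rule face_interface[OF e]) (rule that)
  show "aff_dim e = int CARD('d) - 1" by fact
  show "compact e" unfolding *(4)
    using cell(2)[OF *(1)] compact_translation[OF cell(2)[OF *(2)]] by (rule compact_Int)
  show "convex e" unfolding *(4)
    using cell(1)[OF *(1)] convex_translation[OF cell(1)[OF *(2)]] by (rule convex_Int)
  show ne: "e \<noteq> {}" using *(6) by auto
  show n: "norm (nrm M e) = 1" using mesh_facts(9)[rule_format, OF e] by simp
  have y: "(SOME y. y \<in> e) \<in> e" using ne by (simp add: some_in_eq)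
  have plane: "\<forall>x\<in>e. \<forall>y\<in>e. nrm M e \<bullet> (x - y) = 0" using mesh_facts(9)[rule_format, OF e] by simp
  show sub: "e \<subseteq> {x. nrm M e \<bullet> x = face_level M e}"
  proof
    fix x assume "x \<in> e"
    then have "nrm M e \<bullet> (x - (SOME y. y \<in> e)) = 0" using plane y by blast
    then show "x \<in> {x. nrm M e \<bullet> x = face_level M e}" by (simp add: face_level_def inner_diff_right)
  qed
  have n0: "nrm M e \<noteq> 0" using n by auto
  show "affine hull e = {x. nrm M e \<bullet> x = face_level M e}"
  proof (rule affine_dim_equal)
    show "affine hull e \<subseteq> {x. nrm M e \<bullet> x = face_level M e}"
      by (rule hull_minimal[of _ _ affine, OF sub]) (rule affine_hyperplane)
  qed (use ne n0 *(6) in \<open>auto simp: affine_hyperplane\<close>)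
qed

lemma face_integral_flat: "face_integral M e g = flat_int (nrm M e) (face_level M e) e g"
  unfolding face_integral_def flat_int_def face_level_def Let_def by (simp add: inner_simps inner_commute)

lemma sides:
  assumes e: "e \<in> faces M"
  obtains C C' where "side M e 1 C" "side M e (-1) C'" "e = (+) (snd C) ` fst C \<inter> (+) (snd C') ` fst C'"
proof -
  obtain T T' z where *: "T \<in> cells M" "T' \<in> cells M" "z \<in> periods M" "e = T \<inter> (+) z ` T'"
    "(T, 0) \<noteq> (T', z)" "aff_dim e = int CARD('d) - 1"
    by (rule face_interface[OF e]) (rule that)
  have T0: "(+) 0 ` T = T" by simp
  have "\<exists>\<sigma>\<in>{1, -1}. T \<subseteq> {x. \<sigma> * (nrm M e \<bullet> x) \<le> \<sigma> * face_level M e}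
      \<and> (+) z ` T' \<subseteq> {x. - \<sigma> * (nrm M e \<bullet> x) \<le> - \<sigma> * face_level M e}"
  proof (rule separate_along_facet)
    show "interior T \<inter> interior ((+) z ` T') = {}"
      using cells_disjoint[OF *(1,2) periods_zero *(3,5)] unfolding T0 .
    show "interior ((+) z ` T') \<noteq> {}" using cell(4)[OF *(2)] by (simp add: interior_translation)
    show "e \<subseteq> T \<inter> (+) z ` T'" using *(4) by simp
    show "convex ((+) z ` T')" using cell(1)[OF *(2)] by (rule convex_translation)
  qed (fact cell(1)[OF *(1)] cell(4)[OF *(1)] face(6)[OF e] face(4)[OF e] face(3)[OF e])+
  then obtain \<sigma> where \<sigma>: "\<sigma> \<in> {1, -1}" "T \<subseteq> {x. \<sigma> * (nrm M e \<bullet> x) \<le> \<sigma> * face_level M e}"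
     "(+) z ` T' \<subseteq> {x. - \<sigma> * (nrm M e \<bullet> x) \<le> - \<sigma> * face_level M e}" by blast
  have s: "side M e \<sigma> (T, 0)" "side M e (- \<sigma>) (T', z)"
    using * \<sigma> periods_zero unfolding side_def by auto
  show ?thesis
  proof (cases "\<sigma> = 1")
    case True
    then show ?thesis using that[of "(T, 0)" "(T', z)"] s *(4) by simp
  next
    case False
    then have "\<sigma> = -1" using \<sigma> by simp
    then show ?thesis using that[of "(T', z)" "(T, 0)"] s *(4) by (simp add: Int_commute)
  qed
qed

lemma side_near:
  assumes e: "e \<in> faces M" and \<sigma>: "\<sigma> \<in> {1, -1}" and C: "side M e \<sigma> C" and p: "p \<in> rel_interior e"
    and w: "\<sigma> * (nrm M e \<bullet> w) < 0"
  shows "\<forall>\<^sub>F \<epsilon> in at_right 0. p + \<epsilon> *\<^sub>R w \<in> interior ((+) (snd C) ` fst C)"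
proof (rule eventually_interior_near_facet)
  have T: "fst C \<in> cells M" using C by (simp add: side_def)
  show "convex ((+) (snd C) ` fst C)" using cell(1)[OF T] by (rule convex_translation)
  show "interior ((+) (snd C) ` fst C) \<noteq> {}" using cell(4)[OF T] by (simp add: interior_translation)
  show "(+) (snd C) ` fst C \<subseteq> {x. (\<sigma> *\<^sub>R nrm M e) \<bullet> x \<le> \<sigma> * face_level M e}"
    using C by (simp add: side_def)
  show "norm (\<sigma> *\<^sub>R nrm M e) = 1" using face(4)[OF e] \<sigma> by auto
  show "e \<subseteq> (+) (snd C) ` fst C" using C by (simp add: side_def)
  show "affine hull e = {x. (\<sigma> *\<^sub>R nrm M e) \<bullet> x = \<sigma> * face_level M e}" using face(6)[OF e] \<sigma> by (cases "\<sigma> = 1") simp_all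
qed (use p w in auto)

lemma face_rel_interior: "e \<in> faces M \<Longrightarrow> rel_interior e \<noteq> {}"
  using face(2,3) rel_interior_eq_empty by blast

lemma interiors_meet_imp_eq:
  assumes "fst C \<in> cells M" "snd C \<in> periods M" "fst D \<in> cells M" "snd D \<in> periods M"
    and "\<forall>\<^sub>F \<epsilon> in at_right (0::real). p + \<epsilon> *\<^sub>R w \<in> interior ((+) (snd C) ` fst C)"
      "\<forall>\<^sub>F \<epsilon> in at_right (0::real). p + \<epsilon> *\<^sub>R w \<in> interior ((+) (snd D) ` fst D)"
  shows "C = D"
proof (rule ccontr)
  assume "C \<noteq> D"
  have "\<exists>\<epsilon>::real. p + \<epsilon> *\<^sub>R w \<in> interior ((+) (snd C) ` fst C) \<and> p + \<epsilon> *\<^sub>R w \<in> interior ((+) (snd D) ` fst D)"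
    using eventually_happens'[OF _ eventually_conj[OF assms(5,6)]] by simp
  then show False
    using cells_disjoint[OF assms(1,3,2,4)] \<open>C \<noteq> D\<close> by (metis IntI empty_iff prod.collapse)
qed

text \<open>Just beside a relative interior point of the face, both tiles contain the same points in
  their interiors. Since a face is the full intersection of two tiles, each side belongs to a single
  tile even on a nonconforming mesh, and \<open>nbr\<close> below is well determined.\<close>

lemma side_unique:
  assumes e: "e \<in> faces M" and \<sigma>: "\<sigma> \<in> {1, -1}" and C: "side M e \<sigma> C" "side M e \<sigma> D"
  shows "C = D"
proof -
  obtain p where p: "p \<in> rel_interior e" using face_rel_interior[OF e] by auto
  have nn: "nrm M e \<bullet> nrm M e = 1" using face(4)[OF e] by (simp add: dot_square_norm)
  have w: "\<sigma> * (nrm M e \<bullet> ((- \<sigma>) *\<^sub>R nrm M e)) < 0" using nn \<sigma> by auto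
  show ?thesis
    using side_near[OF e \<sigma> C(1) p w] side_near[OF e \<sigma> C(2) p w] C
    by (intro interiors_meet_imp_eq[where p = p and w = "(- \<sigma>) *\<^sub>R nrm M e"]) (simp_all add: side_def)
qed

definition nbr :: "(real ^ 'd) set \<Rightarrow> real \<Rightarrow> (real ^ 'd) set \<times> (real ^ 'd)"
  where "nbr e \<sigma> = (SOME C. side M e \<sigma> C)"

lemma nbr:
  assumes e: "e \<in> faces M" and \<sigma>: "\<sigma> \<in> {1, -1}"
  shows "side M e \<sigma> (nbr e \<sigma>)"
proof -
  obtain C C' where "side M e 1 C" "side M e (-1) C'" by (rule sides[OF e]) (rule that)
  then have "\<exists>C. side M e \<sigma> C" using \<sigma> by (cases "\<sigma> = 1") (auto simp del: split_paired_Ex)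
  then show ?thesis unfolding nbr_def by (rule someI_ex)
qed

lemma nbr_eq: "e \<in> faces M \<Longrightarrow> \<sigma> \<in> {1, -1} \<Longrightarrow> side M e \<sigma> C \<Longrightarrow> nbr e \<sigma> = C"
  using side_unique nbr by blast

text \<open>A face can be recovered from its two neighbours; this is how facets of one cell with the
  same neighbour tile will be identified.\<close>

lemma face_eq_Int_nbr:
  assumes e: "e \<in> faces M" and \<sigma>: "\<sigma> \<in> {1, -1}"
  shows "e = (+) (snd (nbr e \<sigma>)) ` fst (nbr e \<sigma>) \<inter> (+) (snd (nbr e (- \<sigma>))) ` fst (nbr e (- \<sigma>))"
proof -
  obtain C C' where C: "side M e 1 C" "side M e (-1) C'" "e = (+) (snd C) ` fst C \<inter> (+) (snd C') ` fst C'"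
    by (rule sides[OF e]) (rule that)
  then have "nbr e 1 = C" "nbr e (-1) = C'" using nbr_eq[OF e] by auto
  note nb = this
  show ?thesis
  proof (cases "\<sigma> = 1")
    case True
    show ?thesis unfolding True nb by (rule C(3))
  next
    case False
    then have s: "\<sigma> = -1" "- \<sigma> = 1" using \<sigma> by simp_all
    show ?thesis unfolding s(2) unfolding s(1) nb by (subst Int_commute) (rule C(3))
  qed
qed

end

section \<open>Piecewise smooth functions and integration by parts\<close>

definition pw_C1 :: "('d::finite) mesh \<Rightarrow> (real ^ 'd \<Rightarrow> real) \<Rightarrow> bool"
  where "pw_C1 M F \<longleftrightarrow> (\<forall>T\<in>cells M. \<exists>G. C1 G \<and> (\<forall>y\<in>interior T. F y = G y))"

text \<open>Any smooth extension from the open cell will do: by continuity all of them agree on the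
  closed cell, which is where traces are read off.\<close>

definition piece :: "(real ^ 'd \<Rightarrow> real) \<Rightarrow> (real ^ 'd::finite) set \<Rightarrow> real ^ 'd \<Rightarrow> real"
  where "piece F T = (SOME G. C1 G \<and> (\<forall>y\<in>interior T. F y = G y))"

lemma piece:
  assumes "pw_C1 M F" "T \<in> cells M"
  shows "C1 (piece F T)" "y \<in> interior T \<Longrightarrow> F y = piece F T y"
proof -
  have "\<exists>G. C1 G \<and> (\<forall>y\<in>interior T. F y = G y)" using assms unfolding pw_C1_def by (rule bspec)
  from someI_ex[OF this] have "C1 (piece F T) \<and> (\<forall>y\<in>interior T. F y = piece F T y)"
    unfolding piece_def .
  then show "C1 (piece F T)" "y \<in> interior T \<Longrightarrow> F y = piece F T y" by simp_all
qed

lemma pw_C1_C1: "C1 F \<Longrightarrow> pw_C1 M F"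
  unfolding pw_C1_def by blast

lemma pw_C1_mult:
  assumes "pw_C1 M F" "pw_C1 M G"
  shows "pw_C1 M (\<lambda>x. F x * G x)"
  unfolding pw_C1_def
proof
  fix T assume T: "T \<in> cells M"
  show "\<exists>H. C1 H \<and> (\<forall>y\<in>interior T. F y * G y = H y)"
    by (rule exI[of _ "\<lambda>y. piece F T y * piece G T y"])
      (simp add: C1_mult piece(1)[OF assms(1) T] piece(1)[OF assms(2) T] piece(2)[OF assms(1) T] piece(2)[OF assms(2) T])
qed

lemma pw_C1_add:
  assumes "pw_C1 M F" "pw_C1 M G"
  shows "pw_C1 M (\<lambda>x. F x + G x)"
  unfolding pw_C1_def
proof
  fix T assume T: "T \<in> cells M"
  show "\<exists>H. C1 H \<and> (\<forall>y\<in>interior T. F y + G y = H y)"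
    by (rule exI[of _ "\<lambda>y. piece F T y + piece G T y"])
      (simp add: C1_add piece(1)[OF assms(1) T] piece(1)[OF assms(2) T] piece(2)[OF assms(1) T] piece(2)[OF assms(2) T])
qed

lemma pw_C1_const: "pw_C1 M (\<lambda>x. c)"
  by (rule pw_C1_C1[OF C1_const])

lemma pw_C1_cmult: "pw_C1 M F \<Longrightarrow> pw_C1 M (\<lambda>x. c * F x)"
  by (rule pw_C1_mult[OF pw_C1_const])

lemma pw_C1_sum: "(\<And>i. i \<in> A \<Longrightarrow> pw_C1 M (F i)) \<Longrightarrow> pw_C1 M (\<lambda>x. \<Sum>i\<in>A. F i x)"
  by (induction A rule: infinite_finite_induct) (simp_all add: pw_C1_const pw_C1_add)

lemma pw_C1_dg_space: "U \<in> dg_space M k \<Longrightarrow> pw_C1 M U"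
proof -
  assume U: "U \<in> dg_space M k"
  show ?thesis unfolding pw_C1_def
  proof
    fix T assume "T \<in> cells M"
    then obtain P where "poly_deg_le k P" "\<forall>y\<in>interior T. U y = P y"
      using U unfolding dg_space_def by blast
    then show "\<exists>G. C1 G \<and> (\<forall>y\<in>interior T. U y = G y)" using C1_poly_deg_le by blast
  qed
qed

lemma pw_C1_canon: "C1 g \<Longrightarrow> pw_C1 M (canon M g)"
  unfolding pw_C1_def canon_def by (auto intro!: exI[of _ g])

section \<open>One-sided traces and integrals over faces\<close>

context dg_mesh
begin

definition trace :: "(real ^ 'd) set \<Rightarrow> real \<Rightarrow> (real ^ 'd \<Rightarrow> real) \<Rightarrow> real ^ 'd \<Rightarrow> real"
  where "trace e \<sigma> F x = piece F (fst (nbr e \<sigma>)) (x - snd (nbr e \<sigma>))"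

lemma nbr_cell:
  assumes "e \<in> faces M" "\<sigma> \<in> {1, -1}"
  shows "fst (nbr e \<sigma>) \<in> cells M" "snd (nbr e \<sigma>) \<in> periods M"
  using nbr[OF assms] by (simp_all add: side_def)

lemma continuous_on_trace:
  assumes "pw_C1 M F" "e \<in> faces M" "\<sigma> \<in> {1, -1}"
  shows "continuous_on UNIV (trace e \<sigma> F)"
  unfolding trace_def
  by (intro continuous_on_compose2[OF C1_continuous[OF piece(1)[OF assms(1) nbr_cell(1)[OF assms(2,3)]]]] continuous_intros)
    auto

text \<open>Close to the face the point lies in the interior of the neighbouring tile, where
  \<open>wrap\<close> subtracts exactly the period of that tile. The direction is
  \<open>- \<sigma>\<close> times the normal because \<open>\<sigma> = 1\<close> denotes the side
  that the normal points away from.\<close>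

lemma tendsto_trace:
  assumes F: "pw_C1 M F" and e: "e \<in> faces M" "\<sigma> \<in> {1, -1}" and p: "p \<in> rel_interior e"
  shows "((\<lambda>\<epsilon>. F (wrap M (p + \<epsilon> *\<^sub>R ((- \<sigma>) *\<^sub>R nrm M e)))) \<longlongrightarrow> trace e \<sigma> F p) (at_right 0)"
proof -
  let ?T = "fst (nbr e \<sigma>)" and ?z = "snd (nbr e \<sigma>)" and ?w = "(- \<sigma>) *\<^sub>R nrm M e"
  note T = nbr_cell[OF e]
  have nn: "nrm M e \<bullet> nrm M e = 1" using face(4)[OF e(1)] by (simp add: dot_square_norm)
  have w: "\<sigma> * (nrm M e \<bullet> ?w) < 0" using nn e(2) by auto
  have "\<forall>\<^sub>F \<epsilon> in at_right 0. p + \<epsilon> *\<^sub>R ?w \<in> interior ((+) ?z ` ?T)"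
    by (rule side_near[OF e nbr[OF e] p w])
  then have ev: "\<forall>\<^sub>F \<epsilon> in at_right 0. piece F ?T (p + \<epsilon> *\<^sub>R ?w - ?z) = F (wrap M (p + \<epsilon> *\<^sub>R ?w))"
  proof eventually_elim
    case (elim \<epsilon>)
    then have i: "p + \<epsilon> *\<^sub>R ?w - ?z \<in> interior ?T" by (auto simp: interior_translation)
    then have "wrap M (p + \<epsilon> *\<^sub>R ?w) = p + \<epsilon> *\<^sub>R ?w - ?z"
      using interior_cell_box[OF T(1)] by (intro wrap_eq[OF _ T(2)]) blast
    then show ?case using piece(2)[OF F T(1) i] by (simp only:)
  qed
  have "isCont (piece F ?T) (p - ?z)"
    using C1_continuous[OF piece(1)[OF F T(1)]] by (simp add: continuous_on_eq_continuous_at)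
  moreover have "((\<lambda>\<epsilon>. p + \<epsilon> *\<^sub>R ?w - ?z) \<longlongrightarrow> p - ?z) (at_right 0)"
    by (auto intro!: tendsto_eq_intros)
  ultimately have "((\<lambda>\<epsilon>. piece F ?T (p + \<epsilon> *\<^sub>R ?w - ?z)) \<longlongrightarrow> trace e \<sigma> F p) (at_right 0)"
    unfolding trace_def by (rule isCont_tendsto_compose)
  then show ?thesis by (rule Lim_transform_eventually[OF _ ev])
qed

lemma trm_tendsto:
  assumes F: "pw_C1 M F" and e: "e \<in> faces M" and p: "p \<in> rel_interior e"
  shows "((\<lambda>\<epsilon>. F (wrap M (p - \<epsilon> *\<^sub>R nrm M e))) \<longlongrightarrow> trace e 1 F p) (at_right 0)"
    and "trm M e F p = trace e 1 F p"
proof -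
  show 1: "((\<lambda>\<epsilon>. F (wrap M (p - \<epsilon> *\<^sub>R nrm M e))) \<longlongrightarrow> trace e 1 F p) (at_right 0)"
    using tendsto_trace[OF F e _ p, of 1] by simp
  show "trm M e F p = trace e 1 F p"
    unfolding trm_def by (rule tendsto_Lim[OF _ 1]) simp
qed

lemma trp_tendsto:
  assumes F: "pw_C1 M F" and e: "e \<in> faces M" and p: "p \<in> rel_interior e"
  shows "((\<lambda>\<epsilon>. F (wrap M (p + \<epsilon> *\<^sub>R nrm M e))) \<longlongrightarrow> trace e (-1) F p) (at_right 0)"
    and "trp M e F p = trace e (-1) F p"
proof -
  show 1: "((\<lambda>\<epsilon>. F (wrap M (p + \<epsilon> *\<^sub>R nrm M e))) \<longlongrightarrow> trace e (-1) F p) (at_right 0)"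
    using tendsto_trace[OF F e _ p, of "-1"] by simp
  show "trp M e F p = trace e (-1) F p"
    unfolding trp_def by (rule tendsto_Lim[OF _ 1]) simp
qed

lemma
  assumes e: "e \<in> faces M" and p: "p \<in> rel_interior e" and F: "pw_C1 M F" and G: "pw_C1 M G"
  shows trm_add: "trm M e (\<lambda>x. F x + G x) p = trm M e F p + trm M e G p"
    and trp_add: "trp M e (\<lambda>x. F x + G x) p = trp M e F p + trp M e G p"
    and trm_mult: "trm M e (\<lambda>x. F x * G x) p = trm M e F p * trm M e G p"
    and trp_mult: "trp M e (\<lambda>x. F x * G x) p = trp M e F p * trp M e G p"
  unfolding trm_tendsto(2)[OF F e p] trm_tendsto(2)[OF G e p] trp_tendsto(2)[OF F e p] trp_tendsto(2)[OF G e p]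
  unfolding trm_def trp_def
  by (intro tendsto_Lim tendsto_add tendsto_mult trm_tendsto(1)[OF F e p] trm_tendsto(1)[OF G e p]
      trp_tendsto(1)[OF F e p] trp_tendsto(1)[OF G e p], simp)+

lemma trm_const: "trm M e (\<lambda>x. c) p = c"
  unfolding trm_def by (rule tendsto_Lim) simp_all

lemma trp_const: "trp M e (\<lambda>x. c) p = c"
  unfolding trp_def by (rule tendsto_Lim) simp_all

lemma
  assumes e: "e \<in> faces M" and p: "p \<in> rel_interior e" and F: "\<And>i. i \<in> A \<Longrightarrow> pw_C1 M (F i)"
  shows avg_sum: "avg M e (\<lambda>x. \<Sum>i\<in>A. F i x) p = (\<Sum>i\<in>A. avg M e (F i) p)"
    and jump_sum: "jump M e (\<lambda>x. \<Sum>i\<in>A. F i x) p = (\<Sum>i\<in>A. jump M e (F i) p)"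
proof -
  have "trm M e (\<lambda>x. \<Sum>i\<in>A. F i x) p = (\<Sum>i\<in>A. trm M e (F i) p)
      \<and> trp M e (\<lambda>x. \<Sum>i\<in>A. F i x) p = (\<Sum>i\<in>A. trp M e (F i) p)"
    using F
  proof (induction A rule: infinite_finite_induct)
    case (insert a A)
    then show ?case
      using trm_add[OF e p, of "F a" "\<lambda>x. \<Sum>i\<in>A. F i x"] trp_add[OF e p, of "F a" "\<lambda>x. \<Sum>i\<in>A. F i x"]
      by (simp add: pw_C1_sum)
  qed (simp_all add: trm_const trp_const)
  then show "avg M e (\<lambda>x. \<Sum>i\<in>A. F i x) p = (\<Sum>i\<in>A. avg M e (F i) p)"
      "jump M e (\<lambda>x. \<Sum>i\<in>A. F i x) p = (\<Sum>i\<in>A. jump M e (F i) p)"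
    unfolding avg_def jump_def
    by (simp_all add: sum.distrib sum_subtractf sum_divide_distrib[symmetric])
qed

lemma
  assumes e: "e \<in> faces M" and p: "p \<in> rel_interior e" and F: "pw_C1 M F"
  shows avg_cmult: "avg M e (\<lambda>x. c * F x) p = c * avg M e F p"
    and jump_cmult: "jump M e (\<lambda>x. c * F x) p = c * jump M e F p"
  using trm_mult[OF e p pw_C1_const F, of c] trp_mult[OF e p pw_C1_const F, of c]
  by (simp_all add: avg_def jump_def trm_const trp_const algebra_simps)

text \<open>The product rule has no remainder precisely because the other factor enters by its mean
  value, the same mean that occurs in the discrete derivative and in the central flux.\<close>

lemma jump_mult:
  assumes e: "e \<in> faces M" and p: "p \<in> rel_interior e" and F: "pw_C1 M F" and G: "pw_C1 M G"
  shows "jump M e (\<lambda>x. F x * G x) p = jump M e F p * avg M e G p + avg M e F p * jump M e G p"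
  using trm_mult[OF e p F G] trp_mult[OF e p F G] by (simp add: jump_def avg_def field_simps)

text \<open>The integrands met on faces are uncontrolled on the rim, where limits may fail to exist.
  Agreement with a continuous function in the relative interior suffices for linearity of the face
  integral.\<close>

definition face_cont :: "(real ^ 'd) set \<Rightarrow> (real ^ 'd \<Rightarrow> real) \<Rightarrow> bool"
  where "face_cont e g \<longleftrightarrow> (\<exists>h. continuous_on UNIV h \<and> (\<forall>p\<in>rel_interior e. g p = h p))"

lemma face_cont_continuous: "continuous_on UNIV g \<Longrightarrow> face_cont e g"
  unfolding face_cont_def by blast

lemma face_cont_const: "face_cont e (\<lambda>x. c)"
  by (rule face_cont_continuous) simp

lemma face_cont_add: "face_cont e f \<Longrightarrow> face_cont e g \<Longrightarrow> face_cont e (\<lambda>x. f x + g x)"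
  unfolding face_cont_def
proof (elim exE conjE)
  fix h k assume "continuous_on UNIV h" "\<forall>p\<in>rel_interior e. f p = h p" "continuous_on UNIV k" "\<forall>p\<in>rel_interior e. g p = k p"
  then show "\<exists>h. continuous_on UNIV h \<and> (\<forall>p\<in>rel_interior e. f p + g p = h p)"
    by (intro exI[of _ "\<lambda>x. h x + k x"]) (simp add: continuous_on_add)
qed

lemma face_cont_mult: "face_cont e f \<Longrightarrow> face_cont e g \<Longrightarrow> face_cont e (\<lambda>x. f x * g x)"
  unfolding face_cont_def
proof (elim exE conjE)
  fix h k assume "continuous_on UNIV h" "\<forall>p\<in>rel_interior e. f p = h p" "continuous_on UNIV k" "\<forall>p\<in>rel_interior e. g p = k p"
  then show "\<exists>h. continuous_on UNIV h \<and> (\<forall>p\<in>rel_interior e. f p * g p = h p)"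
    by (intro exI[of _ "\<lambda>x. h x * k x"]) (simp add: continuous_on_mult)
qed

lemma face_cont_sum: "(\<And>i. i \<in> A \<Longrightarrow> face_cont e (f i)) \<Longrightarrow> face_cont e (\<lambda>x. \<Sum>i\<in>A. f i x)"
  by (induction A rule: infinite_finite_induct) (simp_all add: face_cont_const face_cont_add)

lemma
  assumes "e \<in> faces M" "pw_C1 M F"
  shows face_cont_avg: "face_cont e (avg M e F)" and face_cont_jump: "face_cont e (jump M e F)"
proof -
  have c: "continuous_on UNIV (trace e 1 F)" "continuous_on UNIV (trace e (-1) F)"
    using continuous_on_trace[OF assms(2,1)] by simp_all
  show "face_cont e (avg M e F)" unfolding face_cont_def avg_def
    by (rule exI[of _ "\<lambda>p. (trace e (-1) F p + trace e 1 F p) / 2"])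
      (simp add: c continuous_intros trm_tendsto(2)[OF assms(2,1)] trp_tendsto(2)[OF assms(2,1)])
  show "face_cont e (jump M e F)" unfolding face_cont_def jump_def
    by (rule exI[of _ "\<lambda>p. trace e 1 F p - trace e (-1) F p"])
      (simp add: c continuous_intros trm_tendsto(2)[OF assms(2,1)] trp_tendsto(2)[OF assms(2,1)])
qed

lemma face_integral_eq_flat:
  assumes e: "e \<in> faces M" and h: "continuous_on UNIV h" and eq: "\<And>p. p \<in> rel_interior e \<Longrightarrow> g p = h p"
  shows "face_integral M e g = flat_int (nrm M e) (face_level M e) e h"
  unfolding face_integral_flat
  by (rule flat_int_spike[OF face(4)[OF e] face(1)[OF e] face(2)[OF e] face(5)[OF e] h eq])

lemma face_integral_cong:
  assumes e: "e \<in> faces M" and h: "face_cont e h" and eq: "\<And>p. p \<in> rel_interior e \<Longrightarrow> g p = h p"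
  shows "face_integral M e g = face_integral M e h"
proof -
  obtain k where k: "continuous_on UNIV k" "\<forall>p\<in>rel_interior e. h p = k p" using h unfolding face_cont_def by blast
  show ?thesis
    using face_integral_eq_flat[OF e k(1), of g] face_integral_eq_flat[OF e k(1), of h] k(2) eq by simp
qed

lemma face_integral_add:
  assumes e: "e \<in> faces M" and "face_cont e f" "face_cont e g"
  shows "face_integral M e (\<lambda>x. f x + g x) = face_integral M e f + face_integral M e g"
proof -
  obtain h where h: "continuous_on UNIV h" "\<forall>p\<in>rel_interior e. f p = h p" using assms(2) unfolding face_cont_def by blast
  obtain k where k: "continuous_on UNIV k" "\<forall>p\<in>rel_interior e. g p = k p" using assms(3) unfolding face_cont_def by blast
  have "continuous_on UNIV (\<lambda>x. h x + k x)" by (intro continuous_intros h k)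
  from face_integral_eq_flat[OF e this, of "\<lambda>x. f x + g x"] h k
  have "face_integral M e (\<lambda>x. f x + g x) = flat_int (nrm M e) (face_level M e) e (\<lambda>x. h x + k x)" by simp
  also have "\<dots> = flat_int (nrm M e) (face_level M e) e h + flat_int (nrm M e) (face_level M e) e k"
    by (rule flat_int_add[OF face(1)[OF e] h(1) k(1)])
  finally show ?thesis
    using face_integral_eq_flat[OF e h(1), of f] face_integral_eq_flat[OF e k(1), of g] h k by simp
qed

lemma face_integral_cmult: "face_integral M e (\<lambda>x. c * f x) = c * face_integral M e f"
  unfolding face_integral_flat by (rule flat_int_cmult)

lemma face_integral_zero: "face_integral M e (\<lambda>x. 0) = 0"
  using face_integral_cmult[of e 0 "\<lambda>x. 0"] by simp

lemma face_integral_sum: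
  assumes e: "e \<in> faces M" and "\<And>i. i \<in> A \<Longrightarrow> face_cont e (f i)"
  shows "face_integral M e (\<lambda>x. \<Sum>i\<in>A. f i x) = (\<Sum>i\<in>A. face_integral M e (f i))"
  using assms(2)
proof (induction A rule: infinite_finite_induct)
  case (insert a A)
  then show ?case using face_integral_add[OF e, of "f a" "\<lambda>x. \<Sum>i\<in>A. f i x"] by (simp add: face_cont_sum)
qed (simp_all add: face_integral_zero)

text \<open>From a common relative interior point, a step in the direction bisecting the two outer
  normals leaves the cell through both facets at once and enters both neighbours, which are
  therefore one tile. Then both facets are the intersection of \<open>T\<close> with that tile, the
  faces are translates of each other, and so they are the same stored face, seen from opposite
  sides; but opposite normals are impossible for a cell with interior.\<close>

lemma cell_facets_disjoint:
  assumes T: "T \<in> cells M"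
    and i: "e \<in> faces M" "\<sigma> \<in> {1, -1}" "nbr e \<sigma> = (T, z)"
    and j: "e' \<in> faces M" "\<sigma>' \<in> {1, -1}" "nbr e' \<sigma>' = (T, z')"
    and ne: "(e, \<sigma>) \<noteq> (e', \<sigma>')"
  shows "rel_interior ((+) (- z) ` e) \<inter> rel_interior ((+) (- z') ` e') = {}"
proof (rule ccontr)
  assume "\<not> ?thesis"
  then obtain p where p: "p \<in> (+) (- z) ` rel_interior e" "p \<in> (+) (- z') ` rel_interior e'"
    unfolding rel_interior_translation by blast
  have "p + y \<in> S" if "p \<in> (+) (- y) ` S" for y S using that by auto
  note p = this[OF p(1)] this[OF p(2)]
  let ?n = "\<sigma> *\<^sub>R nrm M e" and ?n' = "\<sigma>' *\<^sub>R nrm M e'"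
  have s: "side M e \<sigma> (T, z)" "side M e' \<sigma>' (T, z')" using nbr[OF i(1,2)] nbr[OF j(1,2)] i(3) j(3) by simp_all
  have nn: "?n \<bullet> ?n = 1" "?n' \<bullet> ?n' = 1"
    using face(4)[OF i(1)] face(4)[OF j(1)] i(2) j(2) by (auto simp: dot_square_norm)
  have nneq: "?n + ?n' \<noteq> 0"
  proof
    assume "?n + ?n' = 0"
    then have n': "?n' = - ?n" by (metis add_eq_0_iff)
    \<comment> \<open>With opposite outer normals at a common point, both half-space conditions
      confine the cell to a single hyperplane.\<close>
    have "T \<subseteq> {x. ?n \<bullet> x = ?n \<bullet> p}"
    proof
      fix x assume x: "x \<in> T"
      have pe: "nrm M e \<bullet> (p + z) = face_level M e" "nrm M e' \<bullet> (p + z') = face_level M e'"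
        using p rel_interior_subset[of e] rel_interior_subset[of e'] face(5)[OF i(1)] face(5)[OF j(1)] by blast+
      have "z + x \<in> (+) z ` T" "z' + x \<in> (+) z' ` T" using x by auto
      then have "\<sigma> * (nrm M e \<bullet> (z + x)) \<le> \<sigma> * face_level M e" "\<sigma>' * (nrm M e' \<bullet> (z' + x)) \<le> \<sigma>' * face_level M e'"
        using s unfolding side_def fst_conv snd_conv by blast+
      then have "\<sigma> * (nrm M e \<bullet> (z + x)) \<le> \<sigma> * (nrm M e \<bullet> (p + z))" "\<sigma>' * (nrm M e' \<bullet> (z' + x)) \<le> \<sigma>' * (nrm M e' \<bullet> (p + z'))"
        unfolding pe .
      then have "?n \<bullet> x \<le> ?n \<bullet> p" "?n' \<bullet> x \<le> ?n' \<bullet> p"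
        by (simp_all add: inner_add_right distrib_left)
      then have "?n \<bullet> x \<le> ?n \<bullet> p" "- (?n \<bullet> x) \<le> - (?n \<bullet> p)" unfolding n' inner_minus_left .
      then have "?n \<bullet> x = ?n \<bullet> p" by linarith
      then show "x \<in> {x. ?n \<bullet> x = ?n \<bullet> p}" by (rule CollectI)
    qed
    moreover have "?n \<noteq> 0" using nn by auto
    ultimately have "interior T = {}" using interior_mono interior_hyperplane by (metis subset_empty)
    then show False using cell(4)[OF T] by simp
  qed
  \<comment> \<open>For unit normals, the inner product of \<open>w\<close> with either of them is
    half of \<open>w \<bullet> w\<close>, hence positive.\<close>
  define w where "w = ?n + ?n'"
  have "0 < w \<bullet> w" using nneq by (simp add: w_def)
  moreover have "w \<bullet> w = 2 + 2 * (?n \<bullet> ?n')"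
  proof -
    have "(a + b) \<bullet> (a + b) = a \<bullet> a + 2 * (a \<bullet> b) + b \<bullet> b" for a b :: "real ^ 'd"
      by (simp add: inner_add_left inner_add_right inner_commute)
    from this[of ?n ?n'] show ?thesis unfolding w_def nn by simp
  qed
  moreover have "?n \<bullet> w = 1 + ?n \<bullet> ?n'" "?n' \<bullet> w = 1 + ?n \<bullet> ?n'"
    unfolding w_def inner_add_right nn by (simp_all only: inner_commute add.commute)
  ultimately have w: "?n \<bullet> w > 0" "?n' \<bullet> w > 0" by linarith+
  \<comment> \<open>The stored copy of the face sits at a period \<open>y\<close> from the facet of
    \<open>T\<close>, so its outer neighbour is shifted back by \<open>y\<close>.\<close>
  have near: "\<forall>\<^sub>F \<epsilon> in at_right 0. p + \<epsilon> *\<^sub>R w \<in> interior ((+) (snd (nbr f (- \<theta>)) - y) ` fst (nbr f (- \<theta>)))"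
    if f: "f \<in> faces M" "\<theta> \<in> {1, -1}" "p + y \<in> rel_interior f" "(\<theta> *\<^sub>R nrm M f) \<bullet> w > 0" for f \<theta> y
  proof -
    have m: "- \<theta> \<in> {1, -1}" using f(2) by auto
    have "- \<theta> * (nrm M f \<bullet> w) < 0" using f(4) by simp
    from side_near[OF f(1) m nbr[OF f(1) m] f(3) this] show ?thesis
    proof eventually_elim
      case (elim \<epsilon>)
      have tr: "b - y \<in> (+) (a - y) ` S" if "b \<in> (+) a ` S" for a b and S :: "(real ^ 'd) set"
        using that by auto
      have "p + y + \<epsilon> *\<^sub>R w - y \<in> (+) (snd (nbr f (- \<theta>)) - y) ` interior (fst (nbr f (- \<theta>)))"
        by (rule tr) (use elim in \<open>simp only: interior_translation\<close>)
      then show ?case by (simp only: interior_translation add.commute[of p] add.assoc add_diff_cancel_left')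
    qed
  qed
  define D where "D = (fst (nbr e (- \<sigma>)), snd (nbr e (- \<sigma>)) - z)"
  define D' where "D' = (fst (nbr e' (- \<sigma>')), snd (nbr e' (- \<sigma>')) - z')"
  have m: "- \<sigma> \<in> {1, -1}" "- \<sigma>' \<in> {1, -1}" using i(2) j(2) by auto
  have zp: "z \<in> periods M" "z' \<in> periods M" using s by (simp_all add: side_def)
  have "D = D'"
    by (rule interiors_meet_imp_eq[where p = p and w = w])
      (use near[OF i(1,2) p(1) w(1)] near[OF j(1,2) p(2) w(2)] nbr_cell[OF i(1) m(1)] nbr_cell[OF j(1) m(2)] zp
        in \<open>simp_all add: D_def D'_def periods_diff\<close>)
  have E: "(+) (- y) ` f = T \<inter> (+) (snd (nbr f (- \<theta>)) - y) ` fst (nbr f (- \<theta>))"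
    if f: "f \<in> faces M" "\<theta> \<in> {1, -1}" "nbr f \<theta> = (T, y)" for f \<theta> y
  proof -
    have "(+) (- y) ` f = (+) (- y) ` ((+) y ` T \<inter> (+) (snd (nbr f (- \<theta>))) ` fst (nbr f (- \<theta>)))"
      using face_eq_Int_nbr[OF f(1,2)] f(3) by simp
    also have "\<dots> = (+) (- y) ` (+) y ` T \<inter> (+) (- y) ` (+) (snd (nbr f (- \<theta>))) ` fst (nbr f (- \<theta>))"
      by (rule image_Int) simp
    also have "\<dots> = T \<inter> (+) (snd (nbr f (- \<theta>)) - y) ` fst (nbr f (- \<theta>))"
      by (simp add: image_image algebra_simps)
    finally show ?thesis .
  qed
  have EE: "(+) (- z) ` e = (+) (- z') ` e'"
    using E[OF i] E[OF j] \<open>D = D'\<close> unfolding D_def D'_def by simp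
  have "e' = (+) z' ` (+) (- z') ` e'" by (simp add: image_image)
  also have "\<dots> = (+) z' ` (+) (- z) ` e" by (simp only: EE)
  also have "\<dots> = (+) (z' - z) ` e" by (simp add: image_image algebra_simps)
  finally have e': "e' = (+) (z' - z) ` e" .
  \<comment> \<open>Each class of interfaces modulo periods has exactly one stored representative,
    and \<open>e\<close>, \<open>e'\<close> belong to the same class.\<close>
  have "interface M e" using mesh_facts(7) i(1) by (rule bspec)
  then have "\<exists>!e'. e' \<in> faces M \<and> (\<exists>z\<in>periods M. e' = (+) z ` e)"
    by (rule mesh_facts(8)[THEN spec, THEN mp])
  moreover have "\<exists>z\<in>periods M. e' = (+) z ` e" using e' periods_diff[OF zp(2,1)] by blast
  moreover have "\<exists>z\<in>periods M. e = (+) z ` e" using periods_zero by (intro bexI[of _ 0]) simp_all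
  ultimately have "e = e'" using i(1) j(1) by blast
  then have "\<sigma>' = - \<sigma>" using ne i(2) j(2) by auto
  then show False using nneq \<open>e = e'\<close> by simp
qed

text \<open>A frontier point lies in another tile, and there are finitely many candidates. The
  intersection with that tile has dimension below \<open>CARD('d)\<close>, as interiors are
  disjoint; it is either of codimension at least 2 or an interface.\<close>

lemma cell_frontier_cover:
  assumes T: "T \<in> cells M"
  obtains \<D> where "finite \<D>" "\<And>D. D \<in> \<D> \<Longrightarrow> aff_dim D \<le> int CARD('d) - 2"
    "frontier T \<subseteq> (\<Union>i\<in>{i \<in> faces M \<times> {1, -1}. fst (nbr (fst i) (snd i)) = T}. (+) (- snd (nbr (fst i) (snd i))) ` fst i) \<union> \<Union>\<D>"
proof -
  define Z where "Z = {z \<in> periods M. norm z \<le> 2 * radius + 1}"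
  define \<D> where "\<D> = {D \<in> (\<lambda>(T', z). T \<inter> (+) z ` T') ` (cells M \<times> Z). aff_dim D \<le> int CARD('d) - 2}"
  have fin: "finite \<D>" unfolding \<D>_def Z_def using finite_cells finite_periods by simp
  have "p \<in> (\<Union>i\<in>{i \<in> faces M \<times> {1, -1}. fst (nbr (fst i) (snd i)) = T}. (+) (- snd (nbr (fst i) (snd i))) ` fst i) \<union> \<Union>\<D>"
    if p: "p \<in> frontier T" for p
  proof -
    obtain T' z where T': "T' \<in> cells M" "z \<in> Z" "(T', z) \<noteq> (T, 0)" "p \<in> (+) z ` T'"
      using frontier_cell_neighbour[OF T p] unfolding Z_def by blast
    have z: "z \<in> periods M" using T' by (simp add: Z_def)
    have pT: "p \<in> T" using p cell(3)[OF T] frontier_subset_eq by blast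
    define A where "A = T \<inter> (+) z ` T'"
    have pA: "p \<in> A" using pT T' by (simp add: A_def)
    have disj: "interior T \<inter> interior ((+) z ` T') = {}"
      using cells_disjoint[OF T T'(1) periods_zero z] T'(3) by auto
    have convA: "convex A" unfolding A_def
      using cell(1)[OF T] convex_translation[OF cell(1)[OF T'(1)]] by (rule convex_Int)
    show ?thesis
    proof (cases "aff_dim A \<le> int CARD('d) - 2")
      case True
      then have "A \<in> \<D>" unfolding \<D>_def A_def using T'(1,2) by blast
      then show ?thesis using pA by blast
    next
      case False
      have "aff_dim A \<noteq> int CARD('d)"
      proof
        assume "aff_dim A = int CARD('d)"
        then have "affine hull A = UNIV" by (simp add: aff_dim_eq_full[symmetric])
        then have "interior A \<noteq> {}"
          using rel_interior_interior[of A] rel_interior_eq_empty[OF convA] pA by auto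
        then show False using disj unfolding A_def interior_Int by simp
      qed
      moreover have "aff_dim A \<le> int CARD('d)" using aff_dim_le_DIM[of A] by simp
      ultimately have dimA: "aff_dim A = int CARD('d) - 1" using False by linarith
      have "interface M A" unfolding interface_def using T T'(1) z dimA A_def by blast
      \<comment> \<open>The stored face is the translate of \<open>A\<close> by \<open>w\<close>, so
        beside this face the cell occurs in position \<open>w\<close>; this is the neighbour on one
        of the two sides.\<close>
      then obtain e w where e: "e \<in> faces M" "w \<in> periods M" "e = (+) w ` A" using mesh_facts(8) by blast
      have wT: "(+) w ` T \<inter> (+) (w + z) ` T' = e"
      proof -
        have "(+) w ` A = (+) w ` T \<inter> (+) w ` (+) z ` T'" unfolding A_def by (rule image_Int) simp
        then show ?thesis using e(3) by (simp add: image_image algebra_simps)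
      qed
      have "\<exists>\<sigma>\<in>{1, -1}. (+) w ` T \<subseteq> {x. \<sigma> * (nrm M e \<bullet> x) \<le> \<sigma> * face_level M e}
          \<and> (+) (w + z) ` T' \<subseteq> {x. - \<sigma> * (nrm M e \<bullet> x) \<le> - \<sigma> * face_level M e}"
      proof (rule separate_along_facet)
        show "interior ((+) w ` T) \<inter> interior ((+) (w + z) ` T') = {}"
          using cells_disjoint[OF T T'(1) e(2) periods_add[OF e(2) z]] T'(3) by auto
        show "interior ((+) w ` T) \<noteq> {}" "interior ((+) (w + z) ` T') \<noteq> {}"
          using cell(4)[OF T] cell(4)[OF T'(1)] by (simp_all add: interior_translation)
        show "convex ((+) w ` T)" "convex ((+) (w + z) ` T')"
          using cell(1)[OF T] cell(1)[OF T'(1)] by simp_all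
        show "e \<subseteq> (+) w ` T \<inter> (+) (w + z) ` T'" using wT by simp
      qed (fact face(6)[OF e(1)] face(4)[OF e(1)] face(3)[OF e(1)])+
      then obtain \<sigma> where \<sigma>: "\<sigma> \<in> {1, -1}" "(+) w ` T \<subseteq> {x. \<sigma> * (nrm M e \<bullet> x) \<le> \<sigma> * face_level M e}" by blast
      have "side M e \<sigma> (T, w)" unfolding side_def fst_conv snd_conv using T e(2) wT \<sigma>(2) by blast
      then have nb: "nbr e \<sigma> = (T, w)" by (rule nbr_eq[OF e(1) \<sigma>(1)])
      have "p = - w + (w + p)" "w + p \<in> e" using pA e(3) by auto
      then have "p \<in> (+) (- w) ` e" by blast
      moreover have "(e, \<sigma>) \<in> {i \<in> faces M \<times> {1, -1}. fst (nbr (fst i) (snd i)) = T}"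
        using e(1) \<sigma>(1) nb by simp
      ultimately show ?thesis using nb by (intro UnI1 UN_I[of "(e, \<sigma>)"]) simp_all
    qed
  qed
  then show ?thesis using that[OF fin] unfolding \<D>_def by blast
qed

text \<open>The index runs over pairs (face, side), since a cell can adjoin a face from both sides,
  e.g. on a mesh with one cell. Each facet of the cell is moved to the stored copy of its face, and
  the sign of the outer normal is absorbed by the side.\<close>

lemma cell_flux:
  assumes T: "T \<in> cells M" and G: "C1 G"
  shows "(LINT y:T|lebesgue. pd s G y) = (\<Sum>i\<in>{i \<in> faces M \<times> {1, -1}. fst (nbr (fst i) (snd i)) = T}.
    snd i * nrm M (fst i) $ s * flat_int (nrm M (fst i)) (face_level M (fst i)) (fst i) (\<lambda>x. G (x - snd (nbr (fst i) (snd i)))))"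
proof -
  let ?I = "{i \<in> faces M \<times> {1, -1}. fst (nbr (fst i) (snd i)) = T}"
  obtain G' where G': "continuous_on UNIV G'" "\<And>x. (G has_derivative (\<lambda>h. G' x \<bullet> h)) (at x)"
    "\<And>x s. pd s G x = G' x \<bullet> axis s 1"
    by (rule C1_pd[OF G]) (rule that)
  obtain \<D> where D: "finite \<D>" "\<And>D. D \<in> \<D> \<Longrightarrow> aff_dim D \<le> int CARD('d) - 2"
    "frontier T \<subseteq> (\<Union>i\<in>?I. (+) (- snd (nbr (fst i) (snd i))) ` fst i) \<union> \<Union>\<D>"
    by (rule cell_frontier_cover[OF T]) (rule that)
  define n where "n = (\<lambda>i :: (real ^ 'd) set \<times> real. nrm M (fst i))"
  define z where "z = (\<lambda>i :: (real ^ 'd) set \<times> real. snd (nbr (fst i) (snd i)))"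
  define c where "c = (\<lambda>i. snd i * (face_level M (fst i) - n i \<bullet> z i))"
  have I: "fst i \<in> faces M" "snd i \<in> {1, -1}" "nbr (fst i) (snd i) = (T, z i)" "side M (fst i) (snd i) (T, z i)"
    if "i \<in> ?I" for i
  proof -
    show a: "fst i \<in> faces M" "snd i \<in> {1, -1}" "nbr (fst i) (snd i) = (T, z i)"
      using that by (auto simp: z_def prod_eq_iff)
    show "side M (fst i) (snd i) (T, z i)" using nbr[OF a(1,2)] a(3) by simp
  qed
  have plane: "(+) (- z i) ` fst i \<subseteq> {x. n i \<bullet> x = face_level M (fst i) - n i \<bullet> z i}" if "i \<in> ?I" for i
    using face(5)[OF I(1)[OF that]] by (auto simp: n_def inner_diff_right)
  have "(LINT y:T|lebesgue. pd s G y) = (LINT y:T|lebesgue. G' y \<bullet> axis s 1)"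
    by (simp only: G'(3))
  also have "\<dots> = (\<Sum>i\<in>?I. ((snd i *\<^sub>R n i) \<bullet> axis s 1) * flat_int (snd i *\<^sub>R n i) (c i) ((+) (- z i) ` fst i) G)"
  proof (rule cell_divergence[OF cell(1,2)[OF T] G'(1,2)])
    show "finite ?I" using finite_faces by simp
    fix i assume i: "i \<in> ?I"
    show "norm (snd i *\<^sub>R n i) = 1 \<and> compact ((+) (- z i) ` fst i) \<and> convex ((+) (- z i) ` fst i)"
      using face(1,2,4)[OF I(1)[OF i]] I(2)[OF i] by (auto simp: n_def compact_translation convex_translation simp del: uminus_add_conv_diff)
    have "(+) (- z i) ` fst i \<subseteq> T"
    proof -
      have "fst i \<subseteq> (+) (z i) ` T" using I(4)[OF i] by (simp add: side_def)
      then show ?thesis by auto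
    qed
    moreover have "(+) (- z i) ` fst i \<subseteq> {x. (snd i *\<^sub>R n i) \<bullet> x = c i}"
      using plane[OF i] unfolding c_def by auto
    moreover have "T \<subseteq> {x. (snd i *\<^sub>R n i) \<bullet> x \<le> c i}"
    proof
      fix x assume "x \<in> T"
      then have "z i + x \<in> (+) (z i) ` T" by simp
      then have "snd i * (n i \<bullet> (z i + x)) \<le> snd i * face_level M (fst i)"
        using I(4)[OF i] unfolding side_def fst_conv snd_conv n_def by blast
      then show "x \<in> {x. (snd i *\<^sub>R n i) \<bullet> x \<le> c i}" by (simp add: c_def inner_add_right algebra_simps)
    qed
    ultimately show "(+) (- z i) ` fst i \<subseteq> T \<and> (+) (- z i) ` fst i \<subseteq> {x. (snd i *\<^sub>R n i) \<bullet> x = c i}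
      \<and> T \<subseteq> {x. (snd i *\<^sub>R n i) \<bullet> x \<le> c i}" by blast
  next
    fix i j assume i: "i \<in> ?I" and j: "j \<in> ?I" and ij: "i \<noteq> j"
    show "rel_interior ((+) (- z i) ` fst i) \<inter> rel_interior ((+) (- z j) ` fst j) = {}"
      by (rule cell_facets_disjoint[OF T I(1-3)[OF i] I(1-3)[OF j]]) (use ij in \<open>simp add: prod_eq_iff\<close>)
  next
    show "frontier T \<subseteq> (\<Union>i\<in>?I. (+) (- z i) ` fst i) \<union> \<Union>\<D>" using D(3) unfolding z_def .
    show "axis s 1 \<bullet> axis s (1::real) = 1" by (simp add: inner_axis_axis)
  qed (use D cell(4)[OF T] in simp_all)
  also have "\<dots> = (\<Sum>i\<in>?I. snd i * nrm M (fst i) $ s *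
      flat_int (nrm M (fst i)) (face_level M (fst i)) (fst i) (\<lambda>x. G (x - snd (nbr (fst i) (snd i)))))"
  proof (rule sum.cong[OF refl])
    fix i assume i: "i \<in> ?I"
    note f = face[OF I(1)[OF i]]
    have "flat_int (snd i *\<^sub>R n i) (c i) ((+) (- z i) ` fst i) G
        = flat_int (n i) (face_level M (fst i) - n i \<bullet> z i) ((+) (- z i) ` fst i) G"
    proof (cases "snd i = 1")
      case False
      then have "snd i = -1" using I(2)[OF i] by simp
      then have "snd i *\<^sub>R n i = - n i" "c i = - (face_level M (fst i) - n i \<bullet> z i)" by (simp_all add: c_def)
      then show ?thesis
        using flat_int_uminus[OF f(4) compact_translation[OF f(1)] plane[OF i, unfolded n_def] C1_continuous[OF G]]
        unfolding n_def by (simp only:)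
    qed (simp add: c_def)
    also have "\<dots> = flat_int (n i) (face_level M (fst i)) (fst i) (\<lambda>x. G (x - z i))"
      by (rule flat_int_translate[OF f(1) C1_continuous[OF G]])
    finally show "((snd i *\<^sub>R n i) \<bullet> axis s 1) * flat_int (snd i *\<^sub>R n i) (c i) ((+) (- z i) ` fst i) G
      = snd i * nrm M (fst i) $ s *
        flat_int (nrm M (fst i)) (face_level M (fst i)) (fst i) (\<lambda>x. G (x - snd (nbr (fst i) (snd i))))"
      by (simp add: n_def z_def inner_axis)
  qed
  finally show ?thesis .
qed

section \<open>Divergence theorem and integration by parts on the mesh\<close>

lemma pd_piece:
  assumes "pw_C1 M F" "T \<in> cells M" "y \<in> interior T"
  shows "pd s F y = pd s (piece F T) y"
  using pd_cong_open[OF open_interior assms(3)] piece(2)[OF assms(1,2)] by blast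

lemma negligible_frontier_cell: "T \<in> cells M \<Longrightarrow> negligible (frontier T)"
  using negligible_convex_frontier cell(1) by blast

lemma set_integral_cell:
  fixes f g :: "real ^ 'd \<Rightarrow> real"
  assumes T: "T \<in> cells M" and f: "continuous_on UNIV f" and eq: "\<And>y. y \<in> interior T \<Longrightarrow> g y = f y"
  shows "(LINT y:T|lebesgue. g y) = (LINT y:T|lebesgue. f y)" "set_integrable lebesgue T g"
proof -
  have i: "set_integrable lebesgue T f"
    by (rule set_integral_lebesgue_compact(3)[OF cell(2)[OF T] continuous_on_subset[OF f subset_UNIV]])
  have *: "g y = f y" if "y \<in> T" "y \<notin> frontier T" for y
  proof (rule eq)
    show "y \<in> interior T" using that by (simp add: frontier_def closure_closed[OF cell(3)[OF T]])
  qed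
  show "(LINT y:T|lebesgue. g y) = (LINT y:T|lebesgue. f y)"
    by (rule set_integral_spike(1)[OF i negligible_frontier_cell[OF T] *])
  show "set_integrable lebesgue T g"
    by (rule set_integral_spike(2)[OF i negligible_frontier_cell[OF T] *])
qed

text \<open>Every pair (face, side) belongs to exactly one cell, so the fluxes of all cells can be
  regrouped by faces. The two sides of a face carry opposite outer normals, which leaves the jump;
  by periodicity there is no outer boundary.\<close>

theorem dg_divergence:
  assumes F: "pw_C1 M F"
  shows "(\<Sum>T\<in>cells M. LINT y:T|lebesgue. pd s F y)
    = (\<Sum>e\<in>faces M. face_integral M e (\<lambda>y. nrm M e $ s * jump M e F y))"
proof -
  let ?S = "faces M \<times> {1, -1::real}"
  let ?h = "\<lambda>i. fst (nbr (fst i) (snd i))"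
  define \<Psi> where "\<Psi> = (\<lambda>i. snd i * nrm M (fst i) $ s *
      flat_int (nrm M (fst i)) (face_level M (fst i)) (fst i) (trace (fst i) (snd i) F))"
  have "(\<Sum>T\<in>cells M. LINT y:T|lebesgue. pd s F y) = (\<Sum>T\<in>cells M. \<Sum>i\<in>{i \<in> ?S. ?h i = T}. \<Psi> i)"
  proof (rule sum.cong[OF refl])
    fix T assume T: "T \<in> cells M"
    have "(LINT y:T|lebesgue. pd s F y) = (LINT y:T|lebesgue. pd s (piece F T) y)"
      by (rule set_integral_cell(1)[OF T continuous_on_pd[OF piece(1)[OF F T]] pd_piece[OF F T]])
    also have "\<dots> = (\<Sum>i\<in>{i \<in> ?S. ?h i = T}. \<Psi> i)"
      unfolding cell_flux[OF T piece(1)[OF F T]] \<Psi>_def trace_def[abs_def]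
      by (rule sum.cong[OF refl]) simp
    finally show "(LINT y:T|lebesgue. pd s F y) = (\<Sum>i\<in>{i \<in> ?S. ?h i = T}. \<Psi> i)" .
  qed
  also have "\<dots> = sum \<Psi> ?S"
    by (rule sum.group) (use finite_cells finite_faces nbr_cell in auto)
  also have "\<dots> = (\<Sum>e\<in>faces M. \<Psi> (e, 1) + \<Psi> (e, -1))"
  proof -
    have "sum \<Psi> ?S = (\<Sum>e\<in>faces M. \<Sum>\<sigma>\<in>{1, -1}. \<Psi> (e, \<sigma>))"
      unfolding sum.cartesian_product by (rule sum.cong) auto
    moreover have "(\<Sum>\<sigma>\<in>{1, -1}. \<Psi> (e, \<sigma>)) = \<Psi> (e, 1) + \<Psi> (e, -1)" for e by simp
    ultimately show ?thesis by (simp only:)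
  qed
  also have "\<dots> = (\<Sum>e\<in>faces M. face_integral M e (\<lambda>y. nrm M e $ s * jump M e F y))"
  proof (rule sum.cong[OF refl])
    fix e assume e: "e \<in> faces M"
    have c: "continuous_on UNIV (trace e 1 F)" "continuous_on UNIV (trace e (-1) F)"
      using continuous_on_trace[OF F e] by simp_all
    have "continuous_on UNIV (\<lambda>x. trace e 1 F x + (-1) * trace e (-1) F x)"
      by (intro continuous_intros c)
    from face_integral_eq_flat[OF e this, of "jump M e F"]
    have "face_integral M e (jump M e F) = flat_int (nrm M e) (face_level M e) e (\<lambda>x. trace e 1 F x + (-1) * trace e (-1) F x)"
      by (simp add: jump_def trm_tendsto(2)[OF F e] trp_tendsto(2)[OF F e])
    also have "\<dots> = flat_int (nrm M e) (face_level M e) e (trace e 1 F)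
        + flat_int (nrm M e) (face_level M e) e (\<lambda>x. (-1) * trace e (-1) F x)"
      by (rule flat_int_add[OF face(1)[OF e] c(1)]) (intro continuous_intros c)
    also have "flat_int (nrm M e) (face_level M e) e (\<lambda>x. (-1) * trace e (-1) F x)
      = (-1) * flat_int (nrm M e) (face_level M e) e (trace e (-1) F)" by (rule flat_int_cmult)
    finally show "\<Psi> (e, 1) + \<Psi> (e, -1) = face_integral M e (\<lambda>y. nrm M e $ s * jump M e F y)"
      unfolding face_integral_cmult by (simp only:) (simp add: \<Psi>_def algebra_simps)
  qed
  finally show ?thesis .
qed

text \<open>The divergence theorem for the product \<open>U V\<close>, with the product rule in the
  cells and its discrete counterpart for jumps on the faces.\<close>

theorem dhat_by_parts:
  assumes U: "pw_C1 M U" and V: "pw_C1 M V"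
  shows "dhat M s U V = - (\<Sum>T\<in>cells M. LINT y:T|lebesgue. U y * pd s V y)
    + (\<Sum>e\<in>faces M. face_integral M e (\<lambda>y. nrm M e $ s * (avg M e U y * jump M e V y)))"
proof -
  have cells: "(LINT y:T|lebesgue. pd s (\<lambda>x. U x * V x) y)
      = (LINT y:T|lebesgue. pd s U y * V y) + (LINT y:T|lebesgue. U y * pd s V y)" if T: "T \<in> cells M" for T
  proof -
    note u = piece[OF U T] and v = piece[OF V T]
    have cu: "continuous_on UNIV (\<lambda>y. pd s (piece U T) y * piece V T y)"
      by (intro continuous_intros continuous_on_pd C1_continuous u v)
    have cv: "continuous_on UNIV (\<lambda>y. piece U T y * pd s (piece V T) y)"
      by (intro continuous_intros continuous_on_pd C1_continuous u v)
    have i1: "pd s U y * V y = pd s (piece U T) y * piece V T y" if "y \<in> interior T" for y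
      using pd_piece[OF U T that] v(2)[OF that] by simp
    have i2: "U y * pd s V y = piece U T y * pd s (piece V T) y" if "y \<in> interior T" for y
      using pd_piece[OF V T that] u(2)[OF that] by simp
    have i3: "pd s (\<lambda>x. U x * V x) y = pd s (piece U T) y * piece V T y + piece U T y * pd s (piece V T) y"
      if y: "y \<in> interior T" for y
    proof -
      have "pd s (\<lambda>x. U x * V x) y = pd s (\<lambda>x. piece U T x * piece V T x) y"
        by (rule pd_cong_open[OF open_interior y]) (simp add: u(2) v(2))
      then show ?thesis by (simp add: pd_mult[OF u(1) v(1)])
    qed
    have "(LINT y:T|lebesgue. pd s (\<lambda>x. U x * V x) y)
        = (LINT y:T|lebesgue. pd s (piece U T) y * piece V T y + piece U T y * pd s (piece V T) y)"
      by (rule set_integral_cell(1)[OF T _ i3]) (intro continuous_on_add cu cv)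
    also have "\<dots> = (LINT y:T|lebesgue. pd s (piece U T) y * piece V T y) + (LINT y:T|lebesgue. piece U T y * pd s (piece V T) y)"
      by (rule set_integral_add(2)[OF set_integral_cell(2)[OF T cu] set_integral_cell(2)[OF T cv]]) simp_all
    finally show ?thesis
      by (simp only: set_integral_cell(1)[OF T cu i1] set_integral_cell(1)[OF T cv i2])
  qed
  have faces: "face_integral M e (\<lambda>y. nrm M e $ s * jump M e (\<lambda>x. U x * V x) y)
      = face_integral M e (\<lambda>y. nrm M e $ s * jump M e U y * avg M e V y)
      + face_integral M e (\<lambda>y. nrm M e $ s * (avg M e U y * jump M e V y))" if e: "e \<in> faces M" for e
  proof -
    have c1: "face_cont e (\<lambda>y. nrm M e $ s * jump M e U y * avg M e V y)"
      by (intro face_cont_mult face_cont_const face_cont_jump face_cont_avg e U V)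
    have c2: "face_cont e (\<lambda>y. nrm M e $ s * (avg M e U y * jump M e V y))"
      by (intro face_cont_mult face_cont_const face_cont_jump face_cont_avg e U V)
    have "face_integral M e (\<lambda>y. nrm M e $ s * jump M e (\<lambda>x. U x * V x) y)
      = face_integral M e (\<lambda>y. nrm M e $ s * jump M e U y * avg M e V y + nrm M e $ s * (avg M e U y * jump M e V y))"
      by (rule face_integral_cong[OF e face_cont_add[OF c1 c2]]) (simp add: jump_mult[OF e _ U V] algebra_simps)
    then show ?thesis using face_integral_add[OF e c1 c2] by simp
  qed
  have "(\<Sum>T\<in>cells M. (LINT y:T|lebesgue. pd s U y * V y) + (LINT y:T|lebesgue. U y * pd s V y))
    = (\<Sum>e\<in>faces M. face_integral M e (\<lambda>y. nrm M e $ s * jump M e U y * avg M e V y)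
      + face_integral M e (\<lambda>y. nrm M e $ s * (avg M e U y * jump M e V y)))"
    using dg_divergence[OF pw_C1_mult[OF U V], of s] by (simp add: cells faces cong: sum.cong)
  then show ?thesis unfolding dhat_def by (simp add: sum.distrib)
qed

end

section \<open>Discontinuous Galerkin functions and the discrete derivative\<close>

lemma lin_span_image:
  assumes "inj_on f I" "finite I" "u \<in> lin_span (f ` I)"
  obtains c where "\<And>y. u y = (\<Sum>i\<in>I. c i * f i y)"
proof -
  obtain H c where H: "finite H" "H \<subseteq> f ` I" "\<forall>y. u y = (\<Sum>g\<in>H. c g * g y)"
    using assms(3) unfolding lin_span_def by blast
  have "u y = (\<Sum>i\<in>I. (if f i \<in> H then c (f i) else 0) * f i y)" for y
  proof -
    have "u y = (\<Sum>g\<in>H. c g * g y)" using H(3) by blast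
    also have "\<dots> = (\<Sum>g\<in>f ` I. (if g \<in> H then c g else 0) * g y)"
      by (rule sum.mono_neutral_cong_left) (use H assms(2) in auto)
    also have "\<dots> = (\<Sum>i\<in>I. (if f i \<in> H then c (f i) else 0) * f i y)"
      by (simp add: sum.reindex[OF assms(1)])
    finally show ?thesis .
  qed
  then show ?thesis by (rule that)
qed

lemma lin_span_base: "g \<in> G \<Longrightarrow> g \<in> lin_span G"
  unfolding lin_span_def by (intro CollectI exI[of _ "{g}"] exI[of _ "\<lambda>_. 1"]) simp

lemma orthonormal_inj: "orthonormal inn r u \<Longrightarrow> inj_on u {1..r}"
proof (rule inj_onI)
  fix i j assume o: "orthonormal inn r u" and ij: "i \<in> {1..r}" "j \<in> {1..r}" "u i = u j"
  have "inn (u i) (u j) = (if i = j then 1 else 0)" "inn (u i) (u i) = 1"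
    using o ij(1,2) unfolding orthonormal_def by simp_all
  then show "i = j" using ij(3) by (auto split: if_splits)
qed

lemma orthonormalD: "orthonormal inn r u \<Longrightarrow> i \<in> {1..r} \<Longrightarrow> j \<in> {1..r} \<Longrightarrow> inn (u i) (u j) = (if i = j then 1 else 0)"
  unfolding orthonormal_def by blast

lemma dg_space_cmult:
  assumes "U \<in> dg_space M k" shows "(\<lambda>x. c * U x) \<in> dg_space M k"
proof -
  have "\<exists>P. poly_deg_le k P \<and> (\<forall>y\<in>interior T. c * U y = P y)" if T: "T \<in> cells M" for T
  proof -
    obtain P where P: "poly_deg_le k P" "\<forall>y\<in>interior T. U y = P y"
      using assms T unfolding dg_space_def by blast
    obtain b where b: "\<forall>y. P y = (\<Sum>\<alpha> | (\<Sum>i\<in>UNIV. \<alpha> i) \<le> k. b \<alpha> * (\<Prod>i\<in>UNIV. y $ i ^ \<alpha> i))"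
      using P(1) unfolding poly_deg_le_def by blast
    have "poly_deg_le k (\<lambda>y. c * P y)" unfolding poly_deg_le_def
      by (intro exI[of _ "\<lambda>\<alpha>. c * b \<alpha>"] allI) (simp add: b sum_distrib_left mult.assoc)
    then show ?thesis using P(2) by (intro exI[of _ "\<lambda>y. c * P y"]) simp
  qed
  then show ?thesis using assms unfolding dg_space_def by simp
qed

lemma poly_deg_le_one: "poly_deg_le k (\<lambda>y :: real ^ 'd::finite. 1)"
proof -
  let ?A = "{\<alpha> :: 'd \<Rightarrow> nat. (\<Sum>i\<in>UNIV. \<alpha> i) \<le> k}"
  have "?A \<subseteq> PiE UNIV (\<lambda>_. {..k})"
  proof
    fix \<alpha> assume "\<alpha> \<in> ?A"
    then have "\<alpha> i \<le> k" for i using member_le_sum[of i UNIV \<alpha>] by simp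
    then show "\<alpha> \<in> PiE UNIV (\<lambda>_. {..k})" by (simp add: PiE_UNIV_domain)
  qed
  then have fin: "finite ?A" by (rule finite_subset) (simp add: finite_PiE)
  have "(\<Sum>\<alpha>\<in>?A. (if \<alpha> = (\<lambda>_. 0) then 1 else 0) * (\<Prod>i\<in>UNIV. y $ i ^ \<alpha> i)) = 1" for y :: "real ^ 'd"
  proof -
    have "(\<Sum>\<alpha>\<in>?A. (if \<alpha> = (\<lambda>_. 0) then 1 else 0) * (\<Prod>i\<in>UNIV. y $ i ^ \<alpha> i))
      = (\<Sum>\<alpha>\<in>?A. if \<alpha> = (\<lambda>_. 0) then 1 else 0)"
      by (intro sum.cong) auto
    then show ?thesis using fin by simp
  qed
  then show ?thesis unfolding poly_deg_le_def by (intro exI[of _ "\<lambda>\<alpha>. if \<alpha> = (\<lambda>_. 0) then 1 else 0"]) simp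
qed

lemma canon_one_dg_space: "canon M (\<lambda>_. 1) \<in> dg_space M k"
  unfolding dg_space_def canon_def using poly_deg_le_one by auto

section \<open>Integrals over the box and bilinearity of the discrete derivative\<close>

context dg_mesh
begin

lemma cell_sets: "T \<in> cells M \<Longrightarrow> T \<in> sets lebesgue"
  using cell(3) by simp

lemma Omega_eq: "Omega M = (\<Union>T\<in>cells M. T)"
  using Union_cells by simp

lemma set_integrable_OmegaI:
  fixes g :: "real ^ 'd \<Rightarrow> real"
  assumes "\<And>T. T \<in> cells M \<Longrightarrow> set_integrable lebesgue T g"
  shows "set_integrable lebesgue (Omega M) g"
  unfolding Omega_eq by (rule set_integrable_UN) (use finite_cells assms cell_sets in auto)

lemma integral_Omega:
  fixes g :: "real ^ 'd \<Rightarrow> real"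
  assumes "\<And>T. T \<in> cells M \<Longrightarrow> set_integrable lebesgue T g"
  shows "(LINT y:Omega M|lebesgue. g y) = (\<Sum>T\<in>cells M. LINT y:T|lebesgue. g y)"
  unfolding Omega_eq
proof (rule set_integral_finite_UN_AE)
  fix T T' assume T: "T \<in> cells M" "T' \<in> cells M"
  show "AE x in lebesgue. x \<in> T \<and> x \<in> T' \<longrightarrow> T = T'"
  proof (cases "T = T'")
    case False
    have d: "interior T \<inter> interior T' = {}" using mesh_facts(4)[rule_format, OF T False] .
    have "frontier T \<union> frontier T' \<in> null_sets lebesgue"
      using negligible_frontier_cell T negligible_iff_null_sets negligible_Un by blast
    moreover have "{x \<in> space lebesgue. \<not> (x \<in> T \<and> x \<in> T' \<longrightarrow> T = T')} \<subseteq> frontier T \<union> frontier T'"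
      using d cell(3) T by (auto simp: frontier_def closure_closed)
    ultimately show ?thesis by (rule AE_I')
  qed simp
qed (use finite_cells assms cell_sets in auto)

definition generic :: "(real ^ 'd) set" where "generic = (\<Union>T\<in>cells M. interior T)"

lemma integral_Omega_cong:
  fixes f g :: "real ^ 'd \<Rightarrow> real"
  assumes f: "set_integrable lebesgue (Omega M) f" and eq: "\<And>y. y \<in> generic \<Longrightarrow> g y = f y"
  shows "(LINT y:Omega M|lebesgue. g y) = (LINT y:Omega M|lebesgue. f y)" "set_integrable lebesgue (Omega M) g"
proof -
  have N: "negligible (\<Union>T\<in>cells M. frontier T)"
    using finite_cells negligible_frontier_cell by (intro negligible_Union) auto
  have *: "g y = f y" if y: "y \<in> Omega M" "y \<notin> (\<Union>T\<in>cells M. frontier T)" for y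
  proof (rule eq)
    obtain T where "T \<in> cells M" "y \<in> T" using y(1) unfolding Omega_eq by (elim UN_E)
    then have "y \<in> interior T" using y(2) cell(3)[of T] by (auto simp: frontier_def closure_closed)
    then show "y \<in> generic" using \<open>T \<in> cells M\<close> unfolding generic_def by blast
  qed
  show "(LINT y:Omega M|lebesgue. g y) = (LINT y:Omega M|lebesgue. f y)" "set_integrable lebesgue (Omega M) g"
    by (rule set_integral_spike[OF f N *], assumption+)+
qed

lemma set_integrable_cell_pw:
  assumes "pw_C1 M F" "T \<in> cells M" shows "set_integrable lebesgue T F"
  by (rule set_integral_cell(2)[OF assms(2) C1_continuous[OF piece(1)[OF assms]] piece(2)[OF assms]])

lemma set_integrable_pw: "pw_C1 M F \<Longrightarrow> set_integrable lebesgue (Omega M) F"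
  by (rule set_integrable_OmegaI) (rule set_integrable_cell_pw)

text \<open>Made for products with a component of the electric field, which is merely integrable,
  while the piecewise smooth factor is bounded on each compact cell.\<close>

lemma set_integrable_mult_pw:
  assumes g: "set_integrable lebesgue (Omega M) g" and F: "pw_C1 M F" and T: "T \<in> cells M"
  shows "set_integrable lebesgue T (\<lambda>x. g x * F x)"
proof -
  let ?P = "piece F T"
  have gT: "set_integrable lebesgue T g" by (rule set_integrable_subset[OF g cell_sets[OF T] cell(5)[OF T]])
  have cP: "continuous_on UNIV ?P" by (rule C1_continuous[OF piece(1)[OF F T]])
  have "compact (?P ` T)" by (rule compact_continuous_image[OF continuous_on_subset[OF cP] cell(2)[OF T]]) simp
  from compact_imp_bounded[OF this] obtain B where "\<forall>y\<in>?P ` T. norm y \<le> B"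
    unfolding bounded_iff by (elim exE)
  then have B: "norm (?P x) \<le> B" if "x \<in> T" for x using that by simp
  have mP: "?P \<in> borel_measurable lebesgue" by (rule measurable_completion) (use borel_measurable_continuous_onI[OF cP] in simp)
  have i: "integrable lebesgue (\<lambda>x. indicator T x *\<^sub>R g x)" using gT unfolding set_integrable_def .
  have "integrable lebesgue (\<lambda>x. indicator T x *\<^sub>R (g x * ?P x))"
  proof (rule Bochner_Integration.integrable_bound)
    show "integrable lebesgue (\<lambda>x. B * (indicator T x *\<^sub>R g x))" using i by simp
    have "(\<lambda>x. (indicator T x *\<^sub>R g x) * ?P x) \<in> borel_measurable lebesgue"
      by (rule borel_measurable_times[OF borel_measurable_integrable[OF i] mP])
    then show "(\<lambda>x. indicator T x *\<^sub>R (g x * ?P x)) \<in> borel_measurable lebesgue" by (simp add: mult.assoc)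
    show "AE x in lebesgue. norm (indicator T x *\<^sub>R (g x * ?P x)) \<le> norm (B * (indicator T x *\<^sub>R g x))"
    proof (rule AE_I2)
      fix x
      show "norm (indicator T x *\<^sub>R (g x * ?P x)) \<le> norm (B * (indicator T x *\<^sub>R g x))"
      proof (cases "x \<in> T")
        case True
        then have "\<bar>?P x\<bar> \<le> \<bar>B\<bar>" using B[OF True] by simp
        then have "\<bar>?P x\<bar> * \<bar>g x\<bar> \<le> \<bar>B\<bar> * \<bar>g x\<bar>" by (rule mult_right_mono) simp
        then show ?thesis using True by (simp add: abs_mult mult.commute)
      qed simp
    qed
  qed
  then have "set_integrable lebesgue T (\<lambda>x. g x * ?P x)" unfolding set_integrable_def .
  then show ?thesis
  proof (rule set_integral_spike(2)[OF _ negligible_frontier_cell[OF T]])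
    fix x assume "x \<in> T" "x \<notin> frontier T"
    then have "x \<in> interior T" by (simp add: frontier_def closure_closed[OF cell(3)[OF T]])
    then show "g x * F x = g x * ?P x" using piece(2)[OF F T] by simp
  qed
qed

lemma integral_Omega_sum:
  fixes F :: "'i \<Rightarrow> real ^ 'd \<Rightarrow> real"
  assumes "\<And>i. i \<in> A \<Longrightarrow> pw_C1 M (F i)"
  shows "(LINT y:Omega M|lebesgue. (\<Sum>i\<in>A. c i * F i y)) = (\<Sum>i\<in>A. c i * (LINT y:Omega M|lebesgue. F i y))"
  using assms
proof (induction A rule: infinite_finite_induct)
  case (insert a A)
  have "(LINT y:Omega M|lebesgue. c a * F a y + (\<Sum>i\<in>A. c i * F i y))
    = (LINT y:Omega M|lebesgue. c a * F a y) + (LINT y:Omega M|lebesgue. (\<Sum>i\<in>A. c i * F i y))"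
    using insert.prems by (intro set_integral_add set_integrable_pw pw_C1_cmult pw_C1_sum) simp_all
  then show ?case using insert by simp
qed (simp_all add: set_lebesgue_integral_def)

lemma integral_Omega_add:
  assumes "pw_C1 M F" "pw_C1 M G"
  shows "(LINT y:Omega M|lebesgue. F y + G y) = (LINT y:Omega M|lebesgue. F y) + (LINT y:Omega M|lebesgue. G y)"
  by (intro set_integral_add set_integrable_pw assms)

text \<open>The set of agreement is closed and contains the open cell, which is dense in the cell;
  hence the chosen extension has determined boundary values.\<close>

lemma piece_eq:
  assumes T: "T \<in> cells M" and F: "pw_C1 M F" and g: "continuous_on UNIV g"
    and eq: "\<And>y. y \<in> interior T \<Longrightarrow> F y = g y" and y: "y \<in> T"
  shows "piece F T y = g y"
proof -
  have cl: "closure (interior T) = T"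
    using convex_closure_interior[OF cell(1)[OF T] cell(4)[OF T]] cell(3)[OF T] by (simp add: closure_closed)
  have "closed {y. piece F T y - g y = 0}"
    by (intro closed_Collect_eq continuous_intros C1_continuous[OF piece(1)[OF F T]] g)
  moreover have "interior T \<subseteq> {y. piece F T y - g y = 0}" using eq piece(2)[OF F T] by auto
  ultimately have "T \<subseteq> {y. piece F T y - g y = 0}" using closure_minimal cl by metis
  then show ?thesis using y by auto
qed

lemma face_in_cell: "e \<in> faces M \<Longrightarrow> \<sigma> \<in> {1, -1} \<Longrightarrow> p \<in> e \<Longrightarrow> p - snd (nbr e \<sigma>) \<in> fst (nbr e \<sigma>)"
  using nbr[of e \<sigma>] unfolding side_def by auto

lemma canon_interior: "T \<in> cells M \<Longrightarrow> y \<in> interior T \<Longrightarrow> canon M g y = g y"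
  unfolding canon_def by auto

lemma trace_canon:
  assumes "e \<in> faces M" "\<sigma> \<in> {1, -1}" "p \<in> e" "C1 g"
  shows "trace e \<sigma> (canon M g) p = g (p - snd (nbr e \<sigma>))"
  unfolding trace_def
  by (rule piece_eq[OF nbr_cell(1)[OF assms(1,2)] pw_C1_canon[OF assms(4)] C1_continuous[OF assms(4)]
      canon_interior[OF nbr_cell(1)[OF assms(1,2)]] face_in_cell[OF assms(1,2,3)]])

text \<open>The two arguments are the positions in the closed box from which the face point is
  reached. They differ only across identified sides of the box, where a smooth but nonperiodic
  function such as a coordinate may jump.\<close>

lemma jump_canon:
  assumes "e \<in> faces M" "p \<in> rel_interior e" "C1 g"
  shows "jump M e (canon M g) p = g (p - snd (nbr e 1)) - g (p - snd (nbr e (-1)))"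
proof -
  have p: "p \<in> e" using assms(2) rel_interior_subset by blast
  show ?thesis
    unfolding jump_def trm_tendsto(2)[OF pw_C1_canon[OF assms(3)] assms(1,2)] trp_tendsto(2)[OF pw_C1_canon[OF assms(3)] assms(1,2)]
    using trace_canon[OF assms(1) _ p assms(3), of 1] trace_canon[OF assms(1) _ p assms(3), of "-1"] by simp
qed

text \<open>In the form integrated by parts the first argument occurs without derivative, so
  linearity reduces to that of integrals and mean values.\<close>

lemma dhat_sum_left:
  assumes F: "\<And>i. i \<in> A \<Longrightarrow> pw_C1 M (F i)" and V: "pw_C1 M V"
  shows "dhat M s (\<lambda>y. \<Sum>i\<in>A. c i * F i y) V = (\<Sum>i\<in>A. c i * dhat M s (F i) V)"
  using F
proof (induction A rule: infinite_finite_induct)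
  case (insert a A)
  let ?G = "\<lambda>y. \<Sum>i\<in>A. c i * F i y"
  have G: "pw_C1 M ?G" and Fa: "pw_C1 M (F a)" using insert.prems by (auto intro!: pw_C1_sum pw_C1_cmult)
  have Fa': "pw_C1 M (\<lambda>y. c a * F a y)" by (rule pw_C1_cmult[OF Fa])
  have H: "pw_C1 M (\<lambda>y. c a * F a y + ?G y)" by (rule pw_C1_add[OF Fa' G])
  have cell: "(LINT y:T|lebesgue. (c a * F a y + ?G y) * pd s V y)
    = c a * (LINT y:T|lebesgue. F a y * pd s V y) + (LINT y:T|lebesgue. ?G y * pd s V y)" if T: "T \<in> cells M" for T
  proof -
    have i: "set_integrable lebesgue T (\<lambda>y. W y * pd s V y)" if W: "pw_C1 M W" for W
    proof (rule set_integral_cell(2)[OF T, where f = "\<lambda>y. piece W T y * pd s (piece V T) y"])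
      show "continuous_on UNIV (\<lambda>y. piece W T y * pd s (piece V T) y)"
        by (rule continuous_on_mult[OF C1_continuous[OF piece(1)[OF W T]] continuous_on_pd[OF piece(1)[OF V T]]])
      show "W y * pd s V y = piece W T y * pd s (piece V T) y" if "y \<in> interior T" for y
        using piece(2)[OF W T that] pd_piece[OF V T that] by simp
    qed
    have "(LINT y:T|lebesgue. (c a * F a y + ?G y) * pd s V y)
      = (LINT y:T|lebesgue. c a * (F a y * pd s V y) + ?G y * pd s V y)"
      by (simp only: distrib_right mult.assoc)
    also have "\<dots> = (LINT y:T|lebesgue. c a * (F a y * pd s V y)) + (LINT y:T|lebesgue. ?G y * pd s V y)"
      using i[OF Fa] i[OF G] by (intro set_integral_add) auto
    finally show ?thesis by simp
  qed
  have face: "face_integral M e (\<lambda>y. nrm M e $ s * (avg M e (\<lambda>y. c a * F a y + ?G y) y * jump M e V y))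
    = c a * face_integral M e (\<lambda>y. nrm M e $ s * (avg M e (F a) y * jump M e V y))
      + face_integral M e (\<lambda>y. nrm M e $ s * (avg M e ?G y * jump M e V y))" if e: "e \<in> faces M" for e
  proof -
    have c: "face_cont e (\<lambda>y. nrm M e $ s * (avg M e W y * jump M e V y))" if "pw_C1 M W" for W
      by (intro face_cont_mult face_cont_const face_cont_avg face_cont_jump e that V)
    have "face_integral M e (\<lambda>y. nrm M e $ s * (avg M e (\<lambda>y. c a * F a y + ?G y) y * jump M e V y))
      = face_integral M e (\<lambda>y. c a * (nrm M e $ s * (avg M e (F a) y * jump M e V y)) + nrm M e $ s * (avg M e ?G y * jump M e V y))"
    proof (rule face_integral_cong[OF e])
      show "face_cont e (\<lambda>y. c a * (nrm M e $ s * (avg M e (F a) y * jump M e V y)) + nrm M e $ s * (avg M e ?G y * jump M e V y))"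
        by (rule face_cont_add[OF face_cont_mult[OF face_cont_const c[OF Fa]] c[OF G]])
      fix p assume p: "p \<in> rel_interior e"
      have "avg M e (\<lambda>y. c a * F a y + ?G y) p = c a * avg M e (F a) p + avg M e ?G p"
        using trm_add[OF e p Fa' G] trp_add[OF e p Fa' G] avg_cmult[OF e p Fa, of "c a"] by (simp add: avg_def field_simps)
      then show "nrm M e $ s * (avg M e (\<lambda>y. c a * F a y + ?G y) p * jump M e V p)
        = c a * (nrm M e $ s * (avg M e (F a) p * jump M e V p)) + nrm M e $ s * (avg M e ?G p * jump M e V p)"
        by (simp add: algebra_simps)
    qed
    also have "\<dots> = face_integral M e (\<lambda>y. c a * (nrm M e $ s * (avg M e (F a) y * jump M e V y)))
      + face_integral M e (\<lambda>y. nrm M e $ s * (avg M e ?G y * jump M e V y))"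
      by (rule face_integral_add[OF e face_cont_mult[OF face_cont_const c[OF Fa]] c[OF G]])
    finally show ?thesis by (simp only: face_integral_cmult)
  qed
  have "dhat M s (\<lambda>y. c a * F a y + ?G y) V = c a * dhat M s (F a) V + dhat M s ?G V"
  proof -
    have A: "(\<Sum>T\<in>cells M. LINT y:T|lebesgue. (c a * F a y + ?G y) * pd s V y)
      = c a * (\<Sum>T\<in>cells M. LINT y:T|lebesgue. F a y * pd s V y) + (\<Sum>T\<in>cells M. LINT y:T|lebesgue. ?G y * pd s V y)"
      by (simp only: cell sum.distrib sum_distrib_left cong: sum.cong)
    have B: "(\<Sum>e\<in>faces M. face_integral M e (\<lambda>y. nrm M e $ s * (avg M e (\<lambda>y. c a * F a y + ?G y) y * jump M e V y)))
      = c a * (\<Sum>e\<in>faces M. face_integral M e (\<lambda>y. nrm M e $ s * (avg M e (F a) y * jump M e V y)))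
      + (\<Sum>e\<in>faces M. face_integral M e (\<lambda>y. nrm M e $ s * (avg M e ?G y * jump M e V y)))"
      by (simp only: face sum.distrib sum_distrib_left cong: sum.cong)
    have "- (k * x + y) + (k * u + v) = k * (- x + u) + (- y + v)" for k x y u v :: real
      by (simp add: algebra_simps)
    then show ?thesis
      unfolding dhat_by_parts[OF H V] dhat_by_parts[OF Fa V] dhat_by_parts[OF G V] A B by blast
  qed
  then show ?case using insert by simp
qed (simp_all add: dhat_by_parts[OF pw_C1_const V] avg_def trm_const trp_const face_integral_zero)

lemma dhat_sum_right:
  assumes F: "\<And>i. i \<in> A \<Longrightarrow> pw_C1 M (F i)" and V: "pw_C1 M V"
  shows "dhat M s V (\<lambda>y. \<Sum>i\<in>A. c i * F i y) = (\<Sum>i\<in>A. c i * dhat M s V (F i))"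
  using F
proof (induction A rule: infinite_finite_induct)
  case (insert a A)
  let ?G = "\<lambda>y. \<Sum>i\<in>A. c i * F i y"
  have G: "pw_C1 M ?G" and Fa: "pw_C1 M (F a)" using insert.prems by (auto intro!: pw_C1_sum pw_C1_cmult)
  have Fa': "pw_C1 M (\<lambda>y. c a * F a y)" by (rule pw_C1_cmult[OF Fa])
  have cell: "(LINT y:T|lebesgue. pd s V y * (c a * F a y + ?G y))
    = c a * (LINT y:T|lebesgue. pd s V y * F a y) + (LINT y:T|lebesgue. pd s V y * ?G y)" if T: "T \<in> cells M" for T
  proof -
    have i: "set_integrable lebesgue T (\<lambda>y. pd s V y * W y)" if W: "pw_C1 M W" for W
    proof (rule set_integral_cell(2)[OF T, where f = "\<lambda>y. pd s (piece V T) y * piece W T y"])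
      show "continuous_on UNIV (\<lambda>y. pd s (piece V T) y * piece W T y)"
        by (rule continuous_on_mult[OF continuous_on_pd[OF piece(1)[OF V T]] C1_continuous[OF piece(1)[OF W T]]])
      show "pd s V y * W y = pd s (piece V T) y * piece W T y" if "y \<in> interior T" for y
        using piece(2)[OF W T that] pd_piece[OF V T that] by simp
    qed
    have "(LINT y:T|lebesgue. pd s V y * (c a * F a y + ?G y))
      = (LINT y:T|lebesgue. c a * (pd s V y * F a y) + pd s V y * ?G y)"
      by (simp only: distrib_left mult.left_commute)
    also have "\<dots> = (LINT y:T|lebesgue. c a * (pd s V y * F a y)) + (LINT y:T|lebesgue. pd s V y * ?G y)"
      using i[OF Fa] i[OF G] by (intro set_integral_add) auto
    finally show ?thesis by simp
  qed
  have face: "face_integral M e (\<lambda>y. nrm M e $ s * jump M e V y * avg M e (\<lambda>y. c a * F a y + ?G y) y)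
    = c a * face_integral M e (\<lambda>y. nrm M e $ s * jump M e V y * avg M e (F a) y)
      + face_integral M e (\<lambda>y. nrm M e $ s * jump M e V y * avg M e ?G y)" if e: "e \<in> faces M" for e
  proof -
    have c: "face_cont e (\<lambda>y. nrm M e $ s * jump M e V y * avg M e W y)" if "pw_C1 M W" for W
      by (intro face_cont_mult face_cont_const face_cont_avg face_cont_jump e that V)
    have "face_integral M e (\<lambda>y. nrm M e $ s * jump M e V y * avg M e (\<lambda>y. c a * F a y + ?G y) y)
      = face_integral M e (\<lambda>y. c a * (nrm M e $ s * jump M e V y * avg M e (F a) y) + nrm M e $ s * jump M e V y * avg M e ?G y)"
    proof (rule face_integral_cong[OF e])
      show "face_cont e (\<lambda>y. c a * (nrm M e $ s * jump M e V y * avg M e (F a) y) + nrm M e $ s * jump M e V y * avg M e ?G y)"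
        by (rule face_cont_add[OF face_cont_mult[OF face_cont_const c[OF Fa]] c[OF G]])
      fix p assume p: "p \<in> rel_interior e"
      have "avg M e (\<lambda>y. c a * F a y + ?G y) p = c a * avg M e (F a) p + avg M e ?G p"
        using trm_add[OF e p Fa' G] trp_add[OF e p Fa' G] avg_cmult[OF e p Fa, of "c a"] by (simp add: avg_def field_simps)
      then show "nrm M e $ s * jump M e V p * avg M e (\<lambda>y. c a * F a y + ?G y) p
        = c a * (nrm M e $ s * jump M e V p * avg M e (F a) p) + nrm M e $ s * jump M e V p * avg M e ?G p"
        by (simp add: algebra_simps)
    qed
    also have "\<dots> = face_integral M e (\<lambda>y. c a * (nrm M e $ s * jump M e V y * avg M e (F a) y))
      + face_integral M e (\<lambda>y. nrm M e $ s * jump M e V y * avg M e ?G y)"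
      by (rule face_integral_add[OF e face_cont_mult[OF face_cont_const c[OF Fa]] c[OF G]])
    finally show ?thesis by (simp only: face_integral_cmult)
  qed
  have "dhat M s V (\<lambda>y. c a * F a y + ?G y) = c a * dhat M s V (F a) + dhat M s V ?G"
  proof -
    have A: "(\<Sum>T\<in>cells M. LINT y:T|lebesgue. pd s V y * (c a * F a y + ?G y))
      = c a * (\<Sum>T\<in>cells M. LINT y:T|lebesgue. pd s V y * F a y) + (\<Sum>T\<in>cells M. LINT y:T|lebesgue. pd s V y * ?G y)"
      by (simp only: cell sum.distrib sum_distrib_left cong: sum.cong)
    have B: "(\<Sum>e\<in>faces M. face_integral M e (\<lambda>y. nrm M e $ s * jump M e V y * avg M e (\<lambda>y. c a * F a y + ?G y) y))
      = c a * (\<Sum>e\<in>faces M. face_integral M e (\<lambda>y. nrm M e $ s * jump M e V y * avg M e (F a) y))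
      + (\<Sum>e\<in>faces M. face_integral M e (\<lambda>y. nrm M e $ s * jump M e V y * avg M e ?G y))"
      by (simp only: face sum.distrib sum_distrib_left cong: sum.cong)
    have "(k * x + y) - (k * u + v) = k * (x - u) + (y - v)" for k x y u v :: real
      by (simp add: algebra_simps)
    then show ?thesis unfolding dhat_def A B by blast
  qed
  then show ?case using insert by simp
qed (simp_all add: dhat_def avg_def trm_const trp_const face_integral_zero set_lebesgue_integral_def)

section \<open>Discrete derivative of functions vanishing near the boundary of the box\<close>

lemma frontier_of_period_shift:
  assumes "a \<in> Omega M" "b \<in> Omega M" "a - b \<in> periods M" "a \<noteq> b"
  shows "a \<in> frontier (Omega M)"
proof -
  obtain i where i: "\<bar>(a - b) $ i\<bar> \<ge> hi M $ i - lo M $ i"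
    using period_large[OF assms(3)] assms(4) by auto
  have "a \<notin> box (lo M) (hi M)"
  proof
    assume "a \<in> box (lo M) (hi M)"
    then have "lo M $ i < a $ i" "a $ i < hi M $ i" by (simp_all add: mem_box_cart)
    moreover have "lo M $ i \<le> b $ i" "b $ i \<le> hi M $ i" using assms(2) by (simp_all add: Omega_def mem_box_cart)
    ultimately show False using i by (simp add: abs_le_iff)
  qed
  then show ?thesis using assms(1) interior_Omega by (simp add: frontier_def Omega_def)
qed

text \<open>The trace is the value of a smooth extension at a boundary point of the cell. A nonzero
  value would persist nearby and hence at points of the open cell inside \<open>W\<close>, where the
  extension equals \<open>F\<close>.\<close>

lemma trace_zero:
  assumes e: "e \<in> faces M" "\<sigma> \<in> {1, -1}" "p \<in> e" and F: "pw_C1 M F"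
    and W: "open W" "\<And>y. y \<in> W \<inter> Omega M \<Longrightarrow> F y = 0" and a: "p - snd (nbr e \<sigma>) \<in> W"
  shows "trace e \<sigma> F p = 0"
proof (rule ccontr)
  let ?T = "fst (nbr e \<sigma>)" and ?a = "p - snd (nbr e \<sigma>)"
  note T = nbr_cell(1)[OF e(1,2)]
  assume "trace e \<sigma> F p \<noteq> 0"
  then have nz: "piece F ?T ?a \<noteq> 0" unfolding trace_def .
  have "open (W \<inter> {y. piece F ?T y \<noteq> 0})"
    by (intro open_Int W(1) open_Collect_neq C1_continuous[OF piece(1)[OF F T]] continuous_intros)
  moreover have "?a \<in> W \<inter> {y. piece F ?T y \<noteq> 0}" using a nz by simp
  moreover have "?a \<in> closure (interior ?T)"
    using face_in_cell[OF e] convex_closure_interior[OF cell(1)[OF T] cell(4)[OF T]] closure_subset by blast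
  ultimately have "(W \<inter> {y. piece F ?T y \<noteq> 0}) \<inter> interior ?T \<noteq> {}"
    using open_Int_closure_eq_empty by blast
  then obtain y where y: "y \<in> W" "piece F ?T y \<noteq> 0" "y \<in> interior ?T" by blast
  then have "y \<in> W \<inter> Omega M" using interior_subset cell(5)[OF T] by blast
  then show False using W(2) piece(2)[OF F T y(3)] y(2) by simp
qed

text \<open>After integration by parts the cells contribute the integral of \<open>F\<close> times a
  constant derivative. On a face, either both sides see the same point of the box and the coordinate
  does not jump, or the point lies on identified sides of the box and both traces of
  \<open>F\<close> vanish. This is where the support assumption takes effect.\<close>

lemma dhat_coordinate:
  assumes F: "pw_C1 M F" and W: "open W" "frontier (Omega M) \<subseteq> W" "\<And>y. y \<in> W \<inter> Omega M \<Longrightarrow> F y = 0"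
  shows "dhat M s F (canon M (\<lambda>v. v $ i)) = (if s = i then - (LINT y:Omega M|lebesgue. F y) else 0)"
proof -
  let ?g = "\<lambda>v :: real ^ 'd. v $ i"
  have c: "pw_C1 M (canon M ?g)" by (rule pw_C1_canon[OF C1_nth])
  have "(LINT y:T|lebesgue. F y * pd s (canon M ?g) y) = (if s = i then 1 else 0) * (LINT y:T|lebesgue. F y)"
    if T: "T \<in> cells M" for T
  proof -
    have eq: "pd s (canon M ?g) y = (if s = i then 1 else 0)" if "y \<in> interior T" for y
      using pd_cong_open[OF open_interior that, of "canon M ?g" ?g s] canon_interior[OF T] by (simp add: pd_nth)
    have "(LINT y:T|lebesgue. F y * pd s (canon M ?g) y) = (LINT y:T|lebesgue. (if s = i then 1 else 0) * piece F T y)"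
    proof (rule set_integral_cell(1)[OF T])
      show "continuous_on UNIV (\<lambda>y. (if s = i then 1 else 0) * piece F T y)"
        by (intro continuous_intros C1_continuous piece(1)[OF F T])
      show "F y * pd s (canon M ?g) y = (if s = i then 1 else 0) * piece F T y" if "y \<in> interior T" for y
        using eq[OF that] piece(2)[OF F T that] by simp
    qed
    also have "\<dots> = (if s = i then 1 else 0) * (LINT y:T|lebesgue. piece F T y)" by simp
    also have "(LINT y:T|lebesgue. piece F T y) = (LINT y:T|lebesgue. F y)"
      by (rule set_integral_cell(1)[OF T C1_continuous[OF piece(1)[OF F T]] piece(2)[OF F T], symmetric])
    finally show ?thesis .
  qed
  then have cells: "(\<Sum>T\<in>cells M. LINT y:T|lebesgue. F y * pd s (canon M ?g) y)
      = (if s = i then 1 else 0) * (LINT y:Omega M|lebesgue. F y)"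
    by (simp add: integral_Omega[OF set_integrable_cell_pw[OF F]] sum_distrib_left cong: sum.cong)
  have "face_integral M e (\<lambda>y. nrm M e $ s * (avg M e F y * jump M e (canon M ?g) y)) = face_integral M e (\<lambda>y. 0)"
    if e: "e \<in> faces M" for e
  proof (rule face_integral_cong[OF e face_cont_const])
    fix p assume pr: "p \<in> rel_interior e"
    then have p: "p \<in> e" using rel_interior_subset by blast
    let ?a = "p - snd (nbr e 1)" and ?b = "p - snd (nbr e (-1))"
    have ab: "?a \<in> Omega M" "?b \<in> Omega M"
      using face_in_cell[OF e _ p, of 1] face_in_cell[OF e _ p, of "-1"] cell(5)[OF nbr_cell(1)[OF e, of 1]]
        cell(5)[OF nbr_cell(1)[OF e, of "-1"]] by auto
    have per: "snd (nbr e (-1)) - snd (nbr e 1) \<in> periods M" "snd (nbr e 1) - snd (nbr e (-1)) \<in> periods M"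
      using nbr_cell(2)[OF e, of 1] nbr_cell(2)[OF e, of "-1"] periods_diff by simp_all
    show "nrm M e $ s * (avg M e F p * jump M e (canon M ?g) p) = 0"
    proof (cases "?a = ?b")
      case True
      then show ?thesis using jump_canon[OF e pr C1_nth, of i] by simp
    next
      case False
      have "?a - ?b \<in> periods M" "?b - ?a \<in> periods M" using per by simp_all
      then have "?a \<in> W" "?b \<in> W"
        using frontier_of_period_shift[OF ab(1,2)] frontier_of_period_shift[OF ab(2,1)] False W(2) by auto
      then have "trace e 1 F p = 0" "trace e (-1) F p = 0"
        using trace_zero[OF e _ p F W(1) W(3)] by simp_all
      then show ?thesis unfolding avg_def trm_tendsto(2)[OF F e pr] trp_tendsto(2)[OF F e pr] by simp
    qed
  qed
  then show ?thesis unfolding dhat_by_parts[OF F c] cells by (simp add: face_integral_zero)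
qed

end

section \<open>The weak form with central flux\<close>

lemma set_integral_lincomb:
  fixes f :: "'i \<Rightarrow> 'a \<Rightarrow> real"
  assumes "\<And>i. i \<in> A \<Longrightarrow> set_integrable M S (f i)"
  shows "(LINT y:S|M. (\<Sum>i\<in>A. c i * f i y)) = (\<Sum>i\<in>A. c i * (LINT y:S|M. f i y))"
    and "set_integrable M S (\<lambda>y. \<Sum>i\<in>A. c i * f i y)"
proof -
  have "set_integrable M S (\<lambda>y. \<Sum>i\<in>A. c i * f i y)
      \<and> (LINT y:S|M. (\<Sum>i\<in>A. c i * f i y)) = (\<Sum>i\<in>A. c i * (LINT y:S|M. f i y))"
    using assms
  proof (induction A rule: infinite_finite_induct)
    case (insert a A)
    have 1: "set_integrable M S (\<lambda>y. c a * f a y)" using insert.prems by auto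
    have 2: "set_integrable M S (\<lambda>y. \<Sum>i\<in>A. c i * f i y)" using insert by blast
    show ?case
      using insert set_integral_add[OF 1 2] by simp
  qed (simp_all add: set_lebesgue_integral_def set_integrable_def)
  then show "(LINT y:S|M. (\<Sum>i\<in>A. c i * f i y)) = (\<Sum>i\<in>A. c i * (LINT y:S|M. f i y))"
    "set_integrable M S (\<lambda>y. \<Sum>i\<in>A. c i * f i y)" by simp_all
qed

context dg_mesh
begin

lemma set_integrable_Omega_mult_pw:
  "set_integrable lebesgue (Omega M) g \<Longrightarrow> pw_C1 M F \<Longrightarrow> set_integrable lebesgue (Omega M) (\<lambda>x. g x * F x)"
  by (rule set_integrable_OmegaI) (rule set_integrable_mult_pw)

lemma set_integrable_cell_mult_pd:
  assumes W: "pw_C1 M W" and V: "pw_C1 M V" and T: "T \<in> cells M"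
  shows "set_integrable lebesgue T (\<lambda>y. W y * pd s V y)"
proof (rule set_integral_cell(2)[OF T, where f = "\<lambda>y. piece W T y * pd s (piece V T) y"])
  show "continuous_on UNIV (\<lambda>y. piece W T y * pd s (piece V T) y)"
    by (rule continuous_on_mult[OF C1_continuous[OF piece(1)[OF W T]] continuous_on_pd[OF piece(1)[OF V T]]])
  show "W y * pd s V y = piece W T y * pd s (piece V T) y" if "y \<in> interior T" for y
    using piece(2)[OF W T that] pd_piece[OF V T that] by simp
qed

text \<open>The mean value in the central flux is exactly the face term of
  \<open>dhat_by_parts\<close>. A flux with a jump part would leave a further term pairing jumps
  with jumps, with no counterpart in the S-step.\<close>

lemma weak_form_eq_dhat:
  assumes W: "\<And>s. pw_C1 M (W s)" and Z: "\<And>s. pw_C1 M (Z s)" and \<phi>: "pw_C1 M \<phi>"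
    and E: "\<And>s. set_integrable lebesgue (Omega M) (\<lambda>x. E x $ s)"
  shows "(\<Sum>T\<in>cells M. \<Sum>s\<in>UNIV. LINT x:T|lebesgue. - (W s x * pd s \<phi> x) - E x $ s * (Z s x * \<phi> x))
      + (\<Sum>e\<in>faces M. face_integral M e (\<lambda>x. (\<Sum>s\<in>UNIV. nrm M e $ s * avg M e (W s) x) * jump M e \<phi> x))
    = (\<Sum>s\<in>UNIV. dhat M s (W s) \<phi>) - (\<Sum>s\<in>UNIV. LINT x:Omega M|lebesgue. E x $ s * (Z s x * \<phi> x))"
proof -
  have cell: "(LINT x:T|lebesgue. - (W s x * pd s \<phi> x) - E x $ s * (Z s x * \<phi> x))
    = - (LINT x:T|lebesgue. W s x * pd s \<phi> x) - (LINT x:T|lebesgue. E x $ s * (Z s x * \<phi> x))"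
    if T: "T \<in> cells M" for T s
  proof -
    have 1: "set_integrable lebesgue T (\<lambda>x. W s x * pd s \<phi> x)"
      by (rule set_integrable_cell_mult_pd[OF W \<phi> T])
    have 2: "set_integrable lebesgue T (\<lambda>x. E x $ s * (Z s x * \<phi> x))"
      by (rule set_integrable_mult_pw[OF E pw_C1_mult[OF Z \<phi>] T])
    have 3: "set_integrable lebesgue T (\<lambda>x. - (W s x * pd s \<phi> x))"
      using 1 by (simp add: set_integrable_def)
    show ?thesis using set_integral_diff(2)[OF 3 2] set_integral_uminus[OF 1] by simp
  qed
  have face: "face_integral M e (\<lambda>x. (\<Sum>s\<in>UNIV. nrm M e $ s * avg M e (W s) x) * jump M e \<phi> x)
    = (\<Sum>s\<in>UNIV. face_integral M e (\<lambda>y. nrm M e $ s * (avg M e (W s) y * jump M e \<phi> y)))" if e: "e \<in> faces M" for e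
  proof -
    have "face_cont e (\<lambda>y. nrm M e $ s * (avg M e (W s) y * jump M e \<phi> y))" for s
      by (intro face_cont_mult face_cont_const face_cont_avg face_cont_jump e W \<phi>)
    from face_integral_sum[OF e this, where A = UNIV] show ?thesis
      by (simp only: sum_distrib_right mult.assoc)
  qed
  have "(\<Sum>T\<in>cells M. \<Sum>s\<in>UNIV. LINT x:T|lebesgue. - (W s x * pd s \<phi> x) - E x $ s * (Z s x * \<phi> x))
    = (\<Sum>T\<in>cells M. \<Sum>s\<in>UNIV. - (LINT x:T|lebesgue. W s x * pd s \<phi> x) - (LINT x:T|lebesgue. E x $ s * (Z s x * \<phi> x)))"
    by (simp only: cell cong: sum.cong)
  also have "\<dots> = (\<Sum>s\<in>UNIV. \<Sum>T\<in>cells M. - (LINT x:T|lebesgue. W s x * pd s \<phi> x) - (LINT x:T|lebesgue. E x $ s * (Z s x * \<phi> x)))"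
    by (rule sum.swap)
  also have "\<dots> = (\<Sum>s\<in>UNIV. - (\<Sum>T\<in>cells M. LINT x:T|lebesgue. W s x * pd s \<phi> x)
      - (LINT x:Omega M|lebesgue. E x $ s * (Z s x * \<phi> x)))"
    by (simp only: sum_subtractf sum_negf integral_Omega[OF set_integrable_mult_pw[OF E pw_C1_mult[OF Z \<phi>]]])
  finally have A: "(\<Sum>T\<in>cells M. \<Sum>s\<in>UNIV. LINT x:T|lebesgue. - (W s x * pd s \<phi> x) - E x $ s * (Z s x * \<phi> x))
    = (\<Sum>s\<in>UNIV. - (\<Sum>T\<in>cells M. LINT x:T|lebesgue. W s x * pd s \<phi> x)
      - (LINT x:Omega M|lebesgue. E x $ s * (Z s x * \<phi> x)))" .
  have "(\<Sum>e\<in>faces M. face_integral M e (\<lambda>x. (\<Sum>s\<in>UNIV. nrm M e $ s * avg M e (W s) x) * jump M e \<phi> x))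
    = (\<Sum>e\<in>faces M. \<Sum>s\<in>UNIV. face_integral M e (\<lambda>y. nrm M e $ s * (avg M e (W s) y * jump M e \<phi> y)))"
    by (simp only: face cong: sum.cong)
  also have "\<dots> = (\<Sum>s\<in>UNIV. \<Sum>e\<in>faces M. face_integral M e (\<lambda>y. nrm M e $ s * (avg M e (W s) y * jump M e \<phi> y)))"
    by (rule sum.swap)
  finally have B: "(\<Sum>e\<in>faces M. face_integral M e (\<lambda>x. (\<Sum>s\<in>UNIV. nrm M e $ s * avg M e (W s) x) * jump M e \<phi> x))
    = (\<Sum>s\<in>UNIV. \<Sum>e\<in>faces M. face_integral M e (\<lambda>y. nrm M e $ s * (avg M e (W s) y * jump M e \<phi> y)))" .
  show ?thesis
    unfolding A B dhat_by_parts[OF W \<phi>] by (simp add: sum.distrib sum_subtractf sum_negf)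
qed

end

section \<open>One step of the integrator\<close>

locale dlra_state = X: dg_mesh Mx + V: dg_mesh Mv
  for Mx Mv :: "('d::finite) mesh" +
  fixes p q m :: nat and U :: "nat \<Rightarrow> real ^ 'd \<Rightarrow> real" and st :: "'d state"
  assumes valid: "valid_state Mx Mv p q m U st"
begin

abbreviation "I \<equiv> {1..rk st}"

lemma m_le: "m \<le> rk st"
  and X_dg: "i \<in> I \<Longrightarrow> Xf st i \<in> dg_space Mx p"
  and V_dg: "i \<in> I \<Longrightarrow> Vf st i \<in> dg_space Mv q"
  and V_orth: "orthonormal (ipw Mv) (rk st) (Vf st)"
  and V_eq_U: "a \<in> {1..m} \<Longrightarrow> Vf st a = U a"
  using valid unfolding valid_state_def by simp_all

lemma pw_X: "i \<in> I \<Longrightarrow> pw_C1 Mx (Xf st i)"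
  by (rule pw_C1_dg_space[OF X_dg])

lemma pw_V: "i \<in> I \<Longrightarrow> pw_C1 Mv (Vf st i)"
  by (rule pw_C1_dg_space[OF V_dg])

lemma Kf_alt: "Kf st j = (\<lambda>x. \<Sum>i\<in>I. Sf st i j * Xf st i x)"
  by (simp add: Kf_def fun_eq_iff mult.commute)

lemma pw_K: "pw_C1 Mx (Kf st j)"
  unfolding Kf_alt by (intro pw_C1_sum pw_C1_cmult pw_X)

lemma pw_gwV: "j \<in> I \<Longrightarrow> pw_C1 Mv (\<lambda>v. gw v * Vf st j v)"
  by (rule pw_C1_mult[OF pw_C1_C1[OF C1_gw] pw_V])

section \<open>Moments in the velocity variable\<close>

lemma dens_eq: "dens st x = (\<lambda>v. \<Sum>j\<in>I. Kf st j x * (gw v * Vf st j v))"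
proof
  fix v
  have "dens st x v = gw v * (\<Sum>j\<in>I. \<Sum>i\<in>I. Sf st i j * Xf st i x * Vf st j v)"
    unfolding dens_def by (subst sum.swap) simp
  also have "\<dots> = (\<Sum>j\<in>I. Kf st j x * (gw v * Vf st j v))"
    unfolding Kf_def sum_distrib_left sum_distrib_right by (intro sum.cong refl) (simp add: ac_simps)
  finally show "dens st x v = (\<Sum>j\<in>I. Kf st j x * (gw v * Vf st j v))" .
qed

lemma pw_dens: "pw_C1 Mv (dens st x)"
  unfolding dens_eq by (intro pw_C1_sum pw_C1_cmult) (rule pw_gwV)

lemma moment:
  assumes g: "pw_C1 Mv g"
  shows "(LINT v:Omega Mv|lebesgue. g v * dens st x v)
    = (\<Sum>j\<in>I. Kf st j x * (LINT v:Omega Mv|lebesgue. g v * (gw v * Vf st j v)))"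
proof -
  have "(LINT v:Omega Mv|lebesgue. g v * dens st x v)
    = (LINT v:Omega Mv|lebesgue. (\<Sum>j\<in>I. Kf st j x * (g v * (gw v * Vf st j v))))"
    unfolding dens_eq by (simp only: sum_distrib_left mult.left_commute)
  also have "\<dots> = (\<Sum>j\<in>I. Kf st j x * (LINT v:Omega Mv|lebesgue. g v * (gw v * Vf st j v)))"
    by (rule V.integral_Omega_sum[OF pw_C1_mult[OF g pw_gwV]])
  finally show ?thesis .
qed

lemma charge_eq: "charge Mv st x = (\<Sum>j\<in>I. Kf st j x * (LINT v:Omega Mv|lebesgue. gw v * Vf st j v))"
  using moment[OF pw_C1_const[of Mv 1], of x] by (simp add: charge_def)

lemma pw_charge: "pw_C1 Mx (charge Mv st)"
proof -
  have "charge Mv st = (\<lambda>x. \<Sum>j\<in>I. (LINT v:Omega Mv|lebesgue. gw v * Vf st j v) * Kf st j x)"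
    by (simp add: fun_eq_iff charge_eq mult.commute)
  then show ?thesis by (simp add: pw_C1_sum pw_C1_cmult pw_K)
qed

text \<open>The representation of \<open>g\<close> by the fixed velocity functions holds for its
  canonical representative only, that is on open cells; under the integral sign this is no
  restriction.\<close>

lemma coordinate_pairing:
  assumes g: "C1 g" and c: "\<And>v. canon Mv g v = (\<Sum>a\<in>{1..m}. c a * U a v)" and F: "pw_C1 Mv F"
  shows "(LINT v:Omega Mv|lebesgue. g v * F v) = (\<Sum>a\<in>{1..m}. c a * (LINT v:Omega Mv|lebesgue. U a v * F v))"
proof -
  have pU: "pw_C1 Mv (U a)" if "a \<in> {1..m}" for a
    using pw_V[of a] V_eq_U[OF that] that m_le by simp
  have "(LINT v:Omega Mv|lebesgue. g v * F v) = (LINT v:Omega Mv|lebesgue. (\<Sum>a\<in>{1..m}. c a * (U a v * F v)))"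
  proof (rule V.integral_Omega_cong)
    show "set_integrable lebesgue (Omega Mv) (\<lambda>v. \<Sum>a\<in>{1..m}. c a * (U a v * F v))"
      by (intro V.set_integrable_pw pw_C1_sum pw_C1_cmult pw_C1_mult pU F)
    fix v assume "v \<in> V.generic"
    then have "canon Mv g v = g v" using V.canon_interior unfolding V.generic_def by blast
    then have "g v = (\<Sum>a\<in>{1..m}. c a * U a v)" using c[of v] by simp
    then show "g v * F v = (\<Sum>a\<in>{1..m}. c a * (U a v * F v))"
      by (simp only: sum_distrib_right mult.assoc)
  qed
  also have "\<dots> = (\<Sum>a\<in>{1..m}. c a * (LINT v:Omega Mv|lebesgue. U a v * F v))"
    by (rule V.integral_Omega_sum) (intro pw_C1_mult pU F)
  finally show ?thesis .
qed

text \<open>The weight \<open>gw\<close> in the density is the weight of the inner product in which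
  the velocity basis is orthonormal, so testing against \<open>U a\<close> isolates the coefficient
  function \<open>Kf st a\<close> and removes all columns beyond \<open>m\<close>.\<close>

lemma moment_span:
  assumes g: "C1 g" and c: "\<And>v. canon Mv g v = (\<Sum>a\<in>{1..m}. c a * U a v)"
  shows "(LINT v:Omega Mv|lebesgue. g v * dens st x v) = (\<Sum>a\<in>{1..m}. c a * Kf st a x)"
proof -
  have "(LINT v:Omega Mv|lebesgue. g v * (gw v * Vf st j v)) = (\<Sum>a\<in>{1..m}. if a = j then c a else 0)" if j: "j \<in> I" for j
  proof -
    have "(LINT v:Omega Mv|lebesgue. g v * (gw v * Vf st j v))
      = (\<Sum>a\<in>{1..m}. c a * (LINT v:Omega Mv|lebesgue. U a v * (gw v * Vf st j v)))"
      by (rule coordinate_pairing[OF g c pw_gwV[OF j]])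
    also have "\<dots> = (\<Sum>a\<in>{1..m}. if a = j then c a else 0)"
    proof (rule sum.cong[OF refl])
      fix a assume a: "a \<in> {1..m}"
      then have "a \<in> I" using m_le by simp
      have "(LINT v:Omega Mv|lebesgue. U a v * (gw v * Vf st j v)) = ipw Mv (Vf st a) (Vf st j)"
        unfolding ipw_def V_eq_U[OF a] by (simp only: mult.assoc mult.commute[of "gw _"])
      also have "\<dots> = (if a = j then 1 else 0)" by (rule orthonormalD[OF V_orth \<open>a \<in> I\<close> j])
      finally show "c a * (LINT v:Omega Mv|lebesgue. U a v * (gw v * Vf st j v)) = (if a = j then c a else 0)" by simp
    qed
    finally show ?thesis .
  qed
  note inner = this
  have "(LINT v:Omega Mv|lebesgue. g v * dens st x v) = (\<Sum>j\<in>I. Kf st j x * (\<Sum>a\<in>{1..m}. if a = j then c a else 0))"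
    unfolding moment[OF pw_C1_C1[OF g]] by (rule sum.cong[OF refl]) (simp only: inner)
  also have "\<dots> = (\<Sum>j\<in>I. \<Sum>a\<in>{1..m}. if a = j then c a * Kf st a x else 0)"
    unfolding sum_distrib_left by (intro sum.cong refl) simp
  also have "\<dots> = (\<Sum>a\<in>{1..m}. \<Sum>j\<in>I. if a = j then c a * Kf st a x else 0)"
    by (rule sum.swap)
  also have "\<dots> = (\<Sum>a\<in>{1..m}. c a * Kf st a x)"
    using m_le by (intro sum.cong refl) simp
  finally show ?thesis .
qed

text \<open>The flux that remains when the K-step system is tested with \<open>c i\<close> times one
  scalar function; \<open>force_comb\<close> plays the same part for the force.\<close>

definition flux_comb :: "(nat \<Rightarrow> real) \<Rightarrow> 'd \<Rightarrow> real ^ 'd \<Rightarrow> real"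
  where "flux_comb c s x = (\<Sum>i\<in>I. c i * (\<Sum>j\<in>I. Ax Mv st s i j * Kf st j x))"

definition force_comb :: "(nat \<Rightarrow> real) \<Rightarrow> 'd \<Rightarrow> real ^ 'd \<Rightarrow> real"
  where "force_comb c s x = (\<Sum>i\<in>I. c i * (\<Sum>j\<in>I. Bx Mv st s i j * Kf st j x))"

lemma pw_flux_comb: "pw_C1 Mx (flux_comb c s)"
  and pw_force_comb: "pw_C1 Mx (force_comb c s)"
  unfolding flux_comb_def[abs_def] force_comb_def[abs_def] by (intro pw_C1_sum pw_C1_cmult pw_K)+

lemma avg_flux_comb:
  assumes "e \<in> faces Mx" "x \<in> rel_interior e"
  shows "avg Mx e (flux_comb c s) x = (\<Sum>i\<in>I. c i * (\<Sum>j\<in>I. Ax Mv st s i j * avg Mx e (Kf st j) x))"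
proof -
  have 1: "pw_C1 Mx (\<lambda>x. \<Sum>j\<in>I. Ax Mv st s i j * Kf st j x)" for i by (intro pw_C1_sum pw_C1_cmult pw_K)
  have "avg Mx e (flux_comb c s) x = (\<Sum>i\<in>I. avg Mx e (\<lambda>x. c i * (\<Sum>j\<in>I. Ax Mv st s i j * Kf st j x)) x)"
    unfolding flux_comb_def[abs_def] by (rule X.avg_sum[OF assms]) (rule pw_C1_cmult[OF 1])
  also have "\<dots> = (\<Sum>i\<in>I. c i * avg Mx e (\<lambda>x. \<Sum>j\<in>I. Ax Mv st s i j * Kf st j x) x)"
    by (simp only: X.avg_cmult[OF assms 1])
  finally have 2: "avg Mx e (flux_comb c s) x = (\<Sum>i\<in>I. c i * avg Mx e (\<lambda>x. \<Sum>j\<in>I. Ax Mv st s i j * Kf st j x) x)" .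
  have "avg Mx e (\<lambda>x. \<Sum>j\<in>I. Ax Mv st s i j * Kf st j x) x = (\<Sum>j\<in>I. Ax Mv st s i j * avg Mx e (Kf st j) x)" for i
  proof -
    have "avg Mx e (\<lambda>x. \<Sum>j\<in>I. Ax Mv st s i j * Kf st j x) x = (\<Sum>j\<in>I. avg Mx e (\<lambda>x. Ax Mv st s i j * Kf st j x) x)"
      by (rule X.avg_sum[OF assms]) (rule pw_C1_cmult[OF pw_K])
    then show ?thesis by (simp only: X.avg_cmult[OF assms pw_K])
  qed
  with 2 show ?thesis by (simp only:)
qed

lemma k_step_tested:
  assumes k: "k_step Mx Mv p 1 \<tau> E st Knew" and E: "\<And>s. set_integrable lebesgue (Omega Mx) (\<lambda>x. E x $ s)"
    and \<phi>: "\<phi> \<in> dg_space Mx p"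
  shows "1 / \<tau> * (\<Sum>i\<in>I. c i * ip Mx (\<lambda>x. Knew i x - Kf st i x) \<phi>)
      + (\<Sum>T\<in>cells Mx. \<Sum>s\<in>UNIV. LINT x:T|lebesgue. - (flux_comb c s x * pd s \<phi> x) - E x $ s * (force_comb c s x * \<phi> x))
      + (\<Sum>e\<in>faces Mx. face_integral Mx e (\<lambda>x. (\<Sum>s\<in>UNIV. nrm Mx e $ s * avg Mx e (flux_comb c s) x) * jump Mx e \<phi> x))
    = 0"
proof -
  have p\<phi>: "pw_C1 Mx \<phi>" by (rule pw_C1_dg_space[OF \<phi>])
  let ?\<psi> = "\<lambda>i x. c i * \<phi> x"
  have "\<forall>i\<in>I. ?\<psi> i \<in> dg_space Mx p" using dg_space_cmult[OF \<phi>] by simp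
  then have eq: "1 / \<tau> * (\<Sum>i\<in>I. ip Mx (\<lambda>x. Knew i x - Kf st i x) (?\<psi> i))
      + (\<Sum>T\<in>cells Mx. \<Sum>s\<in>UNIV. LINT x:T|lebesgue.
             - (\<Sum>i\<in>I. (\<Sum>j\<in>I. Ax Mv st s i j * Kf st j x) * pd s (?\<psi> i) x)
             - E x $ s * (\<Sum>i\<in>I. (\<Sum>j\<in>I. Bx Mv st s i j * Kf st j x) * ?\<psi> i x))
      + (\<Sum>e\<in>faces Mx. face_integral Mx e
             (\<lambda>x. \<Sum>i\<in>I. num_flux Mx I 1 (Ax Mv st) e (Kf st) i x * jump Mx e (?\<psi> i) x)) = 0"
    by (rule k[unfolded k_step_def Let_def, THEN conjunct2, THEN spec, THEN mp])
  have 1: "ip Mx (\<lambda>x. Knew i x - Kf st i x) (?\<psi> i) = c i * ip Mx (\<lambda>x. Knew i x - Kf st i x) \<phi>" for i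
    unfolding ip_def by (simp only: mult.left_commute[of _ "c i"] set_integral_mult_right)
  have 2: "(LINT x:T|lebesgue.
             - (\<Sum>i\<in>I. (\<Sum>j\<in>I. Ax Mv st s i j * Kf st j x) * pd s (?\<psi> i) x)
             - E x $ s * (\<Sum>i\<in>I. (\<Sum>j\<in>I. Bx Mv st s i j * Kf st j x) * ?\<psi> i x))
     = (LINT x:T|lebesgue. - (flux_comb c s x * pd s \<phi> x) - E x $ s * (force_comb c s x * \<phi> x))"
    if T: "T \<in> cells Mx" for T s
  proof (rule set_integral_spike(1)[OF _ X.negligible_frontier_cell[OF T]])
    have 3: "set_integrable lebesgue T (\<lambda>x. - (flux_comb c s x * pd s \<phi> x))"
      using X.set_integrable_cell_mult_pd[OF pw_flux_comb p\<phi> T, of c s s] by (simp add: set_integrable_def)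
    show "set_integrable lebesgue T (\<lambda>x. - (flux_comb c s x * pd s \<phi> x) - E x $ s * (force_comb c s x * \<phi> x))"
      by (rule set_integral_diff(1)[OF 3 X.set_integrable_mult_pw[OF E pw_C1_mult[OF pw_force_comb p\<phi>] T]])
    fix x assume "x \<in> T" "x \<notin> frontier T"
    then have x: "x \<in> interior T" by (simp add: frontier_def closure_closed[OF X.cell(3)[OF T]])
    have "pd s (?\<psi> i) x = c i * pd s \<phi> x" for i
    proof -
      have "pd s (?\<psi> i) x = pd s (\<lambda>x. c i * piece \<phi> T x) x"
        by (rule pd_cong_open[OF open_interior x]) (simp add: piece(2)[OF p\<phi> T])
      also have "\<dots> = c i * pd s (piece \<phi> T) x" by (rule pd_cmult[OF piece(1)[OF p\<phi> T]])
      finally show ?thesis using X.pd_piece[OF p\<phi> T x] by simp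
    qed
    then have "(\<Sum>i\<in>I. (\<Sum>j\<in>I. Ax Mv st s i j * Kf st j x) * pd s (?\<psi> i) x) = flux_comb c s x * pd s \<phi> x"
      unfolding flux_comb_def sum_distrib_right[of _ I "pd s \<phi> x"] by (simp only: ac_simps)
    moreover have "(\<Sum>i\<in>I. (\<Sum>j\<in>I. Bx Mv st s i j * Kf st j x) * ?\<psi> i x) = force_comb c s x * \<phi> x"
      unfolding force_comb_def sum_distrib_right[of _ I "\<phi> x"] by (simp only: ac_simps)
    ultimately show "- (\<Sum>i\<in>I. (\<Sum>j\<in>I. Ax Mv st s i j * Kf st j x) * pd s (?\<psi> i) x)
             - E x $ s * (\<Sum>i\<in>I. (\<Sum>j\<in>I. Bx Mv st s i j * Kf st j x) * ?\<psi> i x)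
      = - (flux_comb c s x * pd s \<phi> x) - E x $ s * (force_comb c s x * \<phi> x)" by (simp only:)
  qed
  have 3: "face_integral Mx e (\<lambda>x. \<Sum>i\<in>I. num_flux Mx I 1 (Ax Mv st) e (Kf st) i x * jump Mx e (?\<psi> i) x)
    = face_integral Mx e (\<lambda>x. (\<Sum>s\<in>UNIV. nrm Mx e $ s * avg Mx e (flux_comb c s) x) * jump Mx e \<phi> x)" if e: "e \<in> faces Mx" for e
  proof (rule X.face_integral_cong[OF e])
    show "X.face_cont e (\<lambda>x. (\<Sum>s\<in>UNIV. nrm Mx e $ s * avg Mx e (flux_comb c s) x) * jump Mx e \<phi> x)"
      by (intro X.face_cont_mult X.face_cont_sum X.face_cont_const X.face_cont_avg X.face_cont_jump e pw_flux_comb p\<phi>)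
    fix x assume x: "x \<in> rel_interior e"
    \<comment> \<open>For \<open>\<alpha> = 1\<close> the factor of the matrix absolute value is 0,
      so only the mean value survives.\<close>
    have nf: "num_flux Mx I 1 (Ax Mv st) e (Kf st) i x = (\<Sum>s\<in>UNIV. nrm Mx e $ s * (\<Sum>j\<in>I. Ax Mv st s i j * avg Mx e (Kf st j) x))" for i
    proof -
      have "num_flux Mx I 1 (Ax Mv st) e (Kf st) i x = (\<Sum>j\<in>I. \<Sum>s\<in>UNIV. nrm Mx e $ s * Ax Mv st s i j * avg Mx e (Kf st j) x)"
        unfolding num_flux_def face_mat_def by (simp add: sum_distrib_right)
      also have "\<dots> = (\<Sum>s\<in>UNIV. \<Sum>j\<in>I. nrm Mx e $ s * Ax Mv st s i j * avg Mx e (Kf st j) x)" by (rule sum.swap)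
      finally show ?thesis by (simp only: sum_distrib_left mult.assoc)
    qed
    have "(\<Sum>i\<in>I. num_flux Mx I 1 (Ax Mv st) e (Kf st) i x * jump Mx e (?\<psi> i) x)
      = (\<Sum>i\<in>I. \<Sum>s\<in>UNIV. nrm Mx e $ s * (c i * (\<Sum>j\<in>I. Ax Mv st s i j * avg Mx e (Kf st j) x))) * jump Mx e \<phi> x"
      unfolding nf X.jump_cmult[OF e x p\<phi>] sum_distrib_right by (simp only: ac_simps)
    also have "\<dots> = (\<Sum>s\<in>UNIV. nrm Mx e $ s * avg Mx e (flux_comb c s) x) * jump Mx e \<phi> x"
      by (subst sum.swap) (simp only: avg_flux_comb[OF e x] sum_distrib_left)
    finally show "(\<Sum>i\<in>I. num_flux Mx I 1 (Ax Mv st) e (Kf st) i x * jump Mx e (?\<psi> i) x)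
      = (\<Sum>s\<in>UNIV. nrm Mx e $ s * avg Mx e (flux_comb c s) x) * jump Mx e \<phi> x" .
  qed
  show ?thesis using eq by (simp only: 1 2 3 cong: sum.cong)
qed

lemma k_step_dhat:
  assumes "k_step Mx Mv p 1 \<tau> E st Knew" and E: "\<And>s. set_integrable lebesgue (Omega Mx) (\<lambda>x. E x $ s)"
    and "\<phi> \<in> dg_space Mx p"
  shows "1 / \<tau> * (\<Sum>i\<in>I. c i * ip Mx (\<lambda>x. Knew i x - Kf st i x) \<phi>)
    + (\<Sum>s\<in>UNIV. dhat Mx s (flux_comb c s) \<phi>)
    - (\<Sum>s\<in>UNIV. LINT x:Omega Mx|lebesgue. E x $ s * (force_comb c s x * \<phi> x)) = 0"
  using k_step_tested[OF assms(1) E assms(3), of c]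
    X.weak_form_eq_dhat[where W = "flux_comb c" and Z = "force_comb c", OF pw_flux_comb pw_force_comb pw_C1_dg_space[OF assms(3)] E]
  by linarith

text \<open>For a fixed velocity function, column \<open>a\<close> of the S-step has the matrices of
  row \<open>a\<close> of the K-step: its velocity factors are entries of \<open>Ax\<close> and
  \<open>Bx\<close>, its position factors are discrete derivatives and field terms tested with
  \<open>Xt k\<close>. The old coefficient is the component of \<open>Kf st a\<close> along
  \<open>Xt k\<close> by orthonormality, so both updates start from the same value and add the same
  increment.\<close>

lemma s_step_coefficient:
  assumes tau: "\<tau> > 0" and k: "k_step Mx Mv p 1 \<tau> E st Knew"
    and E: "\<And>s. set_integrable lebesgue (Omega Mx) (\<lambda>x. E x $ s)"
    and aug: "augmentation Mx Mv p q m U st Knew Lnew Rx Xt Rv Vt"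
    and s_step: "s_step Mx Mv \<tau> E st Rx Xt Rv Vt Snew"
    and idx: "k \<in> {1..Rx}" "a \<in> {1..m}"
  shows "Snew k a = ip Mx (Xt k) (Knew a)"
proof -
  have Xt: "Xt k \<in> dg_space Mx p" and mRv: "m \<le> Rv" and Vta: "Vt a = U a"
    using aug idx unfolding augmentation_def by simp_all
  define \<phi> where "\<phi> = Xt k"
  have \<phi>: "\<phi> \<in> dg_space Mx p" using Xt by (simp add: \<phi>_def)
  have p\<phi>: "pw_C1 Mx \<phi>" by (rule pw_C1_dg_space[OF \<phi>])
  have aI: "a \<in> I" using idx m_le by simp
  have Va: "Vt a = Vf st a" using Vta V_eq_U[OF idx(2)] by simp
  have pKn: "pw_C1 Mx (Knew a)"
    using k aI pw_C1_dg_space unfolding k_step_def Let_def by blast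
  have ipVV: "ipw Mv (Vt a) (Vf st j) = (if a = j then 1 else 0)" if "j \<in> I" for j
    unfolding Va by (rule orthonormalD[OF V_orth aI that])
  have ipA: "ipw Mv (Vt a) (\<lambda>v. v $ s * Vf st j v) = Ax Mv st s a j" for s j
    unfolding Va Ax_def ipw_def by (simp only: mult.commute[of "Vf st a _"])
  have dB: "dhat Mv s (\<lambda>v. gw v * Vf st j v) (Vt a) = Bx Mv st s a j" for s j
    unfolding Va Bx_def ..
  \<comment> \<open>The unit vector that singles out equation \<open>a\<close> of the K-step
    system.\<close>
  let ?c = "\<lambda>i. if i = a then 1 else 0 :: real"
  have fl: "flux_comb ?c s = (\<lambda>x. \<Sum>j\<in>I. Ax Mv st s a j * Kf st j x)" for s
    unfolding flux_comb_def[abs_def] using aI by (simp add: if_distrib[of "\<lambda>t. t * _"] cong: if_cong)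
  have fo: "force_comb ?c s = (\<lambda>x. \<Sum>j\<in>I. Bx Mv st s a j * Kf st j x)" for s
    unfolding force_comb_def[abs_def] using aI by (simp add: if_distrib[of "\<lambda>t. t * _"] cong: if_cong)
  have dK: "dhat Mx s (Kf st j) \<phi> = (\<Sum>i\<in>I. Sf st i j * dhat Mx s (Xf st i) \<phi>)" for s j
    unfolding Kf_alt by (rule X.dhat_sum_left[OF pw_X p\<phi>])
  have dW: "dhat Mx s (flux_comb ?c s) \<phi> = (\<Sum>i\<in>I. \<Sum>j\<in>I. dhat Mx s (Xf st i) \<phi> * Sf st i j * Ax Mv st s a j)" for s
  proof -
    have "dhat Mx s (flux_comb ?c s) \<phi> = (\<Sum>j\<in>I. Ax Mv st s a j * dhat Mx s (Kf st j) \<phi>)"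
      unfolding fl by (rule X.dhat_sum_left[OF pw_K p\<phi>])
    also have "\<dots> = (\<Sum>j\<in>I. \<Sum>i\<in>I. dhat Mx s (Xf st i) \<phi> * Sf st i j * Ax Mv st s a j)"
      unfolding dK sum_distrib_left by (simp only: ac_simps)
    finally show ?thesis by (subst sum.swap)
  qed
  have EX: "set_integrable lebesgue (Omega Mx) (\<lambda>x. E x $ s * (Xf st i x * \<phi> x))" if "i \<in> I" for s i
    by (rule X.set_integrable_Omega_mult_pw[OF E pw_C1_mult[OF pw_X[OF that] p\<phi>]])
  have EK: "(LINT x:Omega Mx|lebesgue. E x $ s * (Kf st j x * \<phi> x))
     = (\<Sum>i\<in>I. Sf st i j * (LINT x:Omega Mx|lebesgue. E x $ s * (Xf st i x * \<phi> x)))"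
    "set_integrable lebesgue (Omega Mx) (\<lambda>x. E x $ s * (Kf st j x * \<phi> x))" for s j
  proof -
    have *: "E x $ s * (Kf st j x * \<phi> x) = (\<Sum>i\<in>I. Sf st i j * (E x $ s * (Xf st i x * \<phi> x)))" for x
      unfolding Kf_alt sum_distrib_left sum_distrib_right by (simp only: ac_simps)
    show "(LINT x:Omega Mx|lebesgue. E x $ s * (Kf st j x * \<phi> x))
       = (\<Sum>i\<in>I. Sf st i j * (LINT x:Omega Mx|lebesgue. E x $ s * (Xf st i x * \<phi> x)))"
      unfolding * by (rule set_integral_lincomb(1)[OF EX])
    show "set_integrable lebesgue (Omega Mx) (\<lambda>x. E x $ s * (Kf st j x * \<phi> x))"
      unfolding * by (rule set_integral_lincomb(2)[OF EX])
  qed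
  have EZ: "(LINT x:Omega Mx|lebesgue. E x $ s * (force_comb ?c s x * \<phi> x))
    = - (\<Sum>i\<in>I. \<Sum>j\<in>I. ip Mx \<phi> (\<lambda>x. - E x $ s * Xf st i x) * Sf st i j * Bx Mv st s a j)" for s
  proof -
    have "E x $ s * (force_comb ?c s x * \<phi> x) = (\<Sum>j\<in>I. Bx Mv st s a j * (E x $ s * (Kf st j x * \<phi> x)))" for x
      unfolding fo sum_distrib_left sum_distrib_right by (simp only: ac_simps)
    then have "(LINT x:Omega Mx|lebesgue. E x $ s * (force_comb ?c s x * \<phi> x))
      = (\<Sum>j\<in>I. Bx Mv st s a j * (LINT x:Omega Mx|lebesgue. E x $ s * (Kf st j x * \<phi> x)))"
      using set_integral_lincomb(1)[OF EK(2), where A = I and c = "\<lambda>j. Bx Mv st s a j"] by simp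
    also have "\<dots> = (\<Sum>j\<in>I. \<Sum>i\<in>I. Bx Mv st s a j * (Sf st i j * (LINT x:Omega Mx|lebesgue. E x $ s * (Xf st i x * \<phi> x))))"
      unfolding EK(1) sum_distrib_left ..
    also have "\<dots> = (\<Sum>i\<in>I. \<Sum>j\<in>I. Bx Mv st s a j * (Sf st i j * (LINT x:Omega Mx|lebesgue. E x $ s * (Xf st i x * \<phi> x))))"
      by (rule sum.swap)
    also have "\<dots> = (\<Sum>i\<in>I. \<Sum>j\<in>I. - (ip Mx \<phi> (\<lambda>x. - E x $ s * Xf st i x) * Sf st i j * Bx Mv st s a j))"
    proof (intro sum.cong refl)
      fix i j assume i: "i \<in> I"
      have "ip Mx \<phi> (\<lambda>x. - E x $ s * Xf st i x) = (LINT x:Omega Mx|lebesgue. - (E x $ s * (Xf st i x * \<phi> x)))"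
        unfolding ip_def by (simp add: ac_simps)
      also have "\<dots> = - (LINT x:Omega Mx|lebesgue. E x $ s * (Xf st i x * \<phi> x))"
        by (rule set_integral_uminus[OF EX[OF i]])
      finally show "Bx Mv st s a j * (Sf st i j * (LINT x:Omega Mx|lebesgue. E x $ s * (Xf st i x * \<phi> x)))
         = - (ip Mx \<phi> (\<lambda>x. - E x $ s * Xf st i x) * Sf st i j * Bx Mv st s a j)" by simp
    qed
    finally show ?thesis by (simp add: sum_negf)
  qed
  have ipK: "(\<Sum>i\<in>I. \<Sum>j\<in>I. ip Mx \<phi> (Xf st i) * Sf st i j * ipw Mv (Vt a) (Vf st j)) = ip Mx (Kf st a) \<phi>"
  proof -
    have "(\<Sum>i\<in>I. \<Sum>j\<in>I. ip Mx \<phi> (Xf st i) * Sf st i j * ipw Mv (Vt a) (Vf st j))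
      = (\<Sum>i\<in>I. \<Sum>j\<in>I. if a = j then ip Mx \<phi> (Xf st i) * Sf st i j else 0)"
      by (intro sum.cong refl) (simp add: ipVV)
    also have "\<dots> = (\<Sum>i\<in>I. Sf st i a * (LINT x:Omega Mx|lebesgue. Xf st i x * \<phi> x))"
      using aI by (simp add: ip_def mult.commute)
    also have "\<dots> = (LINT x:Omega Mx|lebesgue. (\<Sum>i\<in>I. Sf st i a * (Xf st i x * \<phi> x)))"
      by (rule X.integral_Omega_sum[symmetric]) (intro pw_C1_mult pw_X p\<phi>)
    also have "\<dots> = ip Mx (Kf st a) \<phi>"
      unfolding ip_def Kf_alt sum_distrib_right by (simp only: mult.assoc)
    finally show ?thesis .
  qed
  have kd: "1 / \<tau> * ip Mx (\<lambda>x. Knew a x - Kf st a x) \<phi>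
    + (\<Sum>s\<in>UNIV. dhat Mx s (flux_comb ?c s) \<phi>)
    - (\<Sum>s\<in>UNIV. LINT x:Omega Mx|lebesgue. E x $ s * (force_comb ?c s x * \<phi> x)) = 0"
  proof -
    have "(\<Sum>i\<in>I. ?c i * ip Mx (\<lambda>x. Knew i x - Kf st i x) \<phi>) = ip Mx (\<lambda>x. Knew a x - Kf st a x) \<phi>"
      using aI by (simp add: if_distrib[of "\<lambda>t. t * _"] cong: if_cong)
    then show ?thesis using k_step_dhat[OF k E \<phi>, of ?c] by simp
  qed
  have sum_eq: "(\<Sum>i\<in>I. \<Sum>j\<in>I. \<Sum>s\<in>UNIV.
           dhat Mx s (Xf st i) \<phi> * Sf st i j * Ax Mv st s a j
         + ip Mx \<phi> (\<lambda>x. - E x $ s * Xf st i x) * Sf st i j * Bx Mv st s a j)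
     = (\<Sum>s\<in>UNIV. dhat Mx s (flux_comb ?c s) \<phi>)
       - (\<Sum>s\<in>UNIV. LINT x:Omega Mx|lebesgue. E x $ s * (force_comb ?c s x * \<phi> x))"
  proof -
    have sw: "(\<Sum>i\<in>I. \<Sum>j\<in>I. \<Sum>s\<in>(UNIV::'d set). G i j s) = (\<Sum>s\<in>UNIV. \<Sum>i\<in>I. \<Sum>j\<in>I. G i j s)" for G :: "nat \<Rightarrow> nat \<Rightarrow> 'd \<Rightarrow> real"
    proof -
      have "(\<Sum>i\<in>I. \<Sum>j\<in>I. \<Sum>s\<in>(UNIV::'d set). G i j s) = (\<Sum>i\<in>I. \<Sum>s\<in>(UNIV::'d set). \<Sum>j\<in>I. G i j s)"
        by (intro sum.cong refl sum.swap)
      then show ?thesis using sum.swap[of "\<lambda>i s. \<Sum>j\<in>I. G i j s" "UNIV::'d set" I] by simp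
    qed
    show ?thesis unfolding sw dW EZ by (simp add: sum.distrib sum_negf)
  qed
  have "Snew k a = ip Mx (Kf st a) \<phi> - \<tau> * (\<Sum>i\<in>I. \<Sum>j\<in>I. \<Sum>s\<in>UNIV.
           dhat Mx s (Xf st i) \<phi> * Sf st i j * Ax Mv st s a j
         + ip Mx \<phi> (\<lambda>x. - E x $ s * Xf st i x) * Sf st i j * Bx Mv st s a j)"
  proof -
    have "a \<in> {1..Rv}" using idx mRv by simp
    with idx(1) s_step[unfolded s_step_def Let_def] show ?thesis
      unfolding ipK[symmetric] ipA[symmetric] dB[symmetric] unfolding \<phi>_def by blast
  qed
  also have "\<dots> = ip Mx (Kf st a) \<phi> + ip Mx (\<lambda>x. Knew a x - Kf st a x) \<phi>"
  proof -
    have "\<tau> * ((\<Sum>s\<in>UNIV. dhat Mx s (flux_comb ?c s) \<phi>)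
       - (\<Sum>s\<in>UNIV. LINT x:Omega Mx|lebesgue. E x $ s * (force_comb ?c s x * \<phi> x))) = - ip Mx (\<lambda>x. Knew a x - Kf st a x) \<phi>"
    proof -
      have "\<tau> * y = - z" if "1 / \<tau> * z + u - w = 0" "y = u - w" for y z u w
      proof -
        have "y = - (1 / \<tau> * z)" using that by linarith
        then show ?thesis using tau by simp
      qed
      from this[OF kd refl] show ?thesis .
    qed
    then show ?thesis unfolding sum_eq by linarith
  qed
  also have "\<dots> = ip Mx (Knew a) \<phi>"
  proof -
    have "ip Mx (\<lambda>x. Knew a x - Kf st a x) \<phi> = (LINT x:Omega Mx|lebesgue. Knew a x * \<phi> x - Kf st a x * \<phi> x)"
      unfolding ip_def by (simp only: left_diff_distrib)
    also have "\<dots> = ip Mx (Knew a) \<phi> - ip Mx (Kf st a) \<phi>"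
      unfolding ip_def by (intro set_integral_diff X.set_integrable_pw pw_C1_mult pKn pw_K p\<phi>)
    finally show ?thesis by simp
  qed
  also have "\<dots> = ip Mx (Xt k) (Knew a)" unfolding \<phi>_def ip_def by (simp only: mult.commute)
  finally show ?thesis .
qed

text \<open>The augmented position space contains the new K-function, so the inner products found in
  the S-step are its exact expansion coefficients; nothing is lost by projection.\<close>

lemma augmented_K:
  assumes tau: "\<tau> > 0" and k: "k_step Mx Mv p 1 \<tau> E st Knew"
    and E: "\<And>s. set_integrable lebesgue (Omega Mx) (\<lambda>x. E x $ s)"
    and aug: "augmentation Mx Mv p q m U st Knew Lnew Rx Xt Rv Vt"
    and s_step: "s_step Mx Mv \<tau> E st Rx Xt Rv Vt Snew"
    and a: "a \<in> {1..m}"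
  shows "(\<Sum>k=1..Rx. Snew k a * Xt k x) = Knew a x"
proof -
  have aI: "a \<in> I" using a m_le by simp
  have Xt: "\<forall>k\<in>{1..Rx}. Xt k \<in> dg_space Mx p" and orth: "orthonormal (ip Mx) Rx Xt"
    and span: "lin_span (Xt ` {1..Rx}) = lin_span (Xf st ` I \<union> Knew ` I)"
    using aug unfolding augmentation_def by simp_all
  have pX: "pw_C1 Mx (Xt k)" if "k \<in> {1..Rx}" for k using Xt that pw_C1_dg_space by blast
  have "Knew a \<in> lin_span (Xt ` {1..Rx})" unfolding span using aI by (intro lin_span_base) blast
  then obtain d where d: "\<And>y. Knew a y = (\<Sum>k\<in>{1..Rx}. d k * Xt k y)"
    using lin_span_image[OF orthonormal_inj[OF orth]] by (metis finite_atLeastAtMost)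
  have "Snew k a = d k" if kk: "k \<in> {1..Rx}" for k
  proof -
    have "Snew k a = ip Mx (Xt k) (Knew a)" by (rule s_step_coefficient[OF tau k E aug s_step kk a])
    also have "\<dots> = (LINT x:Omega Mx|lebesgue. (\<Sum>l\<in>{1..Rx}. d l * (Xt k x * Xt l x)))"
      unfolding ip_def d sum_distrib_left by (simp only: mult.left_commute)
    also have "\<dots> = (\<Sum>l\<in>{1..Rx}. d l * (LINT x:Omega Mx|lebesgue. Xt k x * Xt l x))"
      by (rule X.integral_Omega_sum) (intro pw_C1_mult pX kk)
    also have "\<dots> = (\<Sum>l\<in>{1..Rx}. if k = l then d l else 0)"
      using orthonormalD[OF orth kk] unfolding ip_def by (intro sum.cong refl) simp
    also have "\<dots> = d k" using kk by simp
    finally show ?thesis .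
  qed
  then show ?thesis unfolding d by (intro sum.cong refl) simp
qed

text \<open>Whatever singular values are dropped, the second sum has velocity functions spanned by
  \<open>Vt l\<close> with \<open>l > m\<close>, which are orthogonal to every \<open>U a\<close> in
  the weighted inner product. Moments against the span of the \<open>U a\<close> therefore see the
  untouched first sum only.\<close>

lemma current_truncated:
  assumes tau: "\<tau> > 0" and k: "k_step Mx Mv p 1 \<tau> E st Knew"
    and E: "\<And>s. set_integrable lebesgue (Omega Mx) (\<lambda>x. E x $ s)"
    and aug: "augmentation Mx Mv p q m U st Knew Lnew Rx Xt Rv Vt"
    and s_step: "s_step Mx Mv \<tau> E st Rx Xt Rv Vt Snew"
    and trunc: "truncation Mx Mv m U Rx Xt Rv Vt Snew st'"
    and g: "C1 g" and c: "\<And>v. canon Mv g v = (\<Sum>a\<in>{1..m}. c a * U a v)"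
  shows "(LINT v:Omega Mv|lebesgue. g v * dens st' x v) = (\<Sum>a\<in>{1..m}. c a * Knew a x)"
proof -
  have orth: "orthonormal (ipw Mv) Rv Vt" and Vt: "\<forall>l\<in>{1..Rv}. Vt l \<in> dg_space Mv q" and mRv: "m \<le> Rv"
    and VtU: "\<forall>a\<in>{1..m}. Vt a = U a"
    using aug unfolding augmentation_def by simp_all
  have pVt: "pw_C1 Mv (Vt l)" if "l \<in> {1..Rv}" for l using Vt that pw_C1_dg_space by blast
  obtain R R' \<sigma> P Q where tr: "R' \<le> R \<and>
       (\<forall>k\<in>{1..R}. 0 \<le> \<sigma> k) \<and> (\<forall>k\<in>{1..R}. \<forall>l\<in>{1..R}. k \<le> l \<longrightarrow> \<sigma> l \<le> \<sigma> k) \<and>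
       orthonormal (ip Mx) R P \<and> (\<forall>k\<in>{1..R}. P k \<in> lin_span (Xt ` {1..Rx})) \<and>
       orthonormal (ipw Mv) R Q \<and> (\<forall>k\<in>{1..R}. Q k \<in> lin_span (Vt ` {m+1..Rv})) \<and>
       (\<forall>x v. (\<Sum>l=m+1..Rv. (\<Sum>k=1..Rx. Snew k l * Xt k x) * Vt l v) = (\<Sum>k=1..R. \<sigma> k * P k x * Q k v)) \<and>
       (\<forall>x v. dens st' x v = gw v * (\<Sum>a=1..m. (\<Sum>k=1..Rx. Snew k a * Xt k x) * U a v)
        + gw v * (\<Sum>k=1..R'. \<sigma> k * P k x * Q k v))"
    using trunc unfolding truncation_def Let_def by (elim exE) (rule that)
  from tr have R: "R' \<le> R" by (elim conjE)
  from tr have Q: "\<forall>k\<in>{1..R}. Q k \<in> lin_span (Vt ` {m+1..Rv})" by (elim conjE)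
  from tr have dens': "\<forall>x v. dens st' x v = gw v * (\<Sum>a=1..m. (\<Sum>k=1..Rx. Snew k a * Xt k x) * U a v)
        + gw v * (\<Sum>k=1..R'. \<sigma> k * P k x * Q k v)" by (elim conjE)
  have pU: "pw_C1 Mv (U a)" if "a \<in> {1..m}" for a using VtU pVt[of a] that mRv by simp
  have Qc: "\<exists>d. \<forall>y. Q k y = (\<Sum>l\<in>{m+1..Rv}. d l * Vt l y)" if "k \<in> {1..R'}" for k
  proof -
    have inj: "inj_on Vt {m+1..Rv}" by (rule inj_on_subset[OF orthonormal_inj[OF orth]]) simp
    have "Q k \<in> lin_span (Vt ` {m+1..Rv})" using Q R that by simp
    then obtain d where "\<And>y. Q k y = (\<Sum>l\<in>{m+1..Rv}. d l * Vt l y)"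
      using lin_span_image[OF inj] by (metis finite_atLeastAtMost)
    then show ?thesis by blast
  qed
  have pQ: "pw_C1 Mv (Q k)" if kk: "k \<in> {1..R'}" for k
  proof -
    obtain d where "\<forall>y. Q k y = (\<Sum>l\<in>{m+1..Rv}. d l * Vt l y)" using Qc[OF kk] by blast
    then have "Q k = (\<lambda>y. \<Sum>l\<in>{m+1..Rv}. d l * Vt l y)" by (simp add: fun_eq_iff)
    moreover have "pw_C1 Mv (\<lambda>y. \<Sum>l\<in>{m+1..Rv}. d l * Vt l y)"
      by (intro pw_C1_sum pw_C1_cmult pVt) simp
    ultimately show ?thesis by simp
  qed
  have VV: "(LINT v:Omega Mv|lebesgue. U a v * (gw v * Vt l v)) = (if a = l then 1 else 0)" if "a \<in> {1..m}" "l \<in> {1..Rv}" for a l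
  proof -
    have "(LINT v:Omega Mv|lebesgue. U a v * (gw v * Vt l v)) = ipw Mv (Vt a) (Vt l)"
      using VtU that(1) unfolding ipw_def by (simp add: ac_simps)
    also have "\<dots> = (if a = l then 1 else 0)" by (rule orthonormalD[OF orth]) (use that mRv in auto)
    finally show ?thesis .
  qed
  have gU: "(LINT v:Omega Mv|lebesgue. g v * (gw v * U b v)) = c b" if b: "b \<in> {1..m}" for b
  proof -
    have "(LINT v:Omega Mv|lebesgue. g v * (gw v * U b v)) = (\<Sum>a\<in>{1..m}. c a * (LINT v:Omega Mv|lebesgue. U a v * (gw v * U b v)))"
      by (rule coordinate_pairing[OF g c]) (intro pw_C1_mult pw_C1_C1[OF C1_gw] pU b)
    also have "\<dots> = (\<Sum>a\<in>{1..m}. if a = b then c a else 0)"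
    proof (intro sum.cong refl)
      fix a assume a: "a \<in> {1..m}"
      have "Vt b = U b" "b \<in> {1..Rv}" using VtU b mRv by simp_all
      then show "c a * (LINT v:Omega Mv|lebesgue. U a v * (gw v * U b v)) = (if a = b then c a else 0)"
        using VV[OF a, of b] by simp
    qed
    also have "\<dots> = c b" using b by simp
    finally show ?thesis .
  qed
  have gQ: "(LINT v:Omega Mv|lebesgue. g v * (gw v * Q k v)) = 0" if kk: "k \<in> {1..R'}" for k
  proof -
    obtain d where d: "\<forall>y. Q k y = (\<Sum>l\<in>{m+1..Rv}. d l * Vt l y)" using Qc[OF kk] by blast
    have "(LINT v:Omega Mv|lebesgue. U a v * (gw v * Q k v)) = 0" if a: "a \<in> {1..m}" for a
    proof -
      have "(LINT v:Omega Mv|lebesgue. U a v * (gw v * Q k v))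
        = (LINT v:Omega Mv|lebesgue. (\<Sum>l\<in>{m+1..Rv}. d l * (U a v * (gw v * Vt l v))))"
        using d by (simp add: sum_distrib_left ac_simps)
      also have "\<dots> = (\<Sum>l\<in>{m+1..Rv}. d l * (LINT v:Omega Mv|lebesgue. U a v * (gw v * Vt l v)))"
        by (rule V.integral_Omega_sum) (intro pw_C1_mult pw_C1_C1[OF C1_gw] pU[OF a] pVt, simp)
      also have "\<dots> = 0" by (rule sum.neutral) (use VV[OF a] a in auto)
      finally show ?thesis .
    qed
    moreover have "(LINT v:Omega Mv|lebesgue. g v * (gw v * Q k v)) = (\<Sum>a\<in>{1..m}. c a * (LINT v:Omega Mv|lebesgue. U a v * (gw v * Q k v)))"
      by (rule coordinate_pairing[OF g c]) (intro pw_C1_mult pw_C1_C1[OF C1_gw] pQ kk)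
    ultimately show ?thesis by simp
  qed
  have Kt: "(\<Sum>k=1..Rx. Snew k a * Xt k x) = Knew a x" if "a \<in> {1..m}" for a
    by (rule augmented_K[OF tau k E aug s_step that])
  have split: "g v * dens st' x v = (\<Sum>a\<in>{1..m}. Knew a x * (g v * (gw v * U a v)))
      + (\<Sum>k\<in>{1..R'}. (\<sigma> k * P k x) * (g v * (gw v * Q k v)))" for v
  proof -
    have 1: "dens st' x v = gw v * (\<Sum>a\<in>{1..m}. Knew a x * U a v) + gw v * (\<Sum>k\<in>{1..R'}. \<sigma> k * P k x * Q k v)"
      using dens' Kt by simp
    have 2: "g v * (gw v * (\<Sum>a\<in>{1..m}. Knew a x * U a v)) = (\<Sum>a\<in>{1..m}. Knew a x * (g v * (gw v * U a v)))"
      unfolding sum_distrib_left by (intro sum.cong refl) (simp add: ac_simps)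
    have 3: "g v * (gw v * (\<Sum>k\<in>{1..R'}. \<sigma> k * P k x * Q k v)) = (\<Sum>k\<in>{1..R'}. (\<sigma> k * P k x) * (g v * (gw v * Q k v)))"
      unfolding sum_distrib_left by (intro sum.cong refl) (simp add: ac_simps)
    show ?thesis unfolding 1 distrib_left 2 3 ..
  qed
  have p1: "pw_C1 Mv (\<lambda>v. g v * (gw v * U a v))" if "a \<in> {1..m}" for a
    by (intro pw_C1_mult pw_C1_C1[OF g] pw_C1_C1[OF C1_gw] pU that)
  have p2: "pw_C1 Mv (\<lambda>v. g v * (gw v * Q k v))" if "k \<in> {1..R'}" for k
    by (intro pw_C1_mult pw_C1_C1[OF g] pw_C1_C1[OF C1_gw] pQ that)
  have "(LINT v:Omega Mv|lebesgue. g v * dens st' x v)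
    = (LINT v:Omega Mv|lebesgue. (\<Sum>a\<in>{1..m}. Knew a x * (g v * (gw v * U a v))))
      + (LINT v:Omega Mv|lebesgue. (\<Sum>k\<in>{1..R'}. (\<sigma> k * P k x) * (g v * (gw v * Q k v))))"
    unfolding split by (rule V.integral_Omega_add) (intro pw_C1_sum pw_C1_cmult p1 p2, assumption)+
  also have "\<dots> = (\<Sum>a\<in>{1..m}. Knew a x * (LINT v:Omega Mv|lebesgue. g v * (gw v * U a v)))
      + (\<Sum>k\<in>{1..R'}. (\<sigma> k * P k x) * (LINT v:Omega Mv|lebesgue. g v * (gw v * Q k v)))"
    using V.integral_Omega_sum[OF p1, of "{1..m}" "\<lambda>a. a" "\<lambda>a. Knew a x"]
      V.integral_Omega_sum[OF p2, of "{1..R'}" "\<lambda>a. a" "\<lambda>k. \<sigma> k * P k x"] by simp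
  also have "\<dots> = (\<Sum>a\<in>{1..m}. c a * Knew a x)" using gU gQ by (simp add: mult.commute)
  finally show ?thesis .
qed

end

section \<open>Mollification by periodic kernels\<close>

text \<open>The test function used later is a convolution with a derivative of the kernel and must
  itself be continuously differentiable, so the kernel needs two derivatives.\<close>

definition C2 :: "(real ^ 'd::finite \<Rightarrow> real) \<Rightarrow> bool"
  where "C2 F \<longleftrightarrow> (\<exists>F'. (\<forall>x. (F has_derivative (\<lambda>h. F' x \<bullet> h)) (at x)) \<and> (\<forall>s. C1 (\<lambda>x. F' x $ s)))"

lemma C2I: "(\<And>x. (F has_derivative (\<lambda>h. F' x \<bullet> h)) (at x)) \<Longrightarrow> (\<And>s. C1 (\<lambda>x. F' x $ s)) \<Longrightarrow> C2 F"
  unfolding C2_def by blast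

lemma C2_imp_C1: "C2 F \<Longrightarrow> C1 F"
proof -
  assume "C2 F"
  then obtain F' where F: "\<forall>x. (F has_derivative (\<lambda>h. F' x \<bullet> h)) (at x)" "\<forall>s. C1 (\<lambda>x. F' x $ s)"
    unfolding C2_def by blast
  have "continuous_on UNIV (\<lambda>x. \<chi> s. F' x $ s)"
    using F(2) C1_continuous by (intro continuous_on_vec_lambda) blast
  then have "continuous_on UNIV F'" by simp
  then show ?thesis using F(1) by (intro C1I[of F']) simp_all
qed

lemma C2_pd: "C2 F \<Longrightarrow> C1 (pd s F)"
proof -
  assume "C2 F"
  then obtain F' where F: "\<forall>x. (F has_derivative (\<lambda>h. F' x \<bullet> h)) (at x)" "\<forall>s. C1 (\<lambda>x. F' x $ s)"
    unfolding C2_def by blast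
  have "pd s F = (\<lambda>x. F' x $ s)"
    using pd_has_derivative[OF F(1)[rule_format]] by (simp add: fun_eq_iff inner_axis)
  then show ?thesis using F(2) by simp
qed

lemma C2_const: "C2 (\<lambda>x. c)"
  by (rule C2I[where F' = "\<lambda>x. 0"]) (simp_all add: C1_const)

lemma C2_mult:
  assumes "C2 F" "C2 G" shows "C2 (\<lambda>x. F x * G x)"
proof -
  obtain F' where F: "\<forall>x. (F has_derivative (\<lambda>h. F' x \<bullet> h)) (at x)" "\<forall>s. C1 (\<lambda>x. F' x $ s)"
    using assms(1) unfolding C2_def by blast
  obtain G' where G: "\<forall>x. (G has_derivative (\<lambda>h. G' x \<bullet> h)) (at x)" "\<forall>s. C1 (\<lambda>x. G' x $ s)"
    using assms(2) unfolding C2_def by blast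
  show ?thesis
  proof (rule C2I[where F' = "\<lambda>x. F x *\<^sub>R G' x + G x *\<^sub>R F' x"])
    show "((\<lambda>x. F x * G x) has_derivative (\<lambda>h. (F x *\<^sub>R G' x + G x *\<^sub>R F' x) \<bullet> h)) (at x)" for x
      using has_derivative_mult[OF F(1)[rule_format, of x] G(1)[rule_format, of x]]
      by (simp add: inner_add_left mult.commute)
    show "C1 (\<lambda>x. (F x *\<^sub>R G' x + G x *\<^sub>R F' x) $ s)" for s
      using C1_add[OF C1_mult[OF C2_imp_C1[OF assms(1)] G(2)[rule_format, of s]]
          C1_mult[OF C2_imp_C1[OF assms(2)] F(2)[rule_format, of s]]] by simp
  qed
qed

lemma C2_coordinate:
  assumes h: "\<And>t. (h has_real_derivative h' t) (at t)" and h': "\<And>t. (h' has_real_derivative h'' t) (at t)"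
    and c: "continuous_on UNIV h''"
  shows "C2 (\<lambda>x. h (x $ i))"
proof (rule C2I[where F' = "\<lambda>x. axis i (h' (x $ i))"])
  show "((\<lambda>x. h (x $ i)) has_derivative (\<lambda>k. axis i (h' (x $ i)) \<bullet> k)) (at x)" for x
    using has_derivative_compose[OF bounded_linear_imp_has_derivative[OF bounded_linear_vec_nth] h[of "x $ i", unfolded has_field_derivative_def]]
    by (simp add: inner_axis')
  show "C1 (\<lambda>x. axis i (h' (x $ i)) $ s)" for s
  proof (cases "s = i")
    case True
    have "C1 (\<lambda>x. h' (x $ i))" by (rule C1_compose[OF C1_nth c h'])
    then show ?thesis using True by (simp add: axis_def)
  qed (simp add: axis_def C1_const)
qed

lemma C2_cos: "C2 (\<lambda>x. cos (c * x $ i))"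
  by (rule C2_coordinate[where h = "\<lambda>t. cos (c * t)" and h' = "\<lambda>t. - c * sin (c * t)" and h'' = "\<lambda>t. - c * (c * cos (c * t))"])
    (auto intro!: derivative_eq_intros continuous_intros)

lemma C2_sin: "C2 (\<lambda>x. sin (c * x $ i))"
  by (rule C2_coordinate[where h = "\<lambda>t. sin (c * t)" and h' = "\<lambda>t. c * cos (c * t)" and h'' = "\<lambda>t. - c * (c * sin (c * t))"])
    (auto intro!: derivative_eq_intros continuous_intros)

text \<open>
  Kernels that are finite sums of products \<open>a(x) b(y)\<close>. For these, Fubini's theorem and differentiation under
  the integral sign are mere linearity; trigonometric kernels in \<open>x - y\<close> are of this form.
\<close>

inductive sep :: "((real ^ 'd::finite \<Rightarrow> real) \<Rightarrow> bool) \<Rightarrow> (real ^ 'd \<Rightarrow> real ^ 'd \<Rightarrow> real) \<Rightarrow> bool"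
  for C where
  sep_base: "C a \<Longrightarrow> C1 b \<Longrightarrow> sep C (\<lambda>x y. a x * b y)"
| sep_add: "sep C k \<Longrightarrow> sep C l \<Longrightarrow> sep C (\<lambda>x y. k x y + l x y)"

lemma sep_mult:
  assumes "sep C2 k" "sep C2 l" shows "sep C2 (\<lambda>x y. k x y * l x y)"
  using assms(1)
proof induction
  case (sep_base a b)
  note ab = this
  show ?case using assms(2)
  proof induction
    case (sep_base c d)
    have "sep C2 (\<lambda>x y. (a x * c x) * (b y * d y))"
      by (rule sep.sep_base[of C2, OF C2_mult[OF ab(1) sep_base(1)] C1_mult[OF ab(2) sep_base(2)]])
    then show ?case by (simp only: ac_simps)
  next
    case (sep_add k l)
    show ?case unfolding distrib_left by (rule sep.sep_add[OF sep_add.IH])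
  qed
next
  case (sep_add k l)
  show ?case unfolding distrib_right by (rule sep.sep_add[OF sep_add.IH])
qed

lemma sep_const: "sep C2 (\<lambda>x y. c)"
  using sep_base[of C2, OF C2_const[of c] C1_const[of 1]] by simp

lemma sep_prod: "finite A \<Longrightarrow> (\<And>i. i \<in> A \<Longrightarrow> sep C2 (k i)) \<Longrightarrow> sep C2 (\<lambda>x y. \<Prod>i\<in>A. k i x y)"
  by (induction A rule: finite_induct) (simp_all add: sep_const sep_mult)

lemma sep_power: "sep C2 k \<Longrightarrow> sep C2 (\<lambda>x y. k x y ^ n)"
  by (induction n) (simp_all add: sep_const sep_mult)

lemma sep_C1_left: "sep C1 k \<Longrightarrow> C1 (\<lambda>x. k x y)"
  by (induction rule: sep.induct) (intro C1_mult C1_add C1_const; assumption)+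

lemma sep_C2_imp_C1: "sep C2 k \<Longrightarrow> sep C1 k"
  by (induction rule: sep.induct) (auto intro: sep.intros C2_imp_C1)

lemma sep_pd: "sep C2 k \<Longrightarrow> sep C1 (\<lambda>x y. pd s (\<lambda>x. k x y) x)"
proof (induction rule: sep.induct)
  case (sep_base a b)
  have "pd s (\<lambda>x. a x * b y) x = pd s a x * b y" for x y
    using pd_mult[OF C2_imp_C1[OF sep_base(1)] C1_const[of "b y"], of s x] by (simp add: pd_const)
  then show ?case using sep.sep_base[of C1, OF C2_pd[OF sep_base(1)] sep_base(2)] by simp
next
  case (sep_add k l)
  have "pd s (\<lambda>x. k x y + l x y) x = pd s (\<lambda>x. k x y) x + pd s (\<lambda>x. l x y) x" for x y
    by (rule pd_add[OF sep_C1_left[OF sep_C2_imp_C1[OF sep_add(1)]] sep_C1_left[OF sep_C2_imp_C1[OF sep_add(2)]]])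
  then show ?case using sep.sep_add[of C1, OF sep_add.IH] by simp
qed

lemma pd_shift: "pd s (\<lambda>x. k (x - y)) x = pd s k (x - y)"
  unfolding pd_def by (simp add: algebra_simps)

lemma pd_reflect:
  assumes "C1 k" shows "pd s (\<lambda>y. k (x - y)) y = - pd s k (x - y)"
proof -
  obtain k' where k: "\<And>x. (k has_derivative (\<lambda>h. k' x \<bullet> h)) (at x)"
    by (rule C1E[OF assms]) (rule that)
  have "((\<lambda>y. k (x - y)) has_derivative (\<lambda>h. k' (x - y) \<bullet> (- h))) (at y)"
    by (rule has_derivative_compose[where g = k, OF _ k]) (auto intro!: derivative_eq_intros)
  from pd_has_derivative[OF this, of s] pd_has_derivative[OF k, of s "x - y"] show ?thesis by simp
qed

lemma pd_odd:
  assumes "C1 k" "\<And>z. k (- z) = k z" shows "pd s k (- z) = - pd s k z"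
proof -
  have "pd s (\<lambda>y. k (0 - y)) z = - pd s k (0 - z)" by (rule pd_reflect[OF assms(1)])
  then show ?thesis using assms(2) by simp
qed

lemma pd_periodic: "(\<And>z. k (z + w) = k z) \<Longrightarrow> pd s k (z + w) = pd s k z"
proof -
  assume p: "\<And>z. k (z + w) = k z"
  have "k (z + w + t *\<^sub>R axis s 1) = k (z + t *\<^sub>R axis s 1)" for t
    using p[of "z + t *\<^sub>R axis s 1"] by (simp add: algebra_simps)
  then show ?thesis unfolding pd_def by simp
qed

section \<open>Convolution with separable kernels\<close>

context dg_mesh
begin

abbreviation "L1 f \<equiv> set_integrable lebesgue (Omega M) (f :: real ^ 'd \<Rightarrow> real)"

lemma L1_mult_C1: "L1 f \<Longrightarrow> C1 b \<Longrightarrow> L1 (\<lambda>y. f y * b y)"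
  by (rule set_integrable_Omega_mult_pw[OF _ pw_C1_C1])

text \<open>For a product \<open>a(x) b(y)\<close> the convolution is a multiple of
  \<open>a\<close>. The integrability clauses belong to the induction hypothesis: without them the
  integral of a sum of kernels would not split.\<close>

lemma sep_convolution:
  assumes "sep C1 k" and \<Phi>: "L1 \<Phi>"
  shows "C1 (\<lambda>x. LINT y:Omega M|lebesgue. \<Phi> y * k x y) \<and>
    (\<forall>s x. pd s (\<lambda>x. LINT y:Omega M|lebesgue. \<Phi> y * k x y) x = (LINT y:Omega M|lebesgue. \<Phi> y * pd s (\<lambda>x. k x y) x)) \<and>
    (\<forall>x. L1 (\<lambda>y. \<Phi> y * k x y)) \<and> (\<forall>s x. L1 (\<lambda>y. \<Phi> y * pd s (\<lambda>x. k x y) x))"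
  using assms(1)
proof induction
  case (sep_base a b)
  have b: "L1 (\<lambda>y. \<Phi> y * b y)" by (rule L1_mult_C1[OF \<Phi> sep_base(2)])
  have 1: "\<Phi> y * (a x * b y) = a x * (\<Phi> y * b y)" for x y by simp
  have 2: "pd s (\<lambda>x. a x * b y) x = pd s a x * b y" for s x y
    using pd_mult[OF sep_base(1) C1_const[of "b y"], of s x] by (simp add: pd_const)
  have 3: "\<Phi> y * (pd s a x * b y) = pd s a x * (\<Phi> y * b y)" for s x y by simp
  have 4: "pd s (\<lambda>x. a x * r) x = pd s a x * r" for s x r
    using pd_mult[OF sep_base(1) C1_const[of r], of s x] by (simp add: pd_const)
  have 5: "C1 (\<lambda>x. a x * r)" for r by (rule C1_mult[OF sep_base(1) C1_const])
  show ?case unfolding 1 2 3 set_integral_mult_right 4 using b 5 by simp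
next
  case (sep_add k l)
  note k = sep_add.IH(1) and l = sep_add.IH(2)
  have kl: "L1 (\<lambda>y. \<Phi> y * k x y)" "L1 (\<lambda>y. \<Phi> y * l x y)"
    "L1 (\<lambda>y. \<Phi> y * pd s (\<lambda>x. k x y) x)" "L1 (\<lambda>y. \<Phi> y * pd s (\<lambda>x. l x y) x)" for s x
    using k l by blast+
  have 1: "(LINT y:Omega M|lebesgue. \<Phi> y * (k x y + l x y))
      = (LINT y:Omega M|lebesgue. \<Phi> y * k x y) + (LINT y:Omega M|lebesgue. \<Phi> y * l x y)" for x
    unfolding distrib_left by (rule set_integral_add(2)[OF kl(1,2)])
  have p: "pd s (\<lambda>x. k x y + l x y) x = pd s (\<lambda>x. k x y) x + pd s (\<lambda>x. l x y) x" for s x y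
    by (rule pd_add[OF sep_C1_left[OF sep_add(1)] sep_C1_left[OF sep_add(2)]])
  have 2: "(LINT y:Omega M|lebesgue. \<Phi> y * (pd s (\<lambda>x. k x y) x + pd s (\<lambda>x. l x y) x))
      = (LINT y:Omega M|lebesgue. \<Phi> y * pd s (\<lambda>x. k x y) x) + (LINT y:Omega M|lebesgue. \<Phi> y * pd s (\<lambda>x. l x y) x)" for s x
    unfolding distrib_left by (rule set_integral_add(2)[OF kl(3,4)])
  have c: "C1 (\<lambda>x. LINT y:Omega M|lebesgue. \<Phi> y * k x y)" "C1 (\<lambda>x. LINT y:Omega M|lebesgue. \<Phi> y * l x y)"
    using k l by blast+
  have i: "L1 (\<lambda>y. \<Phi> y * (k x y + l x y))" "L1 (\<lambda>y. \<Phi> y * (pd s (\<lambda>x. k x y) x + pd s (\<lambda>x. l x y) x))" for s x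
    unfolding distrib_left by (rule set_integral_add(1)[OF kl(1,2)], rule set_integral_add(1)[OF kl(3,4)])
  show ?case unfolding 1 p 2 using C1_add[OF c] pd_add[OF c] k l i by simp
qed

text \<open>For a product kernel both sides are the same product of two integrals. The integrability
  of the outer integrands is again carried along for the addition step.\<close>

lemma sep_Fubini:
  assumes "sep C1 k" and f: "L1 f" and h: "L1 h"
  shows "(LINT x:Omega M|lebesgue. f x * (LINT y:Omega M|lebesgue. h y * k x y))
      = (LINT y:Omega M|lebesgue. h y * (LINT x:Omega M|lebesgue. f x * k x y))
    \<and> (\<forall>y. L1 (\<lambda>x. f x * k x y)) \<and> L1 (\<lambda>x. f x * (LINT y:Omega M|lebesgue. h y * k x y))
    \<and> L1 (\<lambda>y. h y * (LINT x:Omega M|lebesgue. f x * k x y))"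
  using assms(1)
proof induction
  case (sep_base a b)
  have i: "L1 (\<lambda>y. h y * b y)" "L1 (\<lambda>x. f x * a x)" using L1_mult_C1 f h sep_base by blast+
  have 1: "h y * (a x * b y) = a x * (h y * b y)" "f x * (a x * b y) = (f x * a x) * b y"
    "f x * (a x * r) = (f x * a x) * r" "h y * (r * b y) = r * (h y * b y)" for x y r by simp_all
  show ?case unfolding 1 set_integral_mult_right set_integral_mult_left using i by simp
next
  case (sep_add k l)
  have kh: "L1 (\<lambda>y. h y * k x y)" "L1 (\<lambda>y. h y * l x y)" for x
    using sep_convolution[OF sep_add(1) h] sep_convolution[OF sep_add(2) h] by blast+
  have kf: "L1 (\<lambda>x. f x * k x y)" "L1 (\<lambda>x. f x * l x y)" for y using sep_add.IH by blast+
  have o: "L1 (\<lambda>x. f x * (LINT y:Omega M|lebesgue. h y * k x y))" "L1 (\<lambda>x. f x * (LINT y:Omega M|lebesgue. h y * l x y))"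
    "L1 (\<lambda>y. h y * (LINT x:Omega M|lebesgue. f x * k x y))" "L1 (\<lambda>y. h y * (LINT x:Omega M|lebesgue. f x * l x y))"
    using sep_add.IH by blast+
  have kf': "L1 (\<lambda>x. f x * k x y + f x * l x y)" for y by (rule set_integral_add(1)[OF kf])
  show ?case
    unfolding distrib_left set_integral_add(2)[OF kh] set_integral_add(2)[OF kf]
    unfolding distrib_left set_integral_add(2)[OF o(1,2)] set_integral_add(2)[OF o(3,4)]
    using sep_add.IH set_integral_add(1)[OF o(1,2)] set_integral_add(1)[OF o(3,4)] kf' by simp
qed

section \<open>The trigonometric kernel\<close>

lemma half_one_plus_cos: "0 \<le> (1 + cos t) / 2" "(1 + cos t) / 2 \<le> 1" for t :: real
proof -
  have 1: "0 \<le> (1 + c) / 2" if "- 1 \<le> c" for c :: real using that by simp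
  have 2: "(1 + c) / 2 \<le> 1" if "c \<le> 1" for c :: real using that by simp
  show "0 \<le> (1 + cos t) / 2" "(1 + cos t) / 2 \<le> 1"
    using 1[OF cos_ge_minus_one] 2[OF cos_le_one] .
qed

text \<open>All factors lie between 0 and 1, and the value 1 is attained exactly at the periods, so
  powers concentrate there. The addition theorem for the cosine splits the kernel in
  \<open>x - y\<close> into finitely many products, which a cut-off kernel would not permit.\<close>

definition bump :: "real ^ 'd \<Rightarrow> real"
  where "bump z = (\<Prod>i\<in>UNIV. (1 + cos (2 * pi / (hi M $ i - lo M $ i) * z $ i)) / 2)"

lemma sep_bump: "sep C2 (\<lambda>x y. bump (x - y) ^ n)"
proof (rule sep_power)
  have "sep C2 (\<lambda>x y. (1 + cos (2 * pi / (hi M $ i - lo M $ i) * (x - y) $ i)) / 2)" for i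
  proof -
    define c where "c = 2 * pi / (hi M $ i - lo M $ i)"
    have "sep C2 (\<lambda>x y. 1 / 2 + ((1 / 2 * cos (c * x $ i)) * cos (c * y $ i) + (1 / 2 * sin (c * x $ i)) * sin (c * y $ i)))"
      by (intro sep_add sep_const sep_base C2_mult C2_const C2_cos C2_sin C2_imp_C1)
    moreover have "1 / 2 + ((1 / 2 * cos (c * x $ i)) * cos (c * y $ i) + (1 / 2 * sin (c * x $ i)) * sin (c * y $ i))
      = (1 + cos (c * (x - y) $ i)) / 2" for x y :: "real ^ 'd"
      by (simp add: cos_diff right_diff_distrib)
    ultimately show ?thesis unfolding c_def[symmetric] by (simp only:)
  qed
  then show "sep C2 (\<lambda>x y. bump (x - y))" unfolding bump_def by (intro sep_prod) simp_all
qed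

lemma C1_bump_power: "C1 (\<lambda>z. bump z ^ n)" "C1 (pd s (\<lambda>z. bump z ^ n))"
proof -
  have "sep C2 (\<lambda>x y. bump (x - y) ^ n)" by (rule sep_bump)
  from sep_C1_left[OF sep_C2_imp_C1[OF this], of 0] show "C1 (\<lambda>z. bump z ^ n)" by simp
  from sep_C1_left[OF sep_pd[OF sep_bump[of n], of s], of 0] show "C1 (pd s (\<lambda>z. bump z ^ n))" by simp
qed

lemma bump_even: "bump (- z) = bump z"
  by (simp add: bump_def)

lemma bump_periodic: assumes "w \<in> periods M" shows "bump (z + w) = bump z"
proof -
  obtain k :: "'d \<Rightarrow> int" where k: "\<And>i. w $ i = of_int (k i) * (hi M $ i - lo M $ i)"
    using assms unfolding periods_def by blast
  have "cos (2 * pi / (hi M $ i - lo M $ i) * (z + w) $ i) = cos (2 * pi / (hi M $ i - lo M $ i) * z $ i)" for i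
  proof -
    have "hi M $ i - lo M $ i \<noteq> 0" using lo_less_hi[of i] by simp
    then have "2 * pi / (hi M $ i - lo M $ i) * (z + w) $ i = 2 * pi / (hi M $ i - lo M $ i) * z $ i + 2 * pi * of_int (k i)"
      by (simp add: k distrib_left)
    then show ?thesis by (simp add: cos_add)
  qed
  then show ?thesis by (simp add: bump_def)
qed

lemma bump_range: "0 \<le> bump z" "bump z \<le> 1" "bump 0 = 1"
proof -
  show "0 \<le> bump z" unfolding bump_def by (intro prod_nonneg ballI half_one_plus_cos)
  show "bump z \<le> 1" unfolding bump_def by (intro prod_le_1 conjI half_one_plus_cos)
  show "bump 0 = 1" by (simp add: bump_def)
qed

text \<open>With \<open>y\<close> in the open box, no coordinate of \<open>x - y\<close> reaches a
  full side length, so \<open>x - y\<close> is a period only if it is zero.\<close>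

lemma bump_less_one:
  assumes "x \<in> Omega M" "y \<in> box (lo M) (hi M)" "x \<noteq> y"
  shows "bump (x - y) < 1"
proof -
  obtain i where i: "x $ i \<noteq> y $ i" using assms(3) by (auto simp: vec_eq_iff)
  let ?L = "hi M $ i - lo M $ i" and ?f = "\<lambda>i. (1 + cos (2 * pi / (hi M $ i - lo M $ i) * (x - y) $ i)) / 2"
  have L: "?L > 0" using lo_less_hi[of i] by simp
  have "lo M $ i \<le> x $ i" "x $ i \<le> hi M $ i" "lo M $ i < y $ i" "y $ i < hi M $ i"
    using assms(1,2) by (simp_all add: Omega_def mem_box_cart)
  then have d: "\<bar>x $ i - y $ i\<bar> < ?L" by linarith
  have "cos (2 * pi / ?L * (x - y) $ i) \<noteq> 1"
  proof
    assume "cos (2 * pi / ?L * (x - y) $ i) = 1"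
    then obtain n :: int where "2 * pi / ?L * (x - y) $ i = of_int n * 2 * pi" unfolding cos_one_2pi_int by blast
    then have "2 * pi * ((x $ i - y $ i) / ?L) = 2 * pi * of_int n" by (simp add: mult.commute mult.left_commute)
    then have "(x $ i - y $ i) / ?L = of_int n" by (rule mult_left_cancel[THEN iffD1, rotated]) simp
    then have n: "x $ i - y $ i = of_int n * ?L" using L by (simp add: field_simps)
    then have "n \<noteq> 0" using i by auto
    then have "1 \<le> \<bar>real_of_int n\<bar>" by linarith
    then have "1 * ?L \<le> \<bar>real_of_int n\<bar> * ?L" using L by (intro mult_right_mono) simp_all
    then show False using d n L by (simp add: abs_mult)
  qed
  then have "cos (2 * pi / ?L * (x - y) $ i) < 1" using cos_le_one by (simp add: less_le)
  then have fi: "?f i < 1" by simp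
  have f: "0 \<le> ?f j \<and> ?f j \<le> 1" for j
    by (intro conjI half_one_plus_cos)
  have "bump (x - y) = ?f i * (\<Prod>j\<in>UNIV - {i}. ?f j)"
    unfolding bump_def by (rule prod.remove) simp_all
  also have "\<dots> \<le> ?f i * 1"
    by (rule mult_left_mono[OF prod_le_1]) (use f in auto)
  finally show ?thesis using fi by simp
qed

lemma continuous_bump: "continuous_on UNIV bump"
  using C1_continuous[OF C1_bump_power(1)[of 1]] by simp

text \<open>The mesh only serves as a partition of the box: a smooth periodic function has no jumps,
  so the divergence theorem of the mesh leaves nothing.\<close>

lemma integral_pd_periodic:
  assumes F: "C1 F" and per: "\<And>x z. z \<in> periods M \<Longrightarrow> F (x + z) = F x"
  shows "(LINT x:Omega M|lebesgue. pd s F x) = 0"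
proof -
  have pF: "pw_C1 M F" by (rule pw_C1_C1[OF F])
  have tr: "trace e \<sigma> F p = F p" if e: "e \<in> faces M" "\<sigma> \<in> {1, -1}" "p \<in> e" for e \<sigma> p
  proof -
    have "trace e \<sigma> F p = F (p - snd (nbr e \<sigma>))"
      unfolding trace_def by (rule piece_eq[OF nbr_cell(1)[OF e(1,2)] pF C1_continuous[OF F] refl face_in_cell[OF e]])
    also have "\<dots> = F p" using per[OF nbr_cell(2)[OF e(1,2)], of "p - snd (nbr e \<sigma>)"] by simp
    finally show ?thesis .
  qed
  have "(LINT x:Omega M|lebesgue. pd s F x) = (\<Sum>T\<in>cells M. LINT y:T|lebesgue. pd s F y)"
    by (rule integral_Omega) (rule set_integral_cell(2)[OF _ continuous_on_pd[OF F] refl])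
  also have "\<dots> = (\<Sum>e\<in>faces M. face_integral M e (\<lambda>y. nrm M e $ s * jump M e F y))"
    by (rule dg_divergence[OF pF])
  also have "\<dots> = (\<Sum>e\<in>faces M. face_integral M e (\<lambda>y. 0))"
  proof (rule sum.cong[OF refl], rule face_integral_cong[OF _ face_cont_const])
    fix e p assume e: "e \<in> faces M" and pr: "p \<in> rel_interior e"
    then have p: "p \<in> e" using rel_interior_subset by blast
    show "nrm M e $ s * jump M e F p = 0"
      unfolding jump_def trm_tendsto(2)[OF pF e pr] trp_tendsto(2)[OF pF e pr] using tr[OF e _ p] by simp
  qed
  finally show ?thesis by (simp add: face_integral_zero)
qed

lemma L1_C1: "C1 F \<Longrightarrow> L1 F"
  by (rule set_integrable_pw[OF pw_C1_C1])

lemma C1_shift: "C1 F \<Longrightarrow> C1 (\<lambda>x. F (x - y))"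
proof -
  assume F: "C1 F"
  obtain F' where F': "continuous_on UNIV F'" "\<And>x. (F has_derivative (\<lambda>h. F' x \<bullet> h)) (at x)"
    by (rule C1E[OF F]) (rule that)
  show ?thesis
  proof (rule C1I[where F' = "\<lambda>x. F' (x - y)"])
    show "continuous_on UNIV (\<lambda>x. F' (x - y))"
      by (intro continuous_on_compose2[OF F'(1)] continuous_intros) auto
    show "((\<lambda>x. F (x - y)) has_derivative (\<lambda>h. F' (x - y) \<bullet> h)) (at x)" for x
      by (rule has_derivative_compose[where g = F, OF _ F'(2)]) (auto intro!: derivative_eq_intros)
  qed
qed

lemma C1_reflect: "C1 F \<Longrightarrow> C1 (\<lambda>y. F (x - y))"
proof -
  assume F: "C1 F"
  obtain F' where F': "continuous_on UNIV F'" "\<And>x. (F has_derivative (\<lambda>h. F' x \<bullet> h)) (at x)"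
    by (rule C1E[OF F]) (rule that)
  show ?thesis
  proof (rule C1I[where F' = "\<lambda>y. - F' (x - y)"])
    show "continuous_on UNIV (\<lambda>y. - F' (x - y))"
      by (intro continuous_intros continuous_on_compose2[OF F'(1)]) auto
    have "((\<lambda>y. F (x - y)) has_derivative (\<lambda>h. F' (x - y) \<bullet> (- h))) (at y)" for y
      by (rule has_derivative_compose[where g = F, OF _ F'(2)]) (auto intro!: derivative_eq_intros)
    then show "((\<lambda>y. F (x - y)) has_derivative (\<lambda>h. (- F' (x - y)) \<bullet> h)) (at y)" for y by simp
  qed
qed

text \<open>The derivative of the mass with respect to the centre is the integral of a derivative of
  a periodic function. A normalization independent of the centre is a constant factor and so
  preserves the orthogonality of the mollified density to the field.\<close>

lemma kernel_mass_const:
  "(LINT x:Omega M|lebesgue. bump (x - y) ^ n) = (LINT x:Omega M|lebesgue. bump (x - y') ^ n)"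
proof -
  define \<beta> where "\<beta> = (\<lambda>z. bump z ^ n)"
  have \<beta>: "C1 \<beta>" using C1_bump_power(1)[of n] by (simp add: \<beta>_def)
  have ev: "\<beta> (a - b) = \<beta> (b - a)" for a b using bump_even[of "a - b"] by (simp add: \<beta>_def)
  have sep: "sep C1 (\<lambda>x y. \<beta> (x - y))" unfolding \<beta>_def by (rule sep_C2_imp_C1[OF sep_bump])
  define m where "m = (\<lambda>y. LINT x:Omega M|lebesgue. 1 * \<beta> (y - x))"
  note conv = sep_convolution[OF sep L1_C1[OF C1_const[of 1]]]
  have mC: "C1 m" using conv unfolding m_def by blast
  have "pd s m y = 0" for s y
  proof -
    have "pd s m y = (LINT x:Omega M|lebesgue. 1 * pd s (\<lambda>y. \<beta> (y - x)) y)" using conv unfolding m_def by blast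
    also have "\<dots> = (LINT x:Omega M|lebesgue. - pd s (\<lambda>x. \<beta> (y - x)) x)"
      by (simp add: pd_shift pd_reflect[OF \<beta>])
    also have "\<dots> = - (LINT x:Omega M|lebesgue. pd s (\<lambda>x. \<beta> (y - x)) x)"
    proof (rule set_integral_uminus)
      have "L1 (\<lambda>x. 1 * pd s (\<lambda>y. \<beta> (y - x)) y)" using conv by blast
      then have "L1 (\<lambda>x. - pd s (\<lambda>x. \<beta> (y - x)) x)" by (simp add: pd_shift pd_reflect[OF \<beta>])
      then show "L1 (\<lambda>x. pd s (\<lambda>x. \<beta> (y - x)) x)" by (simp add: set_integrable_def)
    qed
    also have "(LINT x:Omega M|lebesgue. pd s (\<lambda>x. \<beta> (y - x)) x) = 0"
    proof (rule integral_pd_periodic[OF C1_reflect[OF \<beta>]])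
      fix x z assume "z \<in> periods M"
      then have "bump (y - x + - z) = bump (y - x)" by (intro bump_periodic periods_uminus)
      then show "\<beta> (y - (x + z)) = \<beta> (y - x)" by (simp add: \<beta>_def algebra_simps)
    qed
    finally show ?thesis by simp
  qed
  note pd0 = this
  obtain m' where m': "\<And>x. (m has_derivative (\<lambda>h. m' x \<bullet> h)) (at x)" "\<And>x s. pd s m x = m' x $ s"
    by (rule C1_pd[OF mC]) (rule that)
  have "m' x = 0" for x using m'(2) pd0 by (simp add: vec_eq_iff)
  then have "(m has_derivative (\<lambda>h. 0)) (at x within UNIV)" for x using m'(1)[of x] by simp
  then have "\<exists>c. \<forall>x\<in>UNIV. m x = c" by (intro has_derivative_zero_constant) simp_all
  then have "m y = m y'" by (metis UNIV_I)
  then show ?thesis unfolding m_def by (simp add: ev[of y] ev[of y']) (simp add: \<beta>_def)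
qed

section \<open>Concentration of the powers of the kernel\<close>

lemma lmeasurable_Omega: "Omega M \<in> lmeasurable"
  unfolding Omega_def by simp

lemma L1_const: "L1 (\<lambda>x. c)"
  by (rule L1_C1[OF C1_const])

lemma integral_Omega_const: "(LINT x:Omega M|lebesgue. c) = measure lebesgue (Omega M) * c"
  unfolding set_lebesgue_integral_def by (simp add: mult.commute Omega_def)

lemma integral_mono_Omega:
  assumes "L1 f" "L1 g" "\<And>x. x \<in> Omega M \<Longrightarrow> f x \<le> g x"
  shows "(LINT x:Omega M|lebesgue. f x) \<le> (LINT x:Omega M|lebesgue. g x)"
  using assms(1,2) unfolding set_lebesgue_integral_def set_integrable_def
  by (rule integral_mono) (use assms(3) in \<open>simp add: indicator_def\<close>)

text \<open>The kernel exceeds \<open>t\<close> on a small ball around \<open>y\<close>, and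
  \<open>v\<close> is the volume of that ball. Hence the mass decays no faster than
  \<open>t ^ n\<close>, for every \<open>t\<close> below 1.\<close>

lemma kernel_mass_pos:
  assumes y: "y \<in> box (lo M) (hi M)" and t: "0 \<le> t" "t < 1" and d: "0 < d"
  obtains v where "v > 0" "\<And>n. v * t ^ n \<le> (LINT x:Omega M|lebesgue. bump (x - y) ^ n)"
proof -
  have "open {z. bump z > t}" by (intro open_Collect_less continuous_bump continuous_intros)
  moreover have "0 \<in> {z. bump z > t}" using t bump_range(3) by simp
  ultimately obtain r where r: "r > 0" "ball 0 r \<subseteq> {z. bump z > t}" by (rule openE)
  obtain r' where r': "r' > 0" "ball y r' \<subseteq> box (lo M) (hi M)"
    using y open_box by (meson openE)
  let ?B = "ball y (min r r')"
  have sub: "?B \<subseteq> Omega M" using r'(2) box_subset_cbox unfolding Omega_def by (meson dual_order.trans subset_ball min.cobounded2)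
  have mB: "measure lebesgue ?B > 0" using r r' by (simp add: content_ball_pos)
  have "measure lebesgue ?B * t ^ n \<le> (LINT x:Omega M|lebesgue. bump (x - y) ^ n)" for n
  proof -
    have i: "L1 (\<lambda>x. indicator ?B x * t ^ n)"
    proof -
      have "set_integrable lebesgue (Omega M) (\<lambda>x. indicator ?B x *\<^sub>R t ^ n)"
        using set_integrable_subset[OF L1_const[of "t ^ n"], of ?B] sub
        unfolding set_integrable_def by (simp add: indicator_inter_arith[symmetric] Int_absorb1 mult.assoc[symmetric])
      then show ?thesis by simp
    qed
    have "measure lebesgue ?B * t ^ n = (LINT x:Omega M|lebesgue. indicator ?B x * t ^ n)"
    proof -
      have "(LINT x:Omega M|lebesgue. indicator ?B x * t ^ n) = (LINT x|lebesgue. indicator ?B x * t ^ n)"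
        unfolding set_lebesgue_integral_def using sub by (intro Bochner_Integration.integral_cong) (auto simp: indicator_def)
      moreover have "(LINT x|lebesgue. indicator ?B x * t ^ n) = measure lebesgue ?B * t ^ n" by simp
      ultimately show ?thesis by (simp only:)
    qed
    also have "\<dots> \<le> (LINT x:Omega M|lebesgue. bump (x - y) ^ n)"
    proof (rule integral_mono_Omega[OF i])
      show "L1 (\<lambda>x. bump (x - y) ^ n)" using L1_C1[OF C1_shift[OF C1_bump_power(1)[of n], of y]] .
      fix x
      show "indicator ?B x * t ^ n \<le> bump (x - y) ^ n"
      proof (cases "x \<in> ?B")
        case True
        then have "x - y \<in> ball 0 r" by (simp add: dist_norm norm_minus_commute)
        then have "t \<le> bump (x - y)" using r(2) by auto
        then show ?thesis using True t by (simp add: power_mono)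
      qed (simp add: bump_range)
    qed
    finally show ?thesis .
  qed
  then show ?thesis by (rule that[OF mB])
qed

text \<open>On the compact complement of the ball the kernel attains its maximum, which is below 1
  there.\<close>

lemma kernel_localized:
  assumes y: "y \<in> box (lo M) (hi M)" and d: "0 < d"
  obtains t where "0 \<le> t" "t < 1" "\<And>x. x \<in> Omega M \<Longrightarrow> x \<notin> ball y d \<Longrightarrow> bump (x - y) \<le> t"
proof (cases "Omega M - ball y d = {}")
  case True
  show ?thesis by (rule that[of 0]) (use True in auto)
next
  case False
  have "compact (Omega M - ball y d)" unfolding Omega_def by (intro compact_diff compact_cbox open_ball)
  moreover have "continuous_on (Omega M - ball y d) (\<lambda>x. bump (x - y))"
    by (intro continuous_on_compose2[OF continuous_bump] continuous_intros) auto
  ultimately obtain x0 where x0: "x0 \<in> Omega M - ball y d" "\<forall>x\<in>Omega M - ball y d. bump (x - y) \<le> bump (x0 - y)"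
    using continuous_attains_sup[OF _ False] by blast
  have "x0 \<noteq> y" using x0(1) d by auto
  then have "bump (x0 - y) < 1" using bump_less_one[OF _ y] x0(1) by simp
  then show ?thesis using that[of "bump (x0 - y)"] bump_range(1) x0(2) by simp
qed

lemma approximate_identity:
  assumes y: "y \<in> box (lo M) (hi M)" and g: "L1 g" and B: "\<And>x. \<bar>g x\<bar> \<le> B" and cont: "isCont g y"
  shows "(\<lambda>n. (LINT x:Omega M|lebesgue. g x * bump (x - y) ^ n) / (LINT x:Omega M|lebesgue. bump (x - y) ^ n)) \<longlonglongrightarrow> g y"
proof (rule LIMSEQ_I)
  fix r :: real assume r: "0 < r"
  let ?W = "\<lambda>n. LINT x:Omega M|lebesgue. bump (x - y) ^ n"
  let ?A = "\<lambda>n. LINT x:Omega M|lebesgue. g x * bump (x - y) ^ n"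
  let ?\<mu> = "measure lebesgue (Omega M)"
  have C: "C1 (\<lambda>x. bump (x - y) ^ n)" for n by (rule C1_shift[OF C1_bump_power(1)])
  obtain d where d: "d > 0" "\<And>x. dist x y < d \<Longrightarrow> \<bar>g x - g y\<bar> < r / 2"
    using cont r unfolding continuous_at_eps_delta dist_real_def by (meson half_gt_zero)
  obtain t where t: "0 \<le> t" "t < 1" "\<And>x. x \<in> Omega M \<Longrightarrow> x \<notin> ball y d \<Longrightarrow> bump (x - y) \<le> t"
    by (rule kernel_localized[OF y d(1)]) (rule that)
  \<comment> \<open>A rate strictly between \<open>t\<close> and 1: away from \<open>y\<close> the
    kernel is at most \<open>t ^ n\<close>, while its mass is at least a constant times
    \<open>t' ^ n\<close>, so the relative weight of the far part decays like
    \<open>(t / t') ^ n\<close>.\<close>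
  define t' where "t' = (1 + t) / 2"
  have t': "0 < t'" "t' < 1" "t < t'" using t by (simp_all add: t'_def)
  obtain v where v: "v > 0" "\<And>n. v * t' ^ n \<le> ?W n"
    by (rule kernel_mass_pos[OF y less_imp_le[OF t'(1)] t'(2) d(1)]) (rule that)
  have W: "?W n > 0" for n using v(2)[of n] v(1) t'(1) by (meson mult_pos_pos zero_less_power less_le_trans)
  have est: "\<bar>?A n / ?W n - g y\<bar> \<le> r / 2 + 2 * B * ?\<mu> / v * (t / t') ^ n" for n
  proof -
    have i1: "L1 (\<lambda>x. g x * bump (x - y) ^ n)" by (rule L1_mult_C1[OF g C])
    have i2: "L1 (\<lambda>x. g y * bump (x - y) ^ n)" by (rule L1_C1[OF C1_cmult[OF C]])
    have i3: "L1 (\<lambda>x. r / 2 * bump (x - y) ^ n)" by (rule L1_C1[OF C1_cmult[OF C]])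
    have i4: "L1 (\<lambda>x. r / 2 * bump (x - y) ^ n + 2 * B * t ^ n)" by (rule set_integral_add(1)[OF i3 L1_const])
    have i5: "L1 (\<lambda>x. g x * bump (x - y) ^ n - g y * bump (x - y) ^ n)" by (rule set_integral_diff(1)[OF i1 i2])
    have i6: "L1 (\<lambda>x. - (g x * bump (x - y) ^ n - g y * bump (x - y) ^ n))" using set_integrable_mult_right[of "-1", OF i5] by (simp only: mult_minus1)
    have bnd: "\<bar>g x * bump (x - y) ^ n - g y * bump (x - y) ^ n\<bar> \<le> r / 2 * bump (x - y) ^ n + 2 * B * t ^ n" if x: "x \<in> Omega M" for x
    proof -
      have p: "0 \<le> bump (x - y) ^ n" using bump_range(1) by simp
      have eq: "\<bar>g x * bump (x - y) ^ n - g y * bump (x - y) ^ n\<bar> = \<bar>g x - g y\<bar> * bump (x - y) ^ n"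
        using p by (simp add: abs_mult left_diff_distrib[symmetric])
      have B0: "0 \<le> B" using B[of y] by linarith
      show ?thesis
      proof (cases "x \<in> ball y d")
        case True
        then have "\<bar>g x - g y\<bar> \<le> r / 2" using d(2)[of x] by (simp add: dist_commute)
        then have "\<bar>g x - g y\<bar> * bump (x - y) ^ n \<le> r / 2 * bump (x - y) ^ n" using p by (rule mult_right_mono)
        moreover have "0 \<le> 2 * B * t ^ n" using B0 t by simp
        ultimately show ?thesis unfolding eq by linarith
      next
        case False
        have "\<bar>g x - g y\<bar> \<le> 2 * B" using B[of x] B[of y] by linarith
        moreover have "bump (x - y) ^ n \<le> t ^ n" using t(3)[OF x False] bump_range(1) by (rule power_mono)
        ultimately have "\<bar>g x - g y\<bar> * bump (x - y) ^ n \<le> 2 * B * t ^ n" using p B0 by (intro mult_mono) simp_all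
        moreover have "0 \<le> r / 2 * bump (x - y) ^ n" using p r by simp
        ultimately show ?thesis unfolding eq by linarith
      qed
    qed
    have up: "(LINT x:Omega M|lebesgue. r / 2 * bump (x - y) ^ n + 2 * B * t ^ n) = r / 2 * ?W n + 2 * B * ?\<mu> * t ^ n"
      unfolding set_integral_add(2)[OF i3 L1_const] integral_Omega_const by simp
    have D: "(LINT x:Omega M|lebesgue. g x * bump (x - y) ^ n - g y * bump (x - y) ^ n) = ?A n - g y * ?W n"
      unfolding set_integral_diff(2)[OF i1 i2] by simp
    have "?A n - g y * ?W n \<le> r / 2 * ?W n + 2 * B * ?\<mu> * t ^ n"
      unfolding D[symmetric] up[symmetric] by (rule integral_mono_Omega[OF i5 i4]) (use bnd in \<open>simp add: abs_le_iff\<close>)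
    moreover have "- (?A n - g y * ?W n) \<le> r / 2 * ?W n + 2 * B * ?\<mu> * t ^ n"
      unfolding D[symmetric] up[symmetric] set_integral_uminus[OF i5, symmetric]
      by (rule integral_mono_Omega[OF i6 i4]) (use bnd in \<open>simp add: abs_le_iff\<close>)
    ultimately have 1: "\<bar>?A n - g y * ?W n\<bar> \<le> r / 2 * ?W n + 2 * B * ?\<mu> * t ^ n" by linarith
    have "\<bar>?A n / ?W n - g y\<bar> = \<bar>?A n - g y * ?W n\<bar> / ?W n"
      using W[of n] by (simp add: field_simps abs_divide)
    also have "\<dots> \<le> (r / 2 * ?W n + 2 * B * ?\<mu> * t ^ n) / ?W n" using 1 W[of n] by (simp add: divide_right_mono)
    also have "\<dots> = r / 2 + 2 * B * ?\<mu> * t ^ n / ?W n" using W[of n] by (simp add: add_divide_distrib)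
    also have "2 * B * ?\<mu> * t ^ n / ?W n \<le> 2 * B * ?\<mu> * t ^ n / (v * t' ^ n)"
    proof (rule divide_left_mono[OF v(2)])
      have "0 \<le> B" using B[of y] by linarith
      then show "0 \<le> 2 * B * ?\<mu> * t ^ n" using t by simp
      show "0 < ?W n * (v * t' ^ n)" using W[of n] v(1) t'(1) by simp
    qed
    also have "2 * B * ?\<mu> * t ^ n / (v * t' ^ n) = 2 * B * ?\<mu> / v * (t / t') ^ n"
      by (simp add: power_divide)
    finally show ?thesis by simp
  qed
  have "(\<lambda>n. r / 2 + 2 * B * ?\<mu> / v * (t / t') ^ n) \<longlonglongrightarrow> r / 2 + 2 * B * ?\<mu> / v * 0"
    by (intro tendsto_intros LIMSEQ_realpow_zero) (use t t' in simp_all)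
  then have "\<forall>\<^sub>F n in sequentially. r / 2 + 2 * B * ?\<mu> / v * (t / t') ^ n < r"
    by (rule order_tendstoD(2)) (use r in simp)
  then obtain N where "\<forall>n\<ge>N. r / 2 + 2 * B * ?\<mu> / v * (t / t') ^ n < r"
    unfolding eventually_sequentially by blast
  then have "\<forall>n\<ge>N. norm (?A n / ?W n - g y) < r" using est by (smt (verit) real_norm_def)
  then show "\<exists>N. \<forall>n\<ge>N. norm (?A n / ?W n - g y) < r" by blast
qed

end

section \<open>Balance and conservation of momentum\<close>

lemma set_integral_vec:
  fixes f :: "'d::finite \<Rightarrow> 'a \<Rightarrow> real"
  assumes "\<And>s. set_integrable N S (f s)"
  shows "(LINT x:S|N. (\<chi> s. f s x)) = (\<chi> s. LINT x:S|N. f s x)"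
proof -
  have vec: "(\<chi> s. g s) = (\<Sum>s\<in>UNIV. g s *\<^sub>R axis s (1::real))" for g :: "'d \<Rightarrow> real"
    by (simp add: vec_eq_iff axis_def if_distrib[of "\<lambda>t. _ * t"] cong: if_cong)
  have i: "integrable N (\<lambda>x. indicator S x *\<^sub>R f s x)" for s using assms unfolding set_integrable_def .
  have eq: "indicator S x *\<^sub>R (\<chi> s. f s x) = (\<Sum>s\<in>UNIV. (indicator S x *\<^sub>R f s x) *\<^sub>R axis s (1::real))" for x
    unfolding vec scaleR_sum_right by simp
  have "(LINT x:S|N. (\<chi> s. f s x)) = (\<Sum>s\<in>UNIV. LINT x|N. (indicator S x *\<^sub>R f s x) *\<^sub>R axis s (1::real))"
    unfolding set_lebesgue_integral_def eq
    by (rule Bochner_Integration.integral_sum) (rule integrable_scaleR_left[OF i])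
  also have "\<dots> = (\<Sum>s\<in>UNIV. (LINT x|N. indicator S x *\<^sub>R f s x) *\<^sub>R axis s (1::real))"
    by (rule sum.cong[OF refl]) (rule integral_scaleR_left[OF i])
  also have "\<dots> = (\<chi> s. LINT x:S|N. f s x)"
    unfolding vec[symmetric] set_lebesgue_integral_def ..
  finally show ?thesis .
qed

section \<open>Vanishing of the total electric force\<close>

context dg_mesh
begin

lemma sq_integrable_L1:
  assumes "sq_integrable M g" shows "L1 g"
proof -
  let ?L = "lebesgue_on (Omega M)"
  have m: "g \<in> borel_measurable ?L" and sq: "integrable ?L (\<lambda>x. (g x)\<^sup>2)"
    using assms by (simp_all add: sq_integrable_def)
  have s: "Omega M \<inter> space lebesgue \<in> sets lebesgue" using lmeasurable_Omega by (simp add: fmeasurableD)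
  have "integrable ?L (\<lambda>x. 1 :: real)"
    using L1_const[of 1] integrable_restrict_space[OF s, of "\<lambda>x. 1 :: real"] unfolding set_integrable_def by simp
  then have "integrable ?L (\<lambda>x. 1 + (g x)\<^sup>2)" using sq by (rule Bochner_Integration.integrable_add)
  then have "integrable ?L g"
  proof (rule Bochner_Integration.integrable_bound[OF _ m], intro AE_I2)
    fix x
    have "0 \<le> (\<bar>g x\<bar> - 1)\<^sup>2" by simp
    then have "2 * \<bar>g x\<bar> \<le> 1 + (g x)\<^sup>2" by (simp add: power2_eq_square algebra_simps)
    then have "\<bar>g x\<bar> \<le> 1 + (g x)\<^sup>2" using abs_ge_zero[of "g x"] by linarith
    then show "norm (g x) \<le> norm (1 + (g x)\<^sup>2)" by simp
  qed
  then show ?thesis unfolding set_integrable_def integrable_restrict_space[OF s, symmetric] .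
qed

lemma periodic_C1I:
  assumes "C1 \<phi>" "\<And>x z. z \<in> periods M \<Longrightarrow> \<phi> (x + z) = \<phi> x"
  shows "periodic_C1 M \<phi>"
proof -
  obtain F' where "\<And>x. (\<phi> has_derivative (\<lambda>h. F' x \<bullet> h)) (at x)" by (rule C1E[OF assms(1)]) (rule that)
  then have "\<forall>x. \<phi> differentiable (at x)" unfolding differentiable_def by blast
  then show ?thesis using assms continuous_on_pd[OF assms(1)] unfolding periodic_C1_def by simp
qed

lemma pw_C1_bounded:
  assumes "pw_C1 M F"
  obtains B where "\<And>x. x \<in> generic \<Longrightarrow> \<bar>F x\<bar> \<le> B"
proof -
  have "\<exists>B. \<forall>x\<in>T. \<bar>piece F T x\<bar> \<le> B" if T: "T \<in> cells M" for T
  proof -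
    have "compact (piece F T ` T)"
      by (rule compact_continuous_image[OF continuous_on_subset[OF C1_continuous[OF piece(1)[OF assms T]]] cell(2)[OF T]]) simp
    from compact_imp_bounded[OF this] obtain B where "\<forall>y\<in>piece F T ` T. norm y \<le> B"
      unfolding bounded_iff by (elim exE)
    then show ?thesis by auto
  qed
  then obtain B where B: "\<And>T. T \<in> cells M \<Longrightarrow> \<forall>x\<in>T. \<bar>piece F T x\<bar> \<le> B T" by metis
  have "\<bar>F x\<bar> \<le> (\<Sum>T\<in>cells M. \<bar>B T\<bar>)" if "x \<in> generic" for x
  proof -
    obtain T where T: "T \<in> cells M" "x \<in> interior T" using \<open>x \<in> generic\<close> unfolding generic_def by (elim UN_E)
    have "x \<in> T" using T(2) interior_subset by blast
    then have "\<bar>F x\<bar> \<le> B T" using B[OF T(1)] piece(2)[OF assms T] by simp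
    also have "\<dots> \<le> \<bar>B T\<bar>" by simp
    also have "\<dots> \<le> (\<Sum>T\<in>cells M. \<bar>B T\<bar>)"
      by (rule member_le_sum[OF T(1)]) (simp_all add: finite_cells)
    finally show ?thesis .
  qed
  then show ?thesis by (rule that)
qed

lemma isCont_generic:
  assumes "pw_C1 M F" "y \<in> generic" "\<And>x. x \<in> generic \<Longrightarrow> g x = F x"
  shows "isCont g y"
proof -
  obtain T where T: "T \<in> cells M" "y \<in> interior T" using assms(2) unfolding generic_def by (elim UN_E)
  have "eventually (\<lambda>x. x \<in> interior T) (nhds y)" by (rule eventually_nhds_in_open[OF open_interior T(2)])
  then have "eventually (\<lambda>x. g x = piece F T x) (nhds y)"
  proof eventually_elim
    case (elim x)
    then have "x \<in> generic" using T(1) unfolding generic_def by blast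
    then show ?case using assms(3) piece(2)[OF assms(1) T(1) elim] by simp
  qed
  then have "isCont g y \<longleftrightarrow> isCont (piece F T) y" by (rule isCont_cong)
  then show ?thesis using C1_continuous[OF piece(1)[OF assms(1) T(1)]] by (simp add: continuous_on_eq_continuous_at)
qed

text \<open>One test function is read in two ways. Moving one derivative shows it to be component
  \<open>s\<close> of \<open>G\<close> mollified by the kernel, which produces the required integral
  on the right of the weak equation. Its gradient is \<open>G\<close> mollified by a derivative of
  the kernel, and that derivative is odd, so the quadratic form on the left vanishes for each
  component separately.\<close>

lemma kernel_orthogonality:
  assumes wg: "weak_gradient M \<Phi> G" and g0: "L1 g0"
    and eq: "\<And>\<phi>. periodic_C1 M \<phi> \<Longrightarrow>
      (LINT x:Omega M|lebesgue. (\<Sum>s\<in>UNIV. G x $ s * pd s \<phi> x)) = (LINT x:Omega M|lebesgue. g0 x * \<phi> x)"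
  shows "(LINT y:Omega M|lebesgue. G y $ s * (LINT x:Omega M|lebesgue. g0 x * bump (x - y) ^ n)) = 0"
proof -
  have \<Phi>: "L1 \<Phi>" and G: "L1 (\<lambda>x. G x $ s)" for s
    using wg sq_integrable_L1 unfolding weak_gradient_def by blast+
  have wgD: "(LINT x:Omega M|lebesgue. G x $ s * \<phi> x) = - (LINT x:Omega M|lebesgue. \<Phi> x * pd s \<phi> x)"
    if "periodic_C1 M \<phi>" for s \<phi>
    using wg that unfolding weak_gradient_def by blast
  define \<beta> where "\<beta> = (\<lambda>z. bump z ^ n)"
  define D where "D = pd s \<beta>"
  have C: "C1 \<beta>" "C1 D" using C1_bump_power unfolding \<beta>_def D_def by blast+
  have \<beta>per: "\<beta> (z + w) = \<beta> z" if "w \<in> periods M" for z w using bump_periodic[OF that] by (simp add: \<beta>_def)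
  have Dper: "D (z + w) = D z" if "w \<in> periods M" for z w
    unfolding D_def by (rule pd_periodic) (rule \<beta>per[OF that])
  have Dodd: "D (- z) = - D z" for z
    unfolding D_def by (rule pd_odd[OF C(1)]) (simp add: \<beta>_def bump_even)
  have sep\<beta>: "sep C1 (\<lambda>x y. \<beta> (x - y))" unfolding \<beta>_def by (rule sep_C2_imp_C1[OF sep_bump])
  have sepD: "sep C1 (\<lambda>x y. D (x - y))"
    using sep_pd[OF sep_bump[of n], of s] unfolding D_def \<beta>_def pd_shift[where k = "\<lambda>z. bump z ^ n"] .
  have refl_per: "k (x - (y + z)) = k (x - y)" if "z \<in> periods M" "\<And>a w. w \<in> periods M \<Longrightarrow> k (a + w) = k a" for k :: "real ^ 'd \<Rightarrow> real" and x y z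
    using that(2)[OF periods_uminus[OF that(1)], of "x - y"] by (simp add: algebra_simps)
  have test: "(LINT y:Omega M|lebesgue. G y $ r * k (x - y)) = (LINT y:Omega M|lebesgue. \<Phi> y * pd r k (x - y))"
    if k: "C1 k" "\<And>a w. w \<in> periods M \<Longrightarrow> k (a + w) = k a" for k r x
  proof -
    have "periodic_C1 M (\<lambda>y. k (x - y))" by (rule periodic_C1I[OF C1_reflect[OF k(1)] refl_per[OF _ k(2)]])
    from wgD[OF this, of r]
    have "(LINT y:Omega M|lebesgue. G y $ r * k (x - y)) = - (LINT y:Omega M|lebesgue. (-1) * (\<Phi> y * pd r k (x - y)))"
      unfolding pd_reflect[OF k(1)] by simp
    then show ?thesis unfolding set_integral_mult_right by simp
  qed
  \<comment> \<open>Defined through \<open>\<Phi>\<close> rather than \<open>G\<close>, so that both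
    weak derivatives, in direction \<open>s\<close> and in direction \<open>r\<close>, can be moved
    between \<open>\<Phi>\<close> and the kernel.\<close>
  define \<phi> where "\<phi> = (\<lambda>x. LINT y:Omega M|lebesgue. \<Phi> y * D (x - y))"
  have C1\<phi>: "C1 \<phi>" using sep_convolution[OF sepD \<Phi>] unfolding \<phi>_def by blast
  have pd\<phi>: "pd r \<phi> x = (LINT y:Omega M|lebesgue. G y $ r * D (x - y))" for r x
  proof -
    have "pd r \<phi> x = (LINT y:Omega M|lebesgue. \<Phi> y * pd r (\<lambda>x. D (x - y)) x)"
      using sep_convolution[OF sepD \<Phi>] unfolding \<phi>_def by blast
    also have "\<dots> = (LINT y:Omega M|lebesgue. \<Phi> y * pd r D (x - y))" by (simp only: pd_shift)
    also have "\<dots> = (LINT y:Omega M|lebesgue. G y $ r * D (x - y))"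
      by (rule test[OF C(2), symmetric]) (rule Dper)
    finally show ?thesis .
  qed
  have \<phi>\<beta>: "\<phi> x = (LINT y:Omega M|lebesgue. G y $ s * \<beta> (x - y))" for x
    unfolding \<phi>_def D_def by (rule test[OF C(1), symmetric]) (rule \<beta>per)
  have \<phi>per: "\<phi> (x + z) = \<phi> x" if "z \<in> periods M" for x z
  proof -
    have "D (x + z - y) = D (x - y)" for y using Dper[OF that, of "x - y"] by (simp add: algebra_simps)
    then show ?thesis by (simp add: \<phi>_def)
  qed
  \<comment> \<open>Exchanging the names of the two variables by Fubini and using oddness of
    \<open>D\<close> turns the integral into its negative.\<close>
  have sym: "(LINT x:Omega M|lebesgue. G x $ r * (LINT y:Omega M|lebesgue. G y $ r * D (x - y))) = 0" (is "?J = 0") for r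
  proof -
    have "?J = (LINT y:Omega M|lebesgue. G y $ r * (LINT x:Omega M|lebesgue. G x $ r * D (x - y)))"
      using sep_Fubini[OF sepD G G, of r r] by blast
    also have "\<dots> = (LINT y:Omega M|lebesgue. (-1) * (G y $ r * (LINT x:Omega M|lebesgue. G x $ r * D (y - x))))"
    proof -
      have "G x $ r * D (x - y) = (-1) * (G x $ r * D (y - x))" for x y
        using Dodd[of "y - x"] by simp
      then have "(LINT x:Omega M|lebesgue. G x $ r * D (x - y)) = (LINT x:Omega M|lebesgue. (-1) * (G x $ r * D (y - x)))" for y
        by (simp only:)
      then show ?thesis unfolding set_integral_mult_right by (simp only: mult.left_commute set_integral_mult_right)
    qed
    also have "\<dots> = - ?J" unfolding set_integral_mult_right by simp
    finally show ?thesis by simp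
  qed
  have "(LINT x:Omega M|lebesgue. (\<Sum>r\<in>UNIV. G x $ r * pd r \<phi> x)) = 0"
  proof -
    have i: "L1 (\<lambda>x. G x $ r * (LINT y:Omega M|lebesgue. G y $ r * D (x - y)))" for r
      using sep_Fubini[OF sepD G G, of r r] by blast
    have "(LINT x:Omega M|lebesgue. (\<Sum>r\<in>UNIV. 1 * (G x $ r * (LINT y:Omega M|lebesgue. G y $ r * D (x - y))))) = 0"
      unfolding set_integral_lincomb(1)[OF i] sym by simp
    then show ?thesis by (simp add: pd\<phi>)
  qed
  then have "(LINT x:Omega M|lebesgue. g0 x * (LINT y:Omega M|lebesgue. G y $ s * \<beta> (x - y))) = 0"
    using eq[OF periodic_C1I[OF C1\<phi> \<phi>per]] unfolding \<phi>\<beta> by simp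
  moreover have "(LINT x:Omega M|lebesgue. g0 x * (LINT y:Omega M|lebesgue. G y $ s * \<beta> (x - y)))
      = (LINT y:Omega M|lebesgue. G y $ s * (LINT x:Omega M|lebesgue. g0 x * \<beta> (x - y)))"
    using sep_Fubini[OF sep\<beta> g0 G, of s] by blast
  ultimately show ?thesis unfolding \<beta>_def by simp
qed

text \<open>The mollified density is orthogonal to the field for every power of the kernel. Its
  averages are bounded by the bound of the density and converge on open cells, so the orthogonality
  passes to the limit with a multiple of the modulus of \<open>G\<close> as dominating
  function.\<close>

theorem field_force_zero:
  assumes ef: "electric_field M \<rho> E" and \<rho>: "pw_C1 M \<rho>"
  shows "L1 (\<lambda>x. E x $ s)" and "(LINT x:Omega M|lebesgue. E x $ s * \<rho> x) = 0"
proof -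
  obtain \<Phi> G where wg: "weak_gradient M \<Phi> G"
    and eq: "\<forall>\<phi>. periodic_C1 M \<phi> \<longrightarrow>
      (LINT x:Omega M|lebesgue. (\<Sum>s\<in>UNIV. G x $ s * pd s \<phi> x)) = (LINT x:Omega M|lebesgue. (1 - \<rho> x) * \<phi> x)"
    and EG: "\<forall>x. E x = - G x"
    using ef unfolding electric_field_def by blast
  have G: "L1 (\<lambda>x. G x $ s)" using wg sq_integrable_L1 unfolding weak_gradient_def by blast
  then show LE: "L1 (\<lambda>x. E x $ s)" using EG by (simp add: set_integrable_def)
  \<comment> \<open>The density is bounded on open cells only; with value 0 elsewhere the bound is
    global, as the averaging argument wants, and integrals are unchanged.\<close>
  define g where "g = (\<lambda>x. if x \<in> generic then 1 + (-1) * \<rho> x else 0)"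
  have pw: "pw_C1 M (\<lambda>x. 1 + (-1) * \<rho> x)" by (rule pw_C1_add[OF pw_C1_const pw_C1_cmult[OF \<rho>]])
  have g_gen: "g x = 1 + (-1) * \<rho> x" if "x \<in> generic" for x using that by (simp add: g_def)
  have gL: "L1 g" by (rule integral_Omega_cong(2)[OF set_integrable_pw[OF pw] g_gen])
  obtain B0 where B0: "\<And>x. x \<in> generic \<Longrightarrow> \<bar>1 + (-1) * \<rho> x\<bar> \<le> B0" by (rule pw_C1_bounded[OF pw]) (rule that)
  define B where "B = \<bar>B0\<bar>"
  have B: "\<bar>g x\<bar> \<le> B" for x using B0[of x] by (auto simp: g_def B_def)
  have orth: "(LINT y:Omega M|lebesgue. G y $ s * (LINT x:Omega M|lebesgue. g x * bump (x - y) ^ n)) = 0" for n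
  proof -
    have "(LINT y:Omega M|lebesgue. G y $ s * (LINT x:Omega M|lebesgue. (1 + (-1) * \<rho> x) * bump (x - y) ^ n)) = 0"
      by (rule kernel_orthogonality[OF wg set_integrable_pw[OF pw]]) (use eq in simp)
    moreover have "(LINT x:Omega M|lebesgue. g x * bump (x - y) ^ n) = (LINT x:Omega M|lebesgue. (1 + (-1) * \<rho> x) * bump (x - y) ^ n)" for y
      by (rule integral_Omega_cong(1)[OF set_integrable_pw[OF pw_C1_mult[OF pw pw_C1_C1[OF C1_shift[OF C1_bump_power(1)]]]]])
        (simp add: g_gen)
    ultimately show ?thesis by simp
  qed
  \<comment> \<open>The centre 0 is arbitrary, the mass being the same for all centres.\<close>
  define W where "W = (\<lambda>n. LINT x:Omega M|lebesgue. bump (x - 0) ^ n)"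
  have W: "(LINT x:Omega M|lebesgue. bump (x - y) ^ n) = W n" for y n unfolding W_def by (rule kernel_mass_const)
  define A where "A = (\<lambda>n y. (LINT x:Omega M|lebesgue. g x * bump (x - y) ^ n) / W n)"
  have C: "C1 (\<lambda>x. bump (x - y) ^ n)" for y n by (rule C1_shift[OF C1_bump_power(1)])
  have W0: "0 \<le> W n" for n
    unfolding W_def set_lebesgue_integral_def by (rule integral_nonneg_AE) (simp add: bump_range)
  have Abound: "\<bar>A n y\<bar> \<le> B" for n y
  proof -
    have i1: "L1 (\<lambda>x. g x * bump (x - y) ^ n)" by (rule L1_mult_C1[OF gL C])
    have i2: "L1 (\<lambda>x. B * bump (x - y) ^ n)" by (rule L1_C1[OF C1_cmult[OF C]])
    have i3: "L1 (\<lambda>x. - (g x * bump (x - y) ^ n))" using i1 by (simp add: set_integrable_def)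
    have b: "\<bar>g x * bump (x - y) ^ n\<bar> \<le> B * bump (x - y) ^ n" for x
    proof -
      have p: "0 \<le> bump (x - y) ^ n" using bump_range(1) by simp
      then show ?thesis using mult_right_mono[OF B[of x] p] by (simp add: abs_mult)
    qed
    have "(LINT x:Omega M|lebesgue. g x * bump (x - y) ^ n) \<le> (LINT x:Omega M|lebesgue. B * bump (x - y) ^ n)"
      by (rule integral_mono_Omega[OF i1 i2]) (use b in \<open>simp add: abs_le_iff\<close>)
    moreover have "- (LINT x:Omega M|lebesgue. g x * bump (x - y) ^ n) \<le> (LINT x:Omega M|lebesgue. B * bump (x - y) ^ n)"
      unfolding set_integral_uminus[OF i1, symmetric]
      by (rule integral_mono_Omega[OF i3 i2]) (use b in \<open>simp add: abs_le_iff\<close>)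
    moreover have "(LINT x:Omega M|lebesgue. B * bump (x - y) ^ n) = B * W n" using W[of y n] by simp
    ultimately have 1: "\<bar>LINT x:Omega M|lebesgue. g x * bump (x - y) ^ n\<bar> \<le> B * W n" by linarith
    have B0: "0 \<le> B" by (simp add: B_def)
    \<comment> \<open>If \<open>W n\<close> is 0, the quotient is 0 by convention and obeys the
      bound.\<close>
    show ?thesis
    proof (cases "W n = 0")
      case False
      then have "0 < W n" using W0[of n] by simp
      then show ?thesis using 1 by (simp add: A_def abs_divide divide_le_eq)
    qed (use B0 in \<open>simp add: A_def\<close>)
  qed
  have Aconv: "(\<lambda>n. A n y) \<longlonglongrightarrow> g y" if y: "y \<in> generic" for y
  proof -
    obtain T where "T \<in> cells M" "y \<in> interior T" using y unfolding generic_def by (elim UN_E)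
    then have yb: "y \<in> box (lo M) (hi M)" using interior_cell_box by blast
    show ?thesis
      using approximate_identity[OF yb gL B isCont_generic[OF pw y g_gen]] unfolding A_def W .
  qed
  have GA: "(LINT y:Omega M|lebesgue. G y $ s * A n y) = 0" "L1 (\<lambda>y. G y $ s * A n y)" for n
  proof -
    have 1: "G y $ s * A n y = (1 / W n) * (G y $ s * (LINT x:Omega M|lebesgue. g x * bump (x - y) ^ n))" for y
      by (simp add: A_def)
    show "(LINT y:Omega M|lebesgue. G y $ s * A n y) = 0"
      unfolding 1 set_integral_mult_right orth by simp
    have "L1 (\<lambda>y. G y $ s * (LINT x:Omega M|lebesgue. g x * bump (x - y) ^ n))"
      using sep_Fubini[OF sep_C2_imp_C1[OF sep_bump[of n]] gL G] by blast
    then show "L1 (\<lambda>y. G y $ s * A n y)" unfolding 1 by simp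
  qed
  have Gpw: "L1 (\<lambda>y. G y $ s * (1 + (-1) * \<rho> y))" by (rule set_integrable_Omega_mult_pw[OF G pw])
  have Gg_gen: "G y $ s * g y = G y $ s * (1 + (-1) * \<rho> y)" if "y \<in> generic" for y
    by (simp only: g_gen[OF that])
  note Gg = integral_Omega_cong(2,1)[OF Gpw Gg_gen]
  have "(\<lambda>n. LINT y:Omega M|lebesgue. G y $ s * A n y) \<longlonglongrightarrow> (LINT y:Omega M|lebesgue. G y $ s * g y)"
    unfolding set_lebesgue_integral_def
  proof (rule integral_dominated_convergence[where w = "\<lambda>y. B * norm (indicator (Omega M) y *\<^sub>R G y $ s)"])
    show "(\<lambda>y. indicator (Omega M) y *\<^sub>R (G y $ s * g y)) \<in> borel_measurable lebesgue"
      using Gg(1) unfolding set_integrable_def by (rule borel_measurable_integrable)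
    show "(\<lambda>y. indicator (Omega M) y *\<^sub>R (G y $ s * A n y)) \<in> borel_measurable lebesgue" for n
      using GA(2)[of n] unfolding set_integrable_def by (rule borel_measurable_integrable)
    show "integrable lebesgue (\<lambda>y. B * norm (indicator (Omega M) y *\<^sub>R G y $ s))"
      using G unfolding set_integrable_def by (intro integrable_mult_right integrable_norm)
    have N: "(\<Union>T\<in>cells M. frontier T) \<in> null_sets lebesgue"
      unfolding negligible_iff_null_sets[symmetric] using finite_cells negligible_frontier_cell
      by (intro negligible_Union) auto
    show "AE y in lebesgue. (\<lambda>n. indicator (Omega M) y *\<^sub>R (G y $ s * A n y)) \<longlonglongrightarrow> indicator (Omega M) y *\<^sub>R (G y $ s * g y)"
      using AE_not_in[OF N]
    proof eventually_elim
      case (elim y)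
      show ?case
      proof (cases "y \<in> Omega M")
        case True
        then obtain T where T: "T \<in> cells M" "y \<in> T" unfolding Omega_eq by (elim UN_E)
        then have "y \<in> interior T" using elim cell(3)[OF T(1)] by (auto simp: frontier_def closure_closed)
        then have "y \<in> generic" using T(1) unfolding generic_def by blast
        then show ?thesis by (intro tendsto_intros Aconv)
      qed simp
    qed
    show "AE y in lebesgue. norm (indicator (Omega M) y *\<^sub>R (G y $ s * A n y)) \<le> B * norm (indicator (Omega M) y *\<^sub>R G y $ s)" for n
    proof (rule AE_I2)
      fix y
      have "\<bar>G y $ s\<bar> * \<bar>A n y\<bar> \<le> \<bar>G y $ s\<bar> * B" by (rule mult_left_mono[OF Abound]) simp
      then show "norm (indicator (Omega M) y *\<^sub>R (G y $ s * A n y)) \<le> B * norm (indicator (Omega M) y *\<^sub>R G y $ s)"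
        by (simp add: indicator_def abs_mult mult.commute)
    qed
  qed
  then have "(LINT y:Omega M|lebesgue. G y $ s * g y) = 0" unfolding GA(1) by (simp add: LIMSEQ_const_iff)
  then have z: "(LINT y:Omega M|lebesgue. G y $ s * (1 + (-1) * \<rho> y)) = 0" using Gg(2) by simp
  \<comment> \<open>Testing the weak gradient with a constant shows that \<open>G\<close> has mean
    zero, so the background 1 in \<open>1 - \<rho>\<close> exerts no total force.\<close>
  have "periodic_C1 M (\<lambda>_. 1)" by (rule periodic_C1I[OF C1_const]) simp
  then have "(LINT x:Omega M|lebesgue. G x $ s * 1) = - (LINT x:Omega M|lebesgue. \<Phi> x * pd s (\<lambda>_. 1) x)"
    using wg unfolding weak_gradient_def by blast
  then have G0: "(LINT x:Omega M|lebesgue. G x $ s) = 0" by (simp add: pd_const set_lebesgue_integral_def)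
  have "(LINT x:Omega M|lebesgue. E x $ s * \<rho> x) = (LINT x:Omega M|lebesgue. G x $ s * (1 + (-1) * \<rho> x) - G x $ s)"
    using EG by (simp add: algebra_simps)
  also have "\<dots> = 0" unfolding set_integral_diff(2)[OF Gpw G] z G0 by simp
  finally show "(LINT x:Omega M|lebesgue. E x $ s * \<rho> x) = 0" .
qed

end

section \<open>Momentum balance of one step\<close>

context dlra_state
begin

lemma pw_current: "pw_C1 Mx (current Mv st s)"
proof -
  have "current Mv st s = (\<lambda>x. \<Sum>j\<in>I. (LINT v:Omega Mv|lebesgue. v $ s * (gw v * Vf st j v)) * Kf st j x)"
    using moment[OF pw_C1_C1[OF C1_nth]] by (simp add: fun_eq_iff current_def mult.commute)
  then show ?thesis by (simp add: pw_C1_sum pw_C1_cmult pw_K)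
qed

lemma sum_extend_zero:
  fixes h :: "nat \<Rightarrow> real"
  shows "(\<Sum>i\<in>I. (if i \<in> {1..m} then c i else 0) * h i) = (\<Sum>a\<in>{1..m}. c a * h a)"
proof (rule sum.mono_neutral_cong_right)
  show "{1..m} \<subseteq> I" using m_le by simp
qed auto

text \<open>One factor \<open>v $ s\<close> comes from the weights \<open>c\<close>, the other
  factor \<open>v $ s'\<close> is already in \<open>Ax\<close>.\<close>

lemma flux_comb_stress:
  assumes c: "\<And>v. canon Mv (\<lambda>v. v $ s) v = (\<Sum>a\<in>{1..m}. c a * U a v)"
  shows "flux_comb (\<lambda>i. if i \<in> {1..m} then c i else 0) s' x = stress Mv st s s' x"
proof -
  have pair: "(LINT v:Omega Mv|lebesgue. (v $ s * v $ s') * (gw v * Vf st j v)) = (\<Sum>a\<in>{1..m}. c a * Ax Mv st s' a j)"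
    if j: "j \<in> I" for j
  proof -
    have pF: "pw_C1 Mv (\<lambda>v. v $ s' * (gw v * Vf st j v))"
      by (rule pw_C1_mult[OF pw_C1_C1[OF C1_nth] pw_gwV[OF j]])
    have "(LINT v:Omega Mv|lebesgue. (v $ s * v $ s') * (gw v * Vf st j v))
      = (LINT v:Omega Mv|lebesgue. v $ s * (v $ s' * (gw v * Vf st j v)))" by (simp only: mult.assoc)
    also have "\<dots> = (\<Sum>a\<in>{1..m}. c a * (LINT v:Omega Mv|lebesgue. U a v * (v $ s' * (gw v * Vf st j v))))"
      by (rule coordinate_pairing[OF C1_nth c pF])
    also have "\<dots> = (\<Sum>a\<in>{1..m}. c a * Ax Mv st s' a j)"
      unfolding Ax_def ipw_def by (intro sum.cong refl) (simp add: V_eq_U ac_simps)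
    finally show ?thesis .
  qed
  have "stress Mv st s s' x = (\<Sum>j\<in>I. Kf st j x * (LINT v:Omega Mv|lebesgue. (v $ s * v $ s') * (gw v * Vf st j v)))"
    unfolding stress_def by (rule moment[OF pw_C1_C1[OF C1_mult[OF C1_nth C1_nth]]])
  also have "\<dots> = (\<Sum>j\<in>I. \<Sum>a\<in>{1..m}. c a * (Ax Mv st s' a j * Kf st j x))"
    by (rule sum.cong[OF refl], subst pair, assumption) (simp add: sum_distrib_left ac_simps)
  also have "\<dots> = (\<Sum>a\<in>{1..m}. \<Sum>j\<in>I. c a * (Ax Mv st s' a j * Kf st j x))" by (rule sum.swap)
  also have "\<dots> = (\<Sum>a\<in>{1..m}. c a * (\<Sum>j\<in>I. Ax Mv st s' a j * Kf st j x))" by (simp only: sum_distrib_left)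
  finally show ?thesis unfolding flux_comb_def sum_extend_zero ..
qed

text \<open>The support assumption concerns the whole density and not the single products
  \<open>gw v * Vf st j v\<close>. The sums over both indices are therefore first pulled into the
  discrete derivative, giving the density in one argument and the coordinate in the other, before
  boundary terms are discarded.\<close>

lemma force_comb_charge:
  assumes c: "\<And>v. canon Mv (\<lambda>v. v $ s) v = (\<Sum>a\<in>{1..m}. c a * U a v)"
    and support: "vanishes_near_boundary Mx Mv st" and x: "x \<in> Omega Mx"
  shows "force_comb (\<lambda>i. if i \<in> {1..m} then c i else 0) s' x = (if s' = s then - charge Mv st x else 0)"
proof -
  let ?W = "canon Mv (\<lambda>v. v $ s)" and ?F = "\<lambda>j v. gw v * Vf st j v"
  have pW: "pw_C1 Mv ?W" by (rule pw_C1_canon[OF C1_nth])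
  have pU: "pw_C1 Mv (U a)" if "a \<in> {1..m}" for a
    using pw_V[of a] V_eq_U[OF that] that m_le by simp
  have B: "(\<Sum>a\<in>{1..m}. c a * Bx Mv st s' a j) = dhat Mv s' (?F j) ?W" if j: "j \<in> I" for j
  proof -
    have "?W = (\<lambda>v. \<Sum>a\<in>{1..m}. c a * U a v)" using c by (simp add: fun_eq_iff)
    moreover have "dhat Mv s' (?F j) (\<lambda>v. \<Sum>a\<in>{1..m}. c a * U a v) = (\<Sum>a\<in>{1..m}. c a * dhat Mv s' (?F j) (U a))"
      by (rule V.dhat_sum_right[OF pU pw_gwV[OF j]])
    moreover have "(\<Sum>a\<in>{1..m}. c a * dhat Mv s' (?F j) (U a)) = (\<Sum>a\<in>{1..m}. c a * Bx Mv st s' a j)"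
      unfolding Bx_def by (intro sum.cong refl) (simp only: V_eq_U)
    ultimately show ?thesis by simp
  qed
  have "force_comb (\<lambda>i. if i \<in> {1..m} then c i else 0) s' x = (\<Sum>a\<in>{1..m}. \<Sum>j\<in>I. c a * (Bx Mv st s' a j * Kf st j x))"
    unfolding force_comb_def sum_extend_zero by (simp only: sum_distrib_left)
  also have "\<dots> = (\<Sum>j\<in>I. \<Sum>a\<in>{1..m}. c a * (Bx Mv st s' a j * Kf st j x))" by (rule sum.swap)
  also have "\<dots> = (\<Sum>j\<in>I. Kf st j x * dhat Mv s' (?F j) ?W)"
    by (intro sum.cong refl) (simp only: B[symmetric] sum_distrib_left ac_simps)
  also have "\<dots> = dhat Mv s' (dens st x) ?W"
    unfolding dens_eq by (rule V.dhat_sum_left[OF pw_gwV pW, symmetric])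
  also have "\<dots> = (if s' = s then - (LINT v:Omega Mv|lebesgue. dens st x v) else 0)"
  proof -
    obtain W where W: "open W" "frontier (Omega Mv) \<subseteq> W" "\<forall>x\<in>Omega Mx. \<forall>v\<in>W \<inter> Omega Mv. dens st x v = 0"
      using support unfolding vanishes_near_boundary_def by blast
    show ?thesis by (rule V.dhat_coordinate[OF pw_dens W(1,2)]) (use W(3) x in blast)
  qed
  finally show ?thesis unfolding charge_def .
qed

theorem momentum_balance:
  assumes tau: "\<tau> > 0" and step: "time_step Mx Mv p q m U 1 \<alpha>L \<tau> E st st'"
    and support: "vanishes_near_boundary Mx Mv st"
    and E: "\<And>s. set_integrable lebesgue (Omega Mx) (\<lambda>x. E x $ s)"
    and span: "canon Mv (\<lambda>v. v $ s) \<in> lin_span (U ` {1..m})"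
    and \<psi>: "\<psi> \<in> dg_space Mx p"
  shows "1 / \<tau> * (LINT x : Omega Mx | lebesgue. (current Mv st' s x - current Mv st s x) * \<psi> x)
      + (\<Sum>T\<in>cells Mx. LINT x : T | lebesgue.
          - (\<Sum>s'\<in>UNIV. stress Mv st s s' x * pd s' \<psi> x) + E x $ s * charge Mv st x * \<psi> x)
      + (\<Sum>e\<in>faces Mx. face_integral Mx e
          (\<lambda>x. (\<Sum>s'\<in>UNIV. nrm Mx e $ s' * avg Mx e (stress Mv st s s') x) * jump Mx e \<psi> x))
      = 0"
proof -
  obtain Knew Lnew Rx Xt Rv Vt Snew where k: "k_step Mx Mv p 1 \<tau> E st Knew"
    and aug: "augmentation Mx Mv p q m U st Knew Lnew Rx Xt Rv Vt"
    and ss: "s_step Mx Mv \<tau> E st Rx Xt Rv Vt Snew" and tr: "truncation Mx Mv m U Rx Xt Rv Vt Snew st'"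
    using step unfolding time_step_def by blast
  have inj: "inj_on U {1..m}"
  proof -
    have "inj_on (Vf st) {1..m}" by (rule inj_on_subset[OF orthonormal_inj[OF V_orth]]) (use m_le in simp)
    then show ?thesis by (subst inj_on_cong[of _ U "Vf st"]) (simp_all add: V_eq_U)
  qed
  obtain c where c: "\<And>v. canon Mv (\<lambda>v. v $ s) v = (\<Sum>a\<in>{1..m}. c a * U a v)"
    by (rule lin_span_image[OF inj finite_atLeastAtMost span]) (rule that)
  \<comment> \<open>Extended by zero, the coefficients of the coordinate become weights for all
    components of the K-step system.\<close>
  define c' where "c' = (\<lambda>i. if i \<in> {1..m} then c i else 0)"
  have p\<psi>: "pw_C1 Mx \<psi>" by (rule pw_C1_dg_space[OF \<psi>])
  have pKn: "pw_C1 Mx (Knew i)" if "i \<in> I" for i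
    using k[unfolded k_step_def Let_def, THEN conjunct1] that pw_C1_dg_space by blast
  have cur: "current Mv st s x = (\<Sum>a\<in>{1..m}. c a * Kf st a x)" for x
    unfolding current_def by (rule moment_span[OF C1_nth c])
  have cur': "current Mv st' s x = (\<Sum>a\<in>{1..m}. c a * Knew a x)" for x
    unfolding current_def by (rule current_truncated[OF tau k E aug ss tr C1_nth c])
  have term1: "(LINT x : Omega Mx | lebesgue. (current Mv st' s x - current Mv st s x) * \<psi> x)
      = (\<Sum>i\<in>I. c' i * ip Mx (\<lambda>x. Knew i x - Kf st i x) \<psi>)"
  proof -
    have "(current Mv st' s x - current Mv st s x) * \<psi> x = (\<Sum>i\<in>I. c' i * ((Knew i x - Kf st i x) * \<psi> x))" for x
    proof -
      have "(current Mv st' s x - current Mv st s x) * \<psi> x = (\<Sum>a\<in>{1..m}. c a * ((Knew a x - Kf st a x) * \<psi> x))"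
        unfolding cur cur' sum_subtractf[symmetric] sum_distrib_right by (intro sum.cong refl) (simp add: algebra_simps)
      then show ?thesis unfolding c'_def sum_extend_zero .
    qed
    then have "(LINT x : Omega Mx | lebesgue. (current Mv st' s x - current Mv st s x) * \<psi> x)
      = (LINT x : Omega Mx | lebesgue. (\<Sum>i\<in>I. c' i * ((Knew i x - Kf st i x) * \<psi> x)))" by simp
    also have "\<dots> = (\<Sum>i\<in>I. c' i * (LINT x : Omega Mx | lebesgue. (Knew i x - Kf st i x) * \<psi> x))"
    proof (rule X.integral_Omega_sum)
      fix i assume i: "i \<in> I"
      have "pw_C1 Mx (\<lambda>x. (Knew i x + (-1) * Kf st i x) * \<psi> x)"
        by (rule pw_C1_mult[OF pw_C1_add[OF pKn[OF i] pw_C1_cmult[OF pw_K]] p\<psi>])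
      then show "pw_C1 Mx (\<lambda>x. (Knew i x - Kf st i x) * \<psi> x)" by simp
    qed
    finally show ?thesis unfolding ip_def .
  qed
  have fl: "flux_comb c' s' = stress Mv st s s'" for s'
    using flux_comb_stress[OF c] unfolding c'_def by (simp add: fun_eq_iff)
  have fo: "force_comb c' s' x = (if s' = s then - charge Mv st x else 0)" if "x \<in> Omega Mx" for s' x
    unfolding c'_def by (rule force_comb_charge[OF c support that])
  have cells: "(\<Sum>s'\<in>UNIV. LINT x:T|lebesgue. - (flux_comb c' s' x * pd s' \<psi> x) - E x $ s' * (force_comb c' s' x * \<psi> x))
    = (LINT x:T|lebesgue. - (\<Sum>s'\<in>UNIV. stress Mv st s s' x * pd s' \<psi> x) + E x $ s * charge Mv st x * \<psi> x)"
    if T: "T \<in> cells Mx" for T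
  proof -
    have i: "set_integrable lebesgue T (\<lambda>x. - (flux_comb c' s' x * pd s' \<psi> x) - E x $ s' * (force_comb c' s' x * \<psi> x))" for s'
    proof -
      have 3: "set_integrable lebesgue T (\<lambda>x. - (flux_comb c' s' x * pd s' \<psi> x))"
        using X.set_integrable_cell_mult_pd[OF pw_flux_comb p\<psi> T, of c' s' s'] by (simp add: set_integrable_def)
      show ?thesis by (rule set_integral_diff(1)[OF 3 X.set_integrable_mult_pw[OF E pw_C1_mult[OF pw_force_comb p\<psi>] T]])
    qed
    have "(\<Sum>s'\<in>UNIV. LINT x:T|lebesgue. - (flux_comb c' s' x * pd s' \<psi> x) - E x $ s' * (force_comb c' s' x * \<psi> x))
      = (LINT x:T|lebesgue. (\<Sum>s'\<in>UNIV. 1 * (- (flux_comb c' s' x * pd s' \<psi> x) - E x $ s' * (force_comb c' s' x * \<psi> x))))"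
      unfolding set_integral_lincomb(1)[OF i] by simp
    also have "\<dots> = (LINT x:T|lebesgue. - (\<Sum>s'\<in>UNIV. stress Mv st s s' x * pd s' \<psi> x) + E x $ s * charge Mv st x * \<psi> x)"
    proof (rule set_lebesgue_integral_cong[OF X.cell_sets[OF T]], intro allI impI)
      fix x assume "x \<in> T"
      then have x: "x \<in> Omega Mx" using X.cell(5)[OF T] by blast
      have "(\<Sum>s'\<in>UNIV. E x $ s' * (force_comb c' s' x * \<psi> x)) = (\<Sum>s'\<in>UNIV. if s' = s then - (E x $ s' * (charge Mv st x * \<psi> x)) else 0)"
        by (intro sum.cong refl) (simp add: fo[OF x])
      then have "(\<Sum>s'\<in>UNIV. E x $ s' * (force_comb c' s' x * \<psi> x)) = - (E x $ s * (charge Mv st x * \<psi> x))" by simp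
      then show "(\<Sum>s'\<in>UNIV. 1 * (- (flux_comb c' s' x * pd s' \<psi> x) - E x $ s' * (force_comb c' s' x * \<psi> x)))
        = - (\<Sum>s'\<in>UNIV. stress Mv st s s' x * pd s' \<psi> x) + E x $ s * charge Mv st x * \<psi> x"
        by (simp add: fl sum_subtractf sum_negf)
    qed
    finally show ?thesis .
  qed
  show ?thesis
    using k_step_tested[OF k E \<psi>, of c'] unfolding term1 by (simp only: cells cong: sum.cong) (simp only: fl)
qed

end

theorem theorem3p5:
  fixes Mx Mv :: "('d::finite) mesh"
    and p q m :: nat
    and U :: "nat \<Rightarrow> real ^ 'd \<Rightarrow> real"
    and \<tau> \<alpha>L :: real
    and st :: "nat \<Rightarrow> 'd state"
    and E :: "nat \<Rightarrow> real ^ 'd \<Rightarrow> real ^ 'd"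
  assumes mesh_x: "periodic_mesh Mx" and mesh_v: "periodic_mesh Mv"
    and tau: "\<tau> > 0"
    and U_dg: "\<forall>a\<in>{1..m}. U a \<in> dg_space Mv q"
    and m_ge: "m \<ge> 1 + CARD('d)"
    and one_in_span: "canon Mv (\<lambda>v. 1) \<in> lin_span (U ` {1..m})"
    and v_in_span: "\<forall>s. canon Mv (\<lambda>v. v $ s) \<in> lin_span (U ` {1..m})"
    and states: "\<forall>n. valid_state Mx Mv p q m U (st n)"
    and support: "\<forall>n. vanishes_near_boundary Mx Mv (st n)"
    and compat: "(LINT x : Omega Mx | lebesgue. charge Mv (st 0) x) = measure lebesgue (Omega Mx)"
    and field: "\<forall>n. electric_field Mx (charge Mv (st n)) (E n)"
    and steps: "\<forall>n. time_step Mx Mv p q m U 1 \<alpha>L \<tau> (E n) (st n) (st (Suc n))"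
  shows "(\<forall>n s. \<forall>\<psi>\<in>dg_space Mx p.
      1 / \<tau> * (LINT x : Omega Mx | lebesgue.
          (current Mv (st (Suc n)) s x - current Mv (st n) s x) * \<psi> x)
      + (\<Sum>T\<in>cells Mx. LINT x : T | lebesgue.
          - (\<Sum>s'\<in>UNIV. stress Mv (st n) s s' x * pd s' \<psi> x)
          + E n x $ s * charge Mv (st n) x * \<psi> x)
      + (\<Sum>e\<in>faces Mx. face_integral Mx e
          (\<lambda>x. (\<Sum>s'\<in>UNIV. nrm Mx e $ s' * avg Mx e (stress Mv (st n) s s') x) * jump Mx e \<psi> x))
      = 0)
    \<and> (\<forall>n. (LINT x : Omega Mx | lebesgue. (\<chi> s. current Mv (st (Suc n)) s x))
          = (LINT x : Omega Mx | lebesgue. (\<chi> s. current Mv (st n) s x)))"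
proof -
  interpret X: dg_mesh Mx by unfold_locales (rule mesh_x)
  have state: "dlra_state Mx Mv p q m U (st n)" for n
    using mesh_x mesh_v states by unfold_locales simp_all
  note pw_rho = dlra_state.pw_charge[OF state]
  note pw_j = dlra_state.pw_current[OF state]
  have EL: "set_integrable lebesgue (Omega Mx) (\<lambda>x. E n x $ s)" for n s
    by (rule X.field_force_zero(1)[OF field[rule_format] pw_rho])
  have balance: "1 / \<tau> * (LINT x : Omega Mx | lebesgue.
          (current Mv (st (Suc n)) s x - current Mv (st n) s x) * \<psi> x)
      + (\<Sum>T\<in>cells Mx. LINT x : T | lebesgue.
          - (\<Sum>s'\<in>UNIV. stress Mv (st n) s s' x * pd s' \<psi> x)
          + E n x $ s * charge Mv (st n) x * \<psi> x)
      + (\<Sum>e\<in>faces Mx. face_integral Mx e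
          (\<lambda>x. (\<Sum>s'\<in>UNIV. nrm Mx e $ s' * avg Mx e (stress Mv (st n) s s') x) * jump Mx e \<psi> x))
      = 0" if "\<psi> \<in> dg_space Mx p" for n s \<psi>
    by (rule dlra_state.momentum_balance[OF state tau steps[rule_format] support[rule_format] EL v_in_span[rule_format] that])
  have total: "(LINT x : Omega Mx | lebesgue. current Mv (st (Suc n)) s x) = (LINT x : Omega Mx | lebesgue. current Mv (st n) s x)" for n s
  proof -
    \<comment> \<open>The constant 1 as a member of the DG space: zero on the null set outside the
      open cells, hence with derivative 0 inside the cells and with traces equal to 1.\<close>
    let ?one = "canon Mx (\<lambda>_. 1)"
    have one: "?one x = 1" if "x \<in> X.generic" for x using that unfolding canon_def X.generic_def by simp
    have jL: "set_integrable lebesgue (Omega Mx) (current Mv (st k) s)" for k by (rule X.set_integrable_pw[OF pw_j])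
    \<comment> \<open>A constant takes the same value at identified points, so it has no jump even
      across the sides of the box.\<close>
    have faces: "(\<Sum>e\<in>faces Mx. face_integral Mx e
        (\<lambda>x. (\<Sum>s'\<in>UNIV. nrm Mx e $ s' * avg Mx e (stress Mv (st n) s s') x) * jump Mx e ?one x)) = 0"
    proof (rule sum.neutral, rule ballI)
      fix e assume e: "e \<in> faces Mx"
      have "face_integral Mx e (\<lambda>x. (\<Sum>s'\<in>UNIV. nrm Mx e $ s' * avg Mx e (stress Mv (st n) s s') x) * jump Mx e ?one x)
        = face_integral Mx e (\<lambda>x. 0)"
        by (rule X.face_integral_cong[OF e X.face_cont_const]) (simp add: X.jump_canon[OF e _ C1_const])
      then show "face_integral Mx e (\<lambda>x. (\<Sum>s'\<in>UNIV. nrm Mx e $ s' * avg Mx e (stress Mv (st n) s s') x) * jump Mx e ?one x) = 0"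
        by (simp add: X.face_integral_zero)
    qed
    have cell: "(LINT x : T | lebesgue. - (\<Sum>s'\<in>UNIV. stress Mv (st n) s s' x * pd s' ?one x) + E n x $ s * charge Mv (st n) x * ?one x)
      = (LINT x : T | lebesgue. E n x $ s * charge Mv (st n) x)" if T: "T \<in> cells Mx" for T
    proof (rule set_integral_spike(1)[OF X.set_integrable_mult_pw[OF EL pw_rho T] X.negligible_frontier_cell[OF T]])
      fix x assume "x \<in> T" "x \<notin> frontier T"
      then have x: "x \<in> interior T" by (simp add: frontier_def closure_closed[OF X.cell(3)[OF T]])
      have "pd s' ?one x = 0" for s'
        using pd_cong_open[OF open_interior x, of ?one "\<lambda>_. 1" s'] X.canon_interior[OF T] by (simp add: pd_const)
      then show "- (\<Sum>s'\<in>UNIV. stress Mv (st n) s s' x * pd s' ?one x) + E n x $ s * charge Mv (st n) x * ?one x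
        = E n x $ s * charge Mv (st n) x" using X.canon_interior[OF T x] by simp
    qed
    have cells: "(\<Sum>T\<in>cells Mx. LINT x : T | lebesgue. - (\<Sum>s'\<in>UNIV. stress Mv (st n) s s' x * pd s' ?one x)
        + E n x $ s * charge Mv (st n) x * ?one x) = 0"
    proof -
      have "(\<Sum>T\<in>cells Mx. LINT x : T | lebesgue. E n x $ s * charge Mv (st n) x)
        = (LINT x : Omega Mx | lebesgue. E n x $ s * charge Mv (st n) x)"
        by (rule X.integral_Omega[symmetric]) (rule X.set_integrable_mult_pw[OF EL pw_rho])
      also have "\<dots> = 0" by (rule X.field_force_zero(2)[OF field[rule_format] pw_rho])
      finally show ?thesis by (simp only: cell cong: sum.cong)
    qed
    have "(LINT x : Omega Mx | lebesgue. (current Mv (st (Suc n)) s x - current Mv (st n) s x) * ?one x) = 0"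
      using balance[OF canon_one_dg_space, of n s] tau unfolding cells faces by simp
    moreover have "(LINT x : Omega Mx | lebesgue. (current Mv (st (Suc n)) s x - current Mv (st n) s x) * ?one x)
      = (LINT x : Omega Mx | lebesgue. current Mv (st (Suc n)) s x - current Mv (st n) s x)"
      by (rule X.integral_Omega_cong(1)[OF set_integral_diff(1)[OF jL jL]]) (simp add: one)
    ultimately show ?thesis unfolding set_integral_diff(2)[OF jL jL] by simp
  qed
  have vec: "(LINT x : Omega Mx | lebesgue. (\<chi> s. current Mv (st k) s x)) = (\<chi> s. LINT x : Omega Mx | lebesgue. current Mv (st k) s x)" for k
    by (rule set_integral_vec) (rule X.set_integrable_pw[OF pw_j])
  show ?thesis using balance total unfolding vec by simp
qed

end
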